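(* Set $\alpha=1/9$, $\delta=1/45$ and $$\mathscr P=\Big\{z\in\mathbb C:\ |\operatorname{Im}z|\ge N^{-\alpha}\ \text{ or }\ |\operatorname{Re}z|\ge 1+\tfrac12N^{-2\alpha}\Big\}.$$ For any compact set $K\subset\mathbb C$ there are constants $C_{\beta,K}>0$ (depending only on $\beta,K$) and $c_\beta>0$ (depending only on $\beta$) such that for all $N$, $$\mathbb P\left[\sup_{z\in K\cap\mathscr P}\left|\frac{\varphi_N(z)\,\mathbb E\big[\exp\big(\sqrt{2/\beta}\,\mathrm W(z)\big)\big]}{\pi_N(z)\,\exp\big(\sqrt{2/\beta}\,\mathrm W(z)\big)}-1\right|\ge C_{\beta,K}N^{-1/15}\right]\le e^{-c_\beta N^{\delta}}.$$
   Context: Fix $\beta>0$. Let $b_k\sim\mathcal N(0,2)$ and $a_k\sim\chi_{\beta k}$ ($k\ge1$) be independent, where $\chi_a$ has density proportional to $x^{a-1}e^{-x^2/2}\mathbf 1_{x>0}$. Let $\mathbf A$ be the semi-infinite symmetric tridiagonal matrix with diagonal $(b_1,b_2,\dots)$ and off-diagonal $(a_1,a_2,\dots)$. For $N\in\mathbb N$ let $\varphi_N(z)=\det\big(z-(4N\beta)^{-1/2}[\mathbf A]_{N}\big)$, with $[\mathbf A]_N$ the top-left $N\times N$ block. Its zeros have the law of the Gaussian $\beta$-ensemble, with density proportional to $e^{-\sum_i\beta N\lambda_i^2}\prod_{i>j}|\lambda_i-\lambda_j|^\beta$. $\pi_N$ is the monic polynomial of degree $N$ orthogonal with respect to the weight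 $e^{-2Nx^2}$ on $\mathbb R$ (equivalently $\pi_N=\mathbb E\varphi_N$). Coupling. Let $X_k=b_k/\sqrt2$ for $k\ge1$, $Y_1=0$ and $Y_k=\frac{a_{k-1}^2-\beta(k-1)}{\sqrt{2\beta(k-1)}}$ for $k\ge2$. The probability space supports two independent standard Brownian motions $(\widehat{\mathbf X}_t)_{t\ge0}$, $(\widehat{\mathbf Y}_t)_{t\ge0}$ such that $\sum_{j=1}^nX_j=\widehat{\mathbf X}_n$ for all $n\ge1$ and, for a constant $C_\beta$ and all $n\ge2$, the random variable $\mathcal M_n=\max_{1\le k\le n}\big|\sum_{j=1}^kY_j-\widehat{\mathbf Y}_k\big|$ satisfies $\inf\{t\ge0:\mathbb E e^{\mathcal M_n/t}\le2\}\le C_\beta\log n$ (such a strong embedding exists). Set $\mathbf X_t=N^{-1/2}\widehat{\mathbf X}_{tN}$, $\mathbf Y_t=N^{-1/2}\widehat{\mathbf Y}_{tN}$ for $t\in[0,1]$. Let $J(z)=z-\sqrt{z^2-1}$ be the conformal inverse Joukowsky map from $\mathbb C\setminus[-1,1]$ to the unit disk (branch of the root behaving like $z$ at infinity). For $z\in\mathbb C\setminus[-1,1]$ define $$\mathrm W(z)=-\frac12\int_0^1\frac{d\mathbf X_u+J(z/\sqrt u)\,d\mathbf Y_u}{\sqrt{z^2-u}},$$ where $\sqrt{z^2-u}$ is the branch analytic off $[-\sqrt u,\sqrt u]$ behaving like $z$ at infinity. This is a Gaussian analytic function with $\mathbb E[\mathrm W(z)\mathrm W(w)]=-\log(1-J(z)J(w))$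 and $\overline{\mathrm W(z)}=\mathrm W(\bar z)$. *)

theory Defs
  imports "HOL-Probability.Probability" "HOL-Computational_Algebra.Polynomial"
    "Jordan_Normal_Form.Determinant"
begin

section \<open>The random tridiagonal matrix and its characteristic polynomial\<close>

definition chi_weight :: "real \<Rightarrow> real \<Rightarrow> real" where
  "chi_weight s x = (if x > 0 then x powr (s - 1) * exp (- x\<^sup>2 / 2) else 0)"

definition chi_density :: "real \<Rightarrow> real \<Rightarrow> real" where
  "chi_density s x = chi_weight s x / (LINT y|lborel. chi_weight s y)"

text \<open>Entries are indexed from 1, as are the sequences \<open>a\<close> (off-diagonal) and \<open>b\<close> (diagonal);
  the values \<open>a 0\<close> and \<open>b 0\<close> are never used.\<close>

definition tridiag :: "(nat \<Rightarrow> real) \<Rightarrow> (nat \<Rightarrow> real) \<Rightarrow> nat \<Rightarrow> nat \<Rightarrow> real" where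
  "tridiag a b i j =
     (if i = j then b i else if j = i + 1 then a i else if i = j + 1 then a j else 0)"

definition tridiag_block :: "(nat \<Rightarrow> real) \<Rightarrow> (nat \<Rightarrow> real) \<Rightarrow> nat \<Rightarrow> complex mat" where
  "tridiag_block a b N = mat N N (\<lambda>(i, j). complex_of_real (tridiag a b (i + 1) (j + 1)))"

definition phi :: "real \<Rightarrow> (nat \<Rightarrow> real) \<Rightarrow> (nat \<Rightarrow> real) \<Rightarrow> nat \<Rightarrow> complex \<Rightarrow> complex" where
  "phi \<beta> a b N z =
     Determinant.det (z \<cdot>\<^sub>m 1\<^sub>m N -
       complex_of_real (1 / sqrt (4 * real N * \<beta>)) \<cdot>\<^sub>m tridiag_block a b N)"

definition hermite_monic :: "nat \<Rightarrow> real poly" where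
  "hermite_monic N = (THE p. degree p = N \<and> lead_coeff p = 1 \<and>
     (\<forall>q. degree q < N \<longrightarrow>
        (LINT x|lborel. poly p x * poly q x * exp (- 2 * real N * x\<^sup>2)) = 0))"

definition pi_N :: "nat \<Rightarrow> complex \<Rightarrow> complex" where
  "pi_N N z = poly (map_poly complex_of_real (hermite_monic N)) z"


section \<open>Brownian motion and the coupling\<close>

locale brownian_motion = prob_space M for M :: "'a measure" +
  fixes B :: "real \<Rightarrow> 'a \<Rightarrow> real"
  assumes measurable_at: "\<And>t. 0 \<le> t \<Longrightarrow> B t \<in> borel_measurable M"
    and start: "AE \<omega> in M. B 0 \<omega> = 0"
    and gaussian_increments: "\<And>s t. 0 \<le> s \<Longrightarrow> s < t \<Longrightarrow>
      distributed M lborel (\<lambda>\<omega>. B t \<omega> - B s \<omega>) (normal_density 0 (sqrt (t - s)))"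
    and indep_increments: "\<And>t :: nat \<Rightarrow> real. 0 \<le> t 0 \<Longrightarrow> mono t \<Longrightarrow>
      indep_vars (\<lambda>_. borel) (\<lambda>i \<omega>. B (t (Suc i)) \<omega> - B (t i) \<omega>) UNIV"
    and continuous_paths: "AE \<omega> in M. continuous_on {0..} (\<lambda>t. B t \<omega>)"

text \<open>The Orlicz norm \<open>inf {t. E exp (Z / t) \<le> 2}\<close> of a nonnegative random variable. It is
  \<open>\<infinity>\<close> if there is no such \<open>t\<close>; \<open>t = 0\<close> is excluded because \<open>Z / 0 = 0\<close> in HOL.\<close>

definition psi1_norm :: "'a measure \<Rightarrow> ('a \<Rightarrow> real) \<Rightarrow> ereal" where
  "psi1_norm M Z = Inf {ereal t | t. t > 0 \<and> (\<integral>\<^sup>+ \<omega>. ennreal (exp (Z \<omega> / t)) \<partial>M) \<le> 2}"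

definition X_var :: "(nat \<Rightarrow> 'a \<Rightarrow> real) \<Rightarrow> nat \<Rightarrow> 'a \<Rightarrow> real" where
  "X_var b k \<omega> = b k \<omega> / sqrt 2"

definition Y_var :: "real \<Rightarrow> (nat \<Rightarrow> 'a \<Rightarrow> real) \<Rightarrow> nat \<Rightarrow> 'a \<Rightarrow> real" where
  "Y_var \<beta> a k \<omega> = (if k \<le> 1 then 0
     else ((a (k - 1) \<omega>)\<^sup>2 - \<beta> * real (k - 1)) / sqrt (2 * \<beta> * real (k - 1)))"

definition coupling_error ::
  "real \<Rightarrow> (nat \<Rightarrow> 'a \<Rightarrow> real) \<Rightarrow> (real \<Rightarrow> 'a \<Rightarrow> real) \<Rightarrow> nat \<Rightarrow> 'a \<Rightarrow> real" where
  "coupling_error \<beta> a Yhat n \<omega> =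
     Max ((\<lambda>k. \<bar>(\<Sum>j=1..k. Y_var \<beta> a j \<omega>) - Yhat (real k) \<omega>\<bar>) ` {1..n})"

text \<open>\<open>C0\<close> is the constant of the strong embedding of the partial sums of the \<open>Y\<close> variables; for
  each \<open>\<beta>\<close> such a coupling exists with some \<open>C0\<close> depending only on \<open>\<beta>\<close>.\<close>

locale gbe_coupling = prob_space M for M :: "'a measure" +
  fixes \<beta> C0 :: real
    and a b :: "nat \<Rightarrow> 'a \<Rightarrow> real"
    and Xhat Yhat :: "real \<Rightarrow> 'a \<Rightarrow> real"
  assumes b_distr: "\<And>k. 1 \<le> k \<Longrightarrow> distributed M lborel (b k) (normal_density 0 (sqrt 2))"
    and a_distr: "\<And>k. 1 \<le> k \<Longrightarrow> distributed M lborel (a k) (chi_density (\<beta> * real k))"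
    and indep_entries: "indep_vars (\<lambda>_. borel) (case_sum b a) ({1..} <+> {1..})"
    and Xhat_bm: "brownian_motion M Xhat"
    and Yhat_bm: "brownian_motion M Yhat"
    and indep_bm: "indep_var
      (Pi\<^sub>M {0..} (\<lambda>_. borel)) (\<lambda>\<omega>. \<lambda>t\<in>{0..}. Xhat t \<omega>)
      (Pi\<^sub>M {0..} (\<lambda>_. borel)) (\<lambda>\<omega>. \<lambda>t\<in>{0..}. Yhat t \<omega>)"
    and X_coupled: "\<And>n. 1 \<le> n \<Longrightarrow>
      AE \<omega> in M. (\<Sum>j=1..n. X_var b j \<omega>) = Xhat (real n) \<omega>"
    and Y_coupled: "\<And>n. 2 \<le> n \<Longrightarrow>
      psi1_norm M (coupling_error \<beta> a Yhat n) \<le> ereal (C0 * ln (real n))"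

definition rescaled :: "nat \<Rightarrow> (real \<Rightarrow> 'a \<Rightarrow> real) \<Rightarrow> real \<Rightarrow> 'a \<Rightarrow> real" where
  "rescaled N B t \<omega> = B (t * real N) \<omega> / sqrt (real N)"


section \<open>The Wiener integral and the field W\<close>

definition step_fun :: "nat \<Rightarrow> (nat \<Rightarrow> complex) \<Rightarrow> (nat \<Rightarrow> real) \<Rightarrow> real \<Rightarrow> complex" where
  "step_fun n c t u = (\<Sum>i<n. c i * indicator {t i<..t (Suc i)} u)"

definition step_integral ::
  "(real \<Rightarrow> 'a \<Rightarrow> real) \<Rightarrow> nat \<Rightarrow> (nat \<Rightarrow> complex) \<Rightarrow> (nat \<Rightarrow> real) \<Rightarrow> 'a \<Rightarrow> complex" where
  "step_integral B n c t \<omega> =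
     (\<Sum>i<n. c i * complex_of_real (B (t (Suc i)) \<omega> - B (t i) \<omega>))"

text \<open>\<open>I\<close> is a version of \<open>\<integral>\<^sub>0\<^sup>1 f dB\<close> for a deterministic square-integrable \<open>f\<close>: the
  \<open>L\<^sup>2(M)\<close>-limit of the integrals of step functions approximating \<open>f\<close> in \<open>L\<^sup>2([0,1])\<close>.
  By the Ito isometry \<open>I\<close> is determined up to almost sure equality.\<close>

definition has_wiener_integral ::
  "'a measure \<Rightarrow> (real \<Rightarrow> 'a \<Rightarrow> real) \<Rightarrow> (real \<Rightarrow> complex) \<Rightarrow> ('a \<Rightarrow> complex) \<Rightarrow> bool" where
  "has_wiener_integral M B f I \<longleftrightarrow>
     set_borel_measurable lborel {0..1} f \<and> I \<in> borel_measurable M \<and>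
     (\<exists>n c t. (\<forall>k. mono (t k) \<and> range (t k) \<subseteq> {0..1}) \<and>
        (\<lambda>k. \<integral>\<^sup>+ u\<in>{0..1}. ennreal ((cmod (f u - step_fun (n k) (c k) (t k) u))\<^sup>2) \<partial>lborel)
          \<longlonglongrightarrow> 0 \<and>
        (\<lambda>k. \<integral>\<^sup>+ \<omega>. ennreal ((cmod (I \<omega> - step_integral B (n k) (c k) (t k) \<omega>))\<^sup>2) \<partial>M)
          \<longlonglongrightarrow> 0)"

text \<open>For \<open>u \<ge> 0\<close>, the branch of \<open>sqrt (z\<^sup>2 - u)\<close> that is analytic off
  \<open>[-sqrt u, sqrt u]\<close> and behaves like \<open>z\<close> at infinity; see the three lemmas below.\<close>

definition sqrt_branch :: "real \<Rightarrow> complex \<Rightarrow> complex" where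
  "sqrt_branch u z = z * csqrt (1 - complex_of_real u / z\<^sup>2)"

lemma sqrt_branch_square: "z \<noteq> 0 \<Longrightarrow> (sqrt_branch u z)\<^sup>2 = z\<^sup>2 - complex_of_real u"
  by (simp add: sqrt_branch_def power_mult_distrib right_diff_distrib)

lemma sqrt_branch_holomorphic:
  assumes "0 \<le> u"
  shows "sqrt_branch u holomorphic_on - complex_of_real ` {- sqrt u..sqrt u}"
proof -
  have "1 - complex_of_real u / z\<^sup>2 \<notin> \<real>\<^sub>\<le>\<^sub>0 \<and> z \<noteq> 0"
    if z: "z \<in> - complex_of_real ` {- sqrt u..sqrt u}" for z
  proof -
    have z0: "z \<noteq> 0"
      using z assms by (force simp: image_iff)
    moreover have False if np: "1 - complex_of_real u / z\<^sup>2 \<in> \<real>\<^sub>\<le>\<^sub>0"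
    proof -
      obtain r where r: "1 - complex_of_real u / z\<^sup>2 = complex_of_real r" "r \<le> 0"
        using np by (auto elim!: nonpos_Reals_cases)
      then have "z\<^sup>2 * complex_of_real (1 - r) = complex_of_real u"
        using z0 by (simp add: field_simps)
      moreover have "1 - r \<noteq> 0"
        using r(2) by simp
      ultimately have "z\<^sup>2 = complex_of_real (u / (1 - r))"
        by (simp add: nonzero_eq_divide_eq del: of_real_diff)
      also have "\<dots> = (complex_of_real (sqrt (u / (1 - r))))\<^sup>2"
        using assms r(2) by (simp flip: of_real_power)
      finally have "z = complex_of_real (sqrt (u / (1 - r))) \<or>
          z = complex_of_real (- sqrt (u / (1 - r)))"
        by (simp add: power2_eq_iff)
      moreover have "sqrt (u / (1 - r)) \<in> {- sqrt u..sqrt u}"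
      proof -
        have "u * 1 \<le> u * (1 - r)"
          using assms r(2) by (intro mult_left_mono) auto
        then have "u / (1 - r) \<le> u" "0 \<le> u / (1 - r)"
          using assms r(2) by (simp_all add: pos_divide_le_eq)
        then show ?thesis
          using assms by (auto intro: order_trans[of _ 0])
      qed
      ultimately show False
        using z by (auto simp: image_iff)
    qed
    ultimately show ?thesis by blast
  qed
  then show ?thesis
    unfolding sqrt_branch_def [abs_def] by (intro holomorphic_intros) auto
qed

lemma sqrt_branch_at_infinity: "((\<lambda>z. sqrt_branch u z / z) \<longlongrightarrow> 1) at_infinity"
proof -
  have "((\<lambda>z::complex. 1 - complex_of_real u / z\<^sup>2) \<longlongrightarrow> 1 - 0) at_infinity"
    by (intro tendsto_diff tendsto_const tendsto_divide_0 [OF tendsto_const]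
        filterlim_power_at_infinity filterlim_ident) simp
  then have "((\<lambda>z::complex. csqrt (1 - complex_of_real u / z\<^sup>2)) \<longlongrightarrow> csqrt 1) at_infinity"
    by (intro isCont_tendsto_compose [OF continuous_at_csqrt]) simp_all
  moreover have "eventually (\<lambda>z. csqrt (1 - complex_of_real u / z\<^sup>2) = sqrt_branch u z / z) at_infinity"
    unfolding eventually_at_infinity sqrt_branch_def by (rule exI [of _ 1]) auto
  ultimately show ?thesis
    by (simp add: tendsto_cong)
qed

definition Jouk :: "complex \<Rightarrow> complex" where
  "Jouk z = z - sqrt_branch 1 z"

text \<open>\<open>W\<close> is an analytic version of the field defined by the stochastic integral. At \<open>u = 0\<close> the
  value \<open>Jouk (z / 0) = Jouk 0 = 0\<close> agrees with the limit of \<open>Jouk (z / sqrt u)\<close> as \<open>u\<close> tends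
  to 0.\<close>

definition is_W_field ::
  "'a measure \<Rightarrow> (real \<Rightarrow> 'a \<Rightarrow> real) \<Rightarrow> (real \<Rightarrow> 'a \<Rightarrow> real) \<Rightarrow> (complex \<Rightarrow> 'a \<Rightarrow> complex) \<Rightarrow> bool"
where
  "is_W_field M X Y W \<longleftrightarrow>
     (\<forall>z \<in> - complex_of_real ` {-1..1}. \<exists>I1 I2.
        has_wiener_integral M X (\<lambda>u. 1 / sqrt_branch u z) I1 \<and>
        has_wiener_integral M Y
          (\<lambda>u. Jouk (z / complex_of_real (sqrt u)) / sqrt_branch u z) I2 \<and>
        (\<forall>\<omega>\<in>space M. W z \<omega> = - (1 / 2) * (I1 \<omega> + I2 \<omega>))) \<and>
     (\<forall>\<omega>\<in>space M. (\<lambda>z. W z \<omega>) holomorphic_on - complex_of_real ` {-1..1})"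

definition region :: "real \<Rightarrow> nat \<Rightarrow> complex set" where
  "region \<alpha> N = {z. \<bar>Im z\<bar> \<ge> real N powr (- \<alpha>) \<or>
     \<bar>Re z\<bar> \<ge> 1 + 1 / 2 * real N powr (- 2 * \<alpha>)}"

end

theory Submission
  imports Defs "HOL-Complex_Analysis.Complex_Analysis" "HOL-Real_Asymp.Real_Asymp"
begin

text \<open>The characteristic polynomial is the product of the ratios \<open>r\<^sub>n\<close> of consecutive minors, which follow a
  noisy version of the recursion \<open>r \<mapsto> z - (u/4) / r\<close> with \<open>u = n/N\<close>. Running the noiseless recursion
  backward factorises \<open>\<pi>\<^sub>N\<close>, and \<open>\<phi>\<^sub>N / \<pi>\<^sub>N\<close> telescopes into factors \<open>1 - D\<^sub>n\<close>, where \<open>D\<^sub>n\<close> is linear in the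
  noise of step \<open>n\<close> with coefficients depending on the past. To second order the logarithm of the product is
  \<open>- \<Sum> (D\<^sub>n + D\<^sub>n\<^sup>2 / 2)\<close>. Replacing the coefficients by their deterministic limits \<open>1 / sqrt (z\<^sup>2 - u)\<close> and
  \<open>J (z / sqrt u) / sqrt (z\<^sup>2 - u)\<close> costs a martingale with small increments, controlled by Azuma's
  inequality. The strong embedding and summation by parts then turn the linear sum into a Wiener integral,
  namely \<open>- sqrt (2 / \<beta>) W\<close>, and the quadratic sum becomes a Riemann sum for the variance of the field, which
  is what \<open>E exp (sqrt (2 / \<beta>) W)\<close> compensates. Suprema over \<open>z\<close> are reduced to exponential moments at
  single points by the mean value property on circles and a union bound over polynomially many discs.\<close>

text \<open>With \<open>N = x^90\<close> the claim concerns points at distance about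
  \<open>x^-10\<close> from the cut, errors \<open>x^-6\<close> and probabilities
  \<open>exp (- x^2)\<close>. Noise truncated at a multiple of \<open>x^2\<close> enters the
  recursion at size \<open>x^-43\<close>; the contraction gap is of order \<open>x^-10\<close>, so
  the forward ratios stay within about \<open>x^-33\<close> of the moving fixed point. The dominant
  errors are then the suprema of the two fluctuating fields, of order \<open>x^-7\<close>, and the
  quadratic term, of order \<open>x^-8\<close>. Truncation does double work: Azuma's inequality
  wants bounded increments, and the denominators must stay away from zero for every outcome, so that
  all terms are holomorphic in \<open>z\<close> as the mean value property requires. An asymmetry
  shapes the estimates. The forward recursion starts at its fixed point, because
  \<open>lam 0 z = z\<close>, but the backward one starts at \<open>z\<close>, which is not close to
  \<open>lam 1 z\<close>. The last rows, about \<open>x^11\<close> of them, form a boundary layer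
  where only crude bounds hold. An invariant half-plane keeps the backward ratios off the repelling
  root there as well, and it makes the factorisation of \<open>pi_N\<close> exact for every positive
  \<open>N\<close>.\<close>

abbreviation cplx :: "real \<Rightarrow> complex" where
  "cplx \<equiv> complex_of_real"

abbreviation energy :: "(real \<Rightarrow> complex) \<Rightarrow> ennreal" where
  "energy f \<equiv> (\<integral>\<^sup>+u\<in>{0..1}. ennreal ((cmod (f u))\<^sup>2) \<partial>lborel)"

abbreviation mean_square :: "'a measure \<Rightarrow> ('a \<Rightarrow> complex) \<Rightarrow> ennreal" where
  "mean_square M F \<equiv> (\<integral>\<^sup>+x. ennreal ((cmod (F x))\<^sup>2) \<partial>M)"

abbreviation exp_moment :: "'a measure \<Rightarrow> ('a \<Rightarrow> real) \<Rightarrow> ennreal" where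
  "exp_moment M F \<equiv> (\<integral>\<^sup>+x. ennreal (exp (F x)) \<partial>M)"

section \<open>The attracting fixed point of the recursion\<close>

text \<open>The attracting fixed point of \<open>w \<mapsto> z - (u/4) / w\<close>; the repelling one is \<open>z - lam u z\<close>.\<close>

definition lam :: "real \<Rightarrow> complex \<Rightarrow> complex" where
  "lam u z = (z + sqrt_branch u z) / 2"

lemma sqrt_branch_lam: "sqrt_branch u z = lam u z - (z - lam u z)"
  by (simp add: lam_def field_simps)

lemma lam_mult: "z \<noteq> 0 \<Longrightarrow> lam u z * (z - lam u z) = cplx (u / 4)"
proof -
  assume "z \<noteq> 0"
  then have "(sqrt_branch u z)\<^sup>2 = z\<^sup>2 - cplx u" by (rule sqrt_branch_square)
  moreover have "lam u z * (z - lam u z) = (z\<^sup>2 - (sqrt_branch u z)\<^sup>2) / 4"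
    by (simp add: lam_def field_simps power2_eq_square)
  ultimately show ?thesis by simp
qed

lemma norm_one_minus_le_one_plus: "0 \<le> Re c \<Longrightarrow> cmod (1 - c) \<le> cmod (1 + c)"
  by (rule power2_le_imp_le, unfold cmod_power2) (simp_all add: power2_eq_square algebra_simps)

lemma one_le_norm_one_plus: "0 \<le> Re c \<Longrightarrow> 1 \<le> cmod (1 + c)"
  using abs_Re_le_cmod[of "1 + c"] by simp

lemma lam_altdef: "lam u z = z * (1 + csqrt (1 - cplx u / z\<^sup>2)) / 2"
  by (simp add: lam_def sqrt_branch_def algebra_simps)

lemma norm_csqrt_Re: "0 \<le> Re (csqrt w)"
  by (metis csqrt_principal order.order_iff_strict)

lemma norm_le_lam: "cmod z \<le> 2 * cmod (lam u z)"
  using mult_left_mono[OF one_le_norm_one_plus[OF norm_csqrt_Re[of "1 - cplx u / z\<^sup>2"]], of "cmod z"]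
  by (simp add: lam_altdef norm_mult)

text \<open>\<open>csqrt\<close> has nonnegative real part, so the root taken with the plus sign is
  the larger one. This is what makes \<open>lam\<close> the attracting fixed point.\<close>

lemma norm_colam_le_lam: "cmod (z - lam u z) \<le> cmod (lam u z)"
proof -
  define c where "c = csqrt (1 - cplx u / z\<^sup>2)"
  have e2: "lam u z = z * (1 + c) / 2" by (simp add: lam_altdef c_def)
  have e1: "z - lam u z = z * (1 - c) / 2" unfolding e2 by (simp add: field_simps)
  have "cmod (1 - c) \<le> cmod (1 + c)"
    unfolding c_def by (intro norm_one_minus_le_one_plus norm_csqrt_Re)
  then show ?thesis
    unfolding e1 unfolding e2 norm_divide norm_mult by (intro divide_right_mono mult_left_mono) auto
qed

lemma lam_norm_mult: "z \<noteq> 0 \<Longrightarrow> 0 \<le> u \<Longrightarrow> cmod (lam u z) * cmod (z - lam u z) = u / 4"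
  using arg_cong[OF lam_mult[of z u], of cmod] by (simp add: norm_mult)

lemma lam_norm_square: "z \<noteq> 0 \<Longrightarrow> 0 \<le> u \<Longrightarrow> u / 4 \<le> (cmod (lam u z))\<^sup>2"
  using lam_norm_mult[of z u] mult_left_mono[OF norm_colam_le_lam[of z u], of "cmod (lam u z)"]
  by (simp add: power2_eq_square)

lemma lam_nonzero: "z \<noteq> 0 \<Longrightarrow> lam u z \<noteq> 0"
  using norm_le_lam[of z u] by auto

lemma norm_lam_le:
  assumes "z \<noteq> 0" "0 \<le> u" "u \<le> 1" "cmod z \<le> R"
  shows "cmod (lam u z) \<le> R + 1"
proof -
  have "(cmod (sqrt_branch u z))\<^sup>2 \<le> (cmod z)\<^sup>2 + u"
    using norm_triangle_ineq4[of "z\<^sup>2" "cplx u"] assms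
    by (simp add: sqrt_branch_square flip: norm_power)
  also have "\<dots> \<le> (cmod z + 1)\<^sup>2"
  proof -
    have "b\<^sup>2 + u \<le> (b + 1)\<^sup>2" if "0 \<le> b" for b :: real
      using that assms by (simp add: power2_eq_square algebra_simps)
    then show ?thesis by simp
  qed
  finally have "cmod (sqrt_branch u z) \<le> cmod z + 1" by (rule power2_le_imp_le) simp
  then have "cmod (z + sqrt_branch u z) \<le> 2 * cmod z + 1"
    using norm_triangle_ineq[of z "sqrt_branch u z"] by simp
  then show ?thesis using assms by (simp add: lam_def norm_divide)
qed

text \<open>The product of the two roots is the nonnegative real \<open>u / 4\<close>, so one root
  is a real multiple of the conjugate of the other. The factor, called \<open>k\<close> below, is
  also the modulus of the derivative of the recursion at \<open>lam u z\<close>.\<close>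

lemma colam_eq:
  assumes "z \<noteq> 0" "0 \<le> u"
  shows "z - lam u z = cplx (u / 4 / (cmod (lam u z))\<^sup>2) * cnj (lam u z)"
proof -
  have "lam u z \<noteq> 0" using assms by (simp add: lam_nonzero)
  have "(z - lam u z) * (lam u z * cnj (lam u z)) = cplx (u / 4) * cnj (lam u z)"
    using lam_mult[of z u] assms by (metis mult.assoc mult.commute)
  then have "(z - lam u z) * cplx ((cmod (lam u z))\<^sup>2) = cplx (u / 4) * cnj (lam u z)"
    unfolding complex_norm_square .
  then show ?thesis using \<open>lam u z \<noteq> 0\<close> by (simp add: field_simps)
qed

text \<open>Unlike the region of the theorem, this condition survives small perturbations of \<open>z\<close> (with a smaller \<open>y\<close>).\<close>

definition hyp :: "real \<Rightarrow> complex \<Rightarrow> bool" where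
  "hyp y z \<longleftrightarrow> y \<le> \<bar>Im z\<bar> \<or> (1 \<le> \<bar>Re z\<bar> \<and> y\<^sup>2 \<le> (Re z)\<^sup>2 - 1)"

lemma hyp_imp_norm: "hyp y z \<Longrightarrow> y \<le> 1 \<Longrightarrow> y \<le> cmod z"
  using abs_Re_le_cmod[of z] abs_Im_le_cmod[of z] by (auto simp: hyp_def)

lemma hyp_nonzero: "hyp y z \<Longrightarrow> 0 < y \<Longrightarrow> z \<noteq> 0"
  by (auto simp: hyp_def)

text \<open>Real and imaginary parts of \<open>z = lam + k * cnj lam\<close>. They turn the position
  of \<open>z\<close> relative to the cut into information on the contraction factor
  \<open>k\<close>.\<close>

lemma lam_Im_Re:
  assumes "z \<noteq> 0" "0 \<le> u"
  defines "k \<equiv> u / 4 / (cmod (lam u z))\<^sup>2"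
  shows "Im z = (1 - k) * Im (lam u z)" "Re z = (1 + k) * Re (lam u z)" "0 \<le> k" "k \<le> 1"
proof -
  have "z = lam u z + cplx k * cnj (lam u z)"
    using colam_eq[OF assms(1,2)] unfolding k_def by (simp add: algebra_simps)
  then have "Im z = Im (lam u z + cplx k * cnj (lam u z))"
    "Re z = Re (lam u z + cplx k * cnj (lam u z))" by simp_all
  then show "Im z = (1 - k) * Im (lam u z)" "Re z = (1 + k) * Re (lam u z)" 
    by (simp_all add: algebra_simps)
  show "0 \<le> k" "k \<le> 1"
    using lam_norm_square[of z u] lam_nonzero[of z u] assms(1,2)
    by (auto simp: k_def divide_le_eq)
qed

text \<open>Equivalently \<open>4 * k * ((Re z)^2 - 1) \<le> (1 - k)^2\<close>: beyond the ends of
  the cut the gap \<open>1 - k\<close> is controlled by the square root of the distance to the edge.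
  It follows from \<open>|Re z| \<le> (1 + k) * |lam|\<close> and
  \<open>k * |lam|^2 = u / 4\<close>.\<close>

lemma lam_Re_case:
  assumes "z \<noteq> 0" "0 \<le> u" "u \<le> 1" "1 \<le> \<bar>Re z\<bar>"
  defines "k \<equiv> u / 4 / (cmod (lam u z))\<^sup>2"
  shows "4 * k * (Re z)\<^sup>2 \<le> (1 + k)\<^sup>2"
proof -
  note ks = lam_Im_Re[OF assms(1,2), folded k_def]
  have l: "lam u z \<noteq> 0" using assms by (simp add: lam_nonzero)
  have "(Re z)\<^sup>2 \<le> (1 + k)\<^sup>2 * (cmod (lam u z))\<^sup>2"
    unfolding ks(2) power_mult_distrib cmod_power2 by (intro mult_left_mono) auto
  then have "4 * k * (Re z)\<^sup>2 \<le> 4 * k * ((1 + k)\<^sup>2 * (cmod (lam u z))\<^sup>2)"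
    using ks(3) by (intro mult_left_mono) auto
  also have "\<dots> = u * (1 + k)\<^sup>2"
    using l by (simp add: k_def)
  also have "\<dots> \<le> 1 * (1 + k)\<^sup>2"
    using assms by (intro mult_right_mono) auto
  finally show ?thesis by simp
qed

text \<open>Off the real axis \<open>y \<le> (1 - k) * |Im (lam u z)|\<close>, and
  \<open>lam\<close> is at most \<open>R + 1\<close>. Beyond the ends of the cut
  \<open>lam_Re_case\<close> gives the gap \<open>y\<close> once \<open>k > 1 / 4\<close>, and for
  smaller \<open>k\<close> the gap is at least \<open>3 / 4\<close>.\<close>

lemma lam_gap:
  assumes hyp: "hyp y z" and y: "0 < y" "y \<le> 1 / 2" and u: "0 \<le> u" "u \<le> 1"
    and R: "cmod z \<le> R" "1 \<le> R"
  shows "u / 4 \<le> (1 - y / (R + 1)) * (cmod (lam u z))\<^sup>2"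
proof -
  define k where "k = u / 4 / (cmod (lam u z))\<^sup>2"
  have z: "z \<noteq> 0" using hyp y by (auto dest: hyp_nonzero)
  note ks = lam_Im_Re[OF z u(1), folded k_def]
  have l: "lam u z \<noteq> 0" using z by (simp add: lam_nonzero)
  have "y / (R + 1) \<le> 1 - k"
  proof (cases "y \<le> \<bar>Im z\<bar>")
    case True
    have "y \<le> (1 - k) * \<bar>Im (lam u z)\<bar>" using True ks by (simp add: abs_mult)
    also have "\<dots> \<le> (1 - k) * (R + 1)"
      using norm_lam_le[OF z u R(1)] abs_Im_le_cmod[of "lam u z"] ks
      by (intro mult_left_mono) auto
    finally show ?thesis using R by (simp add: divide_le_eq)
  next
    case False
    then have x: "1 \<le> \<bar>Re z\<bar>" "y\<^sup>2 \<le> (Re z)\<^sup>2 - 1" using hyp by (auto simp: hyp_def)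
    have a: "4 * k * (Re z)\<^sup>2 \<le> (1 + k)\<^sup>2" using lam_Re_case[OF z u x(1)] by (simp add: k_def)
    have "y \<le> 1 - k"
    proof (cases "k \<le> 1 / 4")
      case True then show ?thesis using y by simp
    next
      case False
      have "y\<^sup>2 \<le> 4 * k * ((Re z)\<^sup>2 - 1)"
        using mult_mono[of 1 "4 * k" "y\<^sup>2" "(Re z)\<^sup>2 - 1"] False x by simp
      also have "\<dots> \<le> (1 - k)\<^sup>2" using a by (simp add: power2_eq_square algebra_simps)
      finally show ?thesis by (rule power2_le_imp_le) (use ks in auto)
    qed
    moreover have "y / (R + 1) \<le> y / 1" using y R by (intro divide_left_mono) auto
    ultimately show ?thesis by simp
  qed
  then have "k \<le> 1 - y / (R + 1)" by simp
  then have "k * (cmod (lam u z))\<^sup>2 \<le> (1 - y / (R + 1)) * (cmod (lam u z))\<^sup>2"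
    by (intro mult_right_mono) auto
  then show ?thesis using l by (simp add: k_def)
qed

text \<open>A half-plane that the noiseless recursion maps into itself, and a weight that turns the recursion on it
  into a contraction.\<close>

definition half_dom :: "real \<Rightarrow> complex \<Rightarrow> complex set" where
  "half_dom y z = (if y \<le> \<bar>Im z\<bar> then {w. (Im z)\<^sup>2 \<le> Im z * Im w}
     else {w. \<bar>Re z\<bar> * (\<bar>Re z\<bar> + sqrt ((Re z)\<^sup>2 - 1)) / 2 \<le> Re z * Re w})"

definition half_wt :: "real \<Rightarrow> complex \<Rightarrow> complex \<Rightarrow> real" where
  "half_wt y z w = (if y \<le> \<bar>Im z\<bar> then \<bar>Im w\<bar> else 1)"

lemma half_dom_ImD: "y \<le> \<bar>Im z\<bar> \<Longrightarrow> 0 < y \<Longrightarrow> w \<in> half_dom y z \<Longrightarrow> \<bar>Im z\<bar> \<le> \<bar>Im w\<bar> \<and> 0 < Im z * Im w"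
proof -
  assume a: "y \<le> \<bar>Im z\<bar>" "0 < y" "w \<in> half_dom y z"
  then have b: "(Im z)\<^sup>2 \<le> Im z * Im w" by (simp add: half_dom_def)
  have "\<bar>Im z\<bar> * \<bar>Im z\<bar> \<le> \<bar>Im z\<bar> * \<bar>Im w\<bar>"
    using b abs_ge_self[of "Im z * Im w"] by (simp add: power2_eq_square abs_mult)
  moreover have "0 < \<bar>Im z\<bar>" using a by simp
  ultimately have "\<bar>Im z\<bar> \<le> \<bar>Im w\<bar>" by (simp only: mult_le_cancel_left_pos)
  moreover have "0 < (Im z)\<^sup>2" using a by auto
  ultimately show ?thesis using b by linarith
qed

lemma half_dom_ReD:
  assumes "\<not> y \<le> \<bar>Im z\<bar>" "hyp y z" "w \<in> half_dom y z" "0 < y"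
  shows "(\<bar>Re z\<bar> + sqrt ((Re z)\<^sup>2 - 1)) / 2 \<le> sgn (Re z) * Re w" "1 \<le> \<bar>Re z\<bar>"
    "y \<le> sqrt ((Re z)\<^sup>2 - 1)"
proof -
  show x: "1 \<le> \<bar>Re z\<bar>" "y \<le> sqrt ((Re z)\<^sup>2 - 1)" using assms by (auto simp: hyp_def intro: real_le_rsqrt)
  have "\<bar>Re z\<bar> * ((\<bar>Re z\<bar> + sqrt ((Re z)\<^sup>2 - 1)) / 2) \<le> \<bar>Re z\<bar> * (sgn (Re z) * Re w)"
    unfolding mult.assoc[symmetric] abs_mult_sgn using assms by (simp add: half_dom_def)
  then show "(\<bar>Re z\<bar> + sqrt ((Re z)\<^sup>2 - 1)) / 2 \<le> sgn (Re z) * Re w"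
    using x by (subst (asm) mult_le_cancel_left_pos) auto
qed

lemma half_dom_self:
  assumes "hyp y z" "0 < y"
  shows "z \<in> half_dom y z"
proof (cases "y \<le> \<bar>Im z\<bar>")
  case True
  then show ?thesis by (simp add: half_dom_def power2_eq_square)
next
  case False
  then have "1 \<le> \<bar>Re z\<bar>" using assms by (auto simp: hyp_def)
  have "sqrt ((Re z)\<^sup>2 - 1) \<le> \<bar>Re z\<bar>" by (rule real_le_lsqrt) auto
  then have "\<bar>Re z\<bar> * (\<bar>Re z\<bar> + sqrt ((Re z)\<^sup>2 - 1)) \<le> \<bar>Re z\<bar> * (2 * \<bar>Re z\<bar>)"
    by (intro mult_left_mono) auto
  then show ?thesis using False by (simp add: half_dom_def power2_eq_square)
qed

lemma half_dom_norm:
  assumes "hyp y z" "0 < y" "y \<le> 1 / 2" "w \<in> half_dom y z"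
  shows "y \<le> cmod w" "y \<le> half_wt y z w" "half_wt y z w \<le> cmod w + 1" "w \<noteq> 0"
proof -
  show 1: "y \<le> cmod w"
  proof (cases "y \<le> \<bar>Im z\<bar>")
    case True
    then show ?thesis using half_dom_ImD[of y z w] assms abs_Im_le_cmod[of w] by auto
  next
    case False
    note h = half_dom_ReD[OF False assms(1,4,2)]
    have "sgn (Re z) * Re w \<le> cmod w" using abs_Re_le_cmod[of w] by (auto simp: sgn_if)
    moreover have "y \<le> (\<bar>Re z\<bar> + sqrt ((Re z)\<^sup>2 - 1)) / 2" 
    proof -
      have "y \<le> (a + b) / 2" if "1 \<le> a" "y \<le> b" for a b :: real using that assms(3) by simp
      then show ?thesis using h by blast
    qed
    ultimately show ?thesis using h(1) by (meson order_trans)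
  qed
  show "y \<le> half_wt y z w"
    using half_dom_ImD[of y z w] assms by (auto simp: half_wt_def)
  show "half_wt y z w \<le> cmod w + 1"
    using abs_Im_le_cmod[of w] norm_ge_zero[of w] by (auto simp: half_wt_def simp del: norm_ge_zero)
  show "w \<noteq> 0" using 1 assms by auto
qed

lemma Im_inverse: "Im (cplx v / w) = - v * Im w / (cmod w)\<^sup>2"
  by (simp add: Im_divide cmod_power2)
    

lemma Re_inverse: "Re (cplx v / w) = v * Re w / (cmod w)\<^sup>2"
  by (simp add: Re_divide cmod_power2)

text \<open>In the first case \<open>- v / w\<close> has an imaginary part of the sign of
  \<open>Im w\<close>, so the imaginary part never falls below that of \<open>z\<close>; in the
  second the boundary \<open>l = (x + s) / 2\<close> solves \<open>l = x - (1/4) / l\<close>, the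
  extremal real recursion. The weight inequality says that \<open>sqrt v / |w|\<close> is at most
  the square root of the new weight over the old one, a bound that telescopes along the
  recursion.\<close>

lemma half_dom_step:
  assumes hyp: "hyp y z" and y: "0 < y" "y \<le> 1 / 2" and v: "0 \<le> v" "v \<le> 1 / 4" and w: "w \<in> half_dom y z"
  shows "z - cplx v / w \<in> half_dom y z"
    "v * half_wt y z w \<le> half_wt y z (z - cplx v / w) * (cmod w)\<^sup>2"
proof -
  have w0: "w \<noteq> 0" using half_dom_norm[OF hyp y w] by simp
  have "z - cplx v / w \<in> half_dom y z \<and> v * half_wt y z w \<le> half_wt y z (z - cplx v / w) * (cmod w)\<^sup>2"
  proof (cases "y \<le> \<bar>Im z\<bar>")
    case True
    have e: "Im (z - cplx v / w) = Im z + v * Im w / (cmod w)\<^sup>2"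
      by (simp add: Im_inverse)
    have p: "0 < Im z * Im w" using half_dom_ImD[OF True y(1) w] by simp
    have q: "0 \<le> Im z * (v * Im w / (cmod w)\<^sup>2)"
      using p v mult_nonneg_nonneg[of v "Im z * Im w"] by (simp add: field_simps)
    have "Im z * Im (z - cplx v / w) = (Im z)\<^sup>2 + Im z * (v * Im w / (cmod w)\<^sup>2)"
      unfolding e by (simp only: distrib_left power2_eq_square)
    then have 1: "(Im z)\<^sup>2 \<le> Im z * Im (z - cplx v / w)" using q by linarith
    have sgnsum: "\<bar>b\<bar> \<le> \<bar>a + b\<bar>" if "0 \<le> a * b" for a b :: real
      using that by (auto simp: zero_le_mult_iff)
    have "\<bar>v * Im w / (cmod w)\<^sup>2\<bar> \<le> \<bar>Im z + v * Im w / (cmod w)\<^sup>2\<bar>"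
      by (rule sgnsum[OF q])
    then have "v * \<bar>Im w\<bar> / (cmod w)\<^sup>2 \<le> \<bar>Im (z - cplx v / w)\<bar>"
      using v unfolding e by (simp add: abs_mult)
    then have "v * \<bar>Im w\<bar> \<le> \<bar>Im (z - cplx v / w)\<bar> * (cmod w)\<^sup>2"
      using w0 by (simp add: pos_divide_le_eq)
    then show ?thesis using 1 True by (simp add: half_dom_def half_wt_def)
  next
    case False
    define x where "x = \<bar>Re z\<bar>"
    define s where "s = sqrt (x\<^sup>2 - 1)"
    note h = half_dom_ReD[OF False hyp w y(1), folded x_def]
    have x2: "(Re z)\<^sup>2 = x\<^sup>2" by (simp add: x_def)
    note h = h[unfolded x2, folded s_def]
    have s2: "s\<^sup>2 = x\<^sup>2 - 1" using h(2) by (simp add: s_def)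
    have s0: "0 \<le> s" using h y by simp
    define l where "l = (x + s) / 2"
    have l0: "0 < l" "1 / 2 \<le> l" using s0 h by (auto simp: l_def)
    have ll: "x - l = 1 / 4 / l"
    proof -
      have "(x - l) * l = (x\<^sup>2 - s\<^sup>2) / 4" by (simp add: l_def power2_eq_square field_simps)
      then have "(x - l) * l = 1 / 4" using s2 by simp
      then show ?thesis using l0 by (simp add: field_simps)
    qed
    define t where "t = sgn (Re z)"
    have t: "t * Re z = x" "t * t = 1" "\<bar>t\<bar> = 1" "Re z = t * x" using h by (auto simp: t_def x_def sgn_if)
    have lw: "l \<le> t * Re w" using h by (simp add: l_def t_def)
    have tw: "t * Re w \<le> cmod w" using abs_Re_le_cmod[of w] by (auto simp: t_def sgn_if)
    then have lcw: "l \<le> cmod w" using lw by simp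
    have "t * Re (cplx v / w) = v * (t * Re w / (cmod w)\<^sup>2)"
      unfolding Re_inverse by simp
    also have "\<dots> \<le> (1 / 4) * (1 / cmod w)"
    proof (intro mult_mono v)
      show "t * Re w / (cmod w)\<^sup>2 \<le> 1 / cmod w"
        using tw w0 by (simp add: divide_simps power2_eq_square)
    qed (use lw l0 in auto)
    also have "\<dots> \<le> (1 / 4) * (1 / l)"
      using lcw l0 by (simp add: frac_le)
    finally have "t * Re (z - cplx v / w) \<ge> x - 1 / 4 / l"
      using t(1) unfolding minus_complex.sel right_diff_distrib by linarith
    then have "l \<le> t * Re (z - cplx v / w)" using ll by simp
    then have "x * l \<le> x * (t * Re (z - cplx v / w))"
      using h by (intro mult_left_mono) auto
    also have "\<dots> = Re z * Re (z - cplx v / w)" using t(4) by (simp only: mult_ac)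
    finally have 1: "x * l \<le> Re z * Re (z - cplx v / w)" .
    have "v \<le> (1/2)\<^sup>2" using v by (simp add: power2_eq_square)
    also have "\<dots> \<le> (cmod w)\<^sup>2" using lcw l0 by (intro power_mono) auto
    finally have 2: "v \<le> (cmod w)\<^sup>2" .
    have "\<bar>Re z\<bar> * (\<bar>Re z\<bar> + sqrt ((Re z)\<^sup>2 - 1)) / 2 \<le> Re z * Re (z - cplx v / w)"
      using 1 unfolding x2 unfolding l_def s_def[symmetric] unfolding x_def[symmetric] by simp
    then show ?thesis using 2 False by (simp add: half_dom_def half_wt_def)
  qed
  then show "z - cplx v / w \<in> half_dom y z"
    "v * half_wt y z w \<le> half_wt y z (z - cplx v / w) * (cmod w)\<^sup>2" by auto
qed

text \<open>The repelling root lies on the other side: its imaginary part never has the sign of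
  \<open>Im z\<close>, respectively its real part in the direction of \<open>Re z\<close> is at most
  \<open>(x - s) / 2\<close>. This separation keeps the denominator of \<open>green\<close> away
  from zero.\<close>

lemma half_dom_colam:
  assumes hyp: "hyp y z" and y: "0 < y" "y \<le> 1 / 2" and u: "0 \<le> u" "u \<le> 1" and w: "w \<in> half_dom y z"
  shows "y \<le> cmod (w - (z - lam u z))"
proof -
  define k where "k = u / 4 / (cmod (lam u z))\<^sup>2"
  have z: "z \<noteq> 0" using hyp y by (auto dest: hyp_nonzero)
  note ks = lam_Im_Re[OF z u(1), folded k_def]
  have co: "z - lam u z = cplx k * cnj (lam u z)" using colam_eq[OF z u(1)] by (simp add: k_def)
  show ?thesis
  proof (cases "y \<le> \<bar>Im z\<bar>")
    case True
    have k1: "k < 1" using True y ks by (cases "k = 1") auto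
    have e: "Im (w - (z - lam u z)) = Im w + k * Im (lam u z)" by (simp add: co)
    have "Im (lam u z) = Im z / (1 - k)" using ks k1 by (simp add: field_simps)
    then have "Im z * (k * Im (lam u z)) = k * (Im z)\<^sup>2 / (1 - k)" by (simp add: power2_eq_square)
    then have "0 \<le> Im z * (k * Im (lam u z))" using ks k1 by simp
    moreover have "0 < Im z * Im w" "\<bar>Im z\<bar> \<le> \<bar>Im w\<bar>" using half_dom_ImD[OF True y(1) w] by auto
    moreover have "\<bar>a\<bar> \<le> \<bar>b + c\<bar>" if "0 \<le> a * c" "0 < a * b" "\<bar>a\<bar> \<le> \<bar>b\<bar>" for a b c :: real
      using that by (auto simp: zero_le_mult_iff zero_less_mult_iff)
    ultimately have "\<bar>Im z\<bar> \<le> \<bar>Im w + k * Im (lam u z)\<bar>" by blast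
    then show ?thesis using True e abs_Im_le_cmod[of "w - (z - lam u z)"] by simp
  next
    case False
    define x where "x = \<bar>Re z\<bar>"
    define s where "s = sqrt (x\<^sup>2 - 1)"
    have x2: "(Re z)\<^sup>2 = x\<^sup>2" by (simp add: x_def)
    note h = half_dom_ReD[OF False hyp w y(1), folded x_def, unfolded x2, folded s_def]
    have s2: "s\<^sup>2 = x\<^sup>2 - 1" using h(2) by (simp add: s_def)
    have s0: "0 \<le> s" using h y by simp
    define t where "t = sgn (Re z)"
    have t: "t * Re z = x" "\<bar>t\<bar> = 1" using h by (auto simp: t_def x_def sgn_if)
    have a: "4 * k * x\<^sup>2 \<le> (1 + k)\<^sup>2"
      using lam_Re_case[OF z u] h unfolding k_def[symmetric] x2 by (simp add: x_def)
    have "(s * (1 + k))\<^sup>2 \<le> (x * (1 - k))\<^sup>2"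
    proof -
      have "(x * (1 - k))\<^sup>2 - (s * (1 + k))\<^sup>2 = (1 + k)\<^sup>2 - 4 * k * x\<^sup>2"
        unfolding power_mult_distrib s2 by (simp add: power2_eq_square algebra_simps)
      then show ?thesis using a by linarith
    qed
    then have "s * (1 + k) \<le> x * (1 - k)"
      by (rule power2_le_imp_le) (use ks h in auto)
    moreover have "x = (1 + k) * (t * Re (lam u z))"
      using ks(2) t(1) by (metis mult.left_commute)
    then have tl: "t * Re (lam u z) = x / (1 + k)" using ks by (simp add: field_simps)
    moreover have "Re (z - lam u z) = k * Re (lam u z)" unfolding co by simp
    then have "t * Re (z - lam u z) = k * (t * Re (lam u z))" by simp
    moreover have "k * (x / (1 + k)) \<le> (x - s) / 2"
      using \<open>s * (1 + k) \<le> x * (1 - k)\<close> ks(3) by (simp add: field_simps)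
    ultimately have "t * Re (z - lam u z) \<le> (x - s) / 2" by simp
    then have "s \<le> t * Re (w - (z - lam u z))" using h by (simp add: t_def algebra_simps)
    also have "\<dots> \<le> cmod (w - (z - lam u z))"
      using abs_Re_le_cmod[of "w - (z - lam u z)"] t(2) by (auto simp: abs_if split: if_splits)
    finally show ?thesis using h by simp
  qed
qed

lemma lam_half_dom:
  assumes hyp: "hyp y z" and y: "0 < y" "y \<le> 1 / 2" and u: "0 \<le> u" "u \<le> 1"
  shows "lam u z \<in> half_dom y z"
proof -
  define k where "k = u / 4 / (cmod (lam u z))\<^sup>2"
  have z: "z \<noteq> 0" using hyp y by (auto dest: hyp_nonzero)
  note ks = lam_Im_Re[OF z u(1), folded k_def]
  show ?thesis
  proof (cases "y \<le> \<bar>Im z\<bar>")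
    case True
    have k1: "k < 1" using True y ks by (cases "k = 1") auto
    have "Im (lam u z) = Im z / (1 - k)" using ks k1 by (simp add: field_simps)
    then have "Im z * Im (lam u z) = (Im z)\<^sup>2 / (1 - k)" by (simp add: power2_eq_square)
    moreover have "(Im z)\<^sup>2 / 1 \<le> (Im z)\<^sup>2 / (1 - k)" using ks k1 by (intro divide_left_mono) auto
    ultimately show ?thesis using True by (simp add: half_dom_def)
  next
    case False
    define x where "x = \<bar>Re z\<bar>"
    define s where "s = sqrt (x\<^sup>2 - 1)"
    have x2: "(Re z)\<^sup>2 = x\<^sup>2" by (simp add: x_def)
    have h: "1 \<le> x" using hyp False by (auto simp: hyp_def x_def)
    have s2: "s\<^sup>2 = x\<^sup>2 - 1" using h by (simp add: s_def)
    have a: "4 * k * x\<^sup>2 \<le> (1 + k)\<^sup>2"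
      using lam_Re_case[OF z u] h unfolding k_def[symmetric] x2 by (simp add: x_def)
    have "(s * (1 + k))\<^sup>2 \<le> (x * (1 - k))\<^sup>2"
    proof -
      have "(x * (1 - k))\<^sup>2 - (s * (1 + k))\<^sup>2 = (1 + k)\<^sup>2 - 4 * k * x\<^sup>2"
        unfolding power_mult_distrib s2 by (simp add: power2_eq_square algebra_simps)
      then show ?thesis using a by linarith
    qed
    then have "s * (1 + k) \<le> x * (1 - k)"
      by (rule power2_le_imp_le) (use ks h in auto)
    then have "(x + s) / 2 \<le> x / (1 + k)" using ks(3) by (simp add: field_simps)
    then have "x * ((x + s) / 2) \<le> x * (x / (1 + k))" using h by (intro mult_left_mono) auto
    moreover have "Re z * Re (lam u z) = x * (x / (1 + k))"
    proof -
      have "Re (lam u z) = Re z / (1 + k)" using ks by (simp add: field_simps)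
      then show ?thesis by (simp add: x2 flip: power2_eq_square)
    qed
    ultimately have "x * (x + s) / 2 \<le> Re z * Re (lam u z)" by simp
    then have "\<bar>Re z\<bar> * (\<bar>Re z\<bar> + sqrt ((Re z)\<^sup>2 - 1)) / 2 \<le> Re z * Re (lam u z)"
      unfolding x2 unfolding s_def[symmetric] unfolding x_def[symmetric] .
    then show ?thesis using False by (simp add: half_dom_def)
  qed
qed

section \<open>The square root branch: lower bound and dependence on \<open>u\<close>\<close>

lemma sqrt_branch_norm_ge:
  assumes "hyp y z" "0 < y" "y \<le> 1 / 2" "0 \<le> u" "u \<le> 1"
  shows "y \<le> cmod (sqrt_branch u z)"
  unfolding sqrt_branch_lam by (rule half_dom_colam[OF assms lam_half_dom[OF assms]])

lemma norm_sqrt_branch_le: "cmod (sqrt_branch u z) \<le> 2 * cmod (lam u z)"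
  unfolding sqrt_branch_lam
  using norm_triangle_ineq4[of "lam u z" "z - lam u z"] norm_colam_le_lam[of z u] by linarith

text \<open>Principal roots of two numbers from the closed upper, or from the open lower, half-plane
  lie in the same closed quadrant, so neither their real nor their imaginary parts cancel.\<close>

lemma csqrt_add_norm_ge:
  assumes "0 \<le> Im w \<and> 0 \<le> Im v \<or> Im w < 0 \<and> Im v < 0"
  shows "cmod (csqrt w) \<le> cmod (csqrt w + csqrt v)"
proof -
  have *: "0 \<le> Im (csqrt w)" if "0 \<le> Im w" for w
  proof -
    have "0 \<le> cmod w - Re w" using complex_Re_le_cmod[of w] by simp
    then show ?thesis using that by (auto simp: csqrt.simps sgn_if)
  qed
  have **: "Im (csqrt w) \<le> 0" if "Im w < 0" for w
  proof -
    have "0 \<le> cmod w - Re w" using complex_Re_le_cmod[of w] by simp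
    then show ?thesis using that by (auto simp: csqrt.simps sgn_if)
  qed
  have "0 \<le> Im (csqrt w) * Im (csqrt v)"
    using assms *[of w] *[of v] **[of w] **[of v] by (auto intro: mult_nonneg_nonneg mult_nonpos_nonpos)
  moreover have "0 \<le> Re (csqrt w) * Re (csqrt v)" by (intro mult_nonneg_nonneg norm_csqrt_Re)
  moreover have sq: "a\<^sup>2 \<le> (a + b)\<^sup>2" if "0 \<le> a * b" for a b :: real
    using that by (simp add: power2_eq_square algebra_simps)
  ultimately have "(cmod (csqrt w))\<^sup>2 \<le> (cmod (csqrt w + csqrt v))\<^sup>2"
    using add_mono[OF sq sq, of "Re (csqrt w)" "Re (csqrt v)" "Im (csqrt w)" "Im (csqrt v)"]
    unfolding cmod_power2 plus_complex.sel by blast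
  then show ?thesis by (rule power2_le_imp_le) simp
qed

text \<open>\<open>v - u\<close> is the difference times the sum of the two branches, and the sum is
  no smaller than \<open>sqrt_branch u z\<close>. For positive \<open>u\<close> all numbers
  \<open>1 - u / z^2\<close> lie on the same side of the real axis. Only a zero parameter can break
  this, as 1 counts for the upper side; then \<open>csqrt 1 = 1\<close> is compared
  directly.\<close>

lemma sqrt_branch_diff:
  assumes z: "z \<noteq> 0" and u: "0 \<le> u" "0 \<le> v"
  shows "cmod (sqrt_branch u z - sqrt_branch v z) * cmod (sqrt_branch u z) \<le> \<bar>u - v\<bar>"
proof -
  have e: "(sqrt_branch u z - sqrt_branch v z) * (sqrt_branch u z + sqrt_branch v z) = cplx (v - u)"
    using sqrt_branch_square[OF z, of u] sqrt_branch_square[OF z, of v]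
    by (simp add: power2_eq_square algebra_simps)
  have i: "Im (1 - cplx t / z\<^sup>2) = t * (- Im (1 / z\<^sup>2))" for t
    using Im_inverse[of t "z\<^sup>2"] Im_inverse[of 1 "z\<^sup>2"] by (simp add: algebra_simps)
  have "cmod (sqrt_branch u z) \<le> cmod (sqrt_branch u z + sqrt_branch v z)"
  proof (cases "(u = 0 \<or> v = 0) \<and> Im (1 / z\<^sup>2) > 0")
    case False
    have "cmod (csqrt (1 - cplx u / z\<^sup>2)) \<le> cmod (csqrt (1 - cplx u / z\<^sup>2) + csqrt (1 - cplx v / z\<^sup>2))"
      by (rule csqrt_add_norm_ge, unfold i)
         (use u False in \<open>auto simp: mult_le_0_iff zero_le_mult_iff mult_less_0_iff zero_less_mult_iff\<close>)
    from mult_left_mono[OF this norm_ge_zero[of z]] show ?thesis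
      unfolding sqrt_branch_def distrib_left[symmetric] norm_mult .
  next
    case True
    have 1: "cmod (csqrt w) \<le> cmod (csqrt w + csqrt 1)" for w
      using norm_csqrt_Re[of w]
      by - (rule power2_le_imp_le, unfold cmod_power2, simp_all del: csqrt.sel add: power2_eq_square algebra_simps)
    have 2: "cmod (csqrt 1) \<le> cmod (csqrt 1 + csqrt w)" for w
      using one_le_norm_one_plus[OF norm_csqrt_Re[of w]] by simp
    have "cmod (csqrt (1 - cplx u / z\<^sup>2)) \<le> cmod (csqrt (1 - cplx u / z\<^sup>2) + csqrt (1 - cplx v / z\<^sup>2))"
      using True 1[of "1 - cplx u / z\<^sup>2"] 2[of "1 - cplx v / z\<^sup>2"] by auto
    from mult_left_mono[OF this norm_ge_zero[of z]] show ?thesis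
      unfolding sqrt_branch_def distrib_left[symmetric] norm_mult .
  qed
  then have "cmod (sqrt_branch u z - sqrt_branch v z) * cmod (sqrt_branch u z) \<le>
     cmod (sqrt_branch u z - sqrt_branch v z) * cmod (sqrt_branch u z + sqrt_branch v z)"
    by (intro mult_left_mono) auto
  also have "\<dots> = \<bar>u - v\<bar>" unfolding norm_mult[symmetric] e norm_of_real by (rule abs_minus_commute)
  finally show ?thesis .
qed

lemma lam_diff:
  assumes "hyp y z" "0 < y" "y \<le> 1 / 2" "0 \<le> u" "u \<le> 1" "0 \<le> v"
  shows "cmod (lam u z - lam v z) \<le> \<bar>u - v\<bar> / (2 * y)"
proof -
  have z: "z \<noteq> 0" using assms by (auto dest: hyp_nonzero)
  have "cmod (sqrt_branch u z - sqrt_branch v z) * y \<le> cmod (sqrt_branch u z - sqrt_branch v z) * cmod (sqrt_branch u z)"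
    by (intro mult_left_mono sqrt_branch_norm_ge assms) auto
  also have "\<dots> \<le> \<bar>u - v\<bar>" using assms by (intro sqrt_branch_diff z) auto
  finally have *: "cmod (sqrt_branch u z - sqrt_branch v z) \<le> \<bar>u - v\<bar> / y" using assms by (simp add: pos_le_divide_eq)
  have e: "lam u z - lam v z = (sqrt_branch u z - sqrt_branch v z) / 2"
    by (simp add: lam_def diff_divide_distrib add_divide_distrib)
  show ?thesis unfolding e norm_divide using divide_right_mono[OF *, of 2] by simp
qed

section \<open>The noisy three-term recursion\<close>

definition grid :: "nat \<Rightarrow> nat \<Rightarrow> real" where
  "grid N n = real n / real N"

lemma grid_0 [simp]: "grid N 0 = 0" by (simp add: grid_def)

lemma grid_bounds: "n \<le> N \<Longrightarrow> 0 \<le> grid N n \<and> grid N n \<le> 1"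
  by (cases "N = 0") (auto simp: grid_def)

lemma grid_Suc: "0 < N \<Longrightarrow> grid N (Suc n) - grid N n = 1 / real N"
  by (simp add: grid_def field_simps)

text \<open>Ratios of consecutive minors: \<open>ratio\<close> runs forward from the first row and carries the noise,
  \<open>cofrac\<close> runs backward from the last row and is deterministic.\<close>

fun ratio :: "nat \<Rightarrow> real \<Rightarrow> (nat \<Rightarrow> real) \<Rightarrow> (nat \<Rightarrow> real) \<Rightarrow> complex \<Rightarrow> nat \<Rightarrow> complex" where
  "ratio N k x y z 0 = z - cplx (k * x 0)"
| "ratio N k x y z (Suc n) = z - cplx (k * x (Suc n)) -
     cplx (grid N (Suc n) / 4 + sqrt (grid N (Suc n)) / 2 * (k * y (Suc n))) / ratio N k x y z n"

fun cofrac :: "nat \<Rightarrow> complex \<Rightarrow> nat \<Rightarrow> complex" where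
  "cofrac N z 0 = z"
| "cofrac N z (Suc k) = z - cplx (grid N (N - 1 - k) / 4) / cofrac N z k"

definition theta :: "nat \<Rightarrow> complex \<Rightarrow> nat \<Rightarrow> complex" where
  "theta N z n = cofrac N z (N - 1 - n)"

lemma theta_last: "theta N z (N - 1) = z"
  by (simp add: theta_def)

lemma theta_rec:
  assumes "Suc n < N"
  shows "theta N z n = z - cplx (grid N (Suc n) / 4) / theta N z (Suc n)"
proof -
  have "N - 1 - n = Suc (N - 1 - Suc n)" "N - 1 - (N - 1 - Suc n) = Suc n" using assms by auto
  then show ?thesis unfolding theta_def by (metis cofrac.simps(2))
qed

text \<open>With \<open>theta\<close> near \<open>lam\<close> and the subtracted quotient near
  \<open>z - lam\<close> this is close to \<open>1 / sqrt_branch\<close>, the integrand of the first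
  motion. At \<open>n = 0\<close> the truncated index \<open>n - 1\<close> does no harm because
  \<open>grid N 0 = 0\<close>; the same holds for \<open>hop\<close>.\<close>

definition green :: "nat \<Rightarrow> real \<Rightarrow> (nat \<Rightarrow> real) \<Rightarrow> (nat \<Rightarrow> real) \<Rightarrow> complex \<Rightarrow> nat \<Rightarrow> complex" where
  "green N k x y z n = 1 / (theta N z n - cplx (grid N n / 4) / ratio N k x y z (n - 1))"

definition hop :: "nat \<Rightarrow> real \<Rightarrow> (nat \<Rightarrow> real) \<Rightarrow> (nat \<Rightarrow> real) \<Rightarrow> complex \<Rightarrow> nat \<Rightarrow> complex" where
  "hop N k x y z n = cplx (sqrt (grid N n) / 2) / ratio N k x y z (n - 1)"

definition incr :: "nat \<Rightarrow> real \<Rightarrow> (nat \<Rightarrow> real) \<Rightarrow> (nat \<Rightarrow> real) \<Rightarrow> complex \<Rightarrow> nat \<Rightarrow> complex" where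
  "incr N k x y z n = cplx k * green N k x y z n *
     (cplx (x n) + hop N k x y z n * cplx (y n))"

text \<open>\<open>theta n - (u/4) / ratio (n - 1)\<close> is the ratio of the conditional expectations of the
  characteristic polynomial, which is what makes the product telescope.\<close>

lemma prod_ratio_eq:
  assumes N: "0 < N"
    and r: "\<And>n. n < N \<Longrightarrow> ratio N k x y z n \<noteq> 0"
    and t: "\<And>n. n < N \<Longrightarrow> theta N z n \<noteq> 0"
    and m: "\<And>n. n < N \<Longrightarrow> theta N z n - cplx (grid N n / 4) / ratio N k x y z (n - 1) \<noteq> 0"
  shows "(\<Prod>n<N. ratio N k x y z n) = (\<Prod>n<N. theta N z n) * (\<Prod>n<N. 1 - incr N k x y z n)"
proof -
  define M where "M n = theta N z n - cplx (grid N n / 4) / ratio N k x y z (n - 1)" for n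
  let ?r = "ratio N k x y z" and ?t = "theta N z" and ?D = "incr N k x y z"
  have M0: "M n \<noteq> 0" if "n < N" for n using m that by (simp add: M_def)
  \<comment> \<open>The ratio is affine in the noise of its own step:
    \<open>M n + z - theta n\<close> is its noiseless value given the past, and \<open>D n\<close>
    is the deviation in units of \<open>M n\<close>.\<close>
  have c1: "?r n = M n * (1 - ?D n) + z - ?t n" if "n < N" for n
  proof -
    define A where "A = cplx (grid N n / 4) / ?r (n - 1)"
    define B where "B = cplx (sqrt (grid N n) / 2 * (k * y n)) / ?r (n - 1)"
    have MA: "M n = ?t n - A" by (simp add: M_def A_def)
    have 1: "M n * ?D n = cplx (k * x n) + B"
    proof -
      have "M n * ?D n = (M n * green N k x y z n) * (cplx k * (cplx (x n) + hop N k x y z n * cplx (y n)))"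
        by (simp add: incr_def mult_ac)
      also have "M n * green N k x y z n = 1" using M0[OF that] by (simp add: green_def M_def)
      finally show ?thesis by (simp add: hop_def B_def algebra_simps)
    qed
    have 2: "?r n = z - cplx (k * x n) - A - B"
      by (cases n) (simp_all add: add_divide_distrib A_def B_def)
    have "?r n = M n - M n * ?D n + z - ?t n" unfolding 1 unfolding 2 MA by simp
    then show ?thesis by (simp add: right_diff_distrib)
  qed
  have step: "?r n * M (Suc n) = ?t (Suc n) * (M n * (1 - ?D n))" if "Suc n < N" for n
  proof -
    have "?r n * M (Suc n) = ?t (Suc n) * ?r n - cplx (grid N (Suc n) / 4)"
      using r[of n] that by (simp add: M_def right_diff_distrib)
    also have "\<dots> = ?t (Suc n) * (?r n - cplx (grid N (Suc n) / 4) / ?t (Suc n))"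
      using t[OF that] by (simp add: right_diff_distrib)
    also have "?r n - cplx (grid N (Suc n) / 4) / ?t (Suc n) = M n * (1 - ?D n)"
      using c1[of n] theta_rec[OF that, of z] that by simp
    finally show ?thesis .
  qed
  \<comment> \<open>The telescoping invariant. At the last index
    \<open>theta N z (N - 1) = z\<close>, so \<open>c1\<close> identifies
    \<open>M n * (1 - D n)\<close> with the last ratio and closes the product.\<close>
  have Q: "(\<Prod>i<n. ?r i) * M n = (\<Prod>i\<le>n. ?t i) * (\<Prod>i<n. 1 - ?D i)" if "n < N" for n
    using that
  proof (induction n)
    case 0
    then show ?case by (simp add: M_def)
  next
    case (Suc n)
    have "(\<Prod>i<Suc n. ?r i) * M (Suc n) = (\<Prod>i<n. ?r i) * (?r n * M (Suc n))" by simp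
    also have "\<dots> = ((\<Prod>i<n. ?r i) * M n) * ?t (Suc n) * (1 - ?D n)"
      unfolding step[OF Suc.prems] by (simp add: mult_ac)
    also have "\<dots> = (\<Prod>i\<le>Suc n. ?t i) * (\<Prod>i<Suc n. 1 - ?D i)"
      using Suc by (simp add: mult_ac)
    finally show ?case .
  qed
  obtain n where n: "N = Suc n" using N by (cases N) auto
  have "(\<Prod>i<N. ?r i) = (\<Prod>i<n. ?r i) * ?r n" by (simp add: n)
  also have "?r n = M n * (1 - ?D n)" using c1[of n] theta_last[of N z] by (simp add: n)
  also have "(\<Prod>i<n. ?r i) * (M n * (1 - ?D n)) = ((\<Prod>i<n. ?r i) * M n) * (1 - ?D n)" by simp
  also have "\<dots> = (\<Prod>i<N. ?t i) * (\<Prod>i<N. 1 - ?D i)"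
    using Q[of n] by (simp add: n lessThan_Suc_atMost[symmetric] mult_ac)
  finally show ?thesis .
qed

text \<open>Linearising \<open>w \<mapsto> z - (u/4)/w\<close> at its attracting fixed point \<open>lam u z\<close>.\<close>

lemma near_lam:
  assumes hyp: "hyp y z" and y: "0 < y" "y \<le> 1 / 2" and u: "0 \<le> u" "u \<le> 1"
    and R: "cmod z \<le> R" "1 \<le> R"
  defines "h \<equiv> y / (R + 1)"
  assumes e: "cmod (w - lam u z) \<le> e" "e \<le> h\<^sup>2 / 8"
  shows "cmod (lam u z) \<le> 2 * cmod w" "w \<noteq> 0"
    "sqrt u / 2 \<le> cmod (lam u z)"
    "cmod (cplx (u / 4) / w - cplx (u / 4) / lam u z) \<le> (1 - h / 2) * e"
    "cmod (cplx (sqrt u / 2) / w) \<le> 2"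
    "cmod (cplx (sqrt u / 2) / w - cplx (sqrt u / 2) / lam u z)
       \<le> 4 * e / cmod (sqrt_branch u z)"
proof -
  let ?l = "lam u z"
  have z: "z \<noteq> 0" using hyp y by (auto dest: hyp_nonzero)
  have l0: "?l \<noteq> 0" using z by (simp add: lam_nonzero)
  have h: "0 < h" "2 * h \<le> y" "h \<le> 1 / 4"
  proof -
    show "0 < h" using y R by (simp add: h_def)
    have "h \<le> y / 2" unfolding h_def using y R by (intro divide_left_mono) auto
    then show "2 * h \<le> y" by simp
    then show "h \<le> 1 / 4" using y by simp
  qed
  have yl: "y / 2 \<le> cmod ?l" using norm_le_lam[of z u] hyp_imp_norm[OF hyp] y by simp
  have hl: "h \<le> cmod ?l" using yl h by simp
  have e0: "0 \<le> e" using e(1) norm_ge_zero order_trans by blast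
  have el: "e \<le> h / 8 * cmod ?l"
  proof -
    have "e \<le> h / 8 * h" using e(2) by (simp add: power2_eq_square)
    also have "\<dots> \<le> h / 8 * cmod ?l" using hl h by (intro mult_left_mono) auto
    finally show ?thesis .
  qed
  have wl: "cmod ?l - e \<le> cmod w"
    using norm_triangle_ineq2[of ?l "?l - w"] e(1) by (simp add: norm_minus_commute)
  have wl2: "(1 - h / 8) * cmod ?l \<le> cmod w" using wl el by (simp add: algebra_simps)
  have w0: "0 < cmod w"
  proof -
    have "0 < (1 - h / 8) * cmod ?l" using h l0 by simp
    then show ?thesis using wl2 by linarith
  qed
  then show "w \<noteq> 0" by auto
  have "(1 / 2) * cmod ?l \<le> (1 - h / 8) * cmod ?l" using h by (intro mult_right_mono) auto
  then show half: "cmod ?l \<le> 2 * cmod w" using wl2 by linarith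
  have gap: "u / 4 \<le> (1 - h) * (cmod ?l)\<^sup>2"
    using lam_gap[OF hyp y u R] by (simp add: h_def)
  show sl: "sqrt u / 2 \<le> cmod ?l"
  proof (rule power2_le_imp_le)
    show "(sqrt u / 2)\<^sup>2 \<le> (cmod ?l)\<^sup>2"
      using lam_norm_square[OF z u(1)] u by (simp add: power_divide)
  qed simp
  have q: "cmod ?l / cmod w \<le> 1 + h / 4"
  proof -
    have "cmod ?l \<le> (1 + h / 4) * ((1 - h / 8) * cmod ?l)"
    proof -
      have "h * h \<le> h * (1 / 4)" using h by (intro mult_left_mono) auto
      then have "1 \<le> (1 + h / 4) * (1 - h / 8)" using h by (simp add: algebra_simps)
      from mult_right_mono[OF this, of "cmod ?l"] show ?thesis by (simp add: mult.assoc)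
    qed
    also have "\<dots> \<le> (1 + h / 4) * cmod w" using wl2 h by (intro mult_left_mono) auto
    finally show ?thesis using w0 by (simp add: divide_le_eq)
  qed
  have diff: "cplx c / w - cplx c / ?l = cplx c * (?l - w) / (w * ?l)" for c
    using w0 l0 by (auto simp: field_simps)
  show "cmod (cplx (u / 4) / w - cplx (u / 4) / ?l) \<le> (1 - h / 2) * e"
  proof -
    have "cmod (cplx (u / 4) / w - cplx (u / 4) / ?l) = u / 4 * cmod (?l - w) / (cmod w * cmod ?l)"
      unfolding diff using u by (simp add: norm_mult norm_divide)
    also have "\<dots> \<le> ((1 - h) * (cmod ?l)\<^sup>2) * e / (cmod w * cmod ?l)"
      using gap e u by (intro divide_right_mono mult_mono) (auto simp: norm_minus_commute)
    also have "\<dots> = (1 - h) * (cmod ?l / cmod w) * e" using l0 by (simp add: power2_eq_square)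
    also have "\<dots> \<le> (1 - h) * (1 + h / 4) * e" using q h e0 by (intro mult_right_mono mult_left_mono) auto
    also have "\<dots> \<le> (1 - h / 2) * e"
      using h e0 by (intro mult_right_mono) (auto simp: algebra_simps)
    finally show ?thesis .
  qed
  show "cmod (cplx (sqrt u / 2) / w) \<le> 2"
    using sl half w0 u by (simp add: norm_divide divide_le_eq)
  show "cmod (cplx (sqrt u / 2) / w - cplx (sqrt u / 2) / ?l) \<le> 4 * e / cmod (sqrt_branch u z)"
  proof -
    have s0: "0 < cmod (sqrt_branch u z)" using sqrt_branch_norm_ge[OF hyp y u] y by linarith
    have "cmod (cplx (sqrt u / 2) / w - cplx (sqrt u / 2) / ?l) = sqrt u / 2 * cmod (?l - w) / (cmod w * cmod ?l)"
      unfolding diff using u by (simp add: norm_mult norm_divide)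
    also have "\<dots> \<le> cmod ?l * e / (cmod w * cmod ?l)"
      using sl e u by (intro divide_right_mono mult_mono) (auto simp: norm_minus_commute)
    also have "\<dots> = e / cmod w" using l0 by simp
    also have "\<dots> \<le> e / (cmod (sqrt_branch u z) / 4)"
      using half norm_sqrt_branch_le[of u z] e0 w0 s0 by (intro divide_left_mono) auto
    finally show ?thesis by (simp add: mult.commute)
  qed
qed

text \<open>One outcome of the noise at one point \<open>z\<close>; everything in this locale is
  deterministic, with \<open>\<nu>\<close> bounding the scaled noise.\<close>

locale noisy_recursion =
  fixes N :: nat and z :: complex and R y k \<nu> :: real and X Y :: "nat \<Rightarrow> real"
  assumes N: "0 < N" and hyp: "hyp y z" and y: "0 < y" "y \<le> 1 / 2"
    and R: "cmod z \<le> R" "1 \<le> R"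
    and noise: "\<And>n. n < N \<Longrightarrow> \<bar>k * X n\<bar> \<le> \<nu>" "\<And>n. n < N \<Longrightarrow> \<bar>k * Y n\<bar> \<le> \<nu>"
begin

text \<open>\<open>1 - h\<close> bounds the contraction factor at the fixed point, by
  \<open>lam_gap\<close>; \<open>\<Delta>\<close> bounds the drift of the fixed point in one
  step.\<close>

definition h where "h = y / (R + 1)"
definition \<Delta> where "\<Delta> = 1 / (2 * y * real N)"
text \<open>The steady state of the error: a step adds at most \<open>3 * \<nu> + \<Delta>\<close>,
  one \<open>\<nu>\<close> from the diagonal and two from the off-diagonal entry, and contracts by
  \<open>1 - h / 2\<close>.\<close>

definition d where "d = 2 / h * (3 * \<nu> + \<Delta>)"

lemma h_bounds: "0 < h" "2 * h \<le> y" "h \<le> 1 / 4"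
proof -
  show "0 < h" using y R by (simp add: h_def)
  have "h \<le> y / 2" unfolding h_def using y R by (intro divide_left_mono) auto
  then show "2 * h \<le> y" by simp
  then show "h \<le> 1 / 4" using y by simp
qed

lemma \<Delta>_pos: "0 < \<Delta>" using y N by (simp add: \<Delta>_def)

lemma lam_step:
  assumes "Suc n < N"
  shows "cmod (lam (grid N (Suc n)) z - lam (grid N n) z) \<le> \<Delta>"
proof -
  have "0 \<le> grid N (Suc n)" "grid N (Suc n) \<le> 1" "0 \<le> grid N n"
    using grid_bounds[of "Suc n" N] grid_bounds[of n N] assms by auto
  from lam_diff[OF hyp y this] show ?thesis
    by (simp add: grid_Suc[OF N] \<Delta>_def mult_ac)
qed

text \<open>Induction with \<open>d\<close> as stationary bound. There is no initial layer, because
  \<open>lam 0 z = z\<close> and the first ratio differs from \<open>z\<close> only by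
  noise.\<close>

lemma ratio_near:
  assumes small: "d + \<Delta> \<le> h\<^sup>2 / 8" and "n < N"
  shows "cmod (ratio N k X Y z n - lam (grid N n) z) \<le> d"
  using \<open>n < N\<close>
proof (induction n)
  case 0
  have "\<nu> \<le> d"
  proof -
    have "0 \<le> \<nu>" using noise(1)[OF N] by linarith
    moreover have "1 \<le> 2 / h" using h_bounds by simp
    ultimately have "1 * (3 * \<nu> + \<Delta>) \<le> d" unfolding d_def using \<Delta>_pos by (intro mult_right_mono) auto
    then show ?thesis using \<Delta>_pos \<open>0 \<le> \<nu>\<close> by simp
  qed
  moreover have "lam 0 z = z" by (simp add: lam_def sqrt_branch_def)
  ultimately show ?case using noise(1)[OF N] by (simp flip: of_real_mult)
next
  case (Suc n)
  let ?u = "grid N (Suc n)" and ?w = "ratio N k X Y z n"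
  have u: "0 \<le> ?u" "?u \<le> 1" using grid_bounds[of "Suc n" N] Suc.prems by auto
  have "cmod (?w - lam ?u z) \<le> cmod (?w - lam (grid N n) z) + cmod (lam (grid N n) z - lam ?u z)"
    using norm_triangle_ineq[of "?w - lam (grid N n) z" "lam (grid N n) z - lam ?u z"] by simp
  also have "\<dots> \<le> d + \<Delta>"
    using Suc lam_step[OF Suc.prems] by (simp add: norm_minus_commute)
  finally have e: "cmod (?w - lam ?u z) \<le> d + \<Delta>" .
  note nl = near_lam[OF hyp y u R e small[unfolded h_def], folded h_def]
  have z: "z \<noteq> 0" using hyp y by (auto dest: hyp_nonzero)
  have fxp: "lam ?u z = z - cplx (?u / 4) / lam ?u z"
    using lam_mult[OF z, of ?u] lam_nonzero[OF z, of ?u] by (simp add: field_simps)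
  have "ratio N k X Y z (Suc n) - lam ?u z = - cplx (k * X (Suc n))
      - (cplx (sqrt ?u / 2) / ?w) * cplx (k * Y (Suc n))
      - (cplx (?u / 4) / ?w - cplx (?u / 4) / lam ?u z)"
    unfolding arg_cong[OF fxp, of "\<lambda>t. ratio N k X Y z (Suc n) - t"]
    by (simp add: add_divide_distrib algebra_simps)
  also have "cmod \<dots> \<le> \<bar>k * X (Suc n)\<bar> + cmod (cplx (sqrt ?u / 2) / ?w) * \<bar>k * Y (Suc n)\<bar>
      + cmod (cplx (?u / 4) / ?w - cplx (?u / 4) / lam ?u z)"
  proof -
    have tri: "cmod (- a - b - c) \<le> cmod a + cmod b + cmod c" for a b c
      using norm_triangle_ineq4[of "- a - b" c] norm_triangle_ineq4[of "- a" b] by simp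
    show ?thesis by (rule order_trans[OF tri]) (simp only: norm_mult norm_of_real order_refl)
  qed
  also have "\<dots> \<le> \<nu> + 2 * \<nu> + (1 - h / 2) * (d + \<Delta>)"
    using nl Suc.prems by (intro add_mono mult_mono noise) auto
  also have "\<dots> = 3 * \<nu> + \<Delta> - h / 2 * \<Delta> + d - h / 2 * d" by (simp add: algebra_simps)
  also have "\<dots> \<le> d"
  proof -
    have "h / 2 * d = 3 * \<nu> + \<Delta>" using h_bounds by (simp add: d_def)
    moreover have "0 \<le> h / 2 * \<Delta>" using h_bounds \<Delta>_pos by simp
    ultimately show ?thesis by linarith
  qed
  finally show ?case .
qed

lemma cofrac_half_dom: "j < N \<Longrightarrow> cofrac N z j \<in> half_dom y z"
proof (induction j)
  case 0
  then show ?case using half_dom_self[OF hyp y(1)] by simp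
next
  case (Suc j)
  have "0 \<le> grid N (N - 1 - j) / 4" "grid N (N - 1 - j) / 4 \<le> 1 / 4" using grid_bounds[of "N - 1 - j" N] by auto
  from half_dom_step(1)[OF hyp y this] show ?case using Suc by simp
qed

lemma theta_half_dom: "theta N z n \<in> half_dom y z"
  unfolding theta_def using N by (intro cofrac_half_dom) auto

lemma cofrac_norm_le: "j < N \<Longrightarrow> half_wt y z (cofrac N z j) \<le> (R + 1) / y"
proof -
  assume j: "j < N"
  have "cmod (cofrac N z j) \<le> R + 1 / (4 * y)"
  proof (cases j)
    case 0
    then show ?thesis using R y by (simp add: add_increasing2)
  next
    case (Suc i)
    have "0 \<le> grid N (N - 1 - i)" "grid N (N - 1 - i) \<le> 1" using grid_bounds[of "N - 1 - i" N] by auto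
    moreover have "y \<le> cmod (cofrac N z i)"
      using half_dom_norm(1)[OF hyp y cofrac_half_dom[of i]] Suc j by simp
    ultimately have "cmod (cplx (grid N (N - 1 - i) / 4) / cofrac N z i) \<le> (1 / 4) / y"
      unfolding norm_divide using y by (intro frac_le) auto
    then have "cmod (cofrac N z j) \<le> R + (1 / 4) / y"
      unfolding Suc cofrac.simps using R by (intro order_trans[OF norm_triangle_ineq4] add_mono) auto
    then show ?thesis by simp
  qed
  then have "half_wt y z (cofrac N z j) \<le> R + 1 / (4 * y) + 1"
    using half_dom_norm(3)[OF hyp y cofrac_half_dom[OF j]] by simp
  also have "\<dots> \<le> (R + 1) / y"
  proof -
    have "1 / (4 * y) \<le> (R + 1) * (1 / y - 1)"
    proof -
      have "1 / y \<ge> 2" using y by (simp add: field_simps)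
      then have "1 / (4 * y) \<le> 1 * (1 / y - 1)" by simp
      also have "\<dots> \<le> (R + 1) * (1 / y - 1)" using \<open>1 / y \<ge> 2\<close> R by (intro mult_right_mono) auto
      finally show ?thesis .
    qed
    then show ?thesis by (simp add: algebra_simps)
  qed
  finally show ?thesis .
qed

text \<open>The contraction factor of one step is \<open>v / (|t| * |lam|)\<close>. The half
  \<open>sqrt v / |lam|\<close> is at most \<open>1 - h / 2\<close> by the gap. The half
  \<open>sqrt v / |t|\<close> need not be below 1 while \<open>t\<close> is still far from
  \<open>lam\<close>; it is absorbed into the ratio of the weights.\<close>

lemma cofrac_near_aux:
  assumes "j < N"
  shows "cmod (cofrac N z j - lam (grid N (N - 1 - j)) z) \<le>
    sqrt (half_wt y z (cofrac N z j)) * ((1 - h / 2) ^ j * ((R + 1) / sqrt y) + 2 * \<Delta> / (h * sqrt y))"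
  using assms
proof (induction j)
  case 0
  have z: "z \<noteq> 0" using hyp y by (auto dest: hyp_nonzero)
  have u: "0 \<le> grid N (N - 1)" "grid N (N - 1) \<le> 1" using grid_bounds[of "N - 1" N] by auto
  have w: "sqrt y \<le> sqrt (half_wt y z z)"
    using half_dom_norm(2)[OF hyp y half_dom_self[OF hyp y(1)]] by simp
  \<comment> \<open>The initial error is bounded but not small, which is the source of the boundary
    layer.\<close>
  have "cmod (z - lam (grid N (N - 1)) z) \<le> sqrt y * ((R + 1) / sqrt y)"
    using norm_colam_le_lam[of z "grid N (N - 1)"] norm_lam_le[OF z u R(1)] y by simp
  also have "\<dots> \<le> sqrt (half_wt y z z) * ((R + 1) / sqrt y + 2 * \<Delta> / (h * sqrt y))"
    using w y h_bounds \<Delta>_pos R by (intro mult_mono) (auto intro!: add_nonneg_nonneg)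
  finally show ?case by simp
next
  case (Suc j)
  let ?t = "cofrac N z j" and ?t' = "cofrac N z (Suc j)"
  define E where "E = (1 - h / 2) ^ j * ((R + 1) / sqrt y) + 2 * \<Delta> / (h * sqrt y)"
  define u where "u = grid N (N - 1 - j)"
  define v where "v = u / 4"
  have u: "0 \<le> u" "u \<le> 1" using grid_bounds[of "N - 1 - j" N] by (auto simp: u_def)
  have v: "0 \<le> v" "v \<le> 1 / 4" using u by (auto simp: v_def)
  have td: "?t \<in> half_dom y z" using cofrac_half_dom[of j] Suc by simp
  have t't: "?t' = z - cplx v / ?t" by (simp add: v_def u_def)
  have z: "z \<noteq> 0" using hyp y by (auto dest: hyp_nonzero)
  let ?l = "lam u z"
  have l0: "?l \<noteq> 0" using z by (simp add: lam_nonzero)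
  have t0: "?t \<noteq> 0" using half_dom_norm(4)[OF hyp y td] .
  have wt: "y \<le> half_wt y z ?t'" using half_dom_norm(2)[OF hyp y cofrac_half_dom[OF Suc.prems]] .
  have wt0: "0 \<le> half_wt y z ?t" using half_dom_norm(2)[OF hyp y td] y by simp
  have fxp: "?l = z - cplx v / ?l"
    using lam_mult[OF z, of u] l0 by (simp add: field_simps v_def)
  have E0: "0 \<le> E" using h_bounds \<Delta>_pos y R by (auto simp: E_def)
  have a: "sqrt v \<le> (1 - h / 2) * cmod ?l"
  proof (rule real_le_lsqrt)
    have "v \<le> (1 - h) * (cmod ?l)\<^sup>2" using lam_gap[OF hyp y u R] by (simp add: v_def h_def)
    also have "\<dots> \<le> (1 - h / 2)\<^sup>2 * (cmod ?l)\<^sup>2" 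
      by (intro mult_right_mono) (auto simp: power2_eq_square algebra_simps)
    finally show "v \<le> ((1 - h / 2) * cmod ?l)\<^sup>2" by (simp add: power_mult_distrib)
  qed (use h_bounds in auto)
  have b: "sqrt v * sqrt (half_wt y z ?t) \<le> sqrt (half_wt y z ?t') * cmod ?t"
    using real_sqrt_le_mono[OF half_dom_step(2)[OF hyp y v td]] unfolding t't
    by (simp add: real_sqrt_mult)
  have "?t' - ?l = cplx v * (?t - ?l) / (?t * ?l)"
    unfolding arg_cong[OF fxp, of "\<lambda>t. ?t' - t"] unfolding t't using t0 l0 by (simp add: field_simps)
  then have "cmod (?t' - ?l) = (sqrt v * sqrt v) * cmod (?t - ?l) / (cmod ?t * cmod ?l)"
    using v by (simp add: norm_mult norm_divide)
  also have "\<dots> \<le> (sqrt v * sqrt v) * (sqrt (half_wt y z ?t) * E) / (cmod ?t * cmod ?l)"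
    using Suc v by (intro divide_right_mono mult_left_mono) (auto simp: E_def u_def)
  also have "\<dots> = sqrt v * (sqrt v * sqrt (half_wt y z ?t)) * (E / (cmod ?t * cmod ?l))" by simp
  also have "\<dots> \<le> ((1 - h / 2) * cmod ?l) * (sqrt (half_wt y z ?t') * cmod ?t) * (E / (cmod ?t * cmod ?l))"
    by (rule mult_right_mono[OF mult_mono[OF a b]]) (use v E0 h_bounds wt0 wt y in auto)
  also have "\<dots> = sqrt (half_wt y z ?t') * ((1 - h / 2) * E)" using t0 l0 by simp
  finally have 1: "cmod (?t' - ?l) \<le> sqrt (half_wt y z ?t') * ((1 - h / 2) * E)" .
  have n: "N - 1 - j = Suc (N - 1 - Suc j)" using Suc.prems by simp
  have "cmod (?l - lam (grid N (N - 1 - Suc j)) z) \<le> \<Delta>"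
    unfolding u_def n using Suc.prems by (intro lam_step) simp
  also have "\<Delta> = sqrt y * (\<Delta> / sqrt y)" using y by simp
  also have "\<dots> \<le> sqrt (half_wt y z ?t') * (\<Delta> / sqrt y)"
    using wt y \<Delta>_pos by (intro mult_right_mono) auto
  finally have 2: "cmod (?l - lam (grid N (N - 1 - Suc j)) z) \<le> sqrt (half_wt y z ?t') * (\<Delta> / sqrt y)" .
  have "cmod (?t' - lam (grid N (N - 1 - Suc j)) z) \<le> cmod (?t' - ?l) + cmod (?l - lam (grid N (N - 1 - Suc j)) z)"
    unfolding dist_norm[symmetric] by (rule dist_triangle)
  also have "\<dots> \<le> sqrt (half_wt y z ?t') * ((1 - h / 2) * E + \<Delta> / sqrt y)"
    using 1 2 by (simp add: distrib_left)
  also have "(1 - h / 2) * E + \<Delta> / sqrt y = (1 - h / 2) ^ Suc j * ((R + 1) / sqrt y) + 2 * \<Delta> / (h * sqrt y)"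
    using h_bounds y by (simp add: E_def field_simps)
  finally show ?case .
qed

lemma cofrac_near:
  assumes "j < N"
  shows "cmod (cofrac N z j - lam (grid N (N - 1 - j)) z) \<le>
    (R + 1) / y * ((1 - h / 2) ^ j * (R + 1) + 2 * \<Delta> / h)"
proof -
  let ?E = "(1 - h / 2) ^ j * (R + 1) + 2 * \<Delta> / h"
  have E0: "0 \<le> ?E" using h_bounds \<Delta>_pos R by simp
  have "sqrt (half_wt y z (cofrac N z j)) \<le> sqrt ((R + 1) / y)"
    using cofrac_norm_le[OF assms] by simp
  also have "\<dots> \<le> (R + 1) / sqrt y"
  proof -
    have "sqrt (R + 1) \<le> R + 1" using R by (intro real_le_lsqrt) (auto simp: power2_eq_square)
    then show ?thesis using y by (simp add: real_sqrt_divide divide_right_mono)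
  qed
  finally have w: "sqrt (half_wt y z (cofrac N z j)) \<le> (R + 1) / sqrt y" .
  note cofrac_near_aux[OF assms]
  also have "(1 - h / 2) ^ j * ((R + 1) / sqrt y) + 2 * \<Delta> / (h * sqrt y) = ?E / sqrt y"
    using y h_bounds by (simp add: field_simps)
  also have "sqrt (half_wt y z (cofrac N z j)) * (?E / sqrt y) \<le> (R + 1) / sqrt y * (?E / sqrt y)"
    using w E0 y by (intro mult_right_mono) auto
  also have "\<dots> = (R + 1) / y * ?E" using y by simp
  finally show ?thesis .
qed

end

section \<open>The two integrands of the field and their sums over the grid\<close>

definition ker1 :: "real \<Rightarrow> complex \<Rightarrow> complex" where
  "ker1 u z = 1 / sqrt_branch u z"

text \<open>\<open>J (z / sqrt u)\<close> in a form without division by \<open>sqrt u\<close>; see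
  \<open>Jouk_eq_rot\<close>.\<close>

definition rot :: "real \<Rightarrow> complex \<Rightarrow> complex" where
  "rot u z = cplx (sqrt u / 2) / lam u z"

definition ker2 :: "real \<Rightarrow> complex \<Rightarrow> complex" where
  "ker2 u z = rot u z / sqrt_branch u z"

text \<open>For \<open>s = sqrt u > 0\<close> the inverse Joukowsky map yields the repelling root,
  \<open>s * J (z / s) = 2 * (z - lam u z)\<close>, and the product of the two roots is
  \<open>u / 4\<close>. At \<open>u = 0\<close> both sides are 0.\<close>

lemma Jouk_eq_rot:
  assumes "0 \<le> u" "z \<noteq> 0"
  shows "Jouk (z / cplx (sqrt u)) = rot u z"
proof (cases "u = 0")
  case True
  then show ?thesis by (simp add: Jouk_def rot_def sqrt_branch_def)
next
  case False
  define s where "s = cplx (sqrt u)"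
  have s: "s \<noteq> 0" "s\<^sup>2 = cplx u"
    using False assms by (auto simp: s_def simp flip: of_real_power)
  have "sqrt_branch 1 (z / s) = sqrt_branch u z / s"
    using s by (simp add: sqrt_branch_def power_divide)
  then have "Jouk (z / s) = (z - sqrt_branch u z) / s" by (simp add: Jouk_def diff_divide_distrib)
  also have "z - sqrt_branch u z = 2 * (z - lam u z)" by (simp add: lam_def field_simps)
  also have "z - lam u z = cplx (u / 4) / lam u z"
    using lam_mult[OF assms(2), of u] lam_nonzero[OF assms(2), of u] by (simp add: field_simps)
  also have "2 * (cplx (u / 4) / lam u z) / s = rot u z"
    using s lam_nonzero[OF assms(2), of u] by (simp add: rot_def field_simps power2_eq_square flip: s_def)
  finally show ?thesis by (simp add: s_def)
qed

lemma norm_rot_le: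
  assumes "z \<noteq> 0" "0 \<le> u"
  shows "cmod (rot u z) \<le> 1"
proof -
  have "sqrt u / 2 \<le> cmod (lam u z)"
  proof (rule power2_le_imp_le)
    show "(sqrt u / 2)\<^sup>2 \<le> (cmod (lam u z))\<^sup>2"
      using lam_norm_square[of z u] assms by (simp add: power_divide)
  qed simp
  then show ?thesis using assms lam_nonzero[of z u] by (simp add: rot_def norm_divide divide_le_eq)
qed

lemma norm_ker2_le: "z \<noteq> 0 \<Longrightarrow> 0 \<le> u \<Longrightarrow> cmod (ker2 u z) \<le> cmod (ker1 u z)"
  using norm_rot_le[of z u] by (simp add: ker2_def ker1_def norm_divide divide_right_mono)

lemma norm_ker1_le:
  assumes "hyp y z" "0 < y" "y \<le> 1 / 2" "0 \<le> u" "u \<le> 1"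
  shows "cmod (ker1 u z) \<le> 1 / y"
  using sqrt_branch_norm_ge[OF assms] assms by (simp add: ker1_def norm_divide frac_le)

lemma card_near_le:
  assumes "0 \<le> b"
  shows "real (card {n. n < N \<and> \<bar>a - real n\<bar> \<le> b}) \<le> 2 * b + 1"
proof -
  define S where "S = {n. n < N \<and> \<bar>a - real n\<bar> \<le> b}"
  have fin: "finite S" by (simp add: S_def)
  show ?thesis
  proof (cases "S = {}")
    case False
    define m where "m = Min S"
    have m: "m \<in> S" "\<And>n. n \<in> S \<Longrightarrow> m \<le> n" using fin False by (auto simp: m_def)
    have "S \<subseteq> {m..m + nat \<lfloor>2 * b\<rfloor>}"
    proof
      fix n assume n: "n \<in> S"
      have "\<bar>a - real n\<bar> \<le> b" "\<bar>a - real m\<bar> \<le> b" using n m(1) by (auto simp: S_def)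
      then have "real n - real m \<le> 2 * b" by linarith
      then have "real (n - m) \<le> 2 * b" using m(2)[OF n] by (simp add: of_nat_diff)
      then have "n - m \<le> nat \<lfloor>2 * b\<rfloor>" by (simp add: le_nat_floor)
      then show "n \<in> {m..m + nat \<lfloor>2 * b\<rfloor>}" using m(2)[OF n] by auto
    qed
    then have "card S \<le> card {m..m + nat \<lfloor>2 * b\<rfloor>}" by (intro card_mono) auto
    then have "card S \<le> nat \<lfloor>2 * b\<rfloor> + 1" by simp
    then have "real (card S) \<le> real (nat \<lfloor>2 * b\<rfloor>) + 1" by linarith
    also have "real (nat \<lfloor>2 * b\<rfloor>) \<le> 2 * b" using assms by (intro of_nat_floor) auto
    finally show ?thesis by (simp add: S_def)
  qed (use assms in \<open>simp flip: S_def\<close>)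
qed

text \<open>The squared kernel is \<open>1 / |z^2 - u|\<close>. Only about \<open>2 * y * N\<close>
  grid points lie within \<open>y\<close> of \<open>Re (z^2)\<close> and need the pointwise bound
  \<open>1 / y^2\<close>; elsewhere \<open>1 / y\<close> suffices. This gains a factor
  \<open>y\<close> over summing the pointwise bound.\<close>

lemma sum_ker1_square_le:
  assumes hyp: "hyp y z" and y: "0 < y" "y \<le> 1 / 2" and N: "0 < N" "1 / y \<le> real N"
  shows "(\<Sum>n<N. (cmod (ker1 (grid N n) z))\<^sup>2) \<le> 4 * real N / y"
proof -
  define c where "c = Re (z\<^sup>2)"
  define A where "A = {n. n < N \<and> \<bar>c * real N - real n\<bar> \<le> y * real N}"
  have z: "z \<noteq> 0" using hyp y by (auto dest: hyp_nonzero)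
  have A1: "(cmod (ker1 (grid N n) z))\<^sup>2 \<le> 1 / y\<^sup>2" if "n < N" for n
    using power_mono[OF norm_ker1_le[OF hyp y], of "grid N n" 2] grid_bounds[of n N] that
    by (simp add: power_divide)
  have A2: "(cmod (ker1 (grid N n) z))\<^sup>2 \<le> 1 / y" if "n < N" "n \<notin> A" for n
  proof -
    have "y * real N < \<bar>c * real N - real n\<bar>" using that by (simp add: A_def)
    also have "c * real N - real n = (c - grid N n) * real N" using N by (simp add: grid_def left_diff_distrib)
    finally have "y * real N < \<bar>c - grid N n\<bar> * real N" by (simp add: abs_mult)
    then have "y < \<bar>c - grid N n\<bar>" using N by simp
    also have "\<dots> = \<bar>Re (z\<^sup>2 - cplx (grid N n))\<bar>" by (simp add: c_def)
    also have "\<dots> \<le> cmod (z\<^sup>2 - cplx (grid N n))" by (rule abs_Re_le_cmod)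
    also have "\<dots> = (cmod (sqrt_branch (grid N n) z))\<^sup>2"
      using sqrt_branch_square[OF z, of "grid N n"] by (simp flip: norm_power)
    finally show ?thesis using y by (simp add: ker1_def norm_divide power_divide frac_le)
  qed
  have "(\<Sum>n<N. (cmod (ker1 (grid N n) z))\<^sup>2) \<le> (\<Sum>n<N. (if n \<in> A then 1 / y\<^sup>2 else 0) + 1 / y)"
    using A1 A2 y by (intro sum_mono) (auto simp: add_increasing2)
  also have "\<dots> = real (card A) / y\<^sup>2 + real N / y"
  proof -
    have "{..<N} \<inter> {n. n \<in> A} = A" by (auto simp: A_def)
    then show ?thesis by (simp add: sum.distrib sum.If_cases)
  qed
  also have "\<dots> \<le> (2 * (y * real N) + 1) / y\<^sup>2 + real N / y"
    unfolding A_def using y by (intro add_mono divide_right_mono card_near_le) auto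
  also have "\<dots> = 3 * real N / y + (1 / y) * (1 / y)"
    using y by (simp add: field_simps power2_eq_square)
  also have "\<dots> \<le> 3 * real N / y + real N * (1 / y)"
    using N y by (intro add_mono mult_right_mono) auto
  finally show ?thesis by simp
qed

section \<open>Comparison of the increments with their deterministic-coefficient versions\<close>

context noisy_recursion
begin

lemma z_nonzero: "z \<noteq> 0" using hyp y by (auto dest: hyp_nonzero)

lemma \<nu>_nonneg: "0 \<le> \<nu>" using noise(1)[OF N] by linarith

lemma grid_le: "n < N \<Longrightarrow> 0 \<le> grid N n" "n < N \<Longrightarrow> grid N n \<le> 1"
  using grid_bounds[of n N] by auto

lemma theta_near:
  assumes "n < N"
  shows "cmod (theta N z n - lam (grid N n) z) \<le>
    (R + 1) / y * ((1 - h / 2) ^ (N - 1 - n) * (R + 1) + 2 * \<Delta> / h)"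
  unfolding theta_def using cofrac_near[of "N - 1 - n"] assms by simp

lemma theta_nonzero: "theta N z n \<noteq> 0"
  by (rule half_dom_norm(4)[OF hyp y theta_half_dom])

context
  fixes e :: real
  defines "e \<equiv> d + \<Delta>"
  assumes small: "e \<le> h\<^sup>2 / 8"
begin

lemma d_nonneg: "0 \<le> d" using h_bounds \<Delta>_pos \<nu>_nonneg by (simp add: d_def)

lemma e_bounds: "0 \<le> e" "e \<le> y / 2"
proof -
  show "0 \<le> e" using d_nonneg \<Delta>_pos by (simp add: e_def)
  have "h\<^sup>2 / 8 \<le> h" using h_bounds by (simp add: power2_eq_square)
  then show "e \<le> y / 2" using small h_bounds by linarith
qed

lemma small': "d + \<Delta> \<le> h\<^sup>2 / 8" using small by (simp add: e_def)

lemma ratio_prev_near: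
  assumes "n < N" "0 < n"
  shows "cmod (ratio N k X Y z (n - 1) - lam (grid N n) z) \<le> e"
proof -
  obtain m where m: "n = Suc m" using assms by (cases n) auto
  have "cmod (ratio N k X Y z m - lam (grid N n) z) \<le> cmod (ratio N k X Y z m - lam (grid N m) z) + cmod (lam (grid N m) z - lam (grid N n) z)"
    unfolding dist_norm[symmetric] by (rule dist_triangle)
  also have "\<dots> \<le> d + \<Delta>"
    using ratio_near[OF small', of m] lam_step[of m] assms by (intro add_mono) (auto simp: m norm_minus_commute)
  finally show ?thesis by (simp add: m e_def)
qed

lemma ratio_nonzero:
  assumes "n < N"
  shows "ratio N k X Y z n \<noteq> 0"
proof -
  have "cmod (ratio N k X Y z n - lam (grid N n) z) \<le> e"
    using ratio_near[OF small' assms] \<Delta>_pos by (simp add: e_def)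
  from near_lam(2)[OF hyp y grid_le[OF assms] R this] small show ?thesis by (simp add: h_def)
qed

lemma hop_bounds:
  assumes n: "n < N"
  shows "cmod (hop N k X Y z n) \<le> 2"
    "cmod (hop N k X Y z n - rot (grid N n) z) \<le> 4 * e * cmod (ker1 (grid N n) z)"
    "cmod (cplx (grid N n / 4) / ratio N k X Y z (n - 1) - (z - lam (grid N n) z)) \<le> e"
proof -
  let ?A = "cmod (hop N k X Y z n) \<le> 2 \<and>
    cmod (hop N k X Y z n - rot (grid N n) z) \<le> 4 * e * cmod (ker1 (grid N n) z) \<and>
    cmod (cplx (grid N n / 4) / ratio N k X Y z (n - 1) - (z - lam (grid N n) z)) \<le> e"
  have ?A
  proof (cases "n = 0")
    case True
    have "lam 0 z = z" by (simp add: lam_def sqrt_branch_def)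
    then show ?thesis using True e_bounds by (simp add: hop_def rot_def)
  next
    case False
    note nl = near_lam[OF hyp y grid_le[OF n] R ratio_prev_near[OF n] small[unfolded h_def], folded h_def]
    have "(1 - h / 2) * e \<le> 1 * e" using e_bounds h_bounds by (intro mult_right_mono) auto
    moreover have "z - lam (grid N n) z = cplx (grid N n / 4) / lam (grid N n) z"
      using lam_mult[OF z_nonzero, of "grid N n"] lam_nonzero[OF z_nonzero, of "grid N n"] by (simp add: field_simps)
    ultimately show ?thesis using nl False by (simp add: hop_def rot_def ker1_def norm_divide)
  qed
  then show "cmod (hop N k X Y z n) \<le> 2"
    "cmod (hop N k X Y z n - rot (grid N n) z) \<le> 4 * e * cmod (ker1 (grid N n) z)"
    "cmod (cplx (grid N n / 4) / ratio N k X Y z (n - 1) - (z - lam (grid N n) z)) \<le> e" by auto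
qed

text \<open>The half-plane keeps \<open>theta\<close> at distance \<open>y\<close> from the
  repelling root in every row, and the subtracted quotient is within \<open>e \<le> y / 2\<close> of
  that root. The boundary layer is therefore covered too.\<close>

lemma gap_norm_ge:
  assumes n: "n < N"
  shows "y / 2 \<le> cmod (theta N z n - cplx (grid N n / 4) / ratio N k X Y z (n - 1))"
proof -
  let ?u = "grid N n"
  have "y \<le> cmod (theta N z n - (z - lam ?u z))"
    by (rule half_dom_colam[OF hyp y grid_le[OF n] theta_half_dom])
  also have "\<dots> \<le> cmod (theta N z n - cplx (?u / 4) / ratio N k X Y z (n - 1))
     + cmod (cplx (?u / 4) / ratio N k X Y z (n - 1) - (z - lam ?u z))"
    unfolding dist_norm[symmetric] by (rule dist_triangle)
  finally show ?thesis using hop_bounds(3)[OF n] e_bounds by linarith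
qed

lemma green_norm_le: "n < N \<Longrightarrow> cmod (green N k X Y z n) \<le> 2 / y"
  using gap_norm_ge[of n] y frac_le[of 1 1 "y / 2"] by (simp add: green_def norm_divide)

lemma ker1_norm_le: "n < N \<Longrightarrow> cmod (ker1 (grid N n) z) \<le> 1 / y"
  by (rule norm_ker1_le[OF hyp y grid_le])

lemma ker2_norm_le: "n < N \<Longrightarrow> cmod (ker2 (grid N n) z) \<le> cmod (ker1 (grid N n) z)"
  by (rule norm_ker2_le[OF z_nonzero grid_le(1)])

lemma prod_ratio: "(\<Prod>n<N. ratio N k X Y z n) = (\<Prod>n<N. theta N z n) * (\<Prod>n<N. 1 - incr N k X Y z n)"
proof (rule prod_ratio_eq[OF N])
  fix n assume "n < N"
  then show "theta N z n - cplx (grid N n / 4) / ratio N k X Y z (n - 1) \<noteq> 0"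
    using gap_norm_ge[of n] y by auto
qed (auto simp: ratio_nonzero theta_nonzero)

lemma incr_norm_le:
  assumes "n < N"
  shows "cmod (incr N k X Y z n) \<le> 6 * \<nu> / y"
proof -
  have "incr N k X Y z n = green N k X Y z n * (cplx (k * X n) + hop N k X Y z n * cplx (k * Y n))"
    by (simp add: incr_def algebra_simps)
  also have "cmod \<dots> \<le> cmod (green N k X Y z n) * (\<bar>k * X n\<bar> + cmod (hop N k X Y z n) * \<bar>k * Y n\<bar>)"
    unfolding norm_mult by (intro mult_left_mono order_trans[OF norm_triangle_ineq] add_mono) (simp_all add: norm_mult abs_mult)
  also have "\<dots> \<le> 2 / y * (\<nu> + 2 * \<nu>)"
    using green_norm_le hop_bounds noise assms \<nu>_nonneg y by (intro mult_mono add_mono) auto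
  finally show ?thesis by simp
qed

text \<open>For the rows of the boundary layer, where \<open>theta\<close> has not yet come close to
  \<open>lam\<close>.\<close>

lemma green_crude:
  assumes "n < N"
  shows "cmod (green N k X Y z n - ker1 (grid N n) z) \<le> 3 / y"
    "cmod (green N k X Y z n * hop N k X Y z n - ker2 (grid N n) z) \<le> 5 / y"
proof -
  have k1: "cmod (ker1 (grid N n) z) \<le> 1 / y" "cmod (ker2 (grid N n) z) \<le> 1 / y"
    using ker1_norm_le ker2_norm_le assms order_trans by blast+
  have "cmod (green N k X Y z n - ker1 (grid N n) z) \<le> 2 / y + 1 / y"
    by (intro order_trans[OF norm_triangle_ineq4] add_mono green_norm_le k1 assms)
  then show "cmod (green N k X Y z n - ker1 (grid N n) z) \<le> 3 / y" by simp
  have "cmod (green N k X Y z n * hop N k X Y z n) \<le> 2 / y * 2"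
    unfolding norm_mult using green_norm_le hop_bounds assms y by (intro mult_mono) auto
  then have "cmod (green N k X Y z n * hop N k X Y z n - ker2 (grid N n) z) \<le> 2 / y * 2 + 1 / y"
    by (intro order_trans[OF norm_triangle_ineq4] add_mono k1)
  then show "cmod (green N k X Y z n * hop N k X Y z n - ker2 (grid N n) z) \<le> 5 / y" by simp
qed

text \<open>A difference of reciprocals is the difference of the denominators times both
  reciprocals. Keeping two kernel factors, instead of bounding them by \<open>1 / y\<close>, lets
  \<open>sum_ker1_square_le\<close> act afterwards.\<close>

lemma green_close:
  assumes n: "n < N" and \<epsilon>: "cmod (theta N z n - lam (grid N n) z) + e \<le> \<epsilon>" "\<epsilon> \<le> y / 2"
  shows "cmod (green N k X Y z n - ker1 (grid N n) z) \<le> 2 * \<epsilon> * (cmod (ker1 (grid N n) z))\<^sup>2"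
    "cmod (green N k X Y z n * hop N k X Y z n - ker2 (grid N n) z) \<le> 8 * \<epsilon> * (cmod (ker1 (grid N n) z))\<^sup>2"
    "cmod (green N k X Y z n) \<le> 2 * cmod (ker1 (grid N n) z)"
proof -
  let ?u = "grid N n"
  define m where "m = theta N z n - cplx (?u / 4) / ratio N k X Y z (n - 1)"
  define s where "s = sqrt_branch ?u z"
  have s: "y \<le> cmod s" unfolding s_def by (rule sqrt_branch_norm_ge[OF hyp y grid_le[OF n]])
  have s0: "s \<noteq> 0" "0 < cmod s" using s y by auto
  have m0: "m \<noteq> 0" using gap_norm_ge[OF n] y by (auto simp: m_def)
  have "m - s = (theta N z n - lam ?u z) - (cplx (?u / 4) / ratio N k X Y z (n - 1) - (z - lam ?u z))"
    by (simp add: m_def s_def sqrt_branch_lam)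
  also have "cmod \<dots> \<le> cmod (theta N z n - lam ?u z) + e"
    by (intro order_trans[OF norm_triangle_ineq4] add_mono order_refl hop_bounds(3)[OF n])
  finally have ms: "cmod (m - s) \<le> \<epsilon>" using \<epsilon> by simp
  have \<epsilon>0: "0 \<le> \<epsilon>" using ms norm_ge_zero order_trans by blast
  have ms2: "cmod s / 2 \<le> cmod m"
    using norm_triangle_ineq2[of s "s - m"] ms \<epsilon> s by (simp add: norm_minus_commute)
  show g: "cmod (green N k X Y z n) \<le> 2 * cmod (ker1 ?u z)"
    using ms2 s0 frac_le[of 1 1 "cmod s / 2" "cmod m"]
    unfolding green_def ker1_def m_def[symmetric] s_def[symmetric] norm_divide by simp
  have "green N k X Y z n - ker1 ?u z = (s - m) * (green N k X Y z n * ker1 ?u z)"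
    unfolding green_def ker1_def m_def[symmetric] s_def[symmetric] using m0 s0 by (simp add: field_simps)
  also have "cmod \<dots> \<le> \<epsilon> * ((2 * cmod (ker1 ?u z)) * cmod (ker1 ?u z))"
    unfolding norm_mult using ms g \<epsilon>0 by (intro mult_mono) (auto simp: norm_minus_commute)
  finally show 1: "cmod (green N k X Y z n - ker1 ?u z) \<le> 2 * \<epsilon> * (cmod (ker1 ?u z))\<^sup>2"
    by (simp add: power2_eq_square mult_ac)
  have e\<epsilon>: "e \<le> \<epsilon>" using \<epsilon>(1) norm_ge_zero[of "theta N z n - lam ?u z"] by linarith
  have "green N k X Y z n * hop N k X Y z n - ker2 ?u z =
    (green N k X Y z n - ker1 ?u z) * hop N k X Y z n + ker1 ?u z * (hop N k X Y z n - rot ?u z)"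
    by (simp add: ker2_def ker1_def algebra_simps)
  also have "cmod \<dots> \<le> (2 * \<epsilon> * (cmod (ker1 ?u z))\<^sup>2) * 2 + cmod (ker1 ?u z) * (4 * e * cmod (ker1 ?u z))"
  proof (rule order_trans[OF norm_triangle_ineq], unfold norm_mult, rule add_mono)
    show "cmod (green N k X Y z n - ker1 ?u z) * cmod (hop N k X Y z n) \<le> (2 * \<epsilon> * (cmod (ker1 ?u z))\<^sup>2) * 2"
      by (rule mult_mono[OF 1 hop_bounds(1)[OF n]]) (use \<epsilon>0 in auto)
    show "cmod (ker1 ?u z) * cmod (hop N k X Y z n - rot ?u z) \<le> cmod (ker1 ?u z) * (4 * e * cmod (ker1 ?u z))"
      by (rule mult_left_mono[OF hop_bounds(2)[OF n]]) simp
  qed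
  also have "\<dots> = 4 * (cmod (ker1 ?u z))\<^sup>2 * \<epsilon> + 4 * (cmod (ker1 ?u z))\<^sup>2 * e" by (simp add: power2_eq_square mult_ac)
  also have "\<dots> \<le> 4 * (cmod (ker1 ?u z))\<^sup>2 * \<epsilon> + 4 * (cmod (ker1 ?u z))\<^sup>2 * \<epsilon>"
    using e\<epsilon> by (intro add_mono mult_left_mono) auto
  finally show "cmod (green N k X Y z n * hop N k X Y z n - ker2 ?u z) \<le> 8 * \<epsilon> * (cmod (ker1 ?u z))\<^sup>2"
    by (simp add: mult_ac)
qed

text \<open>The increment with \<open>green\<close> and \<open>green * hop\<close> replaced by their
  limits.\<close>

definition lin :: "nat \<Rightarrow> complex" where
  "lin n = cplx (k * X n) * ker1 (grid N n) z + cplx (k * Y n) * ker2 (grid N n) z"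

text \<open>\<open>a^2 - b^2 = (a - b) * (a + b)\<close> produces three kernel factors in the bulk:
  two are summed as a square and one is bounded by \<open>1 / y\<close>. The last \<open>L\<close>
  rows contribute their number times the crude bound.\<close>

lemma incr_square_diff_sum:
  assumes layer: "\<And>n. n < N - L \<Longrightarrow> cmod (theta N z n - lam (grid N n) z) + e \<le> \<epsilon>" and \<epsilon>: "0 \<le> \<epsilon>" "\<epsilon> \<le> y / 2"
    and yN: "1 / y \<le> real N"
  shows "(\<Sum>n<N. cmod ((incr N k X Y z n)\<^sup>2 - (lin n)\<^sup>2)) \<le> 320 * \<epsilon> * \<nu>\<^sup>2 * real N / y\<^sup>2 + 64 * \<nu>\<^sup>2 / y\<^sup>2 * real L"
proof -
  have inc: "incr N k X Y z n = green N k X Y z n * cplx (k * X n) + (green N k X Y z n * hop N k X Y z n) * cplx (k * Y n)" for n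
    by (simp add: incr_def algebra_simps)
  have lin1: "cmod (lin n) \<le> 2 * \<nu> * cmod (ker1 (grid N n) z)" if n: "n < N" for n
  proof -
    have "cmod (lin n) \<le> \<bar>k * X n\<bar> * cmod (ker1 (grid N n) z) + \<bar>k * Y n\<bar> * cmod (ker2 (grid N n) z)"
      unfolding lin_def by (rule order_trans[OF norm_triangle_ineq]) (simp only: norm_mult norm_of_real order_refl)
    also have "\<dots> \<le> \<nu> * cmod (ker1 (grid N n) z) + \<nu> * cmod (ker1 (grid N n) z)"
      using noise[OF n] ker2_norm_le[OF n] \<nu>_nonneg by (intro add_mono mult_mono) auto
    finally show ?thesis by simp
  qed
  have sq: "cmod (a\<^sup>2 - b\<^sup>2) = cmod (a - b) * cmod (a + b)" for a b :: complex
    by (simp add: power2_eq_square square_diff_square_factored mult.commute flip: norm_mult)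
  have bulk: "cmod ((incr N k X Y z n)\<^sup>2 - (lin n)\<^sup>2) \<le> 80 * \<epsilon> * \<nu>\<^sup>2 / y * (cmod (ker1 (grid N n) z))\<^sup>2" if n: "n < N - L" for n
  proof -
    have nN: "n < N" using n by simp
    let ?f = "cmod (ker1 (grid N n) z)"
    note gc = green_close[OF nN layer[OF n] \<epsilon>(2)]
    have "incr N k X Y z n - lin n = (green N k X Y z n - ker1 (grid N n) z) * cplx (k * X n)
       + (green N k X Y z n * hop N k X Y z n - ker2 (grid N n) z) * cplx (k * Y n)"
      by (simp add: inc lin_def algebra_simps)
    also have "cmod \<dots> \<le> cmod (green N k X Y z n - ker1 (grid N n) z) * \<bar>k * X n\<bar>
       + cmod (green N k X Y z n * hop N k X Y z n - ker2 (grid N n) z) * \<bar>k * Y n\<bar>"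
      by (rule order_trans[OF norm_triangle_ineq]) (simp only: norm_mult norm_of_real order_refl)
    also have "\<dots> \<le> (2 * \<epsilon> * ?f\<^sup>2) * \<nu> + (8 * \<epsilon> * ?f\<^sup>2) * \<nu>"
      using gc noise[OF nN] \<epsilon> by (intro add_mono mult_mono) auto
    finally have 1: "cmod (incr N k X Y z n - lin n) \<le> 10 * \<epsilon> * \<nu> * ?f\<^sup>2" by (simp add: mult_ac)
    have "cmod (incr N k X Y z n) \<le> cmod (green N k X Y z n) * \<bar>k * X n\<bar> + cmod (green N k X Y z n) * cmod (hop N k X Y z n) * \<bar>k * Y n\<bar>"
      unfolding inc by (rule order_trans[OF norm_triangle_ineq]) (simp only: norm_mult norm_of_real order_refl)
    also have "\<dots> \<le> (2 * ?f) * \<nu> + (2 * ?f) * 2 * \<nu>"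
      using gc noise[OF nN] hop_bounds(1)[OF nN] by (intro add_mono mult_mono) auto
    finally have 2: "cmod (incr N k X Y z n + lin n) \<le> 8 * \<nu> * ?f"
      using lin1[OF nN] norm_triangle_ineq[of "incr N k X Y z n" "lin n"] by (simp add: mult_ac)
    have "cmod ((incr N k X Y z n)\<^sup>2 - (lin n)\<^sup>2) \<le> (10 * \<epsilon> * \<nu> * ?f\<^sup>2) * (8 * \<nu> * ?f)"
      unfolding sq using 1 2 \<epsilon> \<nu>_nonneg by (intro mult_mono) auto
    also have "\<dots> = 80 * \<epsilon> * \<nu>\<^sup>2 * ?f\<^sup>2 * ?f" by (simp add: power2_eq_square mult_ac)
    also have "\<dots> \<le> 80 * \<epsilon> * \<nu>\<^sup>2 * ?f\<^sup>2 * (1 / y)"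
      using ker1_norm_le[OF nN] \<epsilon> by (intro mult_left_mono) auto
    finally show ?thesis by (simp add: mult_ac)
  qed
  have edge: "cmod ((incr N k X Y z n)\<^sup>2 - (lin n)\<^sup>2) \<le> 64 * \<nu>\<^sup>2 / y\<^sup>2" if n: "n < N" for n
  proof -
    have "2 * \<nu> * cmod (ker1 (grid N n) z) \<le> 2 * \<nu> * (1 / y)"
      using ker1_norm_le[OF n] \<nu>_nonneg by (intro mult_left_mono) auto
    then have b: "cmod (lin n) \<le> 2 * \<nu> / y" using lin1[OF n] by simp
    have "cmod (incr N k X Y z n - lin n) \<le> 6 * \<nu> / y + 2 * \<nu> / y" "cmod (incr N k X Y z n + lin n) \<le> 6 * \<nu> / y + 2 * \<nu> / y"
      using b incr_norm_le[OF n] by (auto intro!: order_trans[OF norm_triangle_ineq] order_trans[OF norm_triangle_ineq4] add_mono)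
    then have "cmod ((incr N k X Y z n)\<^sup>2 - (lin n)\<^sup>2) \<le> (6 * \<nu> / y + 2 * \<nu> / y) * (6 * \<nu> / y + 2 * \<nu> / y)"
      unfolding sq using y \<nu>_nonneg by (intro mult_mono) auto
    also have "\<dots> = 64 * \<nu>\<^sup>2 / y\<^sup>2" using y by (simp add: field_simps power2_eq_square)
    finally show ?thesis .
  qed
  have "(\<Sum>n<N. cmod ((incr N k X Y z n)\<^sup>2 - (lin n)\<^sup>2)) \<le>
    (\<Sum>n<N. 80 * \<epsilon> * \<nu>\<^sup>2 / y * (cmod (ker1 (grid N n) z))\<^sup>2 + (if n \<in> {N - L..<N} then 64 * \<nu>\<^sup>2 / y\<^sup>2 else 0))"
  proof (intro sum_mono)
    fix n assume "n \<in> {..<N}"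
    then have n: "n < N" by simp
    have p: "0 \<le> 80 * \<epsilon> * \<nu>\<^sup>2 / y * (cmod (ker1 (grid N n) z))\<^sup>2" using y \<epsilon> by simp
    show "cmod ((incr N k X Y z n)\<^sup>2 - (lin n)\<^sup>2) \<le> 80 * \<epsilon> * \<nu>\<^sup>2 / y * (cmod (ker1 (grid N n) z))\<^sup>2 + (if n \<in> {N - L..<N} then 64 * \<nu>\<^sup>2 / y\<^sup>2 else 0)"
      using bulk[of n] edge[OF n] p n by (cases "n < N - L") auto
  qed
  also have "\<dots> = 80 * \<epsilon> * \<nu>\<^sup>2 / y * (\<Sum>n<N. (cmod (ker1 (grid N n) z))\<^sup>2) + real (card {N - L..<N}) * (64 * \<nu>\<^sup>2 / y\<^sup>2)"
  proof -
    have "{..<N} \<inter> {n. n \<in> {N - L..<N}} = {N - L..<N}" by auto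
    then show ?thesis unfolding sum.distrib sum.If_cases[OF finite_lessThan] sum_distrib_left
      by simp
  qed
  also have "\<dots> \<le> 80 * \<epsilon> * \<nu>\<^sup>2 / y * (4 * real N / y) + real L * (64 * \<nu>\<^sup>2 / y\<^sup>2)"
    using sum_ker1_square_le[OF hyp y N yN] y \<epsilon> by (intro add_mono mult_left_mono mult_right_mono) auto
  finally show ?thesis by (simp add: power2_eq_square mult_ac)
qed

end
end

section \<open>Characteristic polynomials and Hermite polynomials\<close>

text \<open>The continuant, that is the three-term recurrence for leading minors of a symmetric
  tridiagonal matrix.\<close>

fun tri_det :: "(nat \<Rightarrow> complex) \<Rightarrow> (nat \<Rightarrow> complex) \<Rightarrow> nat \<Rightarrow> complex" where
  "tri_det d e 0 = 1"
| "tri_det d e (Suc 0) = d 0"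
| "tri_det d e (Suc (Suc n)) = d (Suc n) * tri_det d e (Suc n) - (e n)\<^sup>2 * tri_det d e n"

definition tri_mat :: "(nat \<Rightarrow> complex) \<Rightarrow> (nat \<Rightarrow> complex) \<Rightarrow> nat \<Rightarrow> complex mat" where
  "tri_mat d e n = mat n n (\<lambda>(i, j). if i = j then d i else if j = i + 1 then e i else if i = j + 1 then e j else 0)"

lemma det_tri_mat: "Determinant.det (tri_mat d e n) = tri_det d e n"
proof (induction n rule: induct_nat_012)
  case 0
  then show ?case by (simp add: tri_mat_def)
next
  case 1
  have "Determinant.det (tri_mat d e (Suc 0)) = tri_mat d e (Suc 0) $$ (0, 0)"
    by (rule det_single) (simp add: tri_mat_def)
  then show ?case by (simp add: tri_mat_def)
next
  case (ge2 n)
  let ?A = "tri_mat d e (Suc (Suc n))"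
  have A: "?A \<in> carrier_mat (Suc (Suc n)) (Suc (Suc n))" by (simp add: tri_mat_def)
  define B where "B = mat_delete ?A (Suc n) n"
  have B: "B \<in> carrier_mat (Suc n) (Suc n)" unfolding B_def using mat_delete_carrier[OF A] by simp
  have BB: "mat_delete B n n = tri_mat d e n"
    by (rule eq_matI) (auto simp: B_def mat_delete_def tri_mat_def)
  have AA: "mat_delete ?A (Suc n) (Suc n) = tri_mat d e (Suc n)"
    by (rule eq_matI) (auto simp: mat_delete_def tri_mat_def)
  have Bcol: "B $$ (i, n) = (if i = n then e n else 0)" if "i < Suc n" for i
    using that by (auto simp: B_def mat_delete_def tri_mat_def)
  have "Determinant.det B = (\<Sum>i<Suc n. B $$ (i, n) * cofactor B i n)"
    by (rule laplace_expansion_column[OF B]) simp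
  also have "\<dots> = (\<Sum>i<Suc n. if i = n then e n * cofactor B n n else 0)"
    by (intro sum.cong) (auto simp: Bcol)
  also have "\<dots> = e n * tri_det d e n"
    using ge2(1) by (simp add: cofactor_def BB)
  finally have detB: "Determinant.det B = e n * tri_det d e n" .
  have Arow: "?A $$ (Suc n, j) = (if j = Suc n then d (Suc n) else if j = n then e n else 0)" if "j < Suc (Suc n)" for j
    using that by (auto simp: tri_mat_def)
  have "Determinant.det ?A = (\<Sum>j<Suc (Suc n). ?A $$ (Suc n, j) * cofactor ?A (Suc n) j)"
    by (rule laplace_expansion_row[OF A]) simp
  also have "\<dots> = (\<Sum>j<Suc (Suc n). if j = Suc n then d (Suc n) * cofactor ?A (Suc n) (Suc n) else if j = n then e n * cofactor ?A (Suc n) n else 0)"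
    by (intro sum.cong refl) (auto simp: Arow)
  also have "\<dots> = d (Suc n) * cofactor ?A (Suc n) (Suc n) + e n * cofactor ?A (Suc n) n"
    by (simp add: add.commute)
  also have "cofactor ?A (Suc n) (Suc n) = tri_det d e (Suc n)"
    using ge2(2) by (simp add: cofactor_def AA)
  also have "cofactor ?A (Suc n) n = - (e n * tri_det d e n)"
    using detB by (simp add: cofactor_def flip: B_def)
  finally show ?case by (simp add: power2_eq_square)
qed

lemma phi_eq_tri_det:
  "phi \<beta> a b N z = tri_det (\<lambda>n. z - cplx (b (n + 1) / sqrt (4 * real N * \<beta>)))
     (\<lambda>n. - cplx (a (n + 1) / sqrt (4 * real N * \<beta>))) N"
proof -
  have "z \<cdot>\<^sub>m 1\<^sub>m N - cplx (1 / sqrt (4 * real N * \<beta>)) \<cdot>\<^sub>m tridiag_block a b N =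
    tri_mat (\<lambda>n. z - cplx (b (n + 1) / sqrt (4 * real N * \<beta>)))
     (\<lambda>n. - cplx (a (n + 1) / sqrt (4 * real N * \<beta>))) N"
    by (rule eq_matI) (auto simp: tri_mat_def tridiag_block_def tridiag_def)
  then show ?thesis by (simp add: phi_def det_tri_mat)
qed

lemma tri_det_eq_prod:
  assumes "\<And>n. n < N \<Longrightarrow> r n \<noteq> 0"
    and "0 < N \<Longrightarrow> r 0 = d 0" and "\<And>n. Suc n < N \<Longrightarrow> r (Suc n) = d (Suc n) - (e n)\<^sup>2 / r n"
  shows "tri_det d e N = (\<Prod>n<N. r n)"
proof -
  have "n \<le> N \<Longrightarrow> tri_det d e n = (\<Prod>n<n. r n)" for n
  proof (induction n rule: induct_nat_012)
    case (ge2 n)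
    have "r (Suc n) * r n = d (Suc n) * r n - (e n)\<^sup>2"
      using assms(3)[of n] assms(1)[of n] ge2(3) by (simp add: left_diff_distrib)
    then have "(\<Prod>n<Suc (Suc n). r n) = (\<Prod>n<n. r n) * (d (Suc n) * r n - (e n)\<^sup>2)"
      by (simp add: mult_ac)
    then show ?case using ge2 by (simp add: algebra_simps)
  qed (use assms(2) in auto)
  then show ?thesis by simp
qed

text \<open>The origin of the coefficients in \<open>ratio\<close>: the squared off-diagonal entry
  splits into its mean \<open>u / 4\<close> and a multiple of the standardised variable, with
  \<open>k = 1 / sqrt (2 * N * \<beta>)\<close> as the common scale of both kinds of noise.\<close>

lemma offdiag_square:
  fixes \<alpha> :: real
  assumes \<beta>: "0 < \<beta>" and N: "0 < N"
  shows "grid N (Suc n) / 4 + sqrt (grid N (Suc n)) / 2 *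
      (1 / sqrt (2 * real N * \<beta>) * ((\<alpha>\<^sup>2 - \<beta> * real (Suc n)) / sqrt (2 * \<beta> * real (Suc n)))) =
    (\<alpha> / sqrt (4 * real N * \<beta>))\<^sup>2"
proof -
  define m where "m = real (Suc n)"
  have m: "0 < m" by (simp add: m_def)
  have 2: "sqrt (m / real N) / (sqrt (2 * real N * \<beta>) * sqrt (2 * \<beta> * m)) = 1 / (2 * real N * \<beta>)"
    using m N \<beta> by (simp add: real_sqrt_mult real_sqrt_divide field_simps)
  have "g * (1 / s * (P / t)) = P * (g / (s * t))" for g P s t :: real by simp
  from this[of "sqrt (m / real N)" "sqrt (2 * real N * \<beta>)" "\<alpha>\<^sup>2 - \<beta> * m" "sqrt (2 * \<beta> * m)"]
  have "sqrt (m / real N) * (1 / sqrt (2 * real N * \<beta>) * ((\<alpha>\<^sup>2 - \<beta> * m) / sqrt (2 * \<beta> * m))) = (\<alpha>\<^sup>2 - \<beta> * m) * (1 / (2 * real N * \<beta>))"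
    unfolding 2 .
  moreover have "c + g / 2 * q = c + p / 2" if "g * q = p" for c g q p :: real using that by simp
  ultimately have "m / real N / 4 + sqrt (m / real N) / 2 * (1 / sqrt (2 * real N * \<beta>) * ((\<alpha>\<^sup>2 - \<beta> * m) / sqrt (2 * \<beta> * m))) =
      m / real N / 4 + (\<alpha>\<^sup>2 - \<beta> * m) * (1 / (2 * real N * \<beta>)) / 2"
    by blast
  also have "\<dots> = \<alpha>\<^sup>2 / (4 * real N * \<beta>)" using N \<beta> by (simp add: field_simps)
  also have "\<dots> = (\<alpha> / sqrt (4 * real N * \<beta>))\<^sup>2" using N \<beta> by (simp add: power_divide)
  finally show ?thesis unfolding m_def grid_def .
qed

lemma phi_eq_prod_ratio:
  fixes a b :: "nat \<Rightarrow> real"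
  assumes \<beta>: "0 < \<beta>" and N: "0 < N"
  defines "k \<equiv> 1 / sqrt (2 * real N * \<beta>)"
  defines "X \<equiv> \<lambda>n. b (n + 1) / sqrt 2"
    and "Y \<equiv> \<lambda>n. if n = 0 then 0 else ((a n)\<^sup>2 - \<beta> * real n) / sqrt (2 * \<beta> * real n)"
  assumes r: "\<And>n. n < N \<Longrightarrow> ratio N k X Y z n \<noteq> 0"
  shows "phi \<beta> a b N z = (\<Prod>n<N. ratio N k X Y z n)"
  unfolding phi_eq_tri_det
proof (rule tri_det_eq_prod[OF r])
  have s: "sqrt (4 * real N * \<beta>) = sqrt 2 * sqrt (2 * real N * \<beta>)"
    by (simp flip: real_sqrt_mult)
  have d: "k * X n = b (n + 1) / sqrt (4 * real N * \<beta>)" for n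
    by (simp add: k_def X_def s)
  show "ratio N k X Y z 0 = z - cplx (b (0 + 1) / sqrt (4 * real N * \<beta>))"
    unfolding ratio.simps d ..
  fix n
  have "Y (Suc n) = ((a (Suc n))\<^sup>2 - \<beta> * real (Suc n)) / sqrt (2 * \<beta> * real (Suc n))" by (simp add: Y_def)
  then have e: "grid N (Suc n) / 4 + sqrt (grid N (Suc n)) / 2 * (k * Y (Suc n)) = (a (Suc n) / sqrt (4 * real N * \<beta>))\<^sup>2"
    unfolding k_def by (simp only: offdiag_square[OF \<beta> N])
  show "ratio N k X Y z (Suc n) = z - cplx (b (Suc n + 1) / sqrt (4 * real N * \<beta>)) -
    (- cplx (a (n + 1) / sqrt (4 * real N * \<beta>)))\<^sup>2 / ratio N k X Y z n"
    unfolding ratio.simps d e by simp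
qed auto


section \<open>Monic Hermite polynomials and their orthogonality\<close>

fun hermite_rec :: "nat \<Rightarrow> nat \<Rightarrow> real poly" where
  "hermite_rec N 0 = 1"
| "hermite_rec N (Suc 0) = [:0, 1:]"
| "hermite_rec N (Suc (Suc n)) = [:0, 1:] * hermite_rec N (Suc n) - Polynomial.smult (grid N (Suc n) / 4) (hermite_rec N n)"

lemma hermite_rec_degree: "degree (hermite_rec N n) = n \<and> lead_coeff (hermite_rec N n) = 1"
proof (induction N n rule: hermite_rec.induct)
  case (3 N n)
  have 1: "degree ([:0, 1:] * hermite_rec N (Suc n)) = Suc (Suc n)"
    using 3(1) by (subst degree_mult_eq) auto
  have 2: "degree (Polynomial.smult (grid N (Suc n) / 4) (hermite_rec N n)) < degree ([:0, 1:] * hermite_rec N (Suc n))"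
    using 3(2) 1 degree_smult_le[of "grid N (Suc n) / 4" "hermite_rec N n"] by linarith
  have 4: "degree (hermite_rec N (Suc (Suc n))) = Suc (Suc n)"
    unfolding hermite_rec.simps diff_conv_add_uminus
    by (subst degree_add_eq_left) (use 1 2 in auto)
  moreover have "coeff (Polynomial.smult (grid N (Suc n) / 4) (hermite_rec N n)) (Suc (Suc n)) = 0"
    using 1 2 by (intro coeff_eq_0) simp
  then have "lead_coeff (hermite_rec N (Suc (Suc n))) = lead_coeff ([:0, 1:] * hermite_rec N (Suc n))"
    unfolding 4 1 by simp
  moreover have "lead_coeff ([:0, 1:] * hermite_rec N (Suc n)) = 1"
  proof -
    have a: "lead_coeff [:0, 1 :: real:] = 1" by simp
    show ?thesis unfolding lead_coeff_mult a conjunct2[OF 3(1)] by simp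
  qed
  ultimately show ?case by metis
qed auto

text \<open>The Appell property. It converts the three-term recurrence into the raising relation
  \<open>hermite_rec_Suc\<close>, the form in which Gaussian integration by parts applies.\<close>

lemma hermite_rec_pderiv: "pderiv (hermite_rec N (Suc n)) = Polynomial.smult (real (Suc n)) (hermite_rec N n)"
proof (induction N n rule: hermite_rec.induct)
  case (3 N n)
  have "pderiv (hermite_rec N (Suc (Suc (Suc n)))) = hermite_rec N (Suc (Suc n))
     + [:0, 1:] * pderiv (hermite_rec N (Suc (Suc n))) - Polynomial.smult (grid N (Suc (Suc n)) / 4) (pderiv (hermite_rec N (Suc n)))"
    unfolding hermite_rec.simps(3)[of N "Suc n"] pderiv_diff pderiv_mult pderiv_smult
    by (simp add: pderiv_pCons)
  also have "\<dots> = hermite_rec N (Suc (Suc n)) + Polynomial.smult (real (Suc (Suc n))) ([:0, 1:] * hermite_rec N (Suc n)) - Polynomial.smult (grid N (Suc (Suc n)) / 4 * real (Suc n)) (hermite_rec N n)"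
    unfolding 3(1) 3(2) by simp
  also have "Polynomial.smult (grid N (Suc (Suc n)) / 4 * real (Suc n)) (hermite_rec N n) = Polynomial.smult (real (Suc (Suc n))) (Polynomial.smult (grid N (Suc n) / 4) (hermite_rec N n))"
    by (simp add: grid_def)
  also have "hermite_rec N (Suc (Suc n)) + Polynomial.smult (real (Suc (Suc n))) ([:0, 1:] * hermite_rec N (Suc n)) - Polynomial.smult (real (Suc (Suc n))) (Polynomial.smult (grid N (Suc n) / 4) (hermite_rec N n))
     = hermite_rec N (Suc (Suc n)) + Polynomial.smult (real (Suc (Suc n))) (hermite_rec N (Suc (Suc n)))"
    by (simp only: hermite_rec.simps smult_diff_right add_diff_eq)
  also have "\<dots> = Polynomial.smult (real (Suc (Suc (Suc n)))) (hermite_rec N (Suc (Suc n)))"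
  proof -
    have "p + Polynomial.smult c p = Polynomial.smult (c + 1) p" for p :: "real poly" and c
      by (simp add: smult_add_left)
    moreover have "real (Suc (Suc (Suc n))) = real (Suc (Suc n)) + 1" by simp
    ultimately show ?thesis by (simp only:)
  qed
  finally show ?case .
next
  case (1 N)
  then show ?case by (simp add: pderiv_pCons)
next
  case (2 N)
  have "hermite_rec N (Suc (Suc 0)) = [:- (grid N 1 / 4), 0, 1:]" by simp
  then show ?case by (simp add: pderiv_pCons del: hermite_rec.simps(3))
qed

lemma hermite_rec_Suc:
  assumes "0 < N"
  shows "hermite_rec N (Suc n) = [:0, 1:] * hermite_rec N n - Polynomial.smult (1 / (4 * real N)) (pderiv (hermite_rec N n))"
proof (cases n)
  case 0
  show ?thesis unfolding 0 hermite_rec.simps pderiv_1 smult_0_right mult_1_right diff_0_right ..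
next
  case (Suc m)
  have "1 / (4 * real N) * real (Suc m) = grid N (Suc m) / 4" by (simp add: grid_def)
  then show ?thesis unfolding Suc by (simp only: hermite_rec.simps(3) hermite_rec_pderiv smult_smult)
qed

definition gexp :: "real \<Rightarrow> real poly \<Rightarrow> real" where
  "gexp \<sigma> p = (LINT x|lborel. normal_density 0 \<sigma> x * poly p x)"

context
  fixes \<sigma> :: real
  assumes \<sigma>: "0 < \<sigma>"
begin

lemma integrable_normal_power: "integrable lborel (\<lambda>x. normal_density 0 \<sigma> x * x ^ k)"
  using integrable_normal_moment[OF \<sigma>, of 0 k] by simp

lemma integrable_normal_poly: "integrable lborel (\<lambda>x. normal_density 0 \<sigma> x * poly p x)"
  unfolding poly_altdef sum_distrib_left
  by (intro Bochner_Integration.integrable_sum)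
     (use integrable_mult_right[OF integrable_normal_power] in \<open>simp add: mult.left_commute\<close>)

lemma gexp_add: "gexp \<sigma> (p + q) = gexp \<sigma> p + gexp \<sigma> q"
  unfolding gexp_def poly_add distrib_left
  by (intro Bochner_Integration.integral_add integrable_normal_poly)

lemma gexp_smult: "gexp \<sigma> (Polynomial.smult c p) = c * gexp \<sigma> p"
  unfolding gexp_def by (simp add: mult.left_commute)

lemma gexp_diff: "gexp \<sigma> (p - q) = gexp \<sigma> p - gexp \<sigma> q"
  unfolding gexp_def poly_diff right_diff_distrib
  by (intro Bochner_Integration.integral_diff integrable_normal_poly)

lemma gexp_monom_even: "gexp \<sigma> (monom 1 (2 * k)) = fact (2 * k) / ((2 / \<sigma>\<^sup>2) ^ k * fact k)"
  using integral_normal_moment_even[OF \<sigma>, of 0 k] by (simp add: gexp_def poly_monom)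

lemma gexp_monom_odd: "gexp \<sigma> (monom 1 (2 * k + 1)) = 0"
  using integral_normal_moment_odd[OF \<sigma>, of 0 k] by (simp add: gexp_def poly_monom)

lemma gexp_monom_Suc: "gexp \<sigma> (monom 1 (Suc k)) = \<sigma>\<^sup>2 * gexp \<sigma> (pderiv (monom 1 k))"
proof (cases k)
  case 0
  then show ?thesis using gexp_monom_odd[of 0] by (simp add: pderiv_monom gexp_def)
next
  case (Suc m)
  have pd: "gexp \<sigma> (pderiv (monom 1 k)) = real k * gexp \<sigma> (monom 1 m)"
    using gexp_smult[of "real k" "monom 1 m"] by (simp add: Suc pderiv_monom smult_monom)
  show ?thesis
  proof (cases "even m")
    case True
    then obtain j where j: "m = 2 * j" by blast
    have "Suc k = 2 * Suc j" using j Suc by simp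
    moreover have "gexp \<sigma> (monom 1 (2 * Suc j)) = \<sigma>\<^sup>2 * (real k * gexp \<sigma> (monom 1 m))"
    proof -
      have gen: "(2 * (m + 1)) * (2 * m + 1) * F / ((2 / s * P) * ((m + 1) * f)) = s * ((2 * m + 1) * (F / (P * f)))"
        if "s \<noteq> 0" "P \<noteq> 0" "f \<noteq> 0" "m + 1 \<noteq> 0" for m F s P f :: real
        using that by (simp add: divide_simps)
      have f1: "(fact (2 * Suc j) :: real) = (2 * (real j + 1)) * (2 * real j + 1) * fact (2 * j)"
        by (simp add: algebra_simps)
      have f2: "(fact (Suc j) :: real) = (real j + 1) * fact j" by (simp add: algebra_simps)
      have k: "real k = 2 * real j + 1" using Suc j by simp
      show ?thesis unfolding j gexp_monom_even f1 f2 power_Suc k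
        by (rule gen) (use \<sigma> in \<open>auto simp: add_eq_0_iff\<close>)
    qed
    ultimately show ?thesis using pd by simp
  next
    case False
    then obtain j where j: "m = 2 * j + 1" using oddE by blast
    have "Suc k = 2 * Suc j + 1" using j Suc by simp
    then show ?thesis using pd gexp_monom_odd[of "Suc j"] gexp_monom_odd[of j] j by simp
  qed
qed

text \<open>Stein's identity. On monomials it is the recursion between consecutive Gaussian moments,
  and both sides are linear.\<close>

lemma gexp_parts: "gexp \<sigma> ([:0, 1:] * q) = \<sigma>\<^sup>2 * gexp \<sigma> (pderiv q)"
proof -
  have s: "gexp \<sigma> ([:0, 1:] * (\<Sum>i\<in>A. Polynomial.smult (coeff q i) (monom 1 i))) =
    \<sigma>\<^sup>2 * gexp \<sigma> (pderiv (\<Sum>i\<in>A. Polynomial.smult (coeff q i) (monom 1 i)))" if "finite A" for A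
    using that
  proof (induction A)
    case (insert i A)
    have *: "gexp \<sigma> ([:0, 1:] * Polynomial.smult (coeff q i) (monom 1 i)) = \<sigma>\<^sup>2 * gexp \<sigma> (pderiv (Polynomial.smult (coeff q i) (monom 1 i)))"
    proof -
      have "[:0, 1:] * Polynomial.smult (coeff q i) (monom 1 i) = Polynomial.smult (coeff q i) (monom 1 (Suc i))"
        by (simp add: monom_Suc)
      then show ?thesis by (simp only: gexp_smult pderiv_smult gexp_monom_Suc mult.left_commute)
    qed
    have e: "(\<Sum>i\<in>insert i A. Polynomial.smult (coeff q i) (monom 1 i)) =
      Polynomial.smult (coeff q i) (monom 1 i) + (\<Sum>i\<in>A. Polynomial.smult (coeff q i) (monom 1 i))"
      using insert by simp
    show ?case unfolding e distrib_left pderiv_add gexp_add unfolding * insert.IH ..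
  qed (simp add: gexp_def)
  have "(\<Sum>i\<le>degree q. Polynomial.smult (coeff q i) (monom 1 i)) = q"
    using poly_as_sum_of_monoms[of q] by (simp add: smult_monom)
  then show ?thesis using s[of "{..degree q}"] by simp
qed

lemma gexp_square_zero:
  assumes "gexp \<sigma> (p * p) = 0"
  shows "p = 0"
proof (rule ccontr)
  assume p: "p \<noteq> 0"
  have "AE x in lborel. normal_density 0 \<sigma> x * poly (p * p) x = 0"
  proof (subst integral_nonneg_eq_0_iff_AE[symmetric])
    show "integrable lborel (\<lambda>x. normal_density 0 \<sigma> x * poly (p * p) x)" by (rule integrable_normal_poly)
    show "AE x in lborel. 0 \<le> normal_density 0 \<sigma> x * poly (p * p) x" by simp
    show "(LINT x|lborel. normal_density 0 \<sigma> x * poly (p * p) x) = 0" using assms by (simp add: gexp_def)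
  qed
  then have "AE x in lborel. poly p x = 0"
  proof eventually_elim
    case (elim x)
    then show ?case using normal_density_pos[OF \<sigma>, of 0 x] by simp
  qed
  moreover have "{x. poly p x = 0} \<in> null_sets lborel"
    by (intro finite_imp_null_set_lborel poly_roots_finite p)
  then have "AE x in lborel. x \<notin> {x. poly p x = 0}" by (rule AE_not_in)
  then have "AE x in lborel. poly p x \<noteq> 0" by simp
  ultimately have "AE x in (lborel :: real measure). False" by eventually_elim simp
  then show False by (simp add: eventually_False ae_filter_eq_bot_iff)
qed

end

text \<open>The raising relation and Stein's identity cancel the derivative of the Hermite factor
  and leave \<open>E (P (n + 1) * q) = \<sigma>^2 * E (P n * q')\<close>, where \<open>q'\<close>
  has lower degree.\<close>

lemma hermite_rec_orthogonal:
  assumes N: "0 < N"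
  shows "degree q < n \<or> (n \<noteq> 0 \<and> q = 0) \<Longrightarrow> gexp (1 / sqrt (4 * real N)) (hermite_rec N n * q) = 0"
proof (induction n arbitrary: q)
  case (Suc n)
  let ?s = "1 / sqrt (4 * real N)"
  have s: "0 < ?s" "?s\<^sup>2 = 1 / (4 * real N)" using N by (simp_all add: power_divide)
  have "hermite_rec N (Suc n) * q = [:0, 1:] * (hermite_rec N n * q) - Polynomial.smult (1 / (4 * real N)) (pderiv (hermite_rec N n) * q)"
    unfolding hermite_rec_Suc[OF N] by (simp add: left_diff_distrib)
  then have "gexp ?s (hermite_rec N (Suc n) * q) = ?s\<^sup>2 * gexp ?s (hermite_rec N n * pderiv q)"
  proof -
    assume e: "hermite_rec N (Suc n) * q = [:0, 1:] * (hermite_rec N n * q) - Polynomial.smult (1 / (4 * real N)) (pderiv (hermite_rec N n) * q)"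
    have m: "pderiv (hermite_rec N n * q) = hermite_rec N n * pderiv q + pderiv (hermite_rec N n) * q"
      by (simp add: pderiv_mult mult.commute)
    show ?thesis unfolding e gexp_diff[OF s(1)] gexp_smult[OF s(1)] gexp_parts[OF s(1)] m gexp_add[OF s(1)]
      unfolding s(2) by (simp add: distrib_left)
  qed
  also have "gexp ?s (hermite_rec N n * pderiv q) = 0"
  proof (cases "pderiv q = 0")
    case False
    then have "degree q \<noteq> 0" by (simp add: pderiv_eq_0_iff)
    then show ?thesis using Suc.prems by (intro Suc.IH) (auto simp: degree_pderiv)
  qed (simp add: gexp_def)
  finally show ?case by simp
qed auto

text \<open>The weight is a multiple of the normal density with variance \<open>1 / (4 * N)\<close>.
  For uniqueness, the difference of two candidates has degree below \<open>N\<close>, hence is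
  orthogonal to both candidates and so to itself.\<close>

lemma hermite_monic_eq:
  assumes N: "0 < N"
  shows "hermite_monic N = hermite_rec N N"
proof -
  let ?s = "1 / sqrt (4 * real N)"
  have s: "0 < ?s" "?s\<^sup>2 = 1 / (4 * real N)" using N by (simp_all add: power_divide)
  define c where "c = sqrt (2 * pi * ?s\<^sup>2)"
  have c: "0 < c" using s(1) by (simp add: c_def)
  have w: "exp (- 2 * real N * x\<^sup>2) = c * normal_density 0 ?s x" for x
    unfolding normal_density_def c_def[symmetric] using c by (simp add: s(2))
  have eq: "(LINT x|lborel. poly p x * poly q x * exp (- 2 * real N * x\<^sup>2)) = c * gexp ?s (p * q)" for p q
    unfolding w gexp_def by (subst integral_mult_right_zero[symmetric]) (simp add: mult_ac)
  show ?thesis unfolding hermite_monic_def eq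
  proof (rule the_equality)
    show "degree (hermite_rec N N) = N \<and> lead_coeff (hermite_rec N N) = 1 \<and> (\<forall>q. degree q < N \<longrightarrow> c * gexp ?s (hermite_rec N N * q) = 0)"
      using hermite_rec_degree[of N N] hermite_rec_orthogonal[OF N] by auto
  next
    fix p assume p: "degree p = N \<and> lead_coeff p = 1 \<and> (\<forall>q. degree q < N \<longrightarrow> c * gexp ?s (p * q) = 0)"
    define r where "r = p - hermite_rec N N"
    have "degree r < N"
    proof -
      have "degree r \<le> N" using p hermite_rec_degree[of N N] by (auto simp: r_def intro!: degree_diff_le)
      moreover have "coeff r N = 0"
        using p hermite_rec_degree[of N N] unfolding r_def coeff_diff by (metis diff_self)
      ultimately show ?thesis using N by (metis degree_0 le_neq_implies_less leading_coeff_0_iff)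
    qed
    then have "gexp ?s (p * r) = 0" "gexp ?s (hermite_rec N N * r) = 0"
      using p c hermite_rec_orthogonal[OF N, of r N] by auto
    moreover have "r * r = p * r - hermite_rec N N * r"
      unfolding left_diff_distrib[symmetric] r_def ..
    ultimately have "gexp ?s (r * r) = 0" by (simp add: gexp_diff[OF s(1)])
    from gexp_square_zero[OF s(1) this] show "p = hermite_rec N N" by (simp add: r_def)
  qed
qed

lemma pi_N_eq_tri_det:
  assumes "0 < N"
  shows "pi_N N z = tri_det (\<lambda>_. z) (\<lambda>n. cplx (sqrt (grid N (n + 1)) / 2)) N"
proof -
  have sq: "(cplx (sqrt (grid N (n + 1)) / 2))\<^sup>2 = cplx (grid N (Suc n) / 4)" for n
    by (simp add: grid_def power_divide flip: of_real_power)
  have "poly (map_poly cplx (hermite_rec N n)) z = tri_det (\<lambda>_. z) (\<lambda>n. cplx (sqrt (grid N (n + 1)) / 2)) n" for n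
  proof (induction n rule: induct_nat_012)
    case (ge2 n)
    have "map_poly cplx (hermite_rec N (Suc (Suc n))) = [:0, 1:] * map_poly cplx (hermite_rec N (Suc n)) - Polynomial.smult (cplx (grid N (Suc n) / 4)) (map_poly cplx (hermite_rec N n))"
      by (rule poly_eqI) (simp add: coeff_map_poly coeff_pCons split: nat.split)
    then show ?case using ge2 unfolding tri_det.simps sq by simp
  qed (simp_all add: map_poly_pCons)
  then show ?thesis by (simp add: pi_N_def hermite_monic_eq[OF assms])
qed

text \<open>Without noise the denominator of \<open>green\<close> has this form, with a backward and
  a forward ratio from the same half-plane.\<close>

lemma half_dom_add:
  assumes hyp: "hyp y z" and y: "0 < y" and w: "v \<in> half_dom y z" "w \<in> half_dom y z"
  shows "v + w - z \<noteq> 0"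
proof (cases "y \<le> \<bar>Im z\<bar>")
  case True
  have "(Im z)\<^sup>2 \<le> Im z * Im v" "(Im z)\<^sup>2 \<le> Im z * Im w" using w True by (auto simp: half_dom_def)
  moreover have "0 < (Im z)\<^sup>2" using True y by auto
  moreover have "Im z * Im (v + w - z) = Im z * Im v + Im z * Im w - (Im z)\<^sup>2"
    by (simp add: power2_eq_square algebra_simps)
  ultimately have "0 < Im z * Im (v + w - z)" by linarith
  then show ?thesis by (metis less_irrefl mult_zero_right zero_complex.sel(2))
next
  case False
  note a = half_dom_ReD[OF False hyp w(1) y] and b = half_dom_ReD[OF False hyp w(2) y]
  have "sgn (Re z) * Re z = \<bar>Re z\<bar>" by (simp add: abs_sgn mult.commute)
  then have "sgn (Re z) * Re (v + w - z) = sgn (Re z) * Re v + sgn (Re z) * Re w - \<bar>Re z\<bar>"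
    by (simp add: algebra_simps)
  moreover have "0 < sqrt ((Re z)\<^sup>2 - 1)" using a y by linarith
  moreover have "\<bar>Re z\<bar> + sqrt ((Re z)\<^sup>2 - 1) \<le> 2 * (sgn (Re z) * Re v)"
    "\<bar>Re z\<bar> + sqrt ((Re z)\<^sup>2 - 1) \<le> 2 * (sgn (Re z) * Re w)" using a(1) b(1) by simp_all
  ultimately have "0 < sgn (Re z) * Re (v + w - z)" by linarith
  then show ?thesis by (metis less_irrefl mult_zero_right zero_complex.sel(1))
qed

text \<open>The telescoping identity with zero noise: all increments vanish, so the forward and the
  backward product agree. The nonvanishing comes from the half-plane and not from closeness to
  \<open>lam\<close>, so the identity is available for small \<open>N\<close> as well.\<close>

lemma pi_N_eq_prod_theta:
  assumes N: "0 < N" and hyp: "hyp y z" and y: "0 < y" "y \<le> 1 / 2"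
  shows "pi_N N z = (\<Prod>n<N. theta N z n)"
proof -
  let ?r = "ratio N 0 (\<lambda>_. 0) (\<lambda>_. 0) z"
  have rec: "?r (Suc n) = z - cplx (grid N (Suc n) / 4) / ?r n" for n by simp
  have rd: "?r n \<in> half_dom y z" if "n < N" for n
    using that
  proof (induction n)
    case 0
    then show ?case using half_dom_self[OF hyp y(1)] by simp
  next
    case (Suc n)
    have "0 \<le> grid N (Suc n) / 4" "grid N (Suc n) / 4 \<le> 1 / 4" using grid_bounds[of "Suc n" N] Suc.prems by auto
    from half_dom_step(1)[OF hyp y this] show ?case unfolding rec using Suc by simp
  qed
  have cd: "cofrac N z j \<in> half_dom y z" for j
  proof (induction j)
    case 0
    then show ?case using half_dom_self[OF hyp y(1)] by simp
  next
    case (Suc j)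
    have "0 \<le> grid N (N - 1 - j) / 4" "grid N (N - 1 - j) / 4 \<le> 1 / 4" using grid_bounds[of "N - 1 - j" N] by auto
    from half_dom_step(1)[OF hyp y this] show ?case using Suc by simp
  qed
  have r0: "?r n \<noteq> 0" if "n < N" for n using half_dom_norm(4)[OF hyp y rd[OF that]] .
  have "pi_N N z = (\<Prod>n<N. ?r n)"
    unfolding pi_N_eq_tri_det[OF N]
  proof (rule tri_det_eq_prod[OF r0])
    fix n
    have "(cplx (sqrt (grid N (n + 1)) / 2))\<^sup>2 = cplx (grid N (Suc n) / 4)"
      by (simp add: grid_def power_divide flip: of_real_power)
    then show "?r (Suc n) = z - (cplx (sqrt (grid N (n + 1)) / 2))\<^sup>2 / ?r n" unfolding rec by (simp only:)
  qed auto
  also have "\<dots> = (\<Prod>n<N. theta N z n) * (\<Prod>n<N. 1 - incr N 0 (\<lambda>_. 0) (\<lambda>_. 0) z n)"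
  proof (rule prod_ratio_eq[OF N r0])
    fix n assume n: "n < N"
    show "theta N z n \<noteq> 0" unfolding theta_def by (rule half_dom_norm(4)[OF hyp y cd])
    show "theta N z n - cplx (grid N n / 4) / ?r (n - 1) \<noteq> 0"
    proof (cases n)
      case 0
      then show ?thesis using \<open>theta N z n \<noteq> 0\<close> by simp
    next
      case (Suc m)
      have "theta N z n - cplx (grid N n / 4) / ?r (n - 1) = theta N z n + ?r n - z"
        unfolding Suc rec by simp
      also have "\<dots> \<noteq> 0" unfolding theta_def by (rule half_dom_add[OF hyp y(1) cd rd[OF n]])
      finally show ?thesis .
    qed
  qed auto
  also have "\<dots> = (\<Prod>n<N. theta N z n)" by (simp add: incr_def)
  finally show ?thesis .
qed

text \<open>Serves the continuity of the quotient in \<open>z\<close> and the crude bound for small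
  \<open>N\<close>.\<close>

lemma pi_N_norm_ge:
  assumes N: "0 < N" and hyp: "hyp y z" and y: "0 < y" "y \<le> 1 / 2"
  shows "y ^ N \<le> cmod (pi_N N z)"
proof -
  interpret noisy_recursion N z "max 1 (cmod z)" y 0 0 "\<lambda>_. 0" "\<lambda>_. 0"
    by unfold_locales (use assms in auto)
  have "y ^ N = (\<Prod>n<N. y)" by simp
  also have "\<dots> \<le> (\<Prod>n<N. cmod (theta N z n))"
    using y half_dom_norm(1)[OF hyp y theta_half_dom] by (intro prod_mono) auto
  finally show ?thesis by (simp add: pi_N_eq_prod_theta[OF assms] prod_norm)
qed

section \<open>The chi distribution\<close>

lemma chi_weight_nonneg: "0 \<le> chi_weight p x"
  by (simp add: chi_weight_def)

lemma chi_weight_measurable [measurable]: "chi_weight p \<in> borel_measurable borel"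
  unfolding chi_weight_def[abs_def] by measurable

lemma chi_weight_add_2: "chi_weight (p + 2) x = x\<^sup>2 * chi_weight p x"
proof (cases "0 < x")
  case True
  have "x powr (p + 2 - 1) = x powr (p - 1) * x powr 2"
    by (simp flip: powr_add)
  then show ?thesis using True by (simp add: chi_weight_def)
qed (simp add: chi_weight_def)

text \<open>The exponential factor only rescales the weight; the substitution has ratio
  \<open>c = sqrt (1 - 2 * s)\<close>.\<close>

lemma nn_integral_chi_weight_exp:
  assumes s: "s < 1 / 2"
  shows "(\<integral>\<^sup>+x. ennreal (chi_weight p x * exp (s * x\<^sup>2)) \<partial>lborel) =
    ennreal ((1 - 2 * s) powr (- p / 2)) * (\<integral>\<^sup>+x. ennreal (chi_weight p x) \<partial>lborel)"
proof -
  define c where "c = sqrt (1 - 2 * s)"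
  have c: "0 < c" "c\<^sup>2 = 1 - 2 * s" using s by (simp_all add: c_def)
  have e: "chi_weight p x * exp (s * x\<^sup>2) = c powr (1 - p) * chi_weight p (0 + c * x)" for x
  proof (cases "0 < x")
    case True
    have "exp (- x\<^sup>2 / 2) * exp (s * x\<^sup>2) = exp (- (c * x)\<^sup>2 / 2)"
      by (simp add: power_mult_distrib c(2) field_simps flip: exp_add)
    moreover have "(c * x) powr (p - 1) = c powr (p - 1) * x powr (p - 1)"
      using True c by (simp add: powr_mult)
    moreover have "c powr (1 - p) * c powr (p - 1) = 1"
      using c by (simp flip: powr_add)
    ultimately show ?thesis using True c(1)
      by (simp add: chi_weight_def mult.assoc)
  next
    case False
    then show ?thesis using c by (auto simp: chi_weight_def zero_less_mult_iff)
  qed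
  have "(\<integral>\<^sup>+x. ennreal (chi_weight p x) \<partial>lborel) = ennreal c * (\<integral>\<^sup>+x. ennreal (chi_weight p (0 + c * x)) \<partial>lborel)"
    using nn_integral_real_affine[of "\<lambda>x. ennreal (chi_weight p x)" c 0] c by simp
  moreover have "(1 - 2 * s) powr (- p / 2) = c powr (- p)"
    unfolding c(2)[symmetric] using c(1) by (simp add: powr_powr flip: powr_numeral)
  moreover have "c powr (- p) * c = c powr (1 - p)"
    using c powr_add[of c "- p" 1] by (simp add: add.commute)
  ultimately have "ennreal ((1 - 2 * s) powr (- p / 2)) * (\<integral>\<^sup>+x. ennreal (chi_weight p x) \<partial>lborel) =
    ennreal (c powr (1 - p)) * (\<integral>\<^sup>+x. ennreal (chi_weight p (0 + c * x)) \<partial>lborel)"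
    using c by (simp add: mult.assoc[symmetric] flip: ennreal_mult)
  then show ?thesis unfolding e
    by (simp add: ennreal_mult chi_weight_nonneg nn_integral_cmult)
qed

text \<open>The functional equation of the Gamma function in this normalisation: the derivative of
  \<open>- x^p * exp (- x^2 / 2)\<close> is the difference of the two integrands, and the boundary
  values at 0 and infinity vanish.\<close>

lemma chi_weight_step:
  assumes p: "0 < p" and int: "integrable lborel (chi_weight p)"
  shows "integrable lborel (chi_weight (p + 2))"
    "(LINT x|lborel. chi_weight (p + 2) x) = p * (LINT x|lborel. chi_weight p x)"
proof -
  show int2: "integrable lborel (chi_weight (p + 2))"
  proof (rule integrableI_nonneg)
    have "chi_weight (p + 2) x \<le> 4 * (chi_weight p x * exp (1 / 4 * x\<^sup>2))" for x
    proof -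
      have "1 + 1 / 4 * x\<^sup>2 \<le> exp (1 / 4 * x\<^sup>2)" by (rule exp_ge_add_one_self)
      then have "x\<^sup>2 \<le> 4 * exp (1 / 4 * x\<^sup>2)" by linarith
      from mult_right_mono[OF this chi_weight_nonneg[of p x]] show ?thesis
        by (simp add: chi_weight_add_2 mult_ac)
    qed
    then have "(\<integral>\<^sup>+x. ennreal (chi_weight (p + 2) x) \<partial>lborel) \<le> (\<integral>\<^sup>+x. ennreal 4 * ennreal (chi_weight p x * exp (1 / 4 * x\<^sup>2)) \<partial>lborel)"
      by (intro nn_integral_mono, subst ennreal_mult'[symmetric]) (auto intro: ennreal_leI)
    also have "\<dots> = ennreal 4 * (ennreal ((1 - 2 * (1 / 4)) powr (- p / 2)) * (\<integral>\<^sup>+x. ennreal (chi_weight p x) \<partial>lborel))"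
      by (subst nn_integral_cmult) (simp_all only: nn_integral_chi_weight_exp[of "1/4" p], measurable)
    also have "\<dots> < \<infinity>"
      using int by (auto simp: integrable_iff_bounded chi_weight_nonneg ennreal_mult_less_top)
    finally show "(\<integral>\<^sup>+x. ennreal (chi_weight (p + 2) x) \<partial>lborel) < \<infinity>" .
  qed (auto simp: chi_weight_nonneg)
  define f where "f x = x powr (p + 1) * exp (- x\<^sup>2 / 2) - p * (x powr (p - 1) * exp (- x\<^sup>2 / 2))" for x :: real
  define F where "F x = - (x powr p * exp (- x\<^sup>2 / 2))" for x :: real
  have fe: "indicator {0<..} x * f x = chi_weight (p + 2) x - p * chi_weight p x" for x
    by (auto simp: f_def chi_weight_def indicator_def add.commute)
  have ei: "einterval 0 \<infinity> = {0<..}" by (auto simp: einterval_def zero_ereal_def)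
  have "(LBINT x=ereal 0..\<infinity>. f x) = 0 - 0"
  proof (rule interval_integral_FTC_integrable)
    show "set_integrable lborel (einterval (ereal 0) \<infinity>) f"
      using int int2 by (simp add: set_integrable_def ei fe flip: zero_ereal_def)
    fix x :: real assume "ereal 0 < ereal x"
    then have x: "0 < x" by simp
    show "(F has_vector_derivative f x) (at x)"
    proof -
      have e: "f x = - (p * x powr (p - 1) * exp (- x\<^sup>2 / 2) + x powr p * (exp (- x\<^sup>2 / 2) * (- (2 * x) / 2)))"
        using x by (simp add: f_def powr_add)
      show ?thesis
        unfolding has_real_derivative_iff_has_vector_derivative[symmetric] F_def e
        using x by (auto intro!: derivative_eq_intros)
    qed
    show "isCont f x" unfolding f_def using x by (intro continuous_intros) auto
  next
    have "(F \<longlongrightarrow> 0) (at_right 0)" unfolding F_def using p by real_asymp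
    then show "((F \<circ> real_of_ereal) \<longlongrightarrow> 0) (at_right (ereal 0))" by (simp add: ereal_tendsto_simps1)
    have "(F \<longlongrightarrow> 0) at_top" unfolding F_def using p by real_asymp
    then show "((F \<circ> real_of_ereal) \<longlongrightarrow> 0) (at_left \<infinity>)" by (simp add: ereal_tendsto_simps1)
  qed simp
  then have "(LINT x|lborel. chi_weight (p + 2) x - p * chi_weight p x) = 0"
    by (simp add: interval_lebesgue_integral_def set_lebesgue_integral_def ei fe flip: zero_ereal_def)
  then show "(LINT x|lborel. chi_weight (p + 2) x) = p * (LINT x|lborel. chi_weight p x)"
    using int int2 by simp
qed

context prob_space
begin

context
  fixes A :: "'a \<Rightarrow> real" and p :: real
  assumes D: "distributed M lborel A (chi_density p)" and p: "0 < p"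
begin

lemma chi_weight_Z: "integrable lborel (chi_weight p)" "0 < (LINT y|lborel. chi_weight p y)"
proof -
  let ?Z = "LINT y|lborel. chi_weight p y"
  have "(\<integral>\<^sup>+x. ennreal (chi_density p x) \<partial>lborel) = 1"
    using distributed_nn_integral[OF D, of "\<lambda>_. 1"] by (simp add: emeasure_space_1)
  \<comment> \<open>If the normalising integral were 0, which is also the default value of a
    divergent one, the quotient would vanish identically and could not have mass 1.\<close>
  then have Z0: "?Z \<noteq> 0" by (auto simp: chi_density_def)
  then show "integrable lborel (chi_weight p)" using not_integrable_integral_eq by blast
  have "0 \<le> ?Z" by (simp add: chi_weight_nonneg)
  then show "0 < ?Z" using Z0 by simp
qed

lemma chi_rv [measurable]: "A \<in> borel_measurable M"
  using distributed_measurable[OF D] by simp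

lemma chi_nn_integral:
  assumes [measurable]: "g \<in> borel_measurable borel"
  shows "(\<integral>\<^sup>+\<xi>. ennreal (g (A \<xi>)) \<partial>M) = (\<integral>\<^sup>+x. ennreal (chi_weight p x / (LINT y|lborel. chi_weight p y)) * ennreal (g x) \<partial>lborel)"
  using distributed_nn_integral[OF D, of "\<lambda>x. ennreal (g x)"] by (simp add: chi_density_def)

lemma chi_expectation:
  assumes [measurable]: "g \<in> borel_measurable borel" and g: "\<And>x. 0 \<le> g x"
    and int: "integrable lborel (\<lambda>x. chi_weight p x * g x)"
  shows "integrable M (\<lambda>\<xi>. g (A \<xi>))"
    "expectation (\<lambda>\<xi>. g (A \<xi>)) = (LINT x|lborel. chi_weight p x * g x) / (LINT y|lborel. chi_weight p y)"
proof -
  let ?Z = "LINT y|lborel. chi_weight p y"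
  have n: "0 \<le> chi_density p x" for x using chi_weight_Z by (simp add: chi_density_def chi_weight_nonneg)
  have e: "chi_density p x * g x = chi_weight p x * g x / ?Z" for x by (simp add: chi_density_def)
  have "integrable lborel (\<lambda>x. chi_density p x * g x)" unfolding e using int by simp
  then show "integrable M (\<lambda>\<xi>. g (A \<xi>))"
    using distributed_integrable[OF D, of g] n by simp
  show "expectation (\<lambda>\<xi>. g (A \<xi>)) = (LINT x|lborel. chi_weight p x * g x) / ?Z"
    using distributed_integral[OF D, of g] n unfolding e by simp
qed

lemma chi_square_moments:
  "integrable M (\<lambda>\<xi>. (A \<xi>)\<^sup>2)" "expectation (\<lambda>\<xi>. (A \<xi>)\<^sup>2) = p"
  "integrable M (\<lambda>\<xi>. (A \<xi>) ^ 4)" "expectation (\<lambda>\<xi>. (A \<xi>) ^ 4) = p * (p + 2)"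
proof -
  let ?Z = "LINT y|lborel. chi_weight p y"
  note Z = chi_weight_Z
  note s1 = chi_weight_step[OF p Z(1)]
  have p2: "0 < p + 2" using p by simp
  note s2 = chi_weight_step[OF p2 s1(1)]
  have e2: "chi_weight p x * x\<^sup>2 = chi_weight (p + 2) x" for x by (simp add: chi_weight_add_2)
  have e4: "chi_weight p x * x ^ 4 = chi_weight (p + 2 + 2) x" for x
    unfolding chi_weight_add_2 by (simp add: power2_eq_square power4_eq_xxxx)
  show "integrable M (\<lambda>\<xi>. (A \<xi>)\<^sup>2)" "expectation (\<lambda>\<xi>. (A \<xi>)\<^sup>2) = p"
    using chi_expectation[of "\<lambda>x. x\<^sup>2"] s1 Z(2) unfolding e2 by auto
  show "integrable M (\<lambda>\<xi>. (A \<xi>) ^ 4)" "expectation (\<lambda>\<xi>. (A \<xi>) ^ 4) = p * (p + 2)"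
    using chi_expectation[of "\<lambda>x. x ^ 4"] s1 s2 Z(2) unfolding e4 by auto
qed

text \<open>The range of \<open>t\<close> keeps \<open>|2 * s| \<le> 1 / 2\<close>, where
  \<open>ln (1 - 2 * s) \<ge> - 2 * s - 8 * s^2\<close>. The linear term cancels the centring and
  the quadratic one becomes \<open>2 * t^2\<close>.\<close>

lemma chi_square_exp:
  assumes t: "\<bar>t\<bar> \<le> sqrt (2 * p) / 4"
  shows "exp_moment M (\<lambda>\<xi>. t * (((A \<xi>)\<^sup>2 - p) / sqrt (2 * p))) \<le> ennreal (exp (2 * t\<^sup>2))"
proof -
  let ?Z = "LINT y|lborel. chi_weight p y" and ?s = "sqrt (2 * p)"
  note Z = chi_weight_Z
  define s where "s = t / ?s"
  have s0: "0 < ?s" using p by simp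
  have s: "\<bar>2 * s\<bar> \<le> 1 / 2" using t s0 by (simp add: s_def abs_divide divide_le_eq)
  have "exp_moment M (\<lambda>\<xi>. t * (((A \<xi>)\<^sup>2 - p) / ?s))
     = (\<integral>\<^sup>+x. ennreal (exp (- s * p) / ?Z) * ennreal (chi_weight p x * exp (s * x\<^sup>2)) \<partial>lborel)"
    using Z by (subst chi_nn_integral[of "\<lambda>x. exp (t * ((x\<^sup>2 - p) / ?s))"])
       (auto intro!: nn_integral_cong simp: chi_weight_nonneg s_def right_diff_distrib diff_divide_distrib exp_diff exp_minus field_simps simp flip: ennreal_mult)
  also have "\<dots> = ennreal (exp (- s * p) / ?Z) * (ennreal ((1 - 2 * s) powr (- p / 2)) * (\<integral>\<^sup>+x. ennreal (chi_weight p x) \<partial>lborel))"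
    using s by (subst nn_integral_cmult) (auto simp: nn_integral_chi_weight_exp)
  also have "(\<integral>\<^sup>+x. ennreal (chi_weight p x) \<partial>lborel) = ennreal ?Z"
    using Z by (intro nn_integral_eq_integral) (auto simp: chi_weight_nonneg)
  also have "ennreal (exp (- s * p) / ?Z) * (ennreal ((1 - 2 * s) powr (- p / 2)) * ennreal ?Z) = ennreal (exp (- s * p) * (1 - 2 * s) powr (- p / 2))"
    using Z(2) by (simp flip: ennreal_mult)
  also have "\<dots> \<le> ennreal (exp (2 * t\<^sup>2))"
  proof (rule ennreal_leI)
    have "\<bar>ln (1 + (- 2 * s)) - (- 2 * s)\<bar> \<le> 2 * (- 2 * s)\<^sup>2"
      using s by (intro abs_ln_one_plus_x_minus_x_bound) auto
    then have "- 2 * s - 8 * s\<^sup>2 \<le> ln (1 - 2 * s)" by (auto simp: abs_le_iff power_mult_distrib)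
    then have "p / 2 * (- 2 * s - 8 * s\<^sup>2) \<le> p / 2 * ln (1 - 2 * s)" using p by (intro mult_left_mono) auto
    then have "- s * p + - p / 2 * ln (1 - 2 * s) \<le> 4 * s\<^sup>2 * p" by (simp add: algebra_simps)
    also have "\<dots> = 2 * t\<^sup>2" using p by (simp add: s_def power_divide)
    finally show "exp (- s * p) * (1 - 2 * s) powr (- p / 2) \<le> exp (2 * t\<^sup>2)"
      using s by (simp add: powr_def abs_le_iff flip: exp_add)
  qed
  finally show ?thesis .
qed

end
end

section \<open>Tail bounds for suprema and martingales\<close>

text \<open>Cauchy's formula. A point of the half-radius disc stays at distance at least
  \<open>r / 2\<close> from the circle, so the kernel costs a factor 2.\<close>

lemma norm_le_circle_average:
  assumes hol: "G holomorphic_on cball z0 r" and r: "0 < r" and w: "w \<in> ball z0 (r / 2)"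
  shows "ennreal (cmod (G w)) \<le> 2 * (\<integral>\<^sup>+t. ennreal (cmod (G (circlepath z0 r t))) * indicator {0..1} t \<partial>lborel)"
proof -
  have wr: "cmod (w - z0) < r / 2" using w by (simp add: dist_norm norm_minus_commute)
  let ?p = "circlepath z0 r"
  define h where "h t = cmod (G (?p t))" for t
  have pin: "?p t \<in> cball z0 r" "cmod (?p t - z0) = r" for t :: real
    using r by (simp_all add: circlepath dist_norm norm_mult)
  have cont: "continuous_on {0..1} h"
    unfolding h_def
    by (intro continuous_intros continuous_on_compose2[OF holomorphic_on_imp_continuous_on[OF hol]])
       (use pin in \<open>auto simp: circlepath intro!: continuous_intros\<close>)
  then have hi: "(h has_integral integral {0..1} h) {0..1}"
    by (intro integrable_integral integrable_continuous_interval)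
  have "((\<lambda>u. G u / (u - w)) has_contour_integral (2 * of_real pi * \<i> * G w)) ?p"
    using wr r by (intro Cauchy_integral_circlepath_simple[OF hol]) auto
  then have ci: "((\<lambda>t. G (?p t) / (?p t - w) * vector_derivative ?p (at t within {0..1})) has_integral (2 * of_real pi * \<i> * G w)) {0..1}"
    by (simp add: has_contour_integral_def)
  have "cmod (integral {0..1} (\<lambda>t. G (?p t) / (?p t - w) * vector_derivative ?p (at t within {0..1}))) \<le> integral {0..1} (\<lambda>t. 4 * pi * h t)"
  proof (rule Henstock_Kurzweil_Integration.integral_norm_bound_integral)
    show "(\<lambda>t. G (?p t) / (?p t - w) * vector_derivative ?p (at t within {0..1})) integrable_on {0..1}"
      using ci by blast
    show "(\<lambda>t. 4 * pi * h t) integrable_on {0..1}"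
      using hi by (auto intro!: integrable_on_mult_right)
    fix t :: real assume t: "t \<in> {0..1}"
    have "r / 2 \<le> cmod (?p t - w)"
      using norm_triangle_ineq2[of "?p t - z0" "w - z0"] pin(2)[of t] wr by simp
    then have "1 / cmod (?p t - w) \<le> 1 / (r / 2)" using r by (intro frac_le) auto
    then have "h t * (1 / cmod (?p t - w)) * (2 * pi * r) \<le> h t * (1 / (r / 2)) * (2 * pi * r)"
      using r by (intro mult_right_mono mult_left_mono) (auto simp: h_def)
    also have "\<dots> = 4 * pi * h t" using r by simp
    finally have "h t * (1 / cmod (?p t - w)) * (2 * pi * r) \<le> 4 * pi * h t" .
    moreover have "cmod (G (?p t) / (?p t - w) * vector_derivative ?p (at t within {0..1})) = h t * (1 / cmod (?p t - w)) * (2 * pi * r)"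
      using r t by (simp add: vector_derivative_circlepath01 norm_mult norm_divide h_def)
    ultimately show "cmod (G (?p t) / (?p t - w) * vector_derivative ?p (at t within {0..1})) \<le> 4 * pi * h t"
      by simp
  qed
  also have "\<dots> = 4 * pi * integral {0..1} h" by simp
  finally have "2 * pi * cmod (G w) \<le> 4 * pi * integral {0..1} h"
    using integral_unique[OF ci] by (simp add: norm_mult)
  then have "cmod (G w) \<le> 2 * integral {0..1} h" by simp
  moreover have "(\<integral>\<^sup>+t. ennreal (h t) * indicator {0..1} t \<partial>lborel) = ennreal (integral {0..1} h)"
    by (rule nn_integral_has_integral_lebesgue'[OF _ hi]) (simp add: h_def)
  moreover have "0 \<le> integral {0..1} h" by (rule has_integral_nonneg[OF hi]) (simp add: h_def)
  ultimately show ?thesis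
    unfolding h_def[symmetric] by (metis ennreal_leI ennreal_mult' ennreal_numeral zero_le_numeral)
qed

text \<open>Freezing the time at the grid point below \<open>t\<close> leaves countably many
  measurable slices; refining the grid recovers the function by continuity.\<close>

lemma jointly_measurable_Caratheodory:
  fixes f :: "real \<Rightarrow> 'a \<Rightarrow> real"
  assumes meas: "\<And>t. f t \<in> borel_measurable M" and cont: "\<And>\<xi>. \<xi> \<in> space M \<Longrightarrow> continuous_on UNIV (\<lambda>t. f t \<xi>)"
  shows "(\<lambda>(t, \<xi>). f t \<xi>) \<in> borel_measurable (lborel \<Otimes>\<^sub>M M)"
proof -
  define q where "q m t = real_of_int \<lfloor>real (Suc m) * t\<rfloor> / real (Suc m)" for m :: nat and t :: real
  show ?thesis
  proof (rule borel_measurable_LIMSEQ_metric[of "\<lambda>m x. f (q m (fst x)) (snd x)"])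
  fix m :: nat
  have "(\<lambda>x. (\<lambda>(i :: int) x. f (real_of_int i / real (Suc m)) (snd x)) \<lfloor>real (Suc m) * fst x\<rfloor> x) \<in> borel_measurable (lborel \<Otimes>\<^sub>M M)"
  proof (rule measurable_compose_countable[where f = "\<lambda>i x. f (real_of_int i / real (Suc m)) (snd x)" and g = "\<lambda>x. \<lfloor>real (Suc m) * fst x\<rfloor>"])
    show "(\<lambda>x. f (real_of_int i / real (Suc m)) (snd x)) \<in> borel_measurable (lborel \<Otimes>\<^sub>M M)" for i
      by (rule measurable_compose[OF measurable_snd meas])
    show "(\<lambda>x. \<lfloor>real (Suc m) * fst x\<rfloor>) \<in> (lborel \<Otimes>\<^sub>M M) \<rightarrow>\<^sub>M count_space UNIV" by measurable
  qed
  then show "(\<lambda>x. f (q m (fst x)) (snd x)) \<in> borel_measurable (lborel \<Otimes>\<^sub>M M)" by (simp add: q_def)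
next
  fix x :: "real \<times> 'a" assume x: "x \<in> space (lborel \<Otimes>\<^sub>M M)"
  obtain t \<xi> where to: "x = (t, \<xi>)" "\<xi> \<in> space M" using x by (auto simp: space_pair_measure)
  have "(\<lambda>m. q m t) \<longlonglongrightarrow> t"
  proof (rule tendsto_sandwich)
    show "(\<lambda>m. t - 1 / real (Suc m)) \<longlonglongrightarrow> t"
      using tendsto_diff[OF tendsto_const[of t] LIMSEQ_inverse_real_of_nat] by (simp add: inverse_eq_divide)
    show "\<forall>\<^sub>F m in sequentially. t - 1 / real (Suc m) \<le> q m t"
    proof (intro always_eventually allI)
      fix m :: nat
      have "real (Suc m) * t - 1 \<le> real_of_int \<lfloor>real (Suc m) * t\<rfloor>" by linarith
      then have "(real (Suc m) * t - 1) / real (Suc m) \<le> q m t" unfolding q_def by (intro divide_right_mono) auto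
      then show "t - 1 / real (Suc m) \<le> q m t" by (simp add: diff_divide_distrib del: of_nat_Suc)
    qed
    show "\<forall>\<^sub>F m in sequentially. q m t \<le> t"
    proof (intro always_eventually allI)
      fix m :: nat
      have "real_of_int \<lfloor>real (Suc m) * t\<rfloor> \<le> real (Suc m) * t" by linarith
      then show "q m t \<le> t" unfolding q_def by (simp add: pos_divide_le_eq mult.commute del: of_nat_Suc)
    qed
  qed simp
  then have "(\<lambda>m. f (q m t) \<xi>) \<longlonglongrightarrow> f t \<xi>"
    using cont[OF to(2)] by (intro continuous_on_tendsto_compose[of UNIV "\<lambda>t. f t \<xi>"]) auto
  then show "(\<lambda>m. f (q m (fst x)) (snd x)) \<longlonglongrightarrow> (case x of (t, \<xi>) \<Rightarrow> f t \<xi>)" by (simp add: to q_def)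
  qed
qed

text \<open>The exceptional set is defined through the circle average, which is measurable by Fubini
  and has mean at most \<open>A\<close>. The supremum over the disc itself never enters as a random
  variable.\<close>

lemma (in prob_space) circle_average_Markov:
  assumes hol: "\<And>\<xi>. \<xi> \<in> space M \<Longrightarrow> (\<lambda>z. F z \<xi>) holomorphic_on cball z0 r" and r: "0 < r"
    and meas: "\<And>z. z \<in> cball z0 r \<Longrightarrow> F z \<in> borel_measurable M"
    and A: "\<And>z. z \<in> cball z0 r \<Longrightarrow> (\<integral>\<^sup>+\<xi>. ennreal (cmod (F z \<xi>)) \<partial>M) \<le> ennreal A"
    and c: "0 < c" and A0: "0 \<le> A"
  shows "\<exists>B\<in>sets M. emeasure M B \<le> ennreal (2 * A / c) \<and> (\<forall>\<xi>\<in>space M - B. \<forall>w\<in>ball z0 (r / 2). cmod (F w \<xi>) < c)"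
proof -
  let ?p = "circlepath z0 r"
  have pin: "?p t \<in> cball z0 r" for t :: real
    using r by (simp_all add: circlepath dist_norm norm_mult)
  define f where "f t \<xi> = cmod (F (?p t) \<xi>)" for t \<xi>
  have fm: "(\<lambda>(t, \<xi>). f t \<xi>) \<in> borel_measurable (lborel \<Otimes>\<^sub>M M)"
  proof (rule jointly_measurable_Caratheodory)
    show "f t \<in> borel_measurable M" for t unfolding f_def using meas[OF pin[of t]] by measurable
    show "continuous_on UNIV (\<lambda>t. f t \<xi>)" if "\<xi> \<in> space M" for \<xi>
      unfolding f_def
      by (intro continuous_intros continuous_on_compose2[OF holomorphic_on_imp_continuous_on[OF hol[OF that]]])
         (use pin in \<open>auto simp: circlepath intro!: continuous_intros\<close>)
  qed
  define S where "S \<xi> = (\<integral>\<^sup>+t. ennreal (f t \<xi>) * indicator {0..1} t \<partial>lborel)" for \<xi>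
  interpret P: pair_sigma_finite lborel M ..
  have fm2: "(\<lambda>(\<xi>, t). ennreal (f t \<xi>) * indicator {0..1} t) \<in> borel_measurable (M \<Otimes>\<^sub>M lborel)"
  proof -
    have "(\<lambda>x. f (fst (snd x, fst x)) (snd (snd x, fst x))) \<in> borel_measurable (M \<Otimes>\<^sub>M lborel)"
      using measurable_compose[OF _ fm, of "\<lambda>x. (snd x, fst x)" "M \<Otimes>\<^sub>M lborel"] by (simp add: split_beta' )
    then have [measurable]: "(\<lambda>x. f (snd x) (fst x)) \<in> borel_measurable (M \<Otimes>\<^sub>M lborel)" by simp
    show ?thesis unfolding split_beta' by measurable
  qed
  have Sm[measurable]: "S \<in> borel_measurable M"
    unfolding S_def using lborel.borel_measurable_nn_integral_fst[OF fm2] by simp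
  have "(\<integral>\<^sup>+\<xi>. S \<xi> \<partial>M) = (\<integral>\<^sup>+t. (\<integral>\<^sup>+\<xi>. ennreal (f t \<xi>) * indicator {0..1} t \<partial>M) \<partial>lborel)"
    unfolding S_def using P.Fubini'[of "\<lambda>t \<xi>. ennreal (f t \<xi>) * indicator {0..1} t"] fm
    by (simp add: split_beta' borel_measurable_times_ennreal)
  also have "\<dots> \<le> (\<integral>\<^sup>+t. ennreal A * indicator {0..1} (t :: real) \<partial>lborel)"
  proof (intro nn_integral_mono)
    fix t :: real
    show "(\<integral>\<^sup>+\<xi>. ennreal (f t \<xi>) * indicator {0..1} t \<partial>M) \<le> ennreal A * indicator {0..1} t"
      using A[OF pin[of t]] by (auto simp: indicator_def f_def)
  qed
  also have "\<dots> = ennreal A" by (simp add: nn_integral_cmult_indicator)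
  finally have SA: "(\<integral>\<^sup>+\<xi>. S \<xi> \<partial>M) \<le> ennreal A" .
  define B where "B = {\<xi> \<in> space M. ennreal c \<le> 2 * S \<xi>}"
  have Bs: "B \<in> sets M" unfolding B_def by measurable
  have "emeasure M B = emeasure M {\<xi> \<in> space M. 1 \<le> ennreal (2 / c) * S \<xi>}"
  proof -
    have "ennreal c \<le> 2 * x \<longleftrightarrow> 1 \<le> ennreal (2 / c) * x" for x
    proof -
      have e: "ennreal (2 / c) = ennreal (1 / c) * 2"
        by (metis ennreal_mult' ennreal_numeral mult.commute times_divide_eq_right mult_1_right zero_le_numeral)
      have i: "ennreal (1 / c) * ennreal c = 1" using c by (simp flip: ennreal_mult)
      have i2: "ennreal c * ennreal (1 / c) = 1" using c by (simp flip: ennreal_mult)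
      show ?thesis
      proof
        assume "ennreal c \<le> 2 * x"
        from mult_left_mono[OF this, of "ennreal (1 / c)"] show "1 \<le> ennreal (2 / c) * x"
          unfolding e i by (simp add: mult.assoc)
      next
        assume "1 \<le> ennreal (2 / c) * x"
        from mult_left_mono[OF this, of "ennreal c"] show "ennreal c \<le> 2 * x"
          unfolding e mult.assoc[symmetric] i2 by simp
      qed
    qed
    then show ?thesis by (simp add: B_def)
  qed
  also have "\<dots> = emeasure M ({\<xi> \<in> space M. 1 \<le> ennreal (2 / c) * S \<xi>} \<inter> space M)"
    by (simp add: Int_absorb2 subset_iff)
  also have "\<dots> \<le> ennreal (2 / c) * (\<integral>\<^sup>+\<xi>. S \<xi> * indicator (space M) \<xi> \<partial>M)"
    using nn_integral_Markov_inequality[of S "space M" M "ennreal (2 / c)"] by (simp add: Int_def conj_commute)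
  also have "(\<integral>\<^sup>+\<xi>. S \<xi> * indicator (space M) \<xi> \<partial>M) = (\<integral>\<^sup>+\<xi>. S \<xi> \<partial>M)"
    by (intro nn_integral_cong) simp
  also have "ennreal (2 / c) * (\<integral>\<^sup>+\<xi>. S \<xi> \<partial>M) \<le> ennreal (2 / c) * ennreal A" by (intro mult_left_mono SA) simp
  also have "\<dots> = ennreal (2 * A / c)" using A0 c by (simp flip: ennreal_mult')
  finally have Bm: "emeasure M B \<le> ennreal (2 * A / c)" .
  have "cmod (F w \<xi>) < c" if "\<xi> \<in> space M - B" "w \<in> ball z0 (r / 2)" for w \<xi>
  proof -
    have "ennreal (cmod (F w \<xi>)) \<le> 2 * S \<xi>"
      unfolding S_def f_def using that by (intro norm_le_circle_average hol r) auto
    also have "\<dots> < ennreal c" using that by (auto simp: B_def)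
    finally show ?thesis by (simp add: ennreal_less_iff)
  qed
  with Bs Bm show ?thesis by blast
qed

text \<open>The functions \<open>exp (s * F)\<close> are again holomorphic. The four directions
  \<open>s\<close> along the axes control \<open>|Re| + |Im|\<close>; the factor 8 is four
  directions times the 2 of the circle average.\<close>

lemma (in prob_space) holomorphic_sup_tail:
  assumes hol: "\<And>\<xi>. \<xi> \<in> space M \<Longrightarrow> (\<lambda>z. F z \<xi>) holomorphic_on cball z0 r" and r: "0 < r"
    and meas: "\<And>z. z \<in> cball z0 r \<Longrightarrow> F z \<in> borel_measurable M"
    and A: "\<And>z s. z \<in> cball z0 r \<Longrightarrow> cmod s = l \<Longrightarrow> exp_moment M (\<lambda>\<xi>. Re (s * F z \<xi>)) \<le> ennreal A"
    and l: "0 < l" and A0: "0 \<le> A"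
  shows "\<exists>B\<in>sets M. emeasure M B \<le> ennreal (8 * A * exp (- l * x / 2)) \<and> (\<forall>\<xi>\<in>space M - B. \<forall>w\<in>ball z0 (r / 2). cmod (F w \<xi>) < x)"
proof -
  define Q where "Q = {cplx l, - cplx l, cplx l * \<i>, - (cplx l * \<i>)}"
  have Qn: "cmod s = l" if "s \<in> Q" for s using that l by (auto simp: Q_def norm_mult)
  have "\<exists>B\<in>sets M. emeasure M B \<le> ennreal (2 * A / exp (l * x / 2)) \<and>
    (\<forall>\<xi>\<in>space M - B. \<forall>w\<in>ball z0 (r / 2). cmod (exp (s * F w \<xi>)) < exp (l * x / 2))" if s: "s \<in> Q" for s
  proof (rule circle_average_Markov)
    show "(\<lambda>z. exp (s * F z \<xi>)) holomorphic_on cball z0 r" if "\<xi> \<in> space M" for \<xi>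
      using hol[OF that] by (intro holomorphic_intros)
    show "(\<lambda>\<xi>. exp (s * F z \<xi>)) \<in> borel_measurable M" if "z \<in> cball z0 r" for z
      using meas[OF that] by measurable
    show "(\<integral>\<^sup>+\<xi>. ennreal (cmod (exp (s * F z \<xi>))) \<partial>M) \<le> ennreal A" if "z \<in> cball z0 r" for z
      using A[OF that Qn[OF s]] by (simp only: norm_exp_eq_Re)
  qed (use r A0 in auto)
  then obtain B where B: "\<And>s. s \<in> Q \<Longrightarrow> B s \<in> sets M" "\<And>s. s \<in> Q \<Longrightarrow> emeasure M (B s) \<le> ennreal (2 * A / exp (l * x / 2))"
    "\<And>s \<xi> w. s \<in> Q \<Longrightarrow> \<xi> \<in> space M - B s \<Longrightarrow> w \<in> ball z0 (r / 2) \<Longrightarrow> cmod (exp (s * F w \<xi>)) < exp (l * x / 2)"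
    by metis
  define U where "U = (\<Union>s\<in>Q. B s)"
  have finQ: "finite Q" "card Q \<le> 4" by (auto simp: Q_def card_insert_if)
  have "U \<in> sets M" using B(1) finQ by (auto simp: U_def)
  moreover have "emeasure M U \<le> ennreal (8 * A * exp (- l * x / 2))"
  proof -
    have "emeasure M U \<le> (\<Sum>s\<in>Q. emeasure M (B s))"
      unfolding U_def using finQ B(1) by (intro emeasure_subadditive_finite) auto
    also have "\<dots> \<le> (\<Sum>s\<in>Q. ennreal (2 * A / exp (l * x / 2)))" by (intro sum_mono B(2))
    also have "\<dots> = ennreal (real (card Q) * (2 * A / exp (l * x / 2)))"
      by (simp add: ennreal_of_nat_eq_real_of_nat ennreal_mult'[symmetric])
    also have "\<dots> \<le> ennreal (4 * (2 * A / exp (l * x / 2)))"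
      using finQ A0 by (intro ennreal_leI mult_right_mono) auto
    also have "4 * (2 * A / exp (l * x / 2)) = 8 * A * exp (- l * x / 2)"
      by (simp add: exp_minus field_simps)
    finally show ?thesis .
  qed
  moreover have "cmod (F w \<xi>) < x" if \<xi>: "\<xi> \<in> space M - U" and w: "w \<in> ball z0 (r / 2)" for \<xi> w
  proof -
    have *: "Re (s * F w \<xi>) < l * x / 2" if "s \<in> Q" for s
      using B(3)[OF that, of \<xi> w] \<xi> w that by (auto simp: U_def)
    have "\<bar>l * Re (F w \<xi>)\<bar> < l * x / 2" "\<bar>l * Im (F w \<xi>)\<bar> < l * x / 2"
      using *[of "cplx l"] *[of "- cplx l"] *[of "cplx l * \<i>"] *[of "- (cplx l * \<i>)"]
      by (auto simp: Q_def)
    then have "l * (\<bar>Re (F w \<xi>)\<bar> + \<bar>Im (F w \<xi>)\<bar>) < l * x" 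
      unfolding abs_mult abs_of_pos[OF l] distrib_left by linarith
    then have "\<bar>Re (F w \<xi>)\<bar> + \<bar>Im (F w \<xi>)\<bar> < x" using l by simp
    then show ?thesis using cmod_le[of "F w \<xi>"] by linarith
  qed
  ultimately show ?thesis by blast
qed

section \<open>Exponential inequality for bounded martingale increments\<close>

lemma (in prob_space) Hoeffding_symmetric:
  assumes [measurable]: "f \<in> borel_measurable M" and b: "\<And>\<xi>. \<xi> \<in> space M \<Longrightarrow> \<bar>f \<xi>\<bar> \<le> c" and E0: "expectation f = 0"
  shows "exp_moment M (\<lambda>\<xi>. f \<xi>) \<le> ennreal (exp (c\<^sup>2 / 2))"
proof -
  interpret interval_bounded_random_variable M f "- c" c
    by unfold_locales (use b in \<open>auto simp: abs_le_iff minus_le_iff\<close>)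
  show ?thesis
    using Hoeffdings_lemma_nn_integral_0[of 1] E0 by (simp add: power2_eq_square)
qed

text \<open>The filtration is encoded by sets of independent coordinates: \<open>P n\<close> is the
  past and \<open>Q n\<close> the block revealed in step \<open>n\<close>. Conditioning on the past
  is integration over the new block with the past frozen, by Fubini for the product law, and
  Hoeffding's lemma applies to each frozen past.\<close>

lemma (in prob_space) Azuma_exp_bound:
  fixes V :: "'i \<Rightarrow> 'a \<Rightarrow> real" and P Q :: "nat \<Rightarrow> 'i set"
    and G :: "nat \<Rightarrow> ('i \<Rightarrow> real) \<Rightarrow> ('i \<Rightarrow> real) \<Rightarrow> real"
  assumes ind: "indep_vars (\<lambda>_. borel) V I"
    and P: "\<And>n. P n \<inter> Q n = {}" "\<And>n. P (Suc n) = P n \<union> Q n" "\<And>n. P n \<subseteq> I"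
    and G [measurable]: "\<And>n. n < m \<Longrightarrow> (\<lambda>x. G n (fst x) (snd x)) \<in> borel_measurable (PiM (P n) (\<lambda>_. borel) \<Otimes>\<^sub>M PiM (Q n) (\<lambda>_. borel))"
    and bnd: "\<And>n p q. n < m \<Longrightarrow> \<bar>G n p q\<bar> \<le> c n"
    and centred: "\<And>n p. n < m \<Longrightarrow> p \<in> space (PiM (P n) (\<lambda>_. borel)) \<Longrightarrow> expectation (\<lambda>\<xi>. G n p (restrict (\<lambda>i. V i \<xi>) (Q n))) = 0"
  shows "exp_moment M (\<lambda>\<xi>. \<Sum>n<m. G n (restrict (\<lambda>i. V i \<xi>) (P n)) (restrict (\<lambda>i. V i \<xi>) (Q n)))
    \<le> ennreal (exp (\<Sum>n<m. (c n)\<^sup>2 / 2))"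
  using G bnd centred
proof (induction m)
  case 0
  then show ?case by (simp add: emeasure_space_1)
next
  case (Suc m)
  let ?past = "\<lambda>\<xi>. restrict (\<lambda>i. V i \<xi>) (P m)" and ?new = "\<lambda>\<xi>. restrict (\<lambda>i. V i \<xi>) (Q m)"
  let ?PM = "PiM (P m) (\<lambda>_. borel :: real measure)" and ?QM = "PiM (Q m) (\<lambda>_. borel :: real measure)"
  have sub: "P n \<subseteq> P m" "Q n \<subseteq> P m" if "n < m" for n
  proof -
    have "mono P" by (rule incseq_SucI) (use P(2) in auto)
    then show "P n \<subseteq> P m" using that by (simp add: monoD)
    have "P (Suc n) \<subseteq> P m" using \<open>mono P\<close> that by (simp add: monoD)
    then show "Q n \<subseteq> P m" using P(2)[of n] by auto
  qed
  define s where "s p = (\<Sum>n<m. G n (restrict p (P n)) (restrict p (Q n)))" for p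
  have s_past: "s (?past \<xi>) = (\<Sum>n<m. G n (restrict (\<lambda>i. V i \<xi>) (P n)) (restrict (\<lambda>i. V i \<xi>) (Q n)))" for \<xi>
    unfolding s_def using sub by (intro sum.cong refl) (simp add: restrict_restrict Int_absorb1)
  have Gm: "(\<lambda>x. G n (fst x) (snd x)) \<in> borel_measurable (PiM (P n) (\<lambda>_. borel) \<Otimes>\<^sub>M PiM (Q n) (\<lambda>_. borel))" if "n < Suc m" for n
    using Suc.prems(1) that by blast
  have s_meas: "s \<in> borel_measurable ?PM"
    unfolding s_def
  proof (intro borel_measurable_sum)
    fix n assume n: "n \<in> {..<m}"
    have "(\<lambda>p. (restrict p (P n), restrict p (Q n))) \<in> ?PM \<rightarrow>\<^sub>M PiM (P n) (\<lambda>_. borel) \<Otimes>\<^sub>M PiM (Q n) (\<lambda>_. borel)"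
      using sub n by (intro measurable_Pair measurable_restrict_subset) auto
    from measurable_compose[OF this Gm[of n]] n
    show "(\<lambda>p. G n (restrict p (P n)) (restrict p (Q n))) \<in> borel_measurable ?PM" by simp
  qed
  have indep: "indep_var ?PM ?past ?QM ?new"
    using P(1)[of m] P(2)[of m] P(3)[of m] P(3)[of "Suc m"] by (intro indep_var_restrict[OF ind]) auto
  have pm: "?past \<in> M \<rightarrow>\<^sub>M ?PM" and qm: "?new \<in> M \<rightarrow>\<^sub>M ?QM"
    using indep_var_rv1[OF indep] indep_var_rv2[OF indep] by auto
  have jd: "distr M (?PM \<Otimes>\<^sub>M ?QM) (\<lambda>\<xi>. (?past \<xi>, ?new \<xi>)) = distr M ?PM ?past \<Otimes>\<^sub>M distr M ?QM ?new"
    using indep by (simp add: indep_var_distribution_eq)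
  interpret DP: prob_space "distr M ?PM ?past" by (rule prob_space_distr[OF pm])
  interpret DQ: prob_space "distr M ?QM ?new" by (rule prob_space_distr[OF qm])
  define F where "F x = ennreal (exp (s (fst x) + G m (fst x) (snd x)))" for x
  have Fm: "F \<in> borel_measurable (?PM \<Otimes>\<^sub>M ?QM)"
    unfolding F_def using Gm[of m] measurable_compose[OF measurable_fst s_meas] by measurable
  have "sets (distr M ?PM ?past \<Otimes>\<^sub>M distr M ?QM ?new) = sets (?PM \<Otimes>\<^sub>M ?QM)"
    by (intro sets_pair_measure_cong sets_distr)
  from measurable_cong_sets[OF this refl] Fm
  have Fm': "F \<in> borel_measurable (distr M ?PM ?past \<Otimes>\<^sub>M distr M ?QM ?new)" by simp
  have "exp_moment M (\<lambda>\<xi>. \<Sum>n<Suc m. G n (restrict (\<lambda>i. V i \<xi>) (P n)) (restrict (\<lambda>i. V i \<xi>) (Q n)))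
    = (\<integral>\<^sup>+\<xi>. F (?past \<xi>, ?new \<xi>) \<partial>M)"
    by (simp add: F_def s_past)
  also have "\<dots> = (\<integral>\<^sup>+x. F x \<partial>distr M (?PM \<Otimes>\<^sub>M ?QM) (\<lambda>\<xi>. (?past \<xi>, ?new \<xi>)))"
    by (rule nn_integral_distr[symmetric, OF measurable_Pair[OF pm qm]]) (use Fm in simp)
  also have "\<dots> = (\<integral>\<^sup>+p. (\<integral>\<^sup>+q. F (p, q) \<partial>distr M ?QM ?new) \<partial>distr M ?PM ?past)"
    unfolding jd by (rule DQ.nn_integral_fst[symmetric, OF Fm'])
  also have "\<dots> \<le> (\<integral>\<^sup>+p. ennreal (exp (s p)) * ennreal (exp ((c m)\<^sup>2 / 2)) \<partial>distr M ?PM ?past)"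
  proof (intro nn_integral_mono)
    fix p assume "p \<in> space (distr M ?PM ?past)"
    then have p: "p \<in> space ?PM" by simp
    have Gp: "G m p \<in> borel_measurable ?QM"
      using measurable_compose[OF measurable_Pair1'[OF p] Gm[of m]] by simp
    have "(\<integral>\<^sup>+q. F (p, q) \<partial>distr M ?QM ?new) = (\<integral>\<^sup>+q. ennreal (exp (s p)) * ennreal (exp (G m p q)) \<partial>distr M ?QM ?new)"
      by (simp add: F_def exp_add ennreal_mult)
    also have "\<dots> = ennreal (exp (s p)) * (\<integral>\<^sup>+q. ennreal (exp (G m p q)) \<partial>distr M ?QM ?new)"
      using Gp by (intro nn_integral_cmult) auto
    also have "(\<integral>\<^sup>+q. ennreal (exp (G m p q)) \<partial>distr M ?QM ?new) = exp_moment M (\<lambda>\<xi>. G m p (?new \<xi>))"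
      using Gp qm by (intro nn_integral_distr) auto
    finally have F_eq: "(\<integral>\<^sup>+q. F (p, q) \<partial>distr M ?QM ?new) = ennreal (exp (s p)) * exp_moment M (\<lambda>\<xi>. G m p (?new \<xi>))" .
    have "exp_moment M (\<lambda>\<xi>. G m p (?new \<xi>)) \<le> ennreal (exp ((c m)\<^sup>2 / 2))"
    proof (rule Hoeffding_symmetric)
      show "(\<lambda>\<xi>. G m p (?new \<xi>)) \<in> borel_measurable M" by (rule measurable_compose[OF qm Gp])
      show "\<bar>G m p (?new \<xi>)\<bar> \<le> c m" for \<xi> using Suc.prems(2)[of m] by simp
      show "expectation (\<lambda>\<xi>. G m p (?new \<xi>)) = 0" by (rule Suc.prems(3)[OF lessI p])
    qed
    then show "(\<integral>\<^sup>+q. F (p, q) \<partial>distr M ?QM ?new) \<le> ennreal (exp (s p)) * ennreal (exp ((c m)\<^sup>2 / 2))"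
      unfolding F_eq by (rule mult_left_mono) simp
  qed
  also have "\<dots> = (\<integral>\<^sup>+p. ennreal (exp (s p)) \<partial>distr M ?PM ?past) * ennreal (exp ((c m)\<^sup>2 / 2))"
    using s_meas by (intro nn_integral_multc) auto
  also have "(\<integral>\<^sup>+p. ennreal (exp (s p)) \<partial>distr M ?PM ?past) = exp_moment M (\<lambda>\<xi>. s (?past \<xi>))"
    using s_meas pm by (intro nn_integral_distr) auto
  also have "\<dots> \<le> ennreal (exp (\<Sum>n<m. (c n)\<^sup>2 / 2))"
    unfolding s_past using Suc.prems by (intro Suc.IH) (auto intro: less_SucI)
  finally show ?case by (simp add: exp_add ennreal_mult mult_right_mono)
qed

section \<open>Wiener integrals of deterministic functions\<close>

text \<open>Shifting the variable by \<open>Re \<zeta>\<close> absorbs the real part of the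
  exponent; what remains is the characteristic function at \<open>Im \<zeta>\<close>.\<close>

lemma std_normal_cexp:
  fixes \<zeta> :: complex
  shows "integrable lborel (\<lambda>x. cplx (std_normal_density x) * exp (\<zeta> * cplx x))"
    "(LINT x|lborel. cplx (std_normal_density x) * exp (\<zeta> * cplx x)) = exp (\<zeta>\<^sup>2 / 2)"
proof -
  define a b where "a = Re \<zeta>" and "b = Im \<zeta>"
  have \<zeta>: "\<zeta> = cplx a + \<i> * cplx b" by (simp add: a_def b_def complex_eq)
  have shift: "cplx (std_normal_density (a + 1 * x)) * exp (\<zeta> * cplx (a + 1 * x)) =
    exp (cplx (a\<^sup>2 / 2) + \<i> * cplx (a * b)) * (std_normal_density x *\<^sub>R iexp (b * x))" for x
  proof -
    have "exp (- (a + x)\<^sup>2 / 2) * exp (a * (a + x)) = exp (a\<^sup>2 / 2) * exp (- x\<^sup>2 / 2)"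
      by (simp add: power2_eq_square field_simps flip: exp_add)
    then have "std_normal_density (a + x) * exp (a * (a + x)) = exp (a\<^sup>2 / 2) * std_normal_density x"
      by (simp add: std_normal_density_def)
    then have 1: "cplx (std_normal_density (a + x)) * exp (cplx (a * (a + x))) = cplx (exp (a\<^sup>2 / 2)) * cplx (std_normal_density x)"
      unfolding exp_of_real of_real_mult[symmetric] by simp
    have "exp (\<zeta> * cplx (a + x)) = exp (cplx (a * (a + x))) * (exp (\<i> * cplx (a * b)) * iexp (b * x))"
      unfolding \<zeta> exp_add[symmetric] by (simp add: algebra_simps)
    then have "cplx (std_normal_density (a + x)) * exp (\<zeta> * cplx (a + x)) =
      (cplx (std_normal_density (a + x)) * exp (cplx (a * (a + x)))) * (exp (\<i> * cplx (a * b)) * iexp (b * x))"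
      by simp
    also have "\<dots> = exp (cplx (a\<^sup>2 / 2)) * exp (\<i> * cplx (a * b)) * (cplx (std_normal_density x) * iexp (b * x))"
      unfolding 1 exp_of_real[symmetric] by (simp only: mult_ac)
    finally show ?thesis by (simp add: exp_add scaleR_conv_of_real)
  qed
  have sd: "integrable lborel std_normal_density" by simp
  have int: "integrable lborel (\<lambda>x. std_normal_density x *\<^sub>R iexp (b * x))"
    by (rule Bochner_Integration.integrable_bound[OF sd]) (auto simp: norm_mult)
  have val: "(LINT x|lborel. std_normal_density x *\<^sub>R iexp (b * x)) = cplx (exp (- (b\<^sup>2) / 2))"
  proof -
    have "char std_normal_distribution b = (LINT x|lborel. std_normal_density x *\<^sub>R iexp (b * x))"
      unfolding char_def by (subst integral_density) auto
    moreover have "char std_normal_distribution b = cplx (exp (- (b\<^sup>2) / 2))"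
      unfolding char_std_normal_distribution by simp
    ultimately show ?thesis by (rule trans[OF sym])
  qed
  let ?f = "\<lambda>x. cplx (std_normal_density x) * exp (\<zeta> * cplx x)"
  have "integrable lborel (\<lambda>x. ?f (a + 1 * x))" unfolding shift by (rule integrable_mult_right[OF int])
  then show "integrable lborel ?f" by (rule lborel_integrable_real_affine_iff[THEN iffD1, rotated]) simp
  have "(LINT x|lborel. ?f x) = (LINT x|lborel. ?f (a + 1 * x))"
    using lborel_integral_real_affine[of 1 ?f a] by simp
  also have "\<dots> = exp (cplx (a\<^sup>2 / 2) + \<i> * cplx (a * b)) * cplx (exp (- (b\<^sup>2) / 2))"
    unfolding shift integral_mult_right_zero val ..
  also have "\<dots> = exp (\<zeta>\<^sup>2 / 2)"
    unfolding \<zeta> exp_of_real[symmetric] exp_add[symmetric]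
    by (rule arg_cong[of _ _ exp]) (simp add: power2_eq_square field_simps)
  finally show "(LINT x|lborel. ?f x) = exp (\<zeta>\<^sup>2 / 2)" .
qed

lemma (in prob_space) normal_cexp:
  fixes \<zeta> :: complex
  assumes D: "distributed M lborel X (normal_density 0 \<sigma>)" and \<sigma>: "0 < \<sigma>"
  shows "integrable M (\<lambda>\<xi>. exp (\<zeta> * cplx (X \<xi>)))"
    "expectation (\<lambda>\<xi>. exp (\<zeta> * cplx (X \<xi>))) = exp (\<zeta>\<^sup>2 * cplx (\<sigma>\<^sup>2) / 2)"
proof -
  have D1: "distributed M lborel (\<lambda>\<xi>. X \<xi> / \<sigma>) (\<lambda>x. ennreal (std_normal_density x))"
    using normal_standard_normal_convert[OF \<sigma>, of X 0] D by simp
  let ?g = "\<lambda>x. exp (\<zeta> * cplx \<sigma> * cplx x)"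
  have gm: "?g \<in> borel_measurable borel" by simp
  have e: "?g (X \<xi> / \<sigma>) = exp (\<zeta> * cplx (X \<xi>))" for \<xi> using \<sigma> by simp
  have Xm: "(\<lambda>\<xi>. X \<xi> / \<sigma>) \<in> M \<rightarrow>\<^sub>M lborel" by (rule distributed_measurable[OF D1])
  have de: "distr M lborel (\<lambda>\<xi>. X \<xi> / \<sigma>) = density lborel std_normal_density"
    by (rule distributed_distr_eq_density[OF D1])
  have "integrable (distr M lborel (\<lambda>\<xi>. X \<xi> / \<sigma>)) ?g"
    unfolding de by (subst integrable_density) (use std_normal_cexp(1)[of "\<zeta> * cplx \<sigma>"] in \<open>auto simp: scaleR_conv_of_real\<close>)
  then show "integrable M (\<lambda>\<xi>. exp (\<zeta> * cplx (X \<xi>)))"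
    using integrable_distr[OF Xm] unfolding e[symmetric] by blast
  have "expectation (\<lambda>\<xi>. exp (\<zeta> * cplx (X \<xi>))) = (LINT x|distr M lborel (\<lambda>\<xi>. X \<xi> / \<sigma>). ?g x)"
    unfolding e[symmetric] by (rule integral_distr[symmetric, OF Xm]) simp
  also have "\<dots> = exp ((\<zeta> * cplx \<sigma>)\<^sup>2 / 2)"
    unfolding de by (subst integral_density) (use std_normal_cexp(2)[of "\<zeta> * cplx \<sigma>"] in \<open>auto simp: scaleR_conv_of_real\<close>)
  finally show "expectation (\<lambda>\<xi>. exp (\<zeta> * cplx (X \<xi>))) = exp (\<zeta>\<^sup>2 * cplx (\<sigma>\<^sup>2) / 2)"
    by (simp add: power_mult_distrib)
qed

section \<open>Exponential moments of integrals of step functions\<close>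

locale gaussian_increments = prob_space M for M :: "'a measure" +
  fixes B :: "real \<Rightarrow> 'a \<Rightarrow> real"
  assumes B_measurable: "\<And>t. 0 \<le> t \<Longrightarrow> B t \<in> borel_measurable M"
    and B_gaussian: "\<And>s t. 0 \<le> s \<Longrightarrow> s < t \<Longrightarrow>
      distributed M lborel (\<lambda>\<xi>. B t \<xi> - B s \<xi>) (normal_density 0 (sqrt (t - s)))"
    and B_indep: "\<And>t :: nat \<Rightarrow> real. 0 \<le> t 0 \<Longrightarrow> mono t \<Longrightarrow>
      indep_vars (\<lambda>_. borel) (\<lambda>i \<xi>. B (t (Suc i)) \<xi> - B (t i) \<xi>) UNIV"
begin

lemma increment_cexp:
  assumes "0 \<le> s" "s \<le> t"
  shows "integrable M (\<lambda>\<xi>. exp (\<zeta> * cplx (B t \<xi> - B s \<xi>)))"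
    "expectation (\<lambda>\<xi>. exp (\<zeta> * cplx (B t \<xi> - B s \<xi>))) = exp (\<zeta>\<^sup>2 * cplx (t - s) / 2)"
proof -
  have "integrable M (\<lambda>\<xi>. exp (\<zeta> * cplx (B t \<xi> - B s \<xi>))) \<and>
    expectation (\<lambda>\<xi>. exp (\<zeta> * cplx (B t \<xi> - B s \<xi>))) = exp (\<zeta>\<^sup>2 * cplx (t - s) / 2)"
  proof (cases "s = t")
    case True
    then show ?thesis by (simp add: prob_space)
  next
    case False
    then have "s < t" using assms by simp
    then have sq: "0 < sqrt (t - s)" "(sqrt (t - s))\<^sup>2 = t - s" by simp_all
    note n = normal_cexp[OF B_gaussian[OF assms(1) \<open>s < t\<close>] sq(1), of \<zeta>]
    show ?thesis using n unfolding sq(2) by blast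
  qed
  then show "integrable M (\<lambda>\<xi>. exp (\<zeta> * cplx (B t \<xi> - B s \<xi>)))"
    "expectation (\<lambda>\<xi>. exp (\<zeta> * cplx (B t \<xi> - B s \<xi>))) = exp (\<zeta>\<^sup>2 * cplx (t - s) / 2)" by auto
qed

lemma increments_cexp:
  fixes c :: "nat \<Rightarrow> complex" and t :: "nat \<Rightarrow> real"
  assumes t: "0 \<le> t 0" "mono t"
  shows "integrable M (\<lambda>\<xi>. exp (\<Sum>i<n. c i * cplx (B (t (Suc i)) \<xi> - B (t i) \<xi>)))"
    "expectation (\<lambda>\<xi>. exp (\<Sum>i<n. c i * cplx (B (t (Suc i)) \<xi> - B (t i) \<xi>))) =
       exp (\<Sum>i<n. (c i)\<^sup>2 * cplx (t (Suc i) - t i) / 2)"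
proof -
  define E where "E i \<xi> = exp (c i * cplx (B (t (Suc i)) \<xi> - B (t i) \<xi>))" for i \<xi>
  have t0: "0 \<le> t i" "t i \<le> t (Suc i)" for i
    using t(1) monoD[OF t(2), of 0 i] monoD[OF t(2), of i "Suc i"] by auto
  have "indep_vars (\<lambda>_. borel) (\<lambda>i \<xi>. (\<lambda>x. exp (c i * cplx x)) (B (t (Suc i)) \<xi> - B (t i) \<xi>)) UNIV"
    by (rule indep_vars_compose2[OF B_indep[OF t]]) auto
  then have ind: "indep_vars (\<lambda>_. borel) E {..<n}"
    unfolding E_def by (rule indep_vars_subset) simp
  have int: "integrable M (E i)" for i unfolding E_def by (rule increment_cexp(1)[OF t0])
  have e: "exp (\<Sum>i<n. c i * cplx (B (t (Suc i)) \<xi> - B (t i) \<xi>)) = (\<Prod>i<n. E i \<xi>)" for \<xi>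
    by (simp add: exp_sum E_def)
  show "integrable M (\<lambda>\<xi>. exp (\<Sum>i<n. c i * cplx (B (t (Suc i)) \<xi> - B (t i) \<xi>)))"
    unfolding e by (rule indep_vars_integrable[OF _ ind int]) simp
  have "expectation (\<lambda>\<xi>. \<Prod>i<n. E i \<xi>) = (\<Prod>i<n. expectation (E i))"
    by (rule indep_vars_lebesgue_integral[OF _ ind int]) simp
  also have "\<dots> = (\<Prod>i<n. exp ((c i)\<^sup>2 * cplx (t (Suc i) - t i) / 2))"
    unfolding E_def increment_cexp(2)[OF t0] ..
  finally show "expectation (\<lambda>\<xi>. exp (\<Sum>i<n. c i * cplx (B (t (Suc i)) \<xi> - B (t i) \<xi>))) =
       exp (\<Sum>i<n. (c i)\<^sup>2 * cplx (t (Suc i) - t i) / 2)"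
    unfolding e by (simp add: exp_sum)
qed

lemma step_integral_measurable:
  assumes "\<And>i. 0 \<le> t i"
  shows "step_integral B n c t \<in> borel_measurable M"
  unfolding step_integral_def[abs_def] using B_measurable assms by measurable

text \<open>The increments are real, so the real part of the sum only sees \<open>Re (c i)\<close>,
  and the exact formula applies with these real coefficients.\<close>

lemma increments_exp:
  fixes c :: "nat \<Rightarrow> complex" and t :: "nat \<Rightarrow> real"
  assumes t: "0 \<le> t 0" "mono t"
  shows "exp_moment M (\<lambda>\<xi>. Re (\<Sum>i<n. c i * cplx (B (t (Suc i)) \<xi> - B (t i) \<xi>)))
    \<le> ennreal (exp (\<Sum>i<n. (cmod (c i))\<^sup>2 * (t (Suc i) - t i) / 2))"
proof -
  let ?S = "\<lambda>\<xi>. \<Sum>i<n. cplx (Re (c i)) * cplx (B (t (Suc i)) \<xi> - B (t i) \<xi>)"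
  have e: "cplx (exp (Re (\<Sum>i<n. c i * cplx (B (t (Suc i)) \<xi> - B (t i) \<xi>)))) = exp (?S \<xi>)" for \<xi>
    unfolding exp_of_real[symmetric] by simp
  have int: "integrable M (\<lambda>\<xi>. exp (?S \<xi>))" by (rule increments_cexp(1)[OF t])
  have ir: "integrable M (\<lambda>\<xi>. exp (Re (\<Sum>i<n. c i * cplx (B (t (Suc i)) \<xi> - B (t i) \<xi>))))"
    using integrable_Re[OF int] unfolding e[symmetric] by simp
  have t0: "t i \<le> t (Suc i)" for i using monoD[OF t(2), of i "Suc i"] by auto
  have "cplx (expectation (\<lambda>\<xi>. exp (Re (\<Sum>i<n. c i * cplx (B (t (Suc i)) \<xi> - B (t i) \<xi>))))) = expectation (\<lambda>\<xi>. exp (?S \<xi>))"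
    unfolding e[symmetric] by simp
  also have "\<dots> = exp (\<Sum>i<n. (cplx (Re (c i)))\<^sup>2 * cplx (t (Suc i) - t i) / 2)"
    by (rule increments_cexp(2)[OF t])
  also have "\<dots> = cplx (exp (\<Sum>i<n. (Re (c i))\<^sup>2 * (t (Suc i) - t i) / 2))"
    unfolding exp_of_real[symmetric] by simp
  finally have "expectation (\<lambda>\<xi>. exp (Re (\<Sum>i<n. c i * cplx (B (t (Suc i)) \<xi> - B (t i) \<xi>)))) = exp (\<Sum>i<n. (Re (c i))\<^sup>2 * (t (Suc i) - t i) / 2)"
    by (simp only: of_real_eq_iff)
  also have "\<dots> \<le> exp (\<Sum>i<n. (cmod (c i))\<^sup>2 * (t (Suc i) - t i) / 2)"
    unfolding exp_le_cancel_iff using t0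
    by (intro sum_mono divide_right_mono mult_right_mono) (auto simp: cmod_power2)
  finally show ?thesis using nn_integral_eq_integral[OF ir] by (simp add: ennreal_leI)
qed

end

text \<open>The sorted points of \<open>P\<close>, continued constantly after the last one so that
  \<open>\<tau>\<close> is monotone on all of \<open>nat\<close>.\<close>

lemma obtain_refinement:
  fixes P :: "real set"
  assumes fin: "finite P" and ne: "P \<noteq> {}"
  obtains m :: nat and \<tau> :: "nat \<Rightarrow> real" where "mono \<tau>" "range \<tau> = P" "P = \<tau> ` {..m}"
    "\<And>i j. i < j \<Longrightarrow> j \<le> m \<Longrightarrow> \<tau> i < \<tau> j" "\<And>p. p \<in> P \<Longrightarrow> \<exists>a\<le>m. p = \<tau> a"
proof -
  define s where "s = sorted_list_of_set P"
  have s: "sorted s" "distinct s" "set s = P" using fin by (auto simp: s_def)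
  have len: "0 < length s" using ne s by (cases s) auto
  define m where "m = length s - 1"
  define \<tau> where "\<tau> i = s ! min i m" for i
  have "m < length s" using len by (simp add: m_def)
  then have lt: "min i m < length s" for i by (simp add: min_less_iff_disj)
  have mono: "mono \<tau>"
    unfolding \<tau>_def by (intro monoI sorted_nth_mono[OF s(1)] lt) auto
  have strict: "\<tau> i < \<tau> j" if "i < j" "j \<le> m" for i j
  proof -
    have "\<tau> i \<le> \<tau> j" using mono that by (simp add: monoD)
    moreover have "\<tau> i \<noteq> \<tau> j"
      unfolding \<tau>_def using that by (subst nth_eq_iff_index_eq[OF s(2) lt lt]) auto
    ultimately show ?thesis by simp
  qed
  have ex: "\<exists>a\<le>m. p = \<tau> a" if "p \<in> P" for p
  proof -
    obtain a where a: "a < length s" "p = s ! a" using \<open>p \<in> P\<close> s(3) in_set_conv_nth[of p s] by metis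
    then have "a \<le> m" by (simp add: m_def)
    then show ?thesis using a by (auto simp: \<tau>_def min_def intro!: exI[of _ a])
  qed
  have in_P: "\<tau> i \<in> P" for i unfolding \<tau>_def using nth_mem[OF lt] s(3) by simp
  then have 1: "range \<tau> = P" using ex by blast
  have 2: "P = \<tau> ` {..m}" using ex in_P by blast
  show ?thesis by (rule that[OF mono 1 2 strict ex])
qed

lemma refine_indicator:
  fixes \<tau> :: "nat \<Rightarrow> real"
  assumes strict: "\<And>i j. i < j \<Longrightarrow> j \<le> m \<Longrightarrow> \<tau> i < \<tau> j" and ab: "a \<le> b" "b \<le> m" and j: "j < m"
    and u: "\<tau> j < u" "u \<le> \<tau> (Suc j)"
  shows "indicator {\<tau> a<..\<tau> b} u = (if a \<le> j \<and> j < b then 1 else 0 :: 'b :: zero_neq_one)"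
proof -
  have mono: "\<tau> x \<le> \<tau> y" if "x \<le> y" "y \<le> m" for x y
    using strict[of x y] that by (cases "x = y") auto
  show ?thesis
  proof (cases "a \<le> j \<and> j < b")
    case True
    then have "\<tau> a \<le> \<tau> j" "\<tau> (Suc j) \<le> \<tau> b" using mono ab j by auto
    then show ?thesis using True u by auto
  next
    case False
    then have "Suc j \<le> a \<or> b \<le> j" by auto
    then have "\<tau> (Suc j) \<le> \<tau> a \<or> \<tau> b \<le> \<tau> j" using mono ab j by auto
    then have "u \<notin> {\<tau> a<..\<tau> b}" using u by auto
    then show ?thesis using False by (auto simp: indicator_def)
  qed
qed

text \<open>Cells are open on the left, so the value on a refined cell can be read off at its right
  end point. The increments over a coarse cell telescope over its refined cells.\<close>

lemma step_refine:
  fixes t \<tau> :: "nat \<Rightarrow> real"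
  assumes strict: "\<And>i j. i < j \<Longrightarrow> j \<le> m \<Longrightarrow> \<tau> i < \<tau> j" and ex: "\<And>i. i \<le> n \<Longrightarrow> \<exists>a\<le>m. t i = \<tau> a" and t: "mono t"
  shows "step_integral B n c t \<xi> = (\<Sum>j<m. step_fun n c t (\<tau> (Suc j)) * cplx (B (\<tau> (Suc j)) \<xi> - B (\<tau> j) \<xi>))"
    "\<And>j u. j < m \<Longrightarrow> \<tau> j < u \<Longrightarrow> u \<le> \<tau> (Suc j) \<Longrightarrow> step_fun n c t u = step_fun n c t (\<tau> (Suc j))"
proof -
  obtain \<alpha> where \<alpha>: "\<And>i. i \<le> n \<Longrightarrow> \<alpha> i \<le> m" "\<And>i. i \<le> n \<Longrightarrow> t i = \<tau> (\<alpha> i)" using ex by metis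
  have \<alpha>m: "\<alpha> i \<le> \<alpha> (Suc i)" if "i < n" for i
  proof (rule ccontr)
    assume "\<not> \<alpha> i \<le> \<alpha> (Suc i)"
    then have "\<tau> (\<alpha> (Suc i)) < \<tau> (\<alpha> i)" using strict \<alpha>(1)[of i] that by simp
    then show False using \<alpha>(2)[of i] \<alpha>(2)[of "Suc i"] that monoD[OF t, of i "Suc i"] by simp
  qed
  have ind: "indicator {t i<..t (Suc i)} u = (if \<alpha> i \<le> j \<and> j < \<alpha> (Suc i) then 1 else 0 :: complex)"
    if "i < n" "j < m" "\<tau> j < u" "u \<le> \<tau> (Suc j)" for i j u
    using refine_indicator[OF strict \<alpha>m[OF that(1)] \<alpha>(1)[of "Suc i"] that(2-4)] \<alpha>(2)[of i] \<alpha>(2)[of "Suc i"] that(1) by simp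
  have st: "\<tau> j < \<tau> (Suc j)" if "j < m" for j using strict that by simp
  show "step_fun n c t u = step_fun n c t (\<tau> (Suc j))" if "j < m" "\<tau> j < u" "u \<le> \<tau> (Suc j)" for j u
    unfolding step_fun_def using that st by (intro sum.cong refl) (simp add: ind)
  have tel: "B (t (Suc i)) \<xi> - B (t i) \<xi> = (\<Sum>j<m. (if \<alpha> i \<le> j \<and> j < \<alpha> (Suc i) then 1 else 0) * (B (\<tau> (Suc j)) \<xi> - B (\<tau> j) \<xi>))" if i: "i < n" for i
  proof -
    have "(\<Sum>j<m. (if \<alpha> i \<le> j \<and> j < \<alpha> (Suc i) then 1 else 0) * (B (\<tau> (Suc j)) \<xi> - B (\<tau> j) \<xi>))
      = (\<Sum>j\<in>{\<alpha> i..<\<alpha> (Suc i)}. B (\<tau> (Suc j)) \<xi> - B (\<tau> j) \<xi>)"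
      using \<alpha>(1)[of "Suc i"] i by (intro sum.mono_neutral_cong_right) auto
    also have "\<dots> = B (\<tau> (\<alpha> (Suc i))) \<xi> - B (\<tau> (\<alpha> i)) \<xi>"
      using sum_Suc_diff'[OF \<alpha>m[OF i], of "\<lambda>j. B (\<tau> j) \<xi>"] by simp
    finally show ?thesis using \<alpha>(2)[of i] \<alpha>(2)[of "Suc i"] i by simp
  qed
  have "step_integral B n c t \<xi> = (\<Sum>i<n. \<Sum>j<m. c i * (if \<alpha> i \<le> j \<and> j < \<alpha> (Suc i) then 1 else 0) * cplx (B (\<tau> (Suc j)) \<xi> - B (\<tau> j) \<xi>))"
    unfolding step_integral_def
  proof (intro sum.cong refl)
    fix i assume "i \<in> {..<n}"
    then have i: "i < n" by simp
    show "c i * cplx (B (t (Suc i)) \<xi> - B (t i) \<xi>) = (\<Sum>j<m. c i * (if \<alpha> i \<le> j \<and> j < \<alpha> (Suc i) then 1 else 0) * cplx (B (\<tau> (Suc j)) \<xi> - B (\<tau> j) \<xi>))"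
      unfolding tel[OF i] of_real_sum sum_distrib_left by (intro sum.cong refl) simp
  qed
  also have "\<dots> = (\<Sum>j<m. \<Sum>i<n. c i * (if \<alpha> i \<le> j \<and> j < \<alpha> (Suc i) then 1 else 0) * cplx (B (\<tau> (Suc j)) \<xi> - B (\<tau> j) \<xi>))"
    by (rule sum.swap)
  also have "\<dots> = (\<Sum>j<m. step_fun n c t (\<tau> (Suc j)) * cplx (B (\<tau> (Suc j)) \<xi> - B (\<tau> j) \<xi>))"
    unfolding step_fun_def sum_distrib_right using st by (intro sum.cong refl) (simp add: ind)
  finally show "step_integral B n c t \<xi> = (\<Sum>j<m. step_fun n c t (\<tau> (Suc j)) * cplx (B (\<tau> (Suc j)) \<xi> - B (\<tau> j) \<xi>))" .
qed

lemma sum_eq_single: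
  fixes h :: "nat \<Rightarrow> 'b :: comm_monoid_add"
  assumes "i < n" "\<And>j. j < n \<Longrightarrow> j \<noteq> i \<Longrightarrow> h j = 0"
  shows "(\<Sum>j<n. h j) = h i"
proof -
  have "(\<Sum>j<n. h j) = (\<Sum>j<n. if j = i then h i else 0)"
    using assms(2) by (intro sum.cong) auto
  then show ?thesis using assms(1) by simp
qed

lemma step_fun_cases:
  assumes t: "mono t"
  obtains "\<And>i. i < n \<Longrightarrow> u \<notin> {t i<..t (Suc i)}" "step_fun n c t u = 0"
  | i where "i < n" "u \<in> {t i<..t (Suc i)}" "\<And>j. j < n \<Longrightarrow> u \<in> {t j<..t (Suc j)} \<Longrightarrow> j = i" "step_fun n c t u = c i"
proof (cases "\<exists>i<n. u \<in> {t i<..t (Suc i)}")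
  case False
  then show ?thesis by (intro that(1)) (auto simp: step_fun_def)
next
  case True
  then obtain i where i: "i < n" "u \<in> {t i<..t (Suc i)}" by blast
  have uniq: "j = i" if "j < n" "u \<in> {t j<..t (Suc j)}" for j
  proof (rule ccontr)
    assume "j \<noteq> i"
    then have "Suc j \<le> i \<or> Suc i \<le> j" by auto
    then have "t (Suc j) \<le> t i \<or> t (Suc i) \<le> t j" using t by (auto simp: mono_def)
    then show False using i that by auto
  qed
  have "step_fun n c t u = c i * indicator {t i<..t (Suc i)} u"
    unfolding step_fun_def
  proof (rule sum_eq_single[OF i(1)])
    fix j assume "j < n" "j \<noteq> i"
    then have "u \<notin> {t j<..t (Suc j)}" using uniq[of j] by blast
    then show "c j * indicator {t j<..t (Suc j)} u = 0" by (simp add: indicator_def)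
  qed
  then have "step_fun n c t u = c i" using i(2) by simp
  with i uniq show ?thesis by (intro that(2))
qed

lemma step_fun_measurable [measurable]: "step_fun n c t \<in> borel_measurable borel"
  unfolding step_fun_def[abs_def] by measurable

lemma nn_integral_step_square:
  assumes t: "mono t" "range t \<subseteq> {0..1}"
  shows "energy (\<lambda>u. step_fun n c t u) = ennreal (\<Sum>i<n. (cmod (c i))\<^sup>2 * (t (Suc i) - t i))"
proof -
  have t0: "t i \<le> t (Suc i)" for i using monoD[OF t(1), of i "Suc i"] by simp
  have e: "ennreal ((cmod (step_fun n c t u))\<^sup>2) * indicator {0..1} u = (\<Sum>i<n. ennreal ((cmod (c i))\<^sup>2) * indicator {t i<..t (Suc i)} u)" for u
  proof (rule step_fun_cases[OF t(1), of n u c])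
    assume z: "\<And>i. i < n \<Longrightarrow> u \<notin> {t i<..t (Suc i)}" "step_fun n c t u = 0"
    have "(\<Sum>i<n. ennreal ((cmod (c i))\<^sup>2) * indicator {t i<..t (Suc i)} u) = 0"
    proof (rule sum.neutral, rule ballI)
      fix i assume "i \<in> {..<n}"
      then have "u \<notin> {t i<..t (Suc i)}" using z(1) by blast
      then show "ennreal ((cmod (c i))\<^sup>2) * indicator {t i<..t (Suc i)} u = 0" by (simp add: indicator_def)
    qed
    then show ?thesis using z(2) by simp
  next
    fix i assume i: "i < n" "u \<in> {t i<..t (Suc i)}" "\<And>j. j < n \<Longrightarrow> u \<in> {t j<..t (Suc j)} \<Longrightarrow> j = i" "step_fun n c t u = c i"
    have "t i \<in> {0..1}" "t (Suc i) \<in> {0..1}" using t(2) by blast+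
    then have "u \<in> {0..1}" using i(2) by auto
    moreover have "(\<Sum>i<n. ennreal ((cmod (c i))\<^sup>2) * indicator {t i<..t (Suc i)} u) = ennreal ((cmod (c i))\<^sup>2) * indicator {t i<..t (Suc i)} u"
    proof (rule sum_eq_single[OF i(1)])
      fix j assume "j < n" "j \<noteq> i"
      then have "u \<notin> {t j<..t (Suc j)}" using i(3)[of j] by blast
      then show "ennreal ((cmod (c j))\<^sup>2) * indicator {t j<..t (Suc j)} u = 0" by (simp add: indicator_def)
    qed
    ultimately show ?thesis using i(2,4) by (simp only: indicator_simps mult_1_right scaleR_one)
  qed
  have "energy (\<lambda>u. step_fun n c t u) = (\<Sum>i<n. \<integral>\<^sup>+u. ennreal ((cmod (c i))\<^sup>2) * indicator {t i<..t (Suc i)} u \<partial>lborel)"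
    unfolding e by (rule nn_integral_sum) auto
  also have "\<dots> = (\<Sum>i<n. ennreal ((cmod (c i))\<^sup>2 * (t (Suc i) - t i)))"
    using t0 by (intro sum.cong refl) (simp add: nn_integral_cmult_indicator ennreal_mult)
  also have "\<dots> = ennreal (\<Sum>i<n. (cmod (c i))\<^sup>2 * (t (Suc i) - t i))"
    using t0 by (intro sum_ennreal) auto
  finally show ?thesis .
qed

lemma integral_step_square:
  assumes t: "mono t" "range t \<subseteq> {0..1}"
  shows "set_integrable lborel {0..1} (\<lambda>u. (step_fun n c t u)\<^sup>2)"
    "(LINT u:{0..1}|lborel. (step_fun n c t u)\<^sup>2) = (\<Sum>i<n. (c i)\<^sup>2 * cplx (t (Suc i) - t i))"
proof -
  have t0: "t i \<le> t (Suc i)" for i using monoD[OF t(1), of i "Suc i"] by simp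
  have e: "indicator {0..1} u *\<^sub>R (step_fun n c t u)\<^sup>2 = (\<Sum>i<n. indicator {t i<..t (Suc i)} u *\<^sub>R (c i)\<^sup>2)" for u
  proof (rule step_fun_cases[OF t(1), of n u c])
    assume z: "\<And>i. i < n \<Longrightarrow> u \<notin> {t i<..t (Suc i)}" "step_fun n c t u = 0"
    have "(\<Sum>i<n. indicator {t i<..t (Suc i)} u *\<^sub>R (c i)\<^sup>2) = 0"
    proof (rule sum.neutral, rule ballI)
      fix i assume "i \<in> {..<n}"
      then have "u \<notin> {t i<..t (Suc i)}" using z(1) by blast
      then show "indicator {t i<..t (Suc i)} u *\<^sub>R (c i)\<^sup>2 = 0" by (simp add: indicator_def)
    qed
    then show ?thesis using z(2) by simp
  next
    fix i assume i: "i < n" "u \<in> {t i<..t (Suc i)}" "\<And>j. j < n \<Longrightarrow> u \<in> {t j<..t (Suc j)} \<Longrightarrow> j = i" "step_fun n c t u = c i"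
    have "t i \<in> {0..1}" "t (Suc i) \<in> {0..1}" using t(2) by blast+
    then have "u \<in> {0..1}" using i(2) by auto
    moreover have "(\<Sum>i<n. indicator {t i<..t (Suc i)} u *\<^sub>R (c i)\<^sup>2) = indicator {t i<..t (Suc i)} u *\<^sub>R (c i)\<^sup>2"
    proof (rule sum_eq_single[OF i(1)])
      fix j assume "j < n" "j \<noteq> i"
      then have "u \<notin> {t j<..t (Suc j)}" using i(3)[of j] by blast
      then show "indicator {t j<..t (Suc j)} u *\<^sub>R (c j)\<^sup>2 = 0" by (simp add: indicator_def)
    qed
    ultimately show ?thesis using i(2,4) by (simp only: indicator_simps mult_1_right scaleR_one)
  qed
  have int: "integrable lborel (\<lambda>u. indicator {t i<..t (Suc i)} u *\<^sub>R (c i)\<^sup>2)" for i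
    using t0 by (intro integrable_scaleR_left integrable_real_indicator) auto
  show "set_integrable lborel {0..1} (\<lambda>u. (step_fun n c t u)\<^sup>2)"
    unfolding set_integrable_def e by (intro Bochner_Integration.integrable_sum int)
  have "(LINT u:{0..1}|lborel. (step_fun n c t u)\<^sup>2) = (\<Sum>i<n. LINT u|lborel. indicator {t i<..t (Suc i)} u *\<^sub>R (c i)\<^sup>2)"
    unfolding set_lebesgue_integral_def e by (intro Bochner_Integration.integral_sum int)
  also have "\<dots> = (\<Sum>i<n. (c i)\<^sup>2 * cplx (t (Suc i) - t i))"
    using t0 by (intro sum.cong refl) (simp add: scaleR_conv_of_real mult.commute)
  finally show "(LINT u:{0..1}|lborel. (step_fun n c t u)\<^sup>2) = (\<Sum>i<n. (c i)\<^sup>2 * cplx (t (Suc i) - t i))" .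
qed

context gaussian_increments
begin

text \<open>On a common refinement the difference is again a combination of independent Gaussian
  increments, and its energy is bounded by that of the difference of the step functions.\<close>

lemma step_diff_exp:
  assumes t1: "mono t1" "range t1 \<subseteq> {0..1}" and t2: "mono t2" "range t2 \<subseteq> {0..1}"
    and D: "energy (\<lambda>u. step_fun n1 c1 t1 u - step_fun n2 c2 t2 u) \<le> ennreal D" "0 \<le> D"
  shows "exp_moment M (\<lambda>\<xi>. Re (s * (step_integral B n1 c1 t1 \<xi> - step_integral B n2 c2 t2 \<xi>))) \<le> ennreal (exp ((cmod s)\<^sup>2 * D / 2))"
proof -
  define P where "P = t1 ` {..n1} \<union> t2 ` {..n2}"
  have fP: "finite P" "P \<noteq> {}" by (auto simp: P_def)
  obtain m :: nat and \<tau> :: "nat \<Rightarrow> real" where \<tau>: "mono \<tau>" "range \<tau> = P" "P = \<tau> ` {..m}" "\<And>i j. i < j \<Longrightarrow> j \<le> m \<Longrightarrow> \<tau> i < \<tau> j" "\<And>p. p \<in> P \<Longrightarrow> \<exists>a\<le>m. p = \<tau> a"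
    by (rule obtain_refinement[OF fP]) blast
  have P01: "P \<subseteq> {0..1}" using t1(2) t2(2) by (auto simp: P_def)
  have ex1: "\<exists>a\<le>m. t1 i = \<tau> a" if "i \<le> n1" for i using \<tau>(5)[of "t1 i"] that by (auto simp: P_def)
  have ex2: "\<exists>a\<le>m. t2 i = \<tau> a" if "i \<le> n2" for i using \<tau>(5)[of "t2 i"] that by (auto simp: P_def)
  define d where "d j = step_fun n1 c1 t1 (\<tau> (Suc j)) - step_fun n2 c2 t2 (\<tau> (Suc j))" for j
  have S: "s * (step_integral B n1 c1 t1 \<xi> - step_integral B n2 c2 t2 \<xi>) = (\<Sum>j<m. (s * d j) * cplx (B (\<tau> (Suc j)) \<xi> - B (\<tau> j) \<xi>))" for \<xi>
  proof -
    have e1: "step_integral B n1 c1 t1 \<xi> = (\<Sum>j<m. step_fun n1 c1 t1 (\<tau> (Suc j)) * cplx (B (\<tau> (Suc j)) \<xi> - B (\<tau> j) \<xi>))"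
      by (rule step_refine(1)[where m = m]) (use \<tau>(4) ex1 t1(1) in auto)
    have e2: "step_integral B n2 c2 t2 \<xi> = (\<Sum>j<m. step_fun n2 c2 t2 (\<tau> (Suc j)) * cplx (B (\<tau> (Suc j)) \<xi> - B (\<tau> j) \<xi>))"
      by (rule step_refine(1)[where m = m]) (use \<tau>(4) ex2 t2(1) in auto)
    show ?thesis unfolding e1 e2 d_def sum_subtractf[symmetric] sum_distrib_left
      by (intro sum.cong refl) (simp add: algebra_simps)
  qed
  have \<tau>r: "range \<tau> \<subseteq> {0..1}" using \<tau>(2) P01 by simp
  have \<tau>0: "0 \<le> \<tau> 0" using \<tau>r by (auto simp: subset_iff)
  have "ennreal (\<Sum>j<m. (cmod (d j))\<^sup>2 * (\<tau> (Suc j) - \<tau> j)) = energy (\<lambda>u. step_fun m d \<tau> u)"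
    by (rule nn_integral_step_square[OF \<tau>(1) \<tau>r, symmetric])
  also have "\<dots> \<le> energy (\<lambda>u. step_fun n1 c1 t1 u - step_fun n2 c2 t2 u)"
  proof (intro nn_integral_mono mult_right_mono)
    fix u :: real
    show "ennreal ((cmod (step_fun m d \<tau> u))\<^sup>2) \<le> ennreal ((cmod (step_fun n1 c1 t1 u - step_fun n2 c2 t2 u))\<^sup>2)"
    proof (rule step_fun_cases[OF \<tau>(1), of m u d])
      fix j assume j: "j < m" "u \<in> {\<tau> j<..\<tau> (Suc j)}" "step_fun m d \<tau> u = d j"
      have "step_fun n1 c1 t1 u = step_fun n1 c1 t1 (\<tau> (Suc j))" by (rule step_refine(2)[where m = m]) (use \<tau>(4) ex1 t1(1) j in auto)
      moreover have "step_fun n2 c2 t2 u = step_fun n2 c2 t2 (\<tau> (Suc j))" by (rule step_refine(2)[where m = m]) (use \<tau>(4) ex2 t2(1) j in auto)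
      ultimately show ?thesis using j(3) by (simp add: d_def)
    qed simp
  qed simp
  also have "\<dots> \<le> ennreal D" by (rule D)
  finally have dD: "(\<Sum>j<m. (cmod (d j))\<^sup>2 * (\<tau> (Suc j) - \<tau> j)) \<le> D" using D(2) by simp
  have "exp_moment M (\<lambda>\<xi>. Re (s * (step_integral B n1 c1 t1 \<xi> - step_integral B n2 c2 t2 \<xi>)))
    \<le> ennreal (exp (\<Sum>j<m. (cmod (s * d j))\<^sup>2 * (\<tau> (Suc j) - \<tau> j) / 2))"
    unfolding S by (rule increments_exp[OF \<tau>0 \<tau>(1)])
  also have "(\<Sum>j<m. (cmod (s * d j))\<^sup>2 * (\<tau> (Suc j) - \<tau> j) / 2) = (cmod s)\<^sup>2 * (\<Sum>j<m. (cmod (d j))\<^sup>2 * (\<tau> (Suc j) - \<tau> j)) / 2"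
    by (simp add: norm_mult power_mult_distrib sum_distrib_left sum_divide_distrib mult.assoc)
  also have "ennreal (exp \<dots>) \<le> ennreal (exp ((cmod s)\<^sup>2 * D / 2))"
    using dD by (intro ennreal_leI) (simp add: mult_left_mono)
  finally show ?thesis .
qed

lemma step_integral_cexp:
  assumes t: "mono t" "range t \<subseteq> {0..1}"
  shows "integrable M (\<lambda>\<xi>. exp (s * step_integral B n c t \<xi>))"
    "expectation (\<lambda>\<xi>. exp (s * step_integral B n c t \<xi>)) = exp (s\<^sup>2 / 2 * (LINT u:{0..1}|lborel. (step_fun n c t u)\<^sup>2))"
proof -
  have t0: "0 \<le> t 0" using t(2) by (auto simp: subset_iff)
  have S: "s * step_integral B n c t \<xi> = (\<Sum>i<n. (s * c i) * cplx (B (t (Suc i)) \<xi> - B (t i) \<xi>))" for \<xi>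
    by (simp add: step_integral_def sum_distrib_left mult.assoc)
  show "integrable M (\<lambda>\<xi>. exp (s * step_integral B n c t \<xi>))"
    unfolding S by (rule increments_cexp(1)[OF t0 t(1)])
  show "expectation (\<lambda>\<xi>. exp (s * step_integral B n c t \<xi>)) = exp (s\<^sup>2 / 2 * (LINT u:{0..1}|lborel. (step_fun n c t u)\<^sup>2))"
    unfolding S increments_cexp(2)[OF t0 t(1)] integral_step_square(2)[OF t]
    by (simp add: power_mult_distrib sum_distrib_left mult.assoc)
qed

end

section \<open>Passage from step functions to square-integrable integrands\<close>

lemma L2_limit_AE_subseq:
  fixes I :: "'a \<Rightarrow> complex" and J :: "nat \<Rightarrow> 'a \<Rightarrow> complex"
  assumes [measurable]: "I \<in> borel_measurable M" "\<And>k. J k \<in> borel_measurable M"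
    and lim: "(\<lambda>k. \<integral>\<^sup>+\<xi>. ennreal ((cmod (I \<xi> - J k \<xi>))\<^sup>2) \<partial>M) \<longlonglongrightarrow> 0"
  obtains r :: "nat \<Rightarrow> nat" where "strict_mono r" "AE \<xi> in M. (\<lambda>k. J (r k) \<xi>) \<longlonglongrightarrow> I \<xi>"
proof -
  have "\<forall>\<^sub>F k in sequentially. mean_square M (\<lambda>\<xi>. I \<xi> - J k \<xi>) < 1"
    using order_tendstoD(2)[OF lim, of 1] by simp
  \<comment> \<open>For small indices the mean square may be infinite; shifting by \<open>K\<close>
    makes all squares integrable.\<close>
  then obtain K where K: "\<And>k. K \<le> k \<Longrightarrow> mean_square M (\<lambda>\<xi>. I \<xi> - J k \<xi>) < 1"
    by (auto simp: eventually_sequentially)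
  define u where "u k \<xi> = (cmod (I \<xi> - J (k + K) \<xi>))\<^sup>2" for k \<xi>
  have u0: "0 \<le> (\<integral>\<xi>. u k \<xi> \<partial>M)" for k by (rule integral_nonneg_AE) (simp add: u_def)
  have int: "integrable M (u k)" for k
    unfolding u_def using order_less_trans[OF K[of "k + K"], of \<infinity>]
    by (intro integrableI_nonneg) auto
  have "(\<lambda>k. ennreal (\<integral>\<xi>. u k \<xi> \<partial>M)) \<longlonglongrightarrow> ennreal 0"
  proof -
    have "ennreal (\<integral>\<xi>. u k \<xi> \<partial>M) = mean_square M (\<lambda>\<xi>. I \<xi> - J (k + K) \<xi>)" for k
      using nn_integral_eq_integral[OF int[of k]] by (simp add: u_def[abs_def])
    then show ?thesis using LIMSEQ_ignore_initial_segment[OF lim, of K] by simp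
  qed
  then have "(\<lambda>k. \<integral>\<xi>. u k \<xi> \<partial>M) \<longlonglongrightarrow> 0"
    by (subst (asm) tendsto_ennreal_iff) (simp_all add: u0)
  moreover have "norm (u k \<xi>) = u k \<xi>" for k \<xi> by (simp add: u_def)
  ultimately have "(\<lambda>k. \<integral>\<xi>. norm (u k \<xi>) \<partial>M) \<longlonglongrightarrow> 0" by (simp only:)
  from tendsto_L1_AE_subseq[OF int this] obtain r where r: "strict_mono r" "AE \<xi> in M. (\<lambda>k. u (r k) \<xi>) \<longlonglongrightarrow> 0" by blast
  show ?thesis
  proof (rule that[of "\<lambda>k. r k + K"])
    show "strict_mono (\<lambda>k. r k + K)" using r(1) by (simp add: strict_mono_def)
    show "AE \<xi> in M. (\<lambda>k. J (r k + K) \<xi>) \<longlonglongrightarrow> I \<xi>"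
      using r(2)
    proof eventually_elim
      case (elim \<xi>)
      have "(\<lambda>k. sqrt (u (r k) \<xi>)) \<longlonglongrightarrow> sqrt 0" by (intro tendsto_real_sqrt elim)
      then have "(\<lambda>k. cmod (I \<xi> - J (r k + K) \<xi>)) \<longlonglongrightarrow> 0" by (simp add: u_def)
      then have "(\<lambda>k. I \<xi> - J (r k + K) \<xi>) \<longlonglongrightarrow> 0" by (rule tendsto_norm_zero_cancel)
      from tendsto_diff[OF tendsto_const[of "I \<xi>"] this] show ?case by simp
    qed
  qed
qed

lemma norm_add_square_le: "(cmod (a + b))\<^sup>2 \<le> 2 * (cmod a)\<^sup>2 + 2 * (cmod b)\<^sup>2"
proof -
  have "(cmod (a + b))\<^sup>2 \<le> (cmod a + cmod b)\<^sup>2" by (intro power_mono norm_triangle_ineq) simp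
  also have "\<dots> \<le> 2 * (cmod a)\<^sup>2 + 2 * (cmod b)\<^sup>2" 
    using sum_squares_bound[of "cmod a" "cmod b"] by (simp add: power2_sum)
  finally show ?thesis .
qed

context gaussian_increments
begin

text \<open>Fatou along an almost surely convergent subsequence of step integrals. The triangle
  inequality for squares doubles the energy, which eats the \<open>1 / 2\<close> of the Gaussian
  exponent; the slack \<open>D - D0\<close> pays for the approximation.\<close>

lemma wiener_exp_bound:
  assumes W: "has_wiener_integral M B f I"
    and t0: "mono t0" "range t0 \<subseteq> {0..1}"
    and D: "energy (\<lambda>u. f u - step_fun n0 c0 t0 u) \<le> ennreal D0" "0 \<le> D0" "D0 < D"
  shows "exp_moment M (\<lambda>\<xi>. Re (s * (I \<xi> - step_integral B n0 c0 t0 \<xi>))) \<le> ennreal (exp ((cmod s)\<^sup>2 * D))"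
proof -
  obtain n c t where t: "\<And>k. mono (t k)" "\<And>k. range (t k) \<subseteq> {0..1}"
    and f: "(\<lambda>k. \<integral>\<^sup>+u\<in>{0..1}. ennreal ((cmod (f u - step_fun (n k) (c k) (t k) u))\<^sup>2) \<partial>lborel) \<longlonglongrightarrow> 0"
    and L: "(\<lambda>k. \<integral>\<^sup>+\<xi>. ennreal ((cmod (I \<xi> - step_integral B (n k) (c k) (t k) \<xi>))\<^sup>2) \<partial>M) \<longlonglongrightarrow> 0"
    and fm: "set_borel_measurable lborel {0..1} f" and [measurable]: "I \<in> borel_measurable M"
    using W unfolding has_wiener_integral_def by blast
  have t0': "0 \<le> t0 i" "0 \<le> t k i" for i k using t0(2) t(2)[of k] by (auto simp: subset_iff)
  have [measurable]: "step_integral B n0 c0 t0 \<in> borel_measurable M" "step_integral B (n k) (c k) (t k) \<in> borel_measurable M" for k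
    by (intro step_integral_measurable t0')+
  obtain r where r: "strict_mono r" "AE \<xi> in M. (\<lambda>k. step_integral B (n (r k)) (c (r k)) (t (r k)) \<xi>) \<longlonglongrightarrow> I \<xi>"
    by (rule L2_limit_AE_subseq[OF _ _ L]) measurable
  define S where "S k = step_integral B (n (r k)) (c (r k)) (t (r k))" for k
  have [measurable]: "S k \<in> borel_measurable M" for k unfolding S_def by measurable
  have rS: "AE \<xi> in M. (\<lambda>k. S k \<xi>) \<longlonglongrightarrow> I \<xi>" using r(2) by (simp add: S_def)
  let ?Sz = "step_integral B n0 c0 t0"
  have "exp_moment M (\<lambda>\<xi>. Re (s * (I \<xi> - ?Sz \<xi>))) = (\<integral>\<^sup>+\<xi>. liminf (\<lambda>k. ennreal (exp (Re (s * (S k \<xi> - ?Sz \<xi>))))) \<partial>M)"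
  proof (rule nn_integral_cong_AE, use rS in eventually_elim)
    case (elim \<xi>)
    have "(\<lambda>k. ennreal (exp (Re (s * (S k \<xi> - ?Sz \<xi>))))) \<longlonglongrightarrow> ennreal (exp (Re (s * (I \<xi> - ?Sz \<xi>))))"
      by (intro tendsto_ennrealI tendsto_intros elim)
    from lim_imp_Liminf[OF sequentially_bot this, symmetric] show ?case .
  qed
  also have "\<dots> \<le> liminf (\<lambda>k. \<integral>\<^sup>+\<xi>. ennreal (exp (Re (s * (S k \<xi> - ?Sz \<xi>)))) \<partial>M)"
    by (rule nn_integral_liminf) measurable
  also have "\<dots> \<le> ennreal (exp ((cmod s)\<^sup>2 * D))"
  proof -
    have "\<forall>\<^sub>F k in sequentially. energy (\<lambda>u. f u - step_fun (n (r k)) (c (r k)) (t (r k)) u) < ennreal (D - D0)"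
      using order_tendstoD(2)[OF LIMSEQ_subseq_LIMSEQ[OF f r(1), unfolded o_def], of "ennreal (D - D0)"] D by simp
    then have "\<forall>\<^sub>F k in sequentially. exp_moment M (\<lambda>\<xi>. Re (s * (S k \<xi> - ?Sz \<xi>))) \<le> ennreal (exp ((cmod s)\<^sup>2 * D))"
    proof eventually_elim
      case (elim k)
      let ?h = "step_fun (n (r k)) (c (r k)) (t (r k))" and ?hz = "step_fun n0 c0 t0"
      have fm': "(\<lambda>u. f u * indicator {0..1} u) \<in> borel_measurable borel"
        using fm by (simp add: set_borel_measurable_def scaleR_conv_of_real mult.commute of_real_indicator)
      have m1: "(\<lambda>u. ennreal ((cmod (f u - g u))\<^sup>2) * indicator {0..1} u) \<in> borel_measurable lborel" if "g \<in> borel_measurable borel" for g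
      proof -
        have "(\<lambda>u. ennreal ((cmod (f u - g u))\<^sup>2) * indicator {0..1} u) = (\<lambda>u. ennreal ((cmod (f u * indicator {0..1} u - g u * indicator {0..1} u))\<^sup>2))"
          by (auto simp: indicator_def)
        then show ?thesis using fm' that by simp
      qed
      have "energy (\<lambda>u. ?h u - ?hz u) \<le>
        (\<integral>\<^sup>+u. 2 * (ennreal ((cmod (f u - ?h u))\<^sup>2) * indicator {0..1} u) + 2 * (ennreal ((cmod (f u - ?hz u))\<^sup>2) * indicator {0..1} u) \<partial>lborel)"
      proof (rule nn_integral_mono)
        fix u :: real
        have "(cmod (?h u - ?hz u))\<^sup>2 \<le> 2 * (cmod (f u - ?h u))\<^sup>2 + 2 * (cmod (f u - ?hz u))\<^sup>2"
          using norm_add_square_le[of "?h u - f u" "f u - ?hz u"] by (simp add: norm_minus_commute)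
        then have "ennreal ((cmod (?h u - ?hz u))\<^sup>2) \<le> 2 * ennreal ((cmod (f u - ?h u))\<^sup>2) + 2 * ennreal ((cmod (f u - ?hz u))\<^sup>2)"
          using ennreal_leI[of "(cmod (?h u - ?hz u))\<^sup>2" "2 * (cmod (f u - ?h u))\<^sup>2 + 2 * (cmod (f u - ?hz u))\<^sup>2"]
          by (simp add: ennreal_mult)
        then show "ennreal ((cmod (?h u - ?hz u))\<^sup>2) * indicator {0..1} u \<le> 2 * (ennreal ((cmod (f u - ?h u))\<^sup>2) * indicator {0..1} u) + 2 * (ennreal ((cmod (f u - ?hz u))\<^sup>2) * indicator {0..1} u)"
          by (auto simp: indicator_def)
      qed
      also have "\<dots> = 2 * energy (\<lambda>u. f u - ?h u) + 2 * energy (\<lambda>u. f u - ?hz u)"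
        using m1 by (subst nn_integral_add) (auto simp: nn_integral_cmult)
      also have "\<dots> \<le> 2 * ennreal (D - D0) + 2 * ennreal D0"
        using elim D by (intro add_mono mult_left_mono) auto
      also have "\<dots> = ennreal (2 * D)"
        using D by (simp add: ennreal_mult'[symmetric] ennreal_plus[symmetric] flip: ennreal_numeral del: ennreal_plus)
      finally have "energy (\<lambda>u. ?h u - ?hz u) \<le> ennreal (2 * D)" .
      from step_diff_exp[OF t t0 this, of s] D show ?case by (simp add: S_def)
    qed
    from Liminf_mono[OF this] show ?thesis by (simp add: Liminf_const)
  qed
  finally show ?thesis .
qed

end

text \<open>On the convex half-plane to the left of the rightmost point the derivative of
  \<open>exp\<close> is bounded by the larger of the two exponentials.\<close>

lemma norm_exp_diff_le:
  fixes a b :: complex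
  shows "cmod (exp a - exp b) \<le> cmod (a - b) * (exp (Re a) + exp (Re b))"
proof -
  define m where "m = max (Re a) (Re b)"
  have conv: "convex {w :: complex. Re w \<le> m}" by (rule convex_halfspace_Re_le)
  have "cmod (exp a - exp b) \<le> exp m * cmod (a - b)"
  proof (rule field_differentiable_bound[OF conv])
    fix w assume "w \<in> {w. Re w \<le> m}"
    then show "cmod (exp w) \<le> exp m" by simp
    show "(exp has_field_derivative exp w) (at w within {w. Re w \<le> m})"
      by (rule has_field_derivative_at_within[OF DERIV_exp])
  qed (auto simp: m_def)
  also have "\<dots> = cmod (a - b) * exp m" by simp
  also have "\<dots> \<le> cmod (a - b) * (exp (Re a) + exp (Re b))"
    by (intro mult_left_mono) (auto simp: m_def max_def add_increasing add_increasing2)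
  finally show ?thesis .
qed

lemma set_square_integrable:
  fixes f :: "real \<Rightarrow> complex"
  assumes f: "set_borel_measurable lborel {0..1} f" and C: "energy f \<le> ennreal C"
  shows "set_integrable lborel {0..1} (\<lambda>u. (f u)\<^sup>2)"
  unfolding set_integrable_def
proof (rule integrableI_bounded)
  have eq: "(\<lambda>u. indicator {0..1} u *\<^sub>R (f u)\<^sup>2) = (\<lambda>u. (indicator {0..1} u *\<^sub>R f u)\<^sup>2)"
    by (auto simp: indicator_def)
  show "(\<lambda>u. indicator {0..1} u *\<^sub>R (f u)\<^sup>2) \<in> borel_measurable lborel"
    unfolding eq using f unfolding set_borel_measurable_def by (rule borel_measurable_power)
  have "(\<integral>\<^sup>+u. ennreal (norm (indicator {0..1} u *\<^sub>R (f u)\<^sup>2)) \<partial>lborel) = energy f"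
    by (intro nn_integral_cong) (auto simp: indicator_def norm_power)
  also have "\<dots> < \<infinity>" using C by (simp add: le_less_trans)
  finally show "(\<integral>\<^sup>+u. ennreal (norm (indicator {0..1} u *\<^sub>R (f u)\<^sup>2)) \<partial>lborel) < \<infinity>" .
qed

lemma tendsto_of_small_bounds:
  fixes x :: "nat \<Rightarrow> complex" and C :: real
  assumes "\<And>\<epsilon>. 0 < \<epsilon> \<Longrightarrow> \<forall>\<^sub>F k in sequentially. ennreal (cmod (x k - l)) \<le> ennreal (\<epsilon> * C)" and C: "0 < C"
  shows "x \<longlonglongrightarrow> l"
proof (rule tendstoI)
  fix e :: real assume e: "0 < e"
  then have "0 < e / (2 * C)" using C by simp
  from assms(1)[OF this] show "\<forall>\<^sub>F k in sequentially. dist (x k) l < e"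
  proof eventually_elim
    case (elim k)
    then have "cmod (x k - l) \<le> e / 2" using C e by simp
    then show ?case using e by (simp add: dist_norm)
  qed
qed

text \<open>Young's inequality in the form \<open>|h^2 - f^2| \<le> (1 + 1 / \<epsilon>) * |f - h|^2
  + \<epsilon> * |f|^2\<close>. The threshold \<open>\<epsilon> / (1 + 1 / \<epsilon>)\<close> for
  the energy of \<open>f - h\<close> is chosen so that the first term integrates to at most
  \<open>\<epsilon>\<close>.\<close>

lemma set_integral_square_tendsto:
  fixes f :: "real \<Rightarrow> complex" and h :: "nat \<Rightarrow> real \<Rightarrow> complex"
  assumes f: "set_borel_measurable lborel {0..1} f" and C: "energy f \<le> ennreal C" "0 \<le> C"
    and h: "\<And>k. h k \<in> borel_measurable borel" "\<And>k. set_integrable lborel {0..1} (\<lambda>u. (h k u)\<^sup>2)"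
    and lim: "(\<lambda>k. \<integral>\<^sup>+u\<in>{0..1}. ennreal ((cmod (f u - h k u))\<^sup>2) \<partial>lborel) \<longlonglongrightarrow> 0"
  shows "(\<lambda>k. LINT u:{0..1}|lborel. (h k u)\<^sup>2) \<longlonglongrightarrow> (LINT u:{0..1}|lborel. (f u)\<^sup>2)"
proof (rule tendsto_of_small_bounds[where C = "1 + C"])
  note fi = set_square_integrable[OF f C(1)]
  fix \<epsilon> :: real assume \<epsilon>: "0 < \<epsilon>"
  have "0 < \<epsilon> / (1 + 1 / \<epsilon>)" using \<epsilon> by (simp add: add_pos_pos)
  then have "\<forall>\<^sub>F k in sequentially. energy (\<lambda>u. f u - h k u) < ennreal (\<epsilon> / (1 + 1 / \<epsilon>))"
    using order_tendstoD(2)[OF lim] by simp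
  then show "\<forall>\<^sub>F k in sequentially. ennreal (cmod ((LINT u:{0..1}|lborel. (h k u)\<^sup>2) - (LINT u:{0..1}|lborel. (f u)\<^sup>2))) \<le> ennreal (\<epsilon> * (1 + C))"
  proof eventually_elim
    case (elim k)
    have fm: "(\<lambda>u. f u * indicator {0..1} u) \<in> borel_measurable borel"
      using f by (simp add: set_borel_measurable_def scaleR_conv_of_real mult.commute of_real_indicator)
    have m1: "(\<lambda>u. ennreal ((cmod (f u - h k u))\<^sup>2) * indicator {0..1} u) \<in> borel_measurable lborel"
    proof -
      have "(\<lambda>u. ennreal ((cmod (f u - h k u))\<^sup>2) * indicator {0..1} u) = (\<lambda>u. ennreal ((cmod (f u * indicator {0..1} u - h k u * indicator {0..1} u))\<^sup>2))"
        by (auto simp: indicator_def)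
      then show ?thesis using fm h(1)[of k] by simp
    qed
    have m2: "(\<lambda>u. ennreal ((cmod (f u))\<^sup>2) * indicator {0..1} u) \<in> borel_measurable lborel"
    proof -
      have "(\<lambda>u. ennreal ((cmod (f u))\<^sup>2) * indicator {0..1} u) = (\<lambda>u. ennreal ((cmod (f u * indicator {0..1} u))\<^sup>2))"
        by (auto simp: indicator_def)
      then show ?thesis using fm by simp
    qed
    let ?d = "\<lambda>u. indicator {0..1} u *\<^sub>R (h k u)\<^sup>2 - indicator {0..1} u *\<^sub>R (f u)\<^sup>2"
    have di: "integrable lborel ?d"
      using h(2)[of k] fi unfolding set_integrable_def by (rule Bochner_Integration.integrable_diff)
    have "(LINT u:{0..1}|lborel. (h k u)\<^sup>2) - (LINT u:{0..1}|lborel. (f u)\<^sup>2) = (LINT u|lborel. ?d u)"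
      using h(2)[of k] fi unfolding set_integrable_def set_lebesgue_integral_def
      by (rule Bochner_Integration.integral_diff[symmetric])
    then have "ennreal (cmod ((LINT u:{0..1}|lborel. (h k u)\<^sup>2) - (LINT u:{0..1}|lborel. (f u)\<^sup>2))) \<le> (\<integral>\<^sup>+u. ennreal (norm (?d u)) \<partial>lborel)"
      using integral_norm_bound_ennreal[OF di] by simp
    also have "\<dots> \<le> (\<integral>\<^sup>+u. ennreal (1 + 1 / \<epsilon>) * (ennreal ((cmod (f u - h k u))\<^sup>2) * indicator {0..1} u) + ennreal \<epsilon> * (ennreal ((cmod (f u))\<^sup>2) * indicator {0..1} u) \<partial>lborel)"
    proof (rule nn_integral_mono)
      fix u :: real
      let ?x = "cmod (f u - h k u)" and ?y = "cmod (f u)"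
      have "(h k u)\<^sup>2 - (f u)\<^sup>2 = (f u - h k u)\<^sup>2 - 2 * f u * (f u - h k u)"
        by (simp add: power2_eq_square algebra_simps)
      then have "cmod ((h k u)\<^sup>2 - (f u)\<^sup>2) \<le> ?x\<^sup>2 + 2 * ?y * ?x"
        using norm_triangle_ineq4[of "(f u - h k u)\<^sup>2" "2 * f u * (f u - h k u)"] by (simp add: norm_power norm_mult)
      also have "2 * ?y * ?x \<le> ?x\<^sup>2 / \<epsilon> + \<epsilon> * ?y\<^sup>2"
      proof -
        have "0 \<le> (?x - \<epsilon> * ?y)\<^sup>2 / \<epsilon>" using \<epsilon> by simp
        also have "\<dots> = ?x\<^sup>2 / \<epsilon> + \<epsilon> * ?y\<^sup>2 - 2 * ?y * ?x" using \<epsilon> by (simp add: power2_eq_square field_simps)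
        finally show ?thesis by simp
      qed
      finally have "cmod ((h k u)\<^sup>2 - (f u)\<^sup>2) \<le> (1 + 1 / \<epsilon>) * ?x\<^sup>2 + \<epsilon> * ?y\<^sup>2" by (simp add: distrib_right)
      moreover have "0 \<le> 1 + 1 / \<epsilon>" using \<epsilon> by simp
      then have "ennreal ((1 + 1 / \<epsilon>) * ?x\<^sup>2 + \<epsilon> * ?y\<^sup>2) = ennreal (1 + 1 / \<epsilon>) * ennreal (?x\<^sup>2) + ennreal \<epsilon> * ennreal (?y\<^sup>2)"
        using \<epsilon> by (simp add: ennreal_mult)
      ultimately have "ennreal (cmod ((h k u)\<^sup>2 - (f u)\<^sup>2)) \<le> ennreal (1 + 1 / \<epsilon>) * ennreal (?x\<^sup>2) + ennreal \<epsilon> * ennreal (?y\<^sup>2)"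
        by (metis ennreal_leI)
      then show "ennreal (norm (?d u)) \<le> ennreal (1 + 1 / \<epsilon>) * (ennreal ((cmod (f u - h k u))\<^sup>2) * indicator {0..1} u) + ennreal \<epsilon> * (ennreal ((cmod (f u))\<^sup>2) * indicator {0..1} u)"
        by (auto simp: indicator_def)
    qed
    also have "\<dots> = ennreal (1 + 1 / \<epsilon>) * energy (\<lambda>u. f u - h k u) + ennreal \<epsilon> * energy f"
      using m1 m2 by (simp add: nn_integral_add nn_integral_cmult)
    also have "\<dots> \<le> ennreal (1 + 1 / \<epsilon>) * ennreal (\<epsilon> / (1 + 1 / \<epsilon>)) + ennreal \<epsilon> * ennreal C"
      using elim C by (intro add_mono mult_left_mono) auto
    also have "\<dots> = ennreal (\<epsilon> * (1 + C))"
    proof -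
      have p: "0 < 1 + 1 / \<epsilon>" using \<epsilon> by (simp add: add_pos_pos)
      have "ennreal (1 + 1 / \<epsilon>) * ennreal (\<epsilon> / (1 + 1 / \<epsilon>)) = ennreal \<epsilon>"
        using p \<epsilon> by (subst ennreal_mult[symmetric]) auto
      moreover have "ennreal \<epsilon> * ennreal C = ennreal (\<epsilon> * C)" using \<epsilon> C by (simp add: ennreal_mult)
      ultimately show ?thesis using \<epsilon> C by (simp add: distrib_left)
    qed
    finally show ?case .
  qed
qed (use C in simp)

lemma exp_add_le_half: "exp (a + b) \<le> (exp (2 * a) + exp (2 * b)) / (2 :: real)"
proof -
  have "2 * exp a * exp b \<le> (exp a)\<^sup>2 + (exp b)\<^sup>2" by (rule sum_squares_bound)
  then show ?thesis by (simp add: exp_add exp_double)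
qed

text \<open>The arithmetic-geometric mean inequality trades a doubled exponent for a bound that is
  valid under any joint law of the two summands.\<close>

lemma nn_integral_exp_add_le:
  fixes F G :: "'a \<Rightarrow> complex"
  assumes [measurable]: "F \<in> borel_measurable M" "G \<in> borel_measurable M"
    and A: "exp_moment M (\<lambda>\<xi>. Re (2 * s * F \<xi>)) \<le> ennreal A" "exp_moment M (\<lambda>\<xi>. Re (2 * s * G \<xi>)) \<le> ennreal A" "0 \<le> A"
  shows "exp_moment M (\<lambda>\<xi>. Re (s * (F \<xi> + G \<xi>))) \<le> ennreal A"
proof -
  have "exp_moment M (\<lambda>\<xi>. Re (s * (F \<xi> + G \<xi>))) \<le> (\<integral>\<^sup>+\<xi>. ennreal (1 / 2) * ennreal (exp (Re (2 * s * F \<xi>))) + ennreal (1 / 2) * ennreal (exp (Re (2 * s * G \<xi>))) \<partial>M)"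
  proof (rule nn_integral_mono)
    fix \<xi>
    have "exp (Re (s * (F \<xi> + G \<xi>))) = exp (Re (s * F \<xi>) + Re (s * G \<xi>))"
      by (simp only: distrib_left plus_complex.sel)
    also have "\<dots> \<le> (exp (2 * Re (s * F \<xi>)) + exp (2 * Re (s * G \<xi>))) / 2" by (rule exp_add_le_half)
    also have "\<dots> = 1 / 2 * exp (Re (2 * s * F \<xi>)) + 1 / 2 * exp (Re (2 * s * G \<xi>))"
      by (simp add: algebra_simps)
    finally have "ennreal (exp (Re (s * (F \<xi> + G \<xi>)))) \<le> ennreal (1 / 2 * exp (Re (2 * s * F \<xi>)) + 1 / 2 * exp (Re (2 * s * G \<xi>)))"
      by (rule ennreal_leI)
    also have "\<dots> = ennreal (1 / 2) * ennreal (exp (Re (2 * s * F \<xi>))) + ennreal (1 / 2) * ennreal (exp (Re (2 * s * G \<xi>)))"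
      by (subst ennreal_plus) (simp_all only: ennreal_mult' zero_le_divide_1_iff zero_le_numeral mult_nonneg_nonneg exp_ge_zero)
    finally show "ennreal (exp (Re (s * (F \<xi> + G \<xi>)))) \<le> ennreal (1 / 2) * ennreal (exp (Re (2 * s * F \<xi>))) + ennreal (1 / 2) * ennreal (exp (Re (2 * s * G \<xi>)))" .
  qed
  also have "\<dots> = ennreal (1 / 2) * exp_moment M (\<lambda>\<xi>. Re (2 * s * F \<xi>)) + ennreal (1 / 2) * exp_moment M (\<lambda>\<xi>. Re (2 * s * G \<xi>))"
    by (subst nn_integral_add) (measurable, simp add: nn_integral_cmult)
  also have "\<dots> \<le> ennreal (1 / 2) * ennreal A + ennreal (1 / 2) * ennreal A"
    by (intro add_mono mult_left_mono A) auto
  also have "\<dots> = ennreal A"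
  proof -
    have "ennreal (1 / 2) + ennreal (1 / 2) = 1" by (subst ennreal_plus[symmetric]) simp_all
    then show ?thesis unfolding distrib_right[symmetric] by simp
  qed
  finally show ?thesis .
qed

lemma step_integral_0 [simp]: "step_integral B 0 c t = (\<lambda>_. 0)" "step_fun 0 c t = (\<lambda>_. 0)"
  by (auto simp: step_integral_def step_fun_def)

lemma nn_integral_square_triangle:
  fixes f h :: "real \<Rightarrow> complex"
  assumes f: "set_borel_measurable lborel {0..1} f" and h: "h \<in> borel_measurable borel"
    and "energy f \<le> ennreal C" "0 \<le> C"
    and "energy (\<lambda>u. f u - h u) \<le> ennreal E" "0 \<le> E"
  shows "energy h \<le> ennreal (2 * C + 2 * E)"
proof -
  have fm: "(\<lambda>u. f u * indicator {0..1} u) \<in> borel_measurable borel"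
    using f by (simp add: set_borel_measurable_def scaleR_conv_of_real mult.commute of_real_indicator)
  have e1: "(\<lambda>u. ennreal ((cmod (f u - h u))\<^sup>2) * indicator {0..1} u) = (\<lambda>u. ennreal ((cmod (f u * indicator {0..1} u - h u * indicator {0..1} u))\<^sup>2))"
    "(\<lambda>u. ennreal ((cmod (f u))\<^sup>2) * indicator {0..1} u) = (\<lambda>u. ennreal ((cmod (f u * indicator {0..1} u))\<^sup>2))"
    by (auto simp: indicator_def)
  have m1: "(\<lambda>u. ennreal ((cmod (f u - h u))\<^sup>2) * indicator {0..1} u) \<in> borel_measurable lborel"
    "(\<lambda>u. ennreal ((cmod (f u))\<^sup>2) * indicator {0..1} u) \<in> borel_measurable lborel"
    unfolding e1 using fm h by simp_all
  have "energy h \<le> (\<integral>\<^sup>+u. 2 * (ennreal ((cmod (f u))\<^sup>2) * indicator {0..1} u) + 2 * (ennreal ((cmod (f u - h u))\<^sup>2) * indicator {0..1} u) \<partial>lborel)"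
  proof (rule nn_integral_mono)
    fix u :: real
    have "(cmod (h u))\<^sup>2 \<le> 2 * (cmod (f u))\<^sup>2 + 2 * (cmod (f u - h u))\<^sup>2"
      using norm_add_square_le[of "f u" "h u - f u"] by (simp add: norm_minus_commute)
    from ennreal_leI[OF this] have "ennreal ((cmod (h u))\<^sup>2) \<le> 2 * ennreal ((cmod (f u))\<^sup>2) + 2 * ennreal ((cmod (f u - h u))\<^sup>2)"
      by (simp add: ennreal_mult)
    then show "ennreal ((cmod (h u))\<^sup>2) * indicator {0..1} u \<le> 2 * (ennreal ((cmod (f u))\<^sup>2) * indicator {0..1} u) + 2 * (ennreal ((cmod (f u - h u))\<^sup>2) * indicator {0..1} u)"
      by (auto simp: indicator_def)
  qed
  also have "\<dots> = 2 * energy f + 2 * energy (\<lambda>u. f u - h u)"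
    using m1 by (subst nn_integral_add) (auto simp: nn_integral_cmult)
  also have "\<dots> \<le> 2 * ennreal C + 2 * ennreal E" using assms by (intro add_mono mult_left_mono) auto
  also have "\<dots> = ennreal (2 * C + 2 * E)" using assms by (simp add: ennreal_mult)
  finally show ?thesis .
qed

text \<open>Mean-square convergence is balanced by Young's inequality against exponential moments at
  \<open>2 * s\<close>. The coefficient \<open>u\<close> of the mean square depends on
  \<open>\<epsilon>\<close>, and \<open>\<eta>\<close> is chosen with
  \<open>u * \<eta> \<le> \<epsilon>\<close>.\<close>

lemma (in prob_space) expectation_exp_tendsto:
  fixes Z :: "'a \<Rightarrow> complex" and Zk :: "nat \<Rightarrow> 'a \<Rightarrow> complex"
  assumes [measurable]: "Z \<in> borel_measurable M" "\<And>k. Zk k \<in> borel_measurable M"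
    and lim: "(\<lambda>k. \<integral>\<^sup>+\<xi>. ennreal ((cmod (Z \<xi> - Zk k \<xi>))\<^sup>2) \<partial>M) \<longlonglongrightarrow> 0"
    and A: "exp_moment M (\<lambda>\<xi>. Re (2 * s * Z \<xi>)) \<le> ennreal A"
      "\<forall>\<^sub>F k in sequentially. exp_moment M (\<lambda>\<xi>. Re (2 * s * Zk k \<xi>)) \<le> ennreal A" "0 \<le> A"
    and int: "\<And>k. integrable M (\<lambda>\<xi>. exp (s * Zk k \<xi>))"
  shows "(\<lambda>k. expectation (\<lambda>\<xi>. exp (s * Zk k \<xi>))) \<longlonglongrightarrow> expectation (\<lambda>\<xi>. exp (s * Z \<xi>))"
proof (rule tendsto_of_small_bounds[where C = "1 + 2 * A"])
  have intZ: "integrable M (\<lambda>\<xi>. exp (s * Z \<xi>))"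
  proof (rule integrableI_bounded)
    have "(\<integral>\<^sup>+\<xi>. ennreal (norm (exp (s * Z \<xi>))) \<partial>M) \<le> (\<integral>\<^sup>+\<xi>. 1 + ennreal (exp (Re (2 * s * Z \<xi>))) \<partial>M)"
    proof (rule nn_integral_mono)
      fix \<xi>
      define x where "x = Re (s * Z \<xi>)"
      have q: "Re (2 * s * Z \<xi>) = 2 * x" by (simp add: x_def algebra_simps)
      have "2 * exp x \<le> 1 + exp (2 * x)" using exp_add_le_half[of 0 x] by simp
      then have "exp x \<le> 1 + exp (2 * x)" using exp_gt_zero[of "2 * x"] by linarith
      then have "ennreal (exp x) \<le> ennreal (1 + exp (2 * x))" by (rule ennreal_leI)
      then show "ennreal (norm (exp (s * Z \<xi>))) \<le> 1 + ennreal (exp (Re (2 * s * Z \<xi>)))"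
        unfolding norm_exp_eq_Re q x_def[symmetric] by simp
    qed
    also have "\<dots> = 1 + exp_moment M (\<lambda>\<xi>. Re (2 * s * Z \<xi>))"
      by (subst nn_integral_add) (auto simp: emeasure_space_1)
    also have "\<dots> \<le> 1 + ennreal A" by (intro add_mono order_refl A)
    also have "\<dots> < \<infinity>" by simp
    finally show "(\<integral>\<^sup>+\<xi>. ennreal (norm (exp (s * Z \<xi>))) \<partial>M) < \<infinity>" .
  qed measurable
  fix \<epsilon> :: real assume \<epsilon>: "0 < \<epsilon>"
  define u where "u = (cmod s)\<^sup>2 / (2 * \<epsilon>)"
  define \<eta> where "\<eta> = \<epsilon> / (u + 1)"
  have u: "0 \<le> u" using \<epsilon> by (simp add: u_def)
  then have \<eta>: "0 < \<eta>" "u * \<eta> \<le> \<epsilon>" using \<epsilon> by (simp_all add: \<eta>_def pos_divide_le_eq mult.commute mult_left_mono)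
  have "\<forall>\<^sub>F k in sequentially. mean_square M (\<lambda>\<xi>. Z \<xi> - Zk k \<xi>) < ennreal \<eta>"
    using order_tendstoD(2)[OF lim, of "ennreal \<eta>"] \<eta> by simp
  then show "\<forall>\<^sub>F k in sequentially. ennreal (cmod (expectation (\<lambda>\<xi>. exp (s * Zk k \<xi>)) - expectation (\<lambda>\<xi>. exp (s * Z \<xi>)))) \<le> ennreal (\<epsilon> * (1 + 2 * A))"
    using A(2)
  proof eventually_elim
    case (elim k)
    have "expectation (\<lambda>\<xi>. exp (s * Zk k \<xi>)) - expectation (\<lambda>\<xi>. exp (s * Z \<xi>)) = expectation (\<lambda>\<xi>. exp (s * Zk k \<xi>) - exp (s * Z \<xi>))"
      by (rule Bochner_Integration.integral_diff[symmetric, OF int intZ])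
    then have "ennreal (cmod (expectation (\<lambda>\<xi>. exp (s * Zk k \<xi>)) - expectation (\<lambda>\<xi>. exp (s * Z \<xi>)))) \<le> (\<integral>\<^sup>+\<xi>. ennreal (cmod (exp (s * Zk k \<xi>) - exp (s * Z \<xi>))) \<partial>M)"
      using integral_norm_bound_ennreal[OF Bochner_Integration.integrable_diff[OF int[of k] intZ]] by simp
    also have "\<dots> \<le> (\<integral>\<^sup>+\<xi>. ennreal u * ennreal ((cmod (Z \<xi> - Zk k \<xi>))\<^sup>2) +
        (ennreal \<epsilon> * ennreal (exp (Re (2 * s * Zk k \<xi>))) + ennreal \<epsilon> * ennreal (exp (Re (2 * s * Z \<xi>)))) \<partial>M)"
    proof (rule nn_integral_mono)
      fix \<xi>
      define d p q where "d = cmod (Z \<xi> - Zk k \<xi>)" and "p = exp (Re (s * Z \<xi>))" and "q = exp (Re (s * Zk k \<xi>))"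
      have p2: "exp (Re (2 * s * Zk k \<xi>)) = q\<^sup>2" "exp (Re (2 * s * Z \<xi>)) = p\<^sup>2"
        unfolding p_def q_def exp_double[symmetric] by (simp_all add: algebra_simps)
      have "s * Zk k \<xi> - s * Z \<xi> = - (s * (Z \<xi> - Zk k \<xi>))" by (simp add: algebra_simps)
      then have "cmod (s * Zk k \<xi> - s * Z \<xi>) = cmod s * d" by (simp only: norm_minus_cancel norm_mult d_def)
      then have 1: "cmod (exp (s * Zk k \<xi>) - exp (s * Z \<xi>)) \<le> cmod s * d * (q + p)"
        using norm_exp_diff_le[of "s * Zk k \<xi>" "s * Z \<xi>"] by (simp add: p_def q_def)
      have 2: "cmod s * d * (q + p) \<le> u * d\<^sup>2 + \<epsilon> / 2 * (q + p)\<^sup>2"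
      proof -
        have "0 \<le> (cmod s * d - \<epsilon> * (q + p))\<^sup>2 / (2 * \<epsilon>)" using \<epsilon> by simp
        also have "\<dots> = u * d\<^sup>2 + \<epsilon> / 2 * (q + p)\<^sup>2 - cmod s * d * (q + p)"
          using \<epsilon> unfolding power2_diff u_def by (simp add: power2_eq_square field_simps)
        finally show ?thesis by simp
      qed
      have 3: "\<epsilon> / 2 * (q + p)\<^sup>2 \<le> \<epsilon> / 2 * (2 * q\<^sup>2 + 2 * p\<^sup>2)"
        using sum_squares_bound[of q p] \<epsilon> by (intro mult_left_mono) (auto simp: power2_sum)
      have "cmod (exp (s * Zk k \<xi>) - exp (s * Z \<xi>)) \<le> u * d\<^sup>2 + (\<epsilon> * q\<^sup>2 + \<epsilon> * p\<^sup>2)"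
        using 1 2 3 by (simp add: algebra_simps)
      then have "ennreal (cmod (exp (s * Zk k \<xi>) - exp (s * Z \<xi>))) \<le> ennreal (u * d\<^sup>2 + (\<epsilon> * q\<^sup>2 + \<epsilon> * p\<^sup>2))" by (rule ennreal_leI)
      also have "\<dots> = ennreal u * ennreal (d\<^sup>2) + (ennreal \<epsilon> * ennreal (q\<^sup>2) + ennreal \<epsilon> * ennreal (p\<^sup>2))"
        using u \<epsilon> by (simp only: ennreal_mult ennreal_plus less_imp_le mult_nonneg_nonneg add_nonneg_nonneg zero_le_power2)
      finally show "ennreal (cmod (exp (s * Zk k \<xi>) - exp (s * Z \<xi>))) \<le> ennreal u * ennreal ((cmod (Z \<xi> - Zk k \<xi>))\<^sup>2) +
          (ennreal \<epsilon> * ennreal (exp (Re (2 * s * Zk k \<xi>))) + ennreal \<epsilon> * ennreal (exp (Re (2 * s * Z \<xi>))))"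
        unfolding p2 d_def[symmetric] .
    qed
    also have "\<dots> = ennreal u * mean_square M (\<lambda>\<xi>. Z \<xi> - Zk k \<xi>) +
        (ennreal \<epsilon> * exp_moment M (\<lambda>\<xi>. Re (2 * s * Zk k \<xi>)) + ennreal \<epsilon> * exp_moment M (\<lambda>\<xi>. Re (2 * s * Z \<xi>)))"
      by (simp add: nn_integral_add nn_integral_cmult)
    also have "\<dots> \<le> ennreal u * ennreal \<eta> + (ennreal \<epsilon> * ennreal A + ennreal \<epsilon> * ennreal A)"
      using elim A by (intro add_mono mult_left_mono) auto
    also have "\<dots> = ennreal (u * \<eta> + (\<epsilon> * A + \<epsilon> * A))"
      using u \<eta> \<epsilon> A(3) by (simp only: ennreal_mult ennreal_plus less_imp_le mult_nonneg_nonneg add_nonneg_nonneg)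
    also have "\<dots> \<le> ennreal (\<epsilon> * (1 + 2 * A))" using \<eta> by (intro ennreal_leI) (simp add: algebra_simps)
    finally show ?case .
  qed
qed (use A in simp)

text \<open>Independence is stated for step integrals, which are functions of finitely many path
  values; it reaches the Wiener integrals through the limit in
  \<open>wiener_pair_cexp\<close>.\<close>

locale gaussian_pair = X: gaussian_increments M B1 + Y: gaussian_increments M B2 for M :: "'a measure" and B1 B2 +
  assumes indep_steps: "\<And>n c t n' c' t'. mono t \<Longrightarrow> range t \<subseteq> {0..1} \<Longrightarrow> mono t' \<Longrightarrow> range t' \<subseteq> {0..1} \<Longrightarrow>
    X.indep_var borel (step_integral B1 n c t) borel (step_integral B2 n' c' t')"
begin

lemma wiener_pair_exp_bound:
  assumes W: "has_wiener_integral M B1 f I1" "has_wiener_integral M B2 g I2"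
    and t: "mono t" "range t \<subseteq> {0..1}"
    and D: "energy (\<lambda>u. f u - step_fun n c t u) \<le> ennreal D0"
      "energy (\<lambda>u. g u - step_fun n c' t u) \<le> ennreal D0" "0 \<le> D0" "D0 < D"
  shows "exp_moment M (\<lambda>\<xi>. Re (s * ((I1 \<xi> - step_integral B1 n c t \<xi>) + (I2 \<xi> - step_integral B2 n c' t \<xi>)))) \<le> ennreal (exp (4 * (cmod s)\<^sup>2 * D))"
proof (rule nn_integral_exp_add_le)
  have [measurable]: "I1 \<in> borel_measurable M" "I2 \<in> borel_measurable M" using W by (auto simp: has_wiener_integral_def)
  have t0: "0 \<le> t i" for i using t by (auto simp: subset_iff)
  have [measurable]: "step_integral B1 n c t \<in> borel_measurable M" "step_integral B2 n c' t \<in> borel_measurable M"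
    using X.step_integral_measurable Y.step_integral_measurable t0 by auto
  show "(\<lambda>\<xi>. I1 \<xi> - step_integral B1 n c t \<xi>) \<in> borel_measurable M" by measurable
  show "(\<lambda>\<xi>. I2 \<xi> - step_integral B2 n c' t \<xi>) \<in> borel_measurable M" by measurable
  show "exp_moment M (\<lambda>\<xi>. Re (2 * s * (I1 \<xi> - step_integral B1 n c t \<xi>))) \<le> ennreal (exp (4 * (cmod s)\<^sup>2 * D))"
    using X.wiener_exp_bound[OF W(1) t D(1,3,4), of "2 * s"] by (simp add: norm_mult power_mult_distrib)
  show "exp_moment M (\<lambda>\<xi>. Re (2 * s * (I2 \<xi> - step_integral B2 n c' t \<xi>))) \<le> ennreal (exp (4 * (cmod s)\<^sup>2 * D))"
    using Y.wiener_exp_bound[OF W(2) t D(2,3,4), of "2 * s"] by (simp add: norm_mult power_mult_distrib)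
qed simp

text \<open>The squares are \<open>f^2\<close> and \<open>g^2\<close>, not their moduli: this is the
  bilinear variance of the field, holomorphic in \<open>z\<close>. The formula factorises for step
  functions and passes to the limit on both sides.\<close>

lemma wiener_pair_cexp:
  assumes W: "has_wiener_integral M B1 f I1" "has_wiener_integral M B2 g I2"
    and C: "energy f \<le> ennreal C"
      "energy g \<le> ennreal C" "0 \<le> C"
  shows "X.expectation (\<lambda>\<xi>. exp (s * (I1 \<xi> + I2 \<xi>))) = exp (s\<^sup>2 / 2 * ((LINT u:{0..1}|lborel. (f u)\<^sup>2) + (LINT u:{0..1}|lborel. (g u)\<^sup>2)))"
proof -
  obtain n c t where t: "\<And>k. mono (t k)" "\<And>k. range (t k) \<subseteq> {0..1}"
    and f: "(\<lambda>k. \<integral>\<^sup>+u\<in>{0..1}. ennreal ((cmod (f u - step_fun (n k) (c k) (t k) u))\<^sup>2) \<partial>lborel) \<longlonglongrightarrow> 0"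
    and L1: "(\<lambda>k. \<integral>\<^sup>+\<xi>. ennreal ((cmod (I1 \<xi> - step_integral B1 (n k) (c k) (t k) \<xi>))\<^sup>2) \<partial>M) \<longlonglongrightarrow> 0"
    and fm: "set_borel_measurable lborel {0..1} f" and [measurable]: "I1 \<in> borel_measurable M"
    using W(1) unfolding has_wiener_integral_def by blast
  obtain n' c' t' where t': "\<And>k. mono (t' k)" "\<And>k. range (t' k) \<subseteq> {0..1}"
    and g: "(\<lambda>k. \<integral>\<^sup>+u\<in>{0..1}. ennreal ((cmod (g u - step_fun (n' k) (c' k) (t' k) u))\<^sup>2) \<partial>lborel) \<longlonglongrightarrow> 0"
    and L2: "(\<lambda>k. \<integral>\<^sup>+\<xi>. ennreal ((cmod (I2 \<xi> - step_integral B2 (n' k) (c' k) (t' k) \<xi>))\<^sup>2) \<partial>M) \<longlonglongrightarrow> 0"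
    and gm: "set_borel_measurable lborel {0..1} g" and [measurable]: "I2 \<in> borel_measurable M"
    using W(2) unfolding has_wiener_integral_def by blast
  have t0: "0 \<le> t k i" "0 \<le> t' k i" for k i using t(2)[of k] t'(2)[of k] by (auto simp: subset_iff)
  define S where "S k = step_integral B1 (n k) (c k) (t k)" for k
  define T where "T k = step_integral B2 (n' k) (c' k) (t' k)" for k
  have [measurable]: "S k \<in> borel_measurable M" "T k \<in> borel_measurable M" for k
    unfolding S_def T_def using X.step_integral_measurable Y.step_integral_measurable t0 by auto
  \<comment> \<open>One constant for the moment of the limit at \<open>2 * s\<close> and for those
    of the two step integrals at \<open>4 * s\<close>, once their approximation errors have energy
    at most 1.\<close>
  define A where "A = exp (16 * (cmod s)\<^sup>2 * (C + 1))"
  have A0: "0 < A" by (simp add: A_def)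
  have z: "mono (\<lambda>_ :: nat. 0 :: real)" "range (\<lambda>_ :: nat. 0 :: real) \<subseteq> {0..1}" by (auto simp: mono_def)
  have Aa: "exp_moment M (\<lambda>\<xi>. Re (2 * s * (I1 \<xi> + I2 \<xi>))) \<le> ennreal A"
    using wiener_pair_exp_bound[OF W z, of 0 "\<lambda>_. 0" C "\<lambda>_. 0" "C + 1" "2 * s"] C by (simp add: A_def norm_mult power_mult_distrib)
  have sA: "exp_moment M (\<lambda>\<xi>. Re (4 * s * S k \<xi>)) \<le> ennreal A" if "energy (\<lambda>u. f u - step_fun (n k) (c k) (t k) u) \<le> ennreal 1" for k
  proof -
    have "energy (\<lambda>u. step_fun (n k) (c k) (t k) u) \<le> ennreal (2 * C + 2 * 1)"
      by (rule nn_integral_square_triangle[OF fm _ C(1,3) that]) auto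
    then have "energy (\<lambda>u. step_fun (n k) (c k) (t k) u - step_fun 0 (\<lambda>_. 0) (\<lambda>_. 0) u) \<le> ennreal (2 * C + 2 * 1)" by simp
    from X.step_diff_exp[OF t z this, of "4 * s"] C
    have "exp_moment M (\<lambda>\<xi>. Re (4 * s * (step_integral B1 (n k) (c k) (t k) \<xi> - step_integral B1 0 (\<lambda>_. 0) (\<lambda>_. 0) \<xi>))) \<le> ennreal (exp ((cmod (4 * s))\<^sup>2 * (2 * C + 2 * 1) / 2))" by simp
    moreover have "(cmod (4 * s))\<^sup>2 * (2 * C + 2 * 1) / 2 = 16 * (cmod s)\<^sup>2 * (C + 1)"
      by (simp add: norm_mult power_mult_distrib algebra_simps)
    ultimately show ?thesis unfolding S_def A_def by (simp only: step_integral_0 diff_zero)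
  qed
  have tA: "exp_moment M (\<lambda>\<xi>. Re (4 * s * T k \<xi>)) \<le> ennreal A" if "energy (\<lambda>u. g u - step_fun (n' k) (c' k) (t' k) u) \<le> ennreal 1" for k
  proof -
    have "energy (\<lambda>u. step_fun (n' k) (c' k) (t' k) u) \<le> ennreal (2 * C + 2 * 1)"
      by (rule nn_integral_square_triangle[OF gm _ C(2,3) that]) auto
    then have "energy (\<lambda>u. step_fun (n' k) (c' k) (t' k) u - step_fun 0 (\<lambda>_. 0) (\<lambda>_. 0) u) \<le> ennreal (2 * C + 2 * 1)" by simp
    from Y.step_diff_exp[OF t' z this, of "4 * s"] C
    have "exp_moment M (\<lambda>\<xi>. Re (4 * s * (step_integral B2 (n' k) (c' k) (t' k) \<xi> - step_integral B2 0 (\<lambda>_. 0) (\<lambda>_. 0) \<xi>))) \<le> ennreal (exp ((cmod (4 * s))\<^sup>2 * (2 * C + 2 * 1) / 2))" by simp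
    moreover have "(cmod (4 * s))\<^sup>2 * (2 * C + 2 * 1) / 2 = 16 * (cmod s)\<^sup>2 * (C + 1)"
      by (simp add: norm_mult power_mult_distrib algebra_simps)
    ultimately show ?thesis unfolding T_def A_def by (simp only: step_integral_0 diff_zero)
  qed
  let ?b = "\<lambda>k \<xi>. exp (s * (S k \<xi> + T k \<xi>))"
  have intS: "integrable M (\<lambda>\<xi>. exp (s * S k \<xi>))" "integrable M (\<lambda>\<xi>. exp (s * T k \<xi>))" for k
    unfolding S_def T_def by (rule X.step_integral_cexp(1)[OF t] Y.step_integral_cexp(1)[OF t'])+
  have ind: "X.indep_var borel (\<lambda>\<xi>. exp (s * S k \<xi>)) borel (\<lambda>\<xi>. exp (s * T k \<xi>))" for k
  proof -
    have "X.indep_var borel (S k) borel (T k)" unfolding S_def T_def by (rule indep_steps[OF t t'])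
    from X.indep_var_compose[OF this, of "\<lambda>x. exp (s * x)" borel "\<lambda>x. exp (s * x)" borel]
    show ?thesis by (simp add: comp_def)
  qed
  have be: "?b k = (\<lambda>\<xi>. exp (s * S k \<xi>) * exp (s * T k \<xi>))" for k by (simp add: distrib_left exp_add)
  have intb: "integrable M (?b k)" for k
    unfolding be by (rule X.indep_var_integrable[OF ind intS])
  have Eb: "X.expectation (?b k) = exp (s\<^sup>2 / 2 * ((LINT u:{0..1}|lborel. (step_fun (n k) (c k) (t k) u)\<^sup>2) + (LINT u:{0..1}|lborel. (step_fun (n' k) (c' k) (t' k) u)\<^sup>2)))" for k
    unfolding be X.indep_var_lebesgue_integral[OF ind intS]
    unfolding S_def T_def X.step_integral_cexp(2)[OF t] Y.step_integral_cexp(2)[OF t']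
    by (simp add: distrib_left exp_add)
  have lim1: "(\<lambda>k. X.expectation (?b k)) \<longlonglongrightarrow> X.expectation (\<lambda>\<xi>. exp (s * (I1 \<xi> + I2 \<xi>)))"
  proof (rule X.expectation_exp_tendsto[OF _ _ _ Aa _ less_imp_le[OF A0] intb])
    let ?u = "\<lambda>k. 2 * mean_square M (\<lambda>\<xi>. I1 \<xi> - S k \<xi>) + 2 * mean_square M (\<lambda>\<xi>. I2 \<xi> - T k \<xi>)"
    have le: "mean_square M (\<lambda>\<xi>. I1 \<xi> + I2 \<xi> - (S k \<xi> + T k \<xi>)) \<le> ?u k" for k
    proof -
      have "mean_square M (\<lambda>\<xi>. I1 \<xi> + I2 \<xi> - (S k \<xi> + T k \<xi>))
        \<le> (\<integral>\<^sup>+\<xi>. 2 * ennreal ((cmod (I1 \<xi> - S k \<xi>))\<^sup>2) + 2 * ennreal ((cmod (I2 \<xi> - T k \<xi>))\<^sup>2) \<partial>M)"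
      proof (rule nn_integral_mono)
        fix \<xi>
        have "ennreal ((cmod (I1 \<xi> + I2 \<xi> - (S k \<xi> + T k \<xi>)))\<^sup>2) \<le> ennreal (2 * (cmod (I1 \<xi> - S k \<xi>))\<^sup>2 + 2 * (cmod (I2 \<xi> - T k \<xi>))\<^sup>2)"
          using norm_add_square_le[of "I1 \<xi> - S k \<xi>" "I2 \<xi> - T k \<xi>"] by (intro ennreal_leI) (simp add: algebra_simps)
        then show "ennreal ((cmod (I1 \<xi> + I2 \<xi> - (S k \<xi> + T k \<xi>)))\<^sup>2) \<le> 2 * ennreal ((cmod (I1 \<xi> - S k \<xi>))\<^sup>2) + 2 * ennreal ((cmod (I2 \<xi> - T k \<xi>))\<^sup>2)"
          by (simp add: ennreal_mult)
      qed
      also have "\<dots> = ?u k" by (simp add: nn_integral_add nn_integral_cmult)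
      finally show ?thesis .
    qed
    have u: "?u \<longlonglongrightarrow> 2 * 0 + 2 * 0"
      using L1 L2 unfolding S_def T_def by (intro tendsto_add ennreal_tendsto_cmult) auto
    have ge: "0 \<le> mean_square M (\<lambda>\<xi>. I1 \<xi> + I2 \<xi> - (S k \<xi> + T k \<xi>))" for k by simp
    have zero: "(2 * 0 + 2 * 0 :: ennreal) = 0" by simp
    show "(\<lambda>k. \<integral>\<^sup>+\<xi>. ennreal ((cmod (I1 \<xi> + I2 \<xi> - (S k \<xi> + T k \<xi>)))\<^sup>2) \<partial>M) \<longlonglongrightarrow> 0"
      by (rule tendsto_sandwich[OF always_eventually[OF allI[OF ge]] always_eventually[OF allI[OF le]] tendsto_const u[unfolded zero]])
    show "\<forall>\<^sub>F k in sequentially. exp_moment M (\<lambda>\<xi>. Re (2 * s * (S k \<xi> + T k \<xi>))) \<le> ennreal A"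
      using order_tendstoD(2)[OF f, of "ennreal 1", simplified] order_tendstoD(2)[OF g, of "ennreal 1", simplified]
    proof eventually_elim
      case (elim k)
      show ?case by (rule nn_integral_exp_add_le) (use sA[of k] tA[of k] elim A0 in \<open>auto simp: mult.assoc[symmetric]\<close>)
    qed
  qed measurable
  have lim2: "(\<lambda>k. X.expectation (?b k)) \<longlonglongrightarrow> exp (s\<^sup>2 / 2 * ((LINT u:{0..1}|lborel. (f u)\<^sup>2) + (LINT u:{0..1}|lborel. (g u)\<^sup>2)))"
    unfolding Eb
    by (intro tendsto_intros set_integral_square_tendsto[OF fm C(1,3) _ _ f] set_integral_square_tendsto[OF gm C(2,3) _ _ g] integral_step_square t t') auto
  show ?thesis by (rule LIMSEQ_unique[OF lim1 lim2])
qed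

end

section \<open>Discretisation of the kernels\<close>

lemma sqrt_diff_ge: "v - u \<le> 2 * (sqrt v - sqrt u)" if "0 \<le> u" "u \<le> v" "v \<le> 1" for u v :: real
proof -
  have "v - u = (sqrt v - sqrt u) * (sqrt v + sqrt u)" using that by (simp add: algebra_simps)
  also have "\<dots> \<le> (sqrt v - sqrt u) * 2"
  proof (rule mult_left_mono)
    have "sqrt u \<le> 1" "sqrt v \<le> 1" using that by auto
    then show "sqrt v + sqrt u \<le> 2" by linarith
  qed (use that in simp)
  finally show ?thesis by simp
qed

text \<open>\<open>rot\<close> contains \<open>sqrt u\<close>, which is not Lipschitz at 0.
  Oscillation is therefore measured by \<open>sqrt v - sqrt u\<close>, which still telescopes to 1
  over the grid.\<close>

lemma rot_diff:
  assumes hyp: "hyp y z" and y: "0 < y" "y \<le> 1 / 2" and u: "0 \<le> u" "u \<le> v" "v \<le> 1"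
  shows "cmod (rot u z - rot v z) \<le> 5 / 2 * (sqrt v - sqrt u) / y\<^sup>2"
proof -
  have z0: "z \<noteq> 0" using hyp y by (auto dest: hyp_nonzero)
  have ly: "y / 2 \<le> cmod (lam w z)" for w
    using norm_le_lam[of z w] hyp_imp_norm[OF hyp] y by linarith
  have l0: "lam w z \<noteq> 0" for w using z0 by (rule lam_nonzero)
  have s: "0 \<le> sqrt v - sqrt u" using u by simp
  have eq: "rot u z - rot v z = cplx ((sqrt u - sqrt v) / 2) / lam v z + rot u z * (lam v z - lam u z) / lam v z"
    using l0[of u] l0[of v] by (simp add: rot_def field_simps)
  have "cmod (cplx ((sqrt u - sqrt v) / 2) / lam v z) = (sqrt v - sqrt u) / 2 / cmod (lam v z)"
    using s by (simp add: norm_divide del: of_real_diff of_real_divide)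
  also have "\<dots> \<le> (sqrt v - sqrt u) / 2 / (y / 2)" using s ly[of v] y by (intro divide_left_mono mult_pos_pos) auto
  also have "\<dots> = (sqrt v - sqrt u) / y"
  proof -
    have "t / 2 / (y / 2) = t / y" for t :: real by simp
    then show ?thesis .
  qed
  finally have 1: "cmod (cplx ((sqrt u - sqrt v) / 2) / lam v z) \<le> (sqrt v - sqrt u) / y" .
  have "cmod (rot u z * (lam v z - lam u z) / lam v z) = cmod (rot u z) * cmod (lam v z - lam u z) / cmod (lam v z)"
    by (simp add: norm_mult norm_divide)
  also have "\<dots> \<le> 1 * ((v - u) / (2 * y)) / (y / 2)"
  proof (intro frac_le mult_mono)
    show "cmod (lam v z - lam u z) \<le> (v - u) / (2 * y)"
      using lam_diff[OF hyp y, of v u] u by simp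
  qed (use norm_rot_le[OF z0 u(1)] ly[of v] y u in auto)
  also have "\<dots> = (v - u) / y\<^sup>2"
  proof -
    have "1 * (t / (2 * y)) / (y / 2) = t / y\<^sup>2" for t :: real by (simp add: power2_eq_square)
    then show ?thesis .
  qed
  also have "\<dots> \<le> 2 * (sqrt v - sqrt u) / y\<^sup>2" using sqrt_diff_ge[OF u] y by (intro divide_right_mono) auto
  finally have 2: "cmod (rot u z * (lam v z - lam u z) / lam v z) \<le> 2 * (sqrt v - sqrt u) / y\<^sup>2" .
  have "(sqrt v - sqrt u) / y \<le> 1 / 2 * (sqrt v - sqrt u) / y\<^sup>2"
  proof -
    have "(sqrt v - sqrt u) * y \<le> 1 / 2 * (sqrt v - sqrt u)" using mult_left_mono[OF y(2) s] by (simp add: mult.commute)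
    then have "(sqrt v - sqrt u) * y / y\<^sup>2 \<le> 1 / 2 * (sqrt v - sqrt u) / y\<^sup>2" by (rule divide_right_mono) simp
    moreover have "t * y / y\<^sup>2 = t / y" for t using y by (simp add: power2_eq_square)
    ultimately show ?thesis by simp
  qed
  moreover have "1 / 2 * (sqrt v - sqrt u) / y\<^sup>2 + 2 * (sqrt v - sqrt u) / y\<^sup>2 = 5 / 2 * (sqrt v - sqrt u) / y\<^sup>2"
  proof -
    have "1 / 2 * t / y\<^sup>2 + 2 * t / y\<^sup>2 = 5 / 2 * t / y\<^sup>2" for t :: real by (simp add: add_divide_distrib[symmetric])
    then show ?thesis .
  qed
  ultimately show ?thesis
    using 1 2 norm_triangle_ineq[of "cplx ((sqrt u - sqrt v) / 2) / lam v z" "rot u z * (lam v z - lam u z) / lam v z"]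
    unfolding eq by linarith
qed

lemma ker_diff:
  assumes hyp: "hyp y z" and y: "0 < y" "y \<le> 1 / 2" and u: "0 \<le> u" "u \<le> v" "v \<le> 1"
  shows "cmod (ker1 u z - ker1 v z) \<le> 5 / y ^ 3 * (sqrt v - sqrt u)"
    "cmod (ker2 u z - ker2 v z) \<le> 5 / y ^ 3 * (sqrt v - sqrt u)"
proof -
  have z0: "z \<noteq> 0" using hyp y by (auto dest: hyp_nonzero)
  have sy: "y \<le> cmod (sqrt_branch w z)" if "0 \<le> w" "w \<le> 1" for w
    using sqrt_branch_norm_ge[OF hyp y that] .
  have s0: "sqrt_branch w z \<noteq> 0" if "0 \<le> w" "w \<le> 1" for w using sy[OF that] y by auto
  have s: "0 \<le> sqrt v - sqrt u" using u by simp
  have v: "0 \<le> v" "u \<le> 1" using u by auto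
  have "cmod (ker1 u z - ker1 v z) = cmod (sqrt_branch v z - sqrt_branch u z) / (cmod (sqrt_branch u z) * cmod (sqrt_branch v z))"
    using s0[OF u(1) v(2)] s0[OF v(1) u(3)] by (simp add: ker1_def diff_frac_eq norm_divide norm_mult)
  also have "\<dots> \<le> ((v - u) / y) / (y * y)"
  proof (intro frac_le mult_mono sy u v)
    have "cmod (sqrt_branch v z - sqrt_branch u z) * y \<le> cmod (sqrt_branch v z - sqrt_branch u z) * cmod (sqrt_branch v z)"
      using sy[OF v(1) u(3)] by (intro mult_left_mono) auto
    also have "\<dots> \<le> v - u" using sqrt_branch_diff[OF z0 v(1) u(1)] u by simp
    finally show "cmod (sqrt_branch v z - sqrt_branch u z) \<le> (v - u) / y" using y by (simp add: pos_le_divide_eq)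
  qed (use y u in auto)
  also have "\<dots> = (v - u) / y ^ 3" by (simp add: power3_eq_cube)
  also have "\<dots> \<le> 2 * (sqrt v - sqrt u) / y ^ 3" using sqrt_diff_ge[OF u] y by (intro divide_right_mono) auto
  finally have k1: "cmod (ker1 u z - ker1 v z) \<le> 2 * (sqrt v - sqrt u) / y ^ 3" .
  have "2 * (sqrt v - sqrt u) / y ^ 3 \<le> 5 * (sqrt v - sqrt u) / y ^ 3" using s y by (intro divide_right_mono) auto
  then show "cmod (ker1 u z - ker1 v z) \<le> 5 / y ^ 3 * (sqrt v - sqrt u)" using k1 by simp
  have eq: "ker2 u z - ker2 v z = (rot u z - rot v z) * ker1 u z + rot v z * (ker1 u z - ker1 v z)"
    by (simp add: ker2_def ker1_def algebra_simps)
  have "cmod ((rot u z - rot v z) * ker1 u z) \<le> (5 / 2 * (sqrt v - sqrt u) / y\<^sup>2) * (1 / y)"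
    unfolding norm_mult by (intro mult_mono rot_diff[OF hyp y u] norm_ker1_le[OF hyp y u(1) v(2)]) (use s in auto)
  moreover have "cmod (rot v z * (ker1 u z - ker1 v z)) \<le> 1 * (2 * (sqrt v - sqrt u) / y ^ 3)"
    unfolding norm_mult by (intro mult_mono k1 norm_rot_le[OF z0 v(1)]) auto
  ultimately have "cmod (ker2 u z - ker2 v z) \<le> (5 / 2 * (sqrt v - sqrt u) / y\<^sup>2) * (1 / y) + 1 * (2 * (sqrt v - sqrt u) / y ^ 3)"
    unfolding eq by (intro order_trans[OF norm_triangle_ineq] add_mono)
  also have "\<dots> = 9 / 2 * ((sqrt v - sqrt u) / y ^ 3)"
  proof -
    have "(5 / 2 * t / y\<^sup>2) * (1 / y) + 1 * (2 * t / y ^ 3) = 9 / 2 * (t / y ^ 3)" for t :: real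
      using y by (simp add: power2_eq_square power3_eq_cube field_simps)
    then show ?thesis .
  qed
  also have "\<dots> \<le> 5 * ((sqrt v - sqrt u) / y ^ 3)" using s y by (intro mult_right_mono) auto
  finally show "cmod (ker2 u z - ker2 v z) \<le> 5 / y ^ 3 * (sqrt v - sqrt u)" by simp
qed

text \<open>The grid continued constantly beyond \<open>N\<close>, as partitions are required to be
  monotone and to stay in \<open>{0..1}\<close> on all of \<open>nat\<close>.\<close>

definition grid_clamp :: "nat \<Rightarrow> nat \<Rightarrow> real" where
  "grid_clamp N n = grid N (min n N)"

lemma grid_clamp_mono: "mono (grid_clamp N)"
  unfolding mono_def grid_clamp_def grid_def by (auto intro!: divide_right_mono)

lemma grid_clamp_range: "range (grid_clamp N) \<subseteq> {0..1}"
  using grid_bounds[of "min n N" N for n] by (auto simp: grid_clamp_def)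

lemma sum_sqrt_grid: "0 < N \<Longrightarrow> (\<Sum>n<N. sqrt (grid N (Suc n)) - sqrt (grid N n)) = 1"
  by (subst sum_lessThan_telescope) (simp add: grid_def)

section \<open>Step approximation, Riemann sums and summation by parts for one kernel\<close>

context
  fixes N :: nat and h :: "real \<Rightarrow> complex" and B K :: real
  assumes N: "0 < N" and osc: "\<And>u v. 0 \<le> u \<Longrightarrow> u \<le> v \<Longrightarrow> v \<le> 1 \<Longrightarrow> cmod (h u - h v) \<le> B * (sqrt v - sqrt u)"
    and K: "\<And>u. 0 \<le> u \<Longrightarrow> u \<le> 1 \<Longrightarrow> cmod (h u) \<le> K"
    and meas: "set_borel_measurable lborel {0..1} h"
begin

private definition "cells = step_fun N (\<lambda>n. h (grid N n)) (grid_clamp N)"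

text \<open>Square roots of the oscillations, so that the squares sum to a telescoping series.\<close>

private definition "wt = step_fun N (\<lambda>n. cplx (sqrt (sqrt (grid N (Suc n)) - sqrt (grid N n)))) (grid_clamp N)"

private lemma B_nonneg: "0 \<le> B"
  using norm_ge_zero[of "h 0 - h 1"] osc[of 0 1] by (simp del: norm_ge_zero)

private lemma K_nonneg: "0 \<le> K"
  using norm_ge_zero[of "h 0"] K[of 0] by (simp del: norm_ge_zero)

private lemma cell_cases:
  assumes "0 < u" "u \<le> 1"
  obtains n where "n < N" "u \<in> {grid_clamp N n<..grid_clamp N (Suc n)}"
proof -
  define m where "m = nat \<lceil>u * real N\<rceil>"
  have p: "0 < u * real N" using assms N by simp
  have m1: "u * real N \<le> real m" "real m < u * real N + 1" using p by (auto simp: m_def) linarith+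
  have "u * real N \<le> real N" using assms N by simp
  then have mN: "0 < m" "m \<le> N" using p m1 by linarith+
  show thesis
  proof (rule that[of "m - 1"])
    show "m - 1 < N" using mN by simp
    have "real (m - 1) < u * real N" using m1 mN by linarith
    then show "u \<in> {grid_clamp N (m - 1)<..grid_clamp N (Suc (m - 1))}"
    proof -
      have "min (m - 1) N = m - 1" "min (Suc (m - 1)) N = m" using mN by auto
      then show ?thesis using \<open>real (m - 1) < u * real N\<close> m1 N
        by (simp add: grid_clamp_def grid_def pos_divide_less_eq pos_le_divide_eq)
    qed
  qed
qed

private lemma cell_bounds:
  assumes "0 < u" "u \<le> 1"
  shows "cmod (h u - cells u) \<le> B * (cmod (wt u))\<^sup>2" "cmod (wt u) \<le> 1" "cmod (cells u) \<le> K"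
proof -
  obtain n where n: "n < N" "u \<in> {grid_clamp N n<..grid_clamp N (Suc n)}" using cell_cases[OF assms] by blast
  have one: "j = n" if "j < N" "u \<in> {grid_clamp N j<..grid_clamp N (Suc j)}" for j
  proof (rule ccontr)
    assume "j \<noteq> n"
    then consider "Suc j \<le> n" | "Suc n \<le> j" by linarith
    then show False using monoD[OF grid_clamp_mono, of "Suc j" n N] monoD[OF grid_clamp_mono, of "Suc n" j N] n that
      by cases auto
  qed
  have val: "step_fun N c (grid_clamp N) u = c n" for c
  proof -
    have "c j * indicator {grid_clamp N j<..grid_clamp N (Suc j)} u = 0" if "j < N" "j \<noteq> n" for j
    proof -
      have "u \<notin> {grid_clamp N j<..grid_clamp N (Suc j)}" using one[OF that(1)] that(2) by blast
      then show ?thesis by simp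
    qed
    then have "step_fun N c (grid_clamp N) u = c n * indicator {grid_clamp N n<..grid_clamp N (Suc n)} u"
      unfolding step_fun_def by (intro sum_eq_single n(1))
    also have "\<dots> = c n" using n(2) by simp
    finally show ?thesis .
  qed
  have g: "grid_clamp N n = grid N n" "grid_clamp N (Suc n) = grid N (Suc n)" using n by (auto simp: grid_clamp_def min_def)
  have gb: "0 \<le> grid N n" "grid N n \<le> 1" "grid N n \<le> grid N (Suc n)" "grid N (Suc n) \<le> 1"
    using grid_bounds[of n N] grid_bounds[of "Suc n" N] n N by (auto simp: grid_def divide_right_mono)
  have s: "0 \<le> sqrt (grid N (Suc n)) - sqrt (grid N n)" using gb by simp
  have w2: "(cmod (wt u))\<^sup>2 = sqrt (grid N (Suc n)) - sqrt (grid N n)" using s by (simp add: wt_def val)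
  have "cmod (h u - cells u) \<le> B * (sqrt u - sqrt (grid N n))"
    using osc[of "grid N n" u] n gb assms g by (simp add: cells_def val norm_minus_commute)
  also have "\<dots> \<le> B * (sqrt (grid N (Suc n)) - sqrt (grid N n))"
    using n g B_nonneg by (intro mult_left_mono) auto
  finally show "cmod (h u - cells u) \<le> B * (cmod (wt u))\<^sup>2" using w2 by simp
  have "sqrt (grid N (Suc n)) \<le> 1" "0 \<le> sqrt (grid N n)" using gb by auto
  then have "(cmod (wt u))\<^sup>2 \<le> 1\<^sup>2" unfolding w2 one_power2 by linarith
  then show "cmod (wt u) \<le> 1" by (rule power2_le_imp_le) simp
  show "cmod (cells u) \<le> K" using K[of "grid N n"] gb by (simp add: cells_def val)
qed

private lemma wt_square: "energy wt = ennreal (1 / real N)"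
proof -
  have "(\<Sum>n<N. (cmod (cplx (sqrt (sqrt (grid N (Suc n)) - sqrt (grid N n)))))\<^sup>2 * (grid_clamp N (Suc n) - grid_clamp N n)) =
    (\<Sum>n<N. (sqrt (grid N (Suc n)) - sqrt (grid N n)) * (1 / real N))"
  proof (intro sum.cong refl arg_cong2[of _ _ _ _ times])
    fix n assume "n \<in> {..<N}"
    then have n: "n < N" by simp
    have "sqrt (grid N n) \<le> sqrt (grid N (Suc n))" by (simp add: grid_def divide_right_mono)
    then show "(cmod (cplx (sqrt (sqrt (grid N (Suc n)) - sqrt (grid N n)))))\<^sup>2 = sqrt (grid N (Suc n)) - sqrt (grid N n)" by simp
    show "grid_clamp N (Suc n) - grid_clamp N n = 1 / real N"
      using n grid_Suc[OF N, of n] by (simp add: grid_clamp_def min_def)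
  qed
  also have "\<dots> = 1 / real N" by (simp add: sum_distrib_right[symmetric] sum_sqrt_grid[OF N] del: times_divide_eq_right)
  finally show ?thesis unfolding wt_def by (simp add: nn_integral_step_square[OF grid_clamp_mono grid_clamp_range])
qed

private lemma wt_integral:
  assumes c: "0 \<le> c" and le: "\<And>u. 0 < u \<Longrightarrow> u \<le> 1 \<Longrightarrow> G u \<le> c * (cmod (wt u))\<^sup>2"
  shows "(\<integral>\<^sup>+u\<in>{0..1}. ennreal (G u) \<partial>lborel) \<le> ennreal (c / real N)"
proof -
  have "(\<integral>\<^sup>+u\<in>{0..1}. ennreal (G u) \<partial>lborel) \<le> (\<integral>\<^sup>+u. ennreal c * (ennreal ((cmod (wt u))\<^sup>2) * indicator {0..1} u) \<partial>lborel)"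
  proof (rule nn_integral_mono_AE)
    \<comment> \<open>The cells are open on the left and miss \<open>u = 0\<close>, a null
      set.\<close>
    show "AE u in lborel. ennreal (G u) * indicator {0..1} u \<le> ennreal c * (ennreal ((cmod (wt u))\<^sup>2) * indicator {0..1} u)"
      using AE_lborel_singleton[of 0]
    proof eventually_elim
      case (elim u)
      show ?case
      proof (cases "u \<in> {0..1}")
        case True
        then have "ennreal (G u) \<le> ennreal (c * (cmod (wt u))\<^sup>2)" using elim by (intro ennreal_leI le) auto
        then show ?thesis using True c by (simp add: ennreal_mult)
      qed simp
    qed
  qed
  also have "\<dots> = ennreal c * ennreal (1 / real N)"
    by (subst nn_integral_cmult) (auto simp: wt_def wt_square[unfolded wt_def])
  also have "\<dots> = ennreal (c / real N)" using c by (simp add: ennreal_mult[symmetric])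
  finally show ?thesis .
qed

text \<open>The pointwise error is at most \<open>B * |wt|^2\<close> with
  \<open>|wt| \<le> 1\<close>; after squaring, one factor \<open>|wt|^2\<close> is bounded by 1 and
  the other integrates to \<open>1 / N\<close>.\<close>

lemma cell_square_bound:
  "energy (\<lambda>u. h u - step_fun N (\<lambda>n. h (grid N n)) (grid_clamp N) u) \<le> ennreal (B\<^sup>2 / real N)"
proof (rule wt_integral)
  fix u :: real assume u: "0 < u" "u \<le> 1"
  have "(cmod (h u - cells u))\<^sup>2 \<le> (B * (cmod (wt u))\<^sup>2)\<^sup>2" by (intro power_mono cell_bounds[OF u]) simp
  also have "\<dots> = B\<^sup>2 * (cmod (wt u))\<^sup>2 * (cmod (wt u))\<^sup>2" by (simp add: power2_eq_square)
  also have "\<dots> \<le> B\<^sup>2 * (cmod (wt u))\<^sup>2 * 1"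
    using cell_bounds(2)[OF u] by (intro mult_left_mono) (auto simp: power_le_one)
  finally show "(cmod (h u - step_fun N (\<lambda>n. h (grid N n)) (grid_clamp N) u))\<^sup>2 \<le> B\<^sup>2 * (cmod (wt u))\<^sup>2" by (simp add: cells_def)
qed simp

lemma square_integral_le: "energy h \<le> ennreal (K\<^sup>2)"
proof -
  have "energy h \<le> (\<integral>\<^sup>+u. ennreal (K\<^sup>2) * indicator {0..1 :: real} u \<partial>lborel)"
    by (intro nn_integral_mono) (auto simp: indicator_def intro!: ennreal_leI power_mono K)
  also have "\<dots> = ennreal (K\<^sup>2)" by (simp add: nn_integral_cmult)
  finally show ?thesis .
qed

lemma square_integrable: "set_integrable lborel {0..1} (\<lambda>u. (h u)\<^sup>2)"
  by (rule set_square_integrable[OF meas square_integral_le])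

text \<open>The difference of the squares is a sum bounded by \<open>2 * K\<close> times a
  difference bounded by \<open>B * |wt|^2\<close>. Since \<open>|wt|^2\<close> integrates to
  \<open>1 / N\<close>, the singular behaviour at 0 does not spoil the rate.\<close>

lemma riemann_square_bound:
  "cmod ((\<Sum>n<N. (h (grid N n))\<^sup>2) / of_nat N - (LINT u:{0..1}|lborel. (h u)\<^sup>2)) \<le> 2 * K * B / real N"
proof -
  note st = integral_step_square[OF grid_clamp_mono grid_clamp_range, of N "\<lambda>n. h (grid N n)" N, folded cells_def]
  have "(\<Sum>n<N. (h (grid N n))\<^sup>2) / of_nat N = (LINT u:{0..1}|lborel. (cells u)\<^sup>2)"
    unfolding st(2) sum_divide_distrib
  proof (intro sum.cong refl)
    fix n assume "n \<in> {..<N}"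
    then have "grid_clamp N (Suc n) - grid_clamp N n = 1 / real N"
      using grid_Suc[OF N, of n] by (simp add: grid_clamp_def min_def)
    then show "(h (grid N n))\<^sup>2 / of_nat N = (h (grid N n))\<^sup>2 * cplx (grid_clamp N (Suc n) - grid_clamp N n)"
      by (simp only:) simp
  qed
  then have "(\<Sum>n<N. (h (grid N n))\<^sup>2) / of_nat N - (LINT u:{0..1}|lborel. (h u)\<^sup>2) =
      (LINT u:{0..1}|lborel. (cells u)\<^sup>2 - (h u)\<^sup>2)"
    using set_integral_diff(2)[OF st(1) square_integrable] by simp
  moreover have "ennreal (cmod (LINT u:{0..1}|lborel. (cells u)\<^sup>2 - (h u)\<^sup>2)) \<le> ennreal (2 * K * B / real N)"
  proof -
    have "set_integrable lborel {0..1} (\<lambda>u. (cells u)\<^sup>2 - (h u)\<^sup>2)"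
      by (intro set_integral_diff(1) st(1) square_integrable)
    then have "ennreal (cmod (LINT u:{0..1}|lborel. (cells u)\<^sup>2 - (h u)\<^sup>2)) \<le>
        (\<integral>\<^sup>+u. ennreal (cmod (indicator {0..1} u *\<^sub>R ((cells u)\<^sup>2 - (h u)\<^sup>2))) \<partial>lborel)"
      unfolding set_lebesgue_integral_def set_integrable_def by (rule integral_norm_bound_ennreal)
    also have "\<dots> = (\<integral>\<^sup>+u\<in>{0..1}. ennreal (cmod ((cells u)\<^sup>2 - (h u)\<^sup>2)) \<partial>lborel)"
      by (intro nn_integral_cong) (simp add: indicator_def)
    also have "\<dots> \<le> ennreal (2 * K * B / real N)"
    proof (rule wt_integral)
      fix u :: real assume u: "0 < u" "u \<le> 1"
      have "cmod ((cells u)\<^sup>2 - (h u)\<^sup>2) = cmod (cells u + h u) * cmod (h u - cells u)"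
      proof -
        have "(cells u)\<^sup>2 - (h u)\<^sup>2 = (cells u + h u) * (cells u - h u)" by (simp add: power2_eq_square algebra_simps)
        then show ?thesis by (simp add: norm_mult norm_minus_commute)
      qed
      also have "\<dots> \<le> (2 * K) * (B * (cmod (wt u))\<^sup>2)"
      proof (intro mult_mono cell_bounds(1)[OF u])
        show "cmod (cells u + h u) \<le> 2 * K" using norm_triangle_ineq[of "cells u" "h u"] cell_bounds(3)[OF u] K[of u] u by simp
      qed (use K_nonneg in auto)
      finally show "cmod ((cells u)\<^sup>2 - (h u)\<^sup>2) \<le> 2 * K * B * (cmod (wt u))\<^sup>2" by simp
    qed (use K_nonneg B_nonneg in simp)
    finally show ?thesis .
  qed
  ultimately show ?thesis using K_nonneg B_nonneg by (simp add: ennreal_le_iff)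
qed

text \<open>Summation by parts moves the difference from \<open>D\<close> to the kernel, whose total
  variation over the grid is at most \<open>B\<close>; the boundary term costs
  \<open>K\<close>.\<close>

lemma abel_bound:
  fixes D :: "nat \<Rightarrow> real"
  assumes D0: "D 0 = 0" and D: "\<And>n. n \<le> N \<Longrightarrow> \<bar>D n\<bar> \<le> m"
  shows "cmod (\<Sum>n<N. h (grid N n) * cplx (D (Suc n) - D n)) \<le> (K + B) * m"
proof -
  have m: "0 \<le> m" using D[of 0] D0 by simp
  let ?g = "\<lambda>n. h (grid N n)"
  have parts: "(\<Sum>n<k. ?g n * cplx (D (Suc n) - D n)) = ?g k * cplx (D k) + (\<Sum>n<k. (?g n - ?g (Suc n)) * cplx (D (Suc n)))" for k
    by (induction k) (simp_all add: D0 algebra_simps)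
  have "cmod (?g N * cplx (D N)) \<le> K * m"
    unfolding norm_mult using K[of "grid N N"] D[of N] grid_bounds[of N N] K_nonneg m by (intro mult_mono) auto
  moreover have "cmod (\<Sum>n<N. (?g n - ?g (Suc n)) * cplx (D (Suc n))) \<le> (\<Sum>n<N. B * (sqrt (grid N (Suc n)) - sqrt (grid N n)) * m)"
  proof (intro sum_norm_le)
    fix n assume "n \<in> {..<N}"
    then have n: "n < N" by simp
    have gb: "0 \<le> grid N n" "grid N n \<le> grid N (Suc n)" "grid N (Suc n) \<le> 1"
      using grid_bounds[of n N] grid_bounds[of "Suc n" N] n N by (auto simp: grid_def divide_right_mono)
    then show "cmod ((?g n - ?g (Suc n)) * cplx (D (Suc n))) \<le> B * (sqrt (grid N (Suc n)) - sqrt (grid N n)) * m"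
      unfolding norm_mult using osc[OF gb] D[of "Suc n"] n B_nonneg by (intro mult_mono) auto
  qed
  moreover have "(\<Sum>n<N. B * (sqrt (grid N (Suc n)) - sqrt (grid N n)) * m) = B * m"
    using sum_sqrt_grid[OF N] by (simp add: sum_distrib_left[symmetric] sum_distrib_right[symmetric])
  ultimately have "cmod (\<Sum>n<N. ?g n * cplx (D (Suc n) - D n)) \<le> K * m + B * m"
    unfolding parts by (intro order_trans[OF norm_triangle_ineq]) linarith
  then show ?thesis by (simp add: distrib_right)
qed

end

section \<open>Expansion of the characteristic polynomial\<close>

lemma norm_Ln_one_minus:
  fixes D :: complex
  assumes D: "cmod D \<le> 1 / 2"
  shows "cmod (Ln (1 - D) + D + D\<^sup>2 / 2) \<le> cmod D ^ 3"
proof -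
  have "(\<lambda>n. - ((- (- D)) ^ n) / of_nat n) sums ln (1 + - D)" using D by (intro Ln_series') simp
  then have "(\<lambda>n. - (D ^ n) / of_nat n) sums Ln (1 - D)" by simp
  then have "(\<lambda>n. - (D ^ (n + 3)) / of_nat (n + 3)) sums (Ln (1 - D) - (\<Sum>i<3. - (D ^ i) / of_nat i))"
    by (rule sums_split_initial_segment)
  moreover have "Ln (1 - D) - (\<Sum>i<3. - (D ^ i) / of_nat i) = Ln (1 - D) + D + D\<^sup>2 / 2"
    by (simp add: numeral_3_eq_3 power2_eq_square)
  ultimately have s: "(\<lambda>n. - (D ^ (n + 3)) / of_nat (n + 3)) sums (Ln (1 - D) + D + D\<^sup>2 / 2)" by (simp only:)
  have g: "(\<lambda>n. cmod D ^ 3 / 3 * (1 / 2) ^ n) sums (cmod D ^ 3 / 3 * (1 / (1 - 1 / 2)))"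
    by (intro sums_mult geometric_sums) simp
  have "cmod (suminf (\<lambda>n. - (D ^ (n + 3)) / of_nat (n + 3))) \<le> (\<Sum>n. cmod D ^ 3 / 3 * (1 / 2) ^ n)"
  proof (rule norm_suminf_le)
    fix n
    have "cmod (- (D ^ (n + 3)) / of_nat (n + 3)) = cmod D ^ 3 * cmod D ^ n / (real n + 3)"
      by (simp add: norm_divide norm_mult norm_power power_add mult.commute del: of_nat_add)
    also have "\<dots> \<le> cmod D ^ 3 * (1 / 2) ^ n / 3" using D by (intro frac_le mult_left_mono power_mono) auto
    finally show "cmod (- (D ^ (n + 3)) / of_nat (n + 3)) \<le> cmod D ^ 3 / 3 * (1 / 2) ^ n" by simp
  qed (use g in \<open>auto simp: sums_iff\<close>)
  also have "\<dots> = cmod D ^ 3 / 3 * (1 / (1 - 1 / 2))" using g by (simp add: sums_iff)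
  also have "\<dots> \<le> cmod D ^ 3" by simp
  finally show ?thesis using s by (simp add: sums_iff)
qed

lemma ratio_cong:
  assumes "\<And>m. m \<le> n \<Longrightarrow> x m = x' m" "\<And>m. m \<le> n \<Longrightarrow> y m = y' m"
  shows "ratio N k x y z n = ratio N k x' y' z n"
  using assms by (induction n) auto

text \<open>Predictability: the coefficients of step \<open>n\<close> depend only on the noise of
  earlier steps.\<close>

lemma green_hop_cong:
  assumes "\<And>m. m < n \<Longrightarrow> x m = x' m" "\<And>m. m < n \<Longrightarrow> y m = y' m"
  shows "green N k x y z n = green N k x' y' z n" "hop N k x y z n = hop N k x' y' z n"
proof -
  have *: "ratio N k x y z (n - 1) = ratio N k x' y' z (n - 1)" if "0 < n" using assms that by (intro ratio_cong) auto
  show "green N k x y z n = green N k x' y' z n" "hop N k x y z n = hop N k x' y' z n"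
    by (cases "n = 0"; use * in \<open>simp add: green_def hop_def\<close>)+
qed

lemma ker2_0 [simp]: "ker2 0 z = 0"
  by (simp add: ker2_def rot_def)

text \<open>The deviation of \<open>D + D\<^sup>2 / 2\<close>, for \<open>D\<close> the \<open>n\<close>-th increment, from its deterministic-coefficient version,
  centred; \<open>ma\<close>, \<open>mb\<close>, \<open>va\<close>, \<open>vb\<close> stand for the first two moments of the noise \<open>a\<close>, \<open>b\<close>.\<close>

definition mstep ::
  "nat \<Rightarrow> real \<Rightarrow> (nat \<Rightarrow> real) \<Rightarrow> (nat \<Rightarrow> real) \<Rightarrow> complex \<Rightarrow> nat \<Rightarrow> real \<Rightarrow> real \<Rightarrow> real \<Rightarrow> real \<Rightarrow> real \<Rightarrow> real \<Rightarrow> complex"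
where
  "mstep N k X Y z n a b ma mb va vb =
     cplx k * ((green N k X Y z n - ker1 (grid N n) z) * cplx (a - ma) +
       (green N k X Y z n * hop N k X Y z n - ker2 (grid N n) z) * cplx (b - mb)) +
     cplx (k\<^sup>2 / 2) * ((ker1 (grid N n) z)\<^sup>2 * cplx (a\<^sup>2 - va) +
       2 * (ker1 (grid N n) z * ker2 (grid N n) z) * cplx (a * b - ma * mb) +
       (ker2 (grid N n) z)\<^sup>2 * cplx (b\<^sup>2 - vb))"

definition hyp_dom :: "real \<Rightarrow> real \<Rightarrow> complex set" where
  "hyp_dom R y = {z. hyp y z \<and> cmod z \<le> R}"

lemma hyp_domD: "z \<in> hyp_dom R y \<Longrightarrow> hyp y z" "z \<in> hyp_dom R y \<Longrightarrow> cmod z \<le> R" "z \<in> hyp_dom R y \<Longrightarrow> 0 < y \<Longrightarrow> z \<noteq> 0"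
  by (auto simp: hyp_dom_def dest: hyp_nonzero)

lemma sqrt_branch_dom:
  assumes y: "0 < y" "y \<le> 1 / 2" and u: "0 \<le> u" "u \<le> 1"
  shows "(\<lambda>z. sqrt_branch u z) holomorphic_on hyp_dom R y" "z \<in> hyp_dom R y \<Longrightarrow> sqrt_branch u z \<noteq> 0"
proof -
  have nz: "sqrt_branch u z \<noteq> 0" if "z \<in> hyp_dom R y" for z
    using sqrt_branch_norm_ge[OF hyp_domD(1)[OF that] y u] y by auto
  then show "z \<in> hyp_dom R y \<Longrightarrow> sqrt_branch u z \<noteq> 0" .
  have "hyp_dom R y \<subseteq> - cplx ` {- sqrt u..sqrt u}"
  proof
    fix z assume z: "z \<in> hyp_dom R y"
    show "z \<in> - cplx ` {- sqrt u..sqrt u}"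
    proof
      assume "z \<in> cplx ` {- sqrt u..sqrt u}"
      then obtain x where x: "z = cplx x" "- sqrt u \<le> x" "x \<le> sqrt u" by auto
      have "sqrt u \<le> 1" using u by simp
      then have "\<bar>x\<bar> \<le> 1" using x by linarith
      then have "x\<^sup>2 \<le> 1" by (simp add: abs_square_le_1)
      then show False using hyp_domD(1)[OF z] y x by (simp add: hyp_def) (metis diff_le_0_iff_le zero_less_power not_less order_trans)
    qed
  qed
  then show "(\<lambda>z. sqrt_branch u z) holomorphic_on hyp_dom R y" by (rule holomorphic_on_subset[OF sqrt_branch_holomorphic[OF u(1)]])
qed

lemma ker_holomorphic:
  assumes y: "0 < y" "y \<le> 1 / 2" and u: "0 \<le> u" "u \<le> 1"
  shows "(\<lambda>z. ker1 u z) holomorphic_on hyp_dom R y" "(\<lambda>z. ker2 u z) holomorphic_on hyp_dom R y"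
  unfolding ker1_def ker2_def rot_def lam_def
  using sqrt_branch_dom[OF y u] lam_nonzero[OF hyp_domD(3)[OF _ y(1)], unfolded lam_def, of _ R u]
  by (auto intro!: holomorphic_intros)

text \<open>In the last \<open>L\<close> rows the backward recursion has not yet reached its fixed point; before them it is
  within \<open>\<epsilon>\<close>.\<close>

locale scale =
  fixes N L :: nat and R y k T \<epsilon> :: real
  assumes N: "0 < N" and y: "0 < y" "y \<le> 1 / 2" and R: "1 \<le> R" and k: "0 \<le> k" and T: "0 \<le> T"
    and small: "2 / (y / (R + 1)) * (3 * (k * T) + 1 / (2 * y * real N)) + 1 / (2 * y * real N) \<le> (y / (R + 1))\<^sup>2 / 8"
    and layer: "(R + 1) / y * ((1 - y / (R + 1) / 2) ^ L * (R + 1) + 2 * (1 / (2 * y * real N)) / (y / (R + 1))) +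
      (2 / (y / (R + 1)) * (3 * (k * T) + 1 / (2 * y * real N)) + 1 / (2 * y * real N)) \<le> \<epsilon>"
    and \<epsilon>: "\<epsilon> \<le> y / 2" and \<nu>: "12 * (k * T) \<le> y" and yN: "1 / y \<le> real N"
begin

abbreviation dom where "dom \<equiv> hyp_dom R y"

lemma recursion:
  assumes "z \<in> dom" "\<And>n. n < N \<Longrightarrow> \<bar>X n\<bar> \<le> T" "\<And>n. n < N \<Longrightarrow> \<bar>Y n\<bar> \<le> T"
  shows "noisy_recursion N z R y k (k * T) X Y"
  using assms N y R k by unfold_locales (auto simp: hyp_dom_def abs_mult intro!: mult_left_mono)

context
  fixes X Y :: "nat \<Rightarrow> real"
  assumes XY: "\<And>n. n < N \<Longrightarrow> \<bar>X n\<bar> \<le> T" "\<And>n. n < N \<Longrightarrow> \<bar>Y n\<bar> \<le> T"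
begin

lemma small_dom: "z \<in> dom \<Longrightarrow> noisy_recursion.d N R y (k * T) + noisy_recursion.\<Delta> N y \<le> (noisy_recursion.h R y)\<^sup>2 / 8"
  using small recursion[of z X Y, OF _ XY]
  by (simp add: noisy_recursion.d_def noisy_recursion.h_def noisy_recursion.\<Delta>_def)

lemma near:
  assumes z: "z \<in> dom" and n: "n < N - L"
  shows "cmod (theta N z n - lam (grid N n) z) + (noisy_recursion.d N R y (k * T) + noisy_recursion.\<Delta> N y) \<le> \<epsilon>"
proof -
  interpret noisy_recursion N z R y k "k * T" X Y using z XY by (rule recursion)
  have hh: "h = y / (R + 1)" "\<Delta> = 1 / (2 * y * real N)" by (simp_all add: h_def \<Delta>_def)
  have "(1 - h / 2) ^ (N - 1 - n) \<le> (1 - h / 2) ^ L"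
    using n h_bounds by (intro power_decreasing) auto
  then have "(R + 1) / y * ((1 - h / 2) ^ (N - 1 - n) * (R + 1) + 2 * \<Delta> / h) \<le> (R + 1) / y * ((1 - h / 2) ^ L * (R + 1) + 2 * \<Delta> / h)"
    using R y by (intro mult_left_mono add_right_mono mult_right_mono) auto
  moreover have "cmod (theta N z n - lam (grid N n) z) \<le> (R + 1) / y * ((1 - h / 2) ^ (N - 1 - n) * (R + 1) + 2 * \<Delta> / h)"
    using n by (intro theta_near) simp
  ultimately show ?thesis using layer unfolding d_def hh by linarith
qed

lemma theta_holomorphic: "(\<lambda>z. theta N z n) holomorphic_on dom"
proof -
  have "(\<lambda>z. cofrac N z j) holomorphic_on dom" if "j < N" for j
    using that
  proof (induction j)
    case (Suc j)
    have "cofrac N z j \<noteq> 0" if "z \<in> dom" for z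
    proof -
      interpret noisy_recursion N z R y k "k * T" X Y using that XY by (rule recursion)
      have "theta N z (N - 1 - j) \<noteq> 0" by (rule theta_nonzero)
      moreover have "N - 1 - (N - 1 - j) = j" using Suc.prems by simp
      ultimately show ?thesis by (simp add: theta_def)
    qed
    then show ?case using Suc by (auto intro!: holomorphic_intros)
  qed (auto intro!: holomorphic_intros)
  then show ?thesis unfolding theta_def using N by simp
qed

lemma ratio_nonzero:
  assumes "z \<in> dom" "n < N"
  shows "ratio N k X Y z n \<noteq> 0"
proof -
  interpret noisy_recursion N z R y k "k * T" X Y using assms(1) XY by (rule recursion)
  show ?thesis using noisy_recursion.ratio_nonzero[OF recursion[of z X Y, OF assms(1) XY] small_dom[OF assms(1)] assms(2)] .
qed

lemma ratio_holomorphic: "n < N \<Longrightarrow> (\<lambda>z. ratio N k X Y z n) holomorphic_on dom"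
proof (induction n)
  case (Suc n)
  then have "(\<lambda>z. ratio N k X Y z n) holomorphic_on dom" by simp
  moreover have "\<And>z. z \<in> dom \<Longrightarrow> ratio N k X Y z n \<noteq> 0" using ratio_nonzero Suc by simp
  ultimately show ?case by (auto intro!: holomorphic_intros)
qed (auto intro!: holomorphic_intros)

lemma hop_holomorphic: "n < N \<Longrightarrow> (\<lambda>z. hop N k X Y z n) holomorphic_on dom"
  unfolding hop_def using ratio_holomorphic[of "n - 1"] ratio_nonzero[of _ "n - 1"] by (intro holomorphic_intros) auto

lemma green_holomorphic:
  assumes n: "n < N"
  shows "(\<lambda>z. green N k X Y z n) holomorphic_on dom"
proof -
  have "theta N z n - cplx (grid N n / 4) / ratio N k X Y z (n - 1) \<noteq> 0" if z: "z \<in> dom" for z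
    using noisy_recursion.gap_norm_ge[OF recursion[of z X Y, OF z XY] small_dom[OF z] n] y by auto
  moreover have "(\<lambda>z. ratio N k X Y z (n - 1)) holomorphic_on dom" "\<And>z. z \<in> dom \<Longrightarrow> ratio N k X Y z (n - 1) \<noteq> 0"
    using ratio_holomorphic[of "n - 1"] ratio_nonzero[of _ "n - 1"] n by auto
  ultimately show ?thesis unfolding green_def by (intro holomorphic_intros theta_holomorphic) auto
qed

end

lemma mstep_holomorphic:
  assumes "\<And>n. n < N \<Longrightarrow> \<bar>X n\<bar> \<le> T" "\<And>n. n < N \<Longrightarrow> \<bar>Y n\<bar> \<le> T" "n < N"
  shows "(\<lambda>z. mstep N k X Y z n a b ma mb va vb) holomorphic_on dom"
  unfolding mstep_def
  using green_holomorphic[OF assms] hop_holomorphic[OF assms] ker_holomorphic[OF y, of "grid N n"] grid_bounds[of n N] assms(3)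
  by (intro holomorphic_intros) auto

text \<open>\<open>green_close\<close> in the bulk, \<open>green_crude\<close> in the last
  \<open>L\<close> rows, each times centred noise of size at most \<open>2 * T\<close>; the last
  summand is the quadratic part.\<close>

definition step_bound :: "nat \<Rightarrow> real" where
  "step_bound n = (if n < N - L then 20 * \<epsilon> * (k * T) / y\<^sup>2 else 16 * (k * T) / y) + 3 * (k * T)\<^sup>2 / y\<^sup>2"

lemma mstep_bound:
  assumes XY: "\<And>n. n < N \<Longrightarrow> \<bar>X n\<bar> \<le> T" "\<And>n. n < N \<Longrightarrow> \<bar>Y n\<bar> \<le> T" and n: "n < N" and z: "z \<in> dom"
    and ab: "\<bar>a\<bar> \<le> T" "\<bar>b\<bar> \<le> T" "\<bar>ma\<bar> \<le> T" "\<bar>mb\<bar> \<le> T" "0 \<le> va" "va \<le> T\<^sup>2" "0 \<le> vb" "vb \<le> T\<^sup>2"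
  shows "cmod (mstep N k X Y z n a b ma mb va vb) \<le> step_bound n"
proof -
  interpret noisy_recursion N z R y k "k * T" X Y using z XY by (rule recursion)
  note sm = small_dom[of X Y z, OF XY z]
  let ?f = "ker1 (grid N n) z" and ?g = "ker2 (grid N n) z"
  let ?p = "green N k X Y z n" and ?q = "green N k X Y z n * hop N k X Y z n"
  have f: "cmod ?f \<le> 1 / y" using ker1_norm_le[OF sm n] .
  have g: "cmod ?g \<le> 1 / y" using ker2_norm_le[OF sm n] f by linarith
  obtain G1 G2 where G: "cmod (?p - ?f) \<le> G1" "cmod (?q - ?g) \<le> G2"
    "G1 + G2 = (if n < N - L then 10 * \<epsilon> / y\<^sup>2 else 8 / y)"
  proof (cases "n < N - L")
    case True
    have eps0: "0 \<le> \<epsilon>" using near[of X Y z, OF XY z True] e_bounds(1)[OF sm] norm_ge_zero[of "theta N z n - lam (grid N n) z"] by linarith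
    note gc = green_close[OF sm n near[of X Y z, OF XY z True] \<epsilon>]
    have f2: "(cmod ?f)\<^sup>2 \<le> 1 / y\<^sup>2" using power_mono[OF f, of 2] by (simp add: power_divide)
    have "cmod (?p - ?f) \<le> 2 * \<epsilon> * (1 / y\<^sup>2)"
      using gc(1) mult_left_mono[OF f2, of "2 * \<epsilon>"] eps0 by linarith
    moreover have "cmod (?q - ?g) \<le> 8 * \<epsilon> * (1 / y\<^sup>2)"
      using gc(2) mult_left_mono[OF f2, of "8 * \<epsilon>"] eps0 by linarith
    moreover have "2 * \<epsilon> * (1 / y\<^sup>2) + 8 * \<epsilon> * (1 / y\<^sup>2) = (if n < N - L then 10 * \<epsilon> / y\<^sup>2 else 8 / y)"
      using True by (simp add: add_divide_distrib[symmetric])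
    ultimately show ?thesis by (rule that)
  next
    case False
    have "3 / y + 5 / y = 8 / y" by (simp add: add_divide_distrib[symmetric])
    then have e: "3 / y + 5 / y = (if n < N - L then 10 * \<epsilon> / y\<^sup>2 else 8 / y)" unfolding if_not_P[OF False] .
    show ?thesis by (rule that[OF green_crude(1,2)[OF sm n] e])
  qed
  have T2: "a\<^sup>2 \<le> T\<^sup>2" "b\<^sup>2 \<le> T\<^sup>2" using ab T by (metis abs_ge_zero power2_abs power_mono)+
  have d: "\<bar>a - ma\<bar> \<le> 2 * T" "\<bar>b - mb\<bar> \<le> 2 * T" using ab by linarith+
  have d2: "\<bar>a\<^sup>2 - va\<bar> \<le> T\<^sup>2" "\<bar>b\<^sup>2 - vb\<bar> \<le> T\<^sup>2"
    using ab T2 zero_le_power2[of a] zero_le_power2[of b] by (simp_all only: abs_le_iff) linarith+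
  have d3: "\<bar>a * b - ma * mb\<bar> \<le> 2 * T\<^sup>2"
  proof -
    have "\<bar>a * b\<bar> \<le> T * T" "\<bar>ma * mb\<bar> \<le> T * T" unfolding abs_mult using ab T by (intro mult_mono; simp)+
    then show ?thesis unfolding power2_eq_square by linarith
  qed
  have t1: "cmod ((?p - ?f) * cplx (a - ma)) \<le> G1 * (2 * T)"
    unfolding norm_mult norm_of_real using G(1) d(1) order_trans[OF norm_ge_zero G(1)] by (intro mult_mono) auto
  have t2: "cmod ((?q - ?g) * cplx (b - mb)) \<le> G2 * (2 * T)"
    unfolding norm_mult norm_of_real using G(2) d(2) order_trans[OF norm_ge_zero G(2)] by (intro mult_mono) auto
  have t12: "cmod ((?p - ?f) * cplx (a - ma) + (?q - ?g) * cplx (b - mb)) \<le> (G1 + G2) * (2 * T)"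
    using norm_triangle_ineq[of "(?p - ?f) * cplx (a - ma)" "(?q - ?g) * cplx (b - mb)"] t1 t2
    by (simp only: distrib_right)
  have s1: "cmod (?f\<^sup>2 * cplx (a\<^sup>2 - va)) \<le> (1 / y)\<^sup>2 * T\<^sup>2"
    unfolding norm_mult norm_of_real norm_power using f d2 by (intro mult_mono power_mono) auto
  have s2: "cmod (2 * (?f * ?g) * cplx (a * b - ma * mb)) \<le> 2 * ((1 / y) * (1 / y)) * (2 * T\<^sup>2)"
    unfolding norm_mult norm_of_real norm_numeral using f g d3 y by (intro mult_mono) auto
  have s3: "cmod (?g\<^sup>2 * cplx (b\<^sup>2 - vb)) \<le> (1 / y)\<^sup>2 * T\<^sup>2"
    unfolding norm_mult norm_of_real norm_power using g d2 by (intro mult_mono power_mono) auto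
  let ?s = "?f\<^sup>2 * cplx (a\<^sup>2 - va) + 2 * (?f * ?g) * cplx (a * b - ma * mb) + ?g\<^sup>2 * cplx (b\<^sup>2 - vb)"
  have "cmod ?s \<le> (1 / y)\<^sup>2 * T\<^sup>2 + 2 * ((1 / y) * (1 / y)) * (2 * T\<^sup>2) + (1 / y)\<^sup>2 * T\<^sup>2"
    by (intro order_trans[OF norm_triangle_ineq] add_mono s1 s2 s3)
  also have "\<dots> = 6 * T\<^sup>2 / y\<^sup>2" by (simp add: power2_eq_square)
  finally have s: "cmod ?s \<le> 6 * T\<^sup>2 / y\<^sup>2" .
  have "cmod (mstep N k X Y z n a b ma mb va vb) \<le> k * ((G1 + G2) * (2 * T)) + k\<^sup>2 / 2 * (6 * T\<^sup>2 / y\<^sup>2)"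
    unfolding mstep_def
  proof (intro order_trans[OF norm_triangle_ineq] add_mono)
    show "cmod (cplx k * ((?p - ?f) * cplx (a - ma) + (?q - ?g) * cplx (b - mb))) \<le> k * ((G1 + G2) * (2 * T))"
      unfolding norm_mult norm_of_real using k t12 by (intro mult_mono) auto
    show "cmod (cplx (k\<^sup>2 / 2) * ?s) \<le> k\<^sup>2 / 2 * (6 * T\<^sup>2 / y\<^sup>2)"
      unfolding norm_mult norm_of_real using s by (intro mult_mono) auto
  qed
  also have "\<dots> = step_bound n"
    unfolding step_bound_def G(3) by (simp add: power_mult_distrib mult_ac)
  finally show ?thesis .
qed

lemma step_bound_square_sum:
  "(\<Sum>n<N. (step_bound n)\<^sup>2) \<le> real N * (20 * \<epsilon> * (k * T) / y\<^sup>2 + 3 * (k * T)\<^sup>2 / y\<^sup>2)\<^sup>2 + real L * (16 * (k * T) / y + 3 * (k * T)\<^sup>2 / y\<^sup>2)\<^sup>2"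
proof -
  let ?a = "20 * \<epsilon> * (k * T) / y\<^sup>2 + 3 * (k * T)\<^sup>2 / y\<^sup>2" and ?b = "16 * (k * T) / y + 3 * (k * T)\<^sup>2 / y\<^sup>2"
  have "(\<Sum>n<N. (step_bound n)\<^sup>2) \<le> (\<Sum>n<N. ?a\<^sup>2 + (if n \<in> {N - L..<N} then ?b\<^sup>2 else 0))"
    by (intro sum_mono) (auto simp: step_bound_def)
  also have "\<dots> = real N * ?a\<^sup>2 + (\<Sum>n<N. if n \<in> {N - L..<N} then ?b\<^sup>2 else 0)" by (simp add: sum.distrib)
  also have "(\<Sum>n<N. if n \<in> {N - L..<N} then ?b\<^sup>2 else 0) = (\<Sum>n\<in>{..<N} \<inter> {N - L..<N}. ?b\<^sup>2)"
    by (rule sum.inter_restrict[symmetric]) simp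
  also have "\<dots> = real (card ({..<N} \<inter> {N - L..<N})) * ?b\<^sup>2" by simp
  also have "\<dots> \<le> real L * ?b\<^sup>2"
  proof (intro mult_right_mono)
    have "card ({..<N} \<inter> {N - L..<N}) \<le> card {N - L..<N}" by (intro card_mono) auto
    then show "real (card ({..<N} \<inter> {N - L..<N})) \<le> real L" by simp
  qed simp
  finally show ?thesis by simp
qed

text \<open>In this order: the bias caused by truncation, the replacement of \<open>D^2\<close> by
  the square with deterministic coefficients, and the cubic remainder of the logarithm.\<close>

definition core_error :: "real \<Rightarrow> real" where
  "core_error b = real N * (8 * k * b / y + 2 * k\<^sup>2 * b / y\<^sup>2) +
     (160 * \<epsilon> * (k * T)\<^sup>2 * real N / y\<^sup>2 + 32 * (k * T)\<^sup>2 / y\<^sup>2 * real L) + real N * (6 * (k * T) / y) ^ 3"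

text \<open>\<open>Q\<close> is the sum of the logarithms. Changing the coefficients of the linear
  term is too expensive pathwise and is left to the martingale \<open>mstep\<close>; changing those
  of the quadratic term is affordable by \<open>incr_square_diff_sum\<close>.\<close>

lemma prod_incr_eq_exp:
  assumes XY: "\<And>n. n < N \<Longrightarrow> \<bar>X n\<bar> \<le> T" "\<And>n. n < N \<Longrightarrow> \<bar>Y n\<bar> \<le> T" and z: "z \<in> dom"
    and b: "b \<le> 1" "\<And>n. \<bar>ma n\<bar> \<le> b" "\<And>n. \<bar>mb n\<bar> \<le> b" "\<And>n. \<bar>va n - 1\<bar> \<le> b" "\<And>n. 0 < n \<Longrightarrow> \<bar>vb n - 1\<bar> \<le> b"
  obtains Q where "(\<Prod>n<N. 1 - incr N k X Y z n) = exp Q"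
    "cmod (Q + (\<Sum>n<N. mstep N k X Y z n (X n) (Y n) (ma n) (mb n) (va n) (vb n)) +
      (\<Sum>n<N. cplx (k * X n) * ker1 (grid N n) z + cplx (k * Y n) * ker2 (grid N n) z) +
      cplx (k\<^sup>2 / 2) * (\<Sum>n<N. (ker1 (grid N n) z)\<^sup>2 + (ker2 (grid N n) z)\<^sup>2)) \<le> core_error b"
proof -
  interpret noisy_recursion N z R y k "k * T" X Y using z XY by (rule recursion)
  note sm = small_dom[of X Y z, OF XY z]
  let ?D = "incr N k X Y z"
  let ?f = "\<lambda>n. ker1 (grid N n) z" and ?g = "\<lambda>n. ker2 (grid N n) z"
  let ?p = "\<lambda>n. green N k X Y z n" and ?h = "\<lambda>n. hop N k X Y z n"
  let ?M = "\<lambda>n. mstep N k X Y z n (X n) (Y n) (ma n) (mb n) (va n) (vb n)"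
  have b0: "0 \<le> b" using b(2)[of 0] by linarith
  have kT: "0 \<le> k * T" using k T by simp
  have eps0: "0 \<le> \<epsilon>"
  proof -
    have "0 \<le> (R + 1) / y * ((1 - y / (R + 1) / 2) ^ L * (R + 1) + 2 * (1 / (2 * y * real N)) / (y / (R + 1)))"
      using R y N by (intro mult_nonneg_nonneg add_nonneg_nonneg) (auto simp: field_simps)
    moreover have "0 \<le> 2 / (y / (R + 1)) * (3 * (k * T) + 1 / (2 * y * real N)) + 1 / (2 * y * real N)"
      using R y N k T by (intro mult_nonneg_nonneg add_nonneg_nonneg) auto
    ultimately show ?thesis using layer by linarith
  qed
  have D: "cmod (?D n) \<le> 6 * (k * T) / y" if "n < N" for n using incr_norm_le[OF sm that] by simp
  have D2: "cmod (?D n) \<le> 1 / 2" if "n < N" for n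
  proof -
    have "6 * (k * T) / y \<le> 1 / 2" using \<nu> y by (simp add: pos_divide_le_eq)
    then show ?thesis using D[OF that] by linarith
  qed
  have lin: "lin n = cplx (k * X n) * ?f n + cplx (k * Y n) * ?g n" for n
    by (rule lin_def[OF sm])
  \<comment> \<open>What centring leaves over: the given moments are only close to mean 0 and
    variance 1.\<close>
  define bias where "bias n = cplx k * ((?p n - ?f n) * cplx (ma n) + (?p n * ?h n - ?g n) * cplx (mb n)) +
     cplx (k\<^sup>2 / 2) * ((?f n)\<^sup>2 * cplx (va n - 1) +
       2 * (?f n * ?g n) * cplx (ma n * mb n) + (?g n)\<^sup>2 * cplx (vb n - 1))" for n
  have id: "?D n + (lin n)\<^sup>2 / 2 = ?M n + lin n + cplx (k\<^sup>2 / 2) * ((?f n)\<^sup>2 + (?g n)\<^sup>2) + bias n" for n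
    by (simp add: incr_def lin mstep_def bias_def power2_eq_square field_simps)
  have bias_le: "cmod (bias n) \<le> 8 * k * b / y + 2 * k\<^sup>2 * b / y\<^sup>2" if n: "n < N" for n
  proof -
    have f: "cmod (?f n) \<le> 1 / y" using ker1_norm_le[OF sm n] .
    have g: "cmod (?g n) \<le> 1 / y" using ker2_norm_le[OF sm n] f by linarith
    have mm: "\<bar>ma n * mb n\<bar> \<le> b * 1" unfolding abs_mult using b b0 by (intro mult_mono) (auto intro: order_trans)
    have t1: "cmod ((?p n - ?f n) * cplx (ma n)) \<le> 3 / y * b"
      unfolding norm_mult norm_of_real using green_crude(1)[OF sm n] b(2)[of n] y by (intro mult_mono) auto
    have t2: "cmod ((?p n * ?h n - ?g n) * cplx (mb n)) \<le> 5 / y * b"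
      unfolding norm_mult norm_of_real using green_crude(2)[OF sm n] b(3)[of n] y by (intro mult_mono) auto
    have s1: "cmod ((?f n)\<^sup>2 * cplx (va n - 1)) \<le> (1 / y)\<^sup>2 * b"
      unfolding norm_mult norm_of_real norm_power using f b(4)[of n] by (intro mult_mono power_mono) auto
    have s2: "cmod (2 * (?f n * ?g n) * cplx (ma n * mb n)) \<le> 2 * ((1 / y) * (1 / y)) * b"
      unfolding norm_mult norm_of_real norm_numeral using f g mm y by (intro mult_mono) auto
    \<comment> \<open>In step 0 there is no bound on \<open>vb 0 - 1\<close> beyond what the
      vanishing of \<open>ker2 0 z\<close> supplies.\<close>
    have s3: "cmod ((?g n)\<^sup>2 * cplx (vb n - 1)) \<le> (1 / y)\<^sup>2 * b"
    proof (cases "n = 0")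
      case False
      then show ?thesis unfolding norm_mult norm_of_real norm_power using g b(5)[of n] by (intro mult_mono power_mono) auto
    qed (use b0 in simp)
    have "cmod (bias n) \<le> k * (3 / y * b + 5 / y * b) + k\<^sup>2 / 2 * ((1 / y)\<^sup>2 * b + 2 * ((1 / y) * (1 / y)) * b + (1 / y)\<^sup>2 * b)"
      unfolding bias_def
    proof (intro order_trans[OF norm_triangle_ineq] add_mono)
      show "cmod (cplx k * ((?p n - ?f n) * cplx (ma n) + (?p n * ?h n - ?g n) * cplx (mb n))) \<le> k * (3 / y * b + 5 / y * b)"
        unfolding norm_mult[of "cplx k"] norm_of_real using k by (intro mult_mono order_trans[OF norm_triangle_ineq] add_mono t1 t2) auto
      show "cmod (cplx (k\<^sup>2 / 2) * ((?f n)\<^sup>2 * cplx (va n - 1) +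
          2 * (?f n * ?g n) * cplx (ma n * mb n) + (?g n)\<^sup>2 * cplx (vb n - 1)))
        \<le> k\<^sup>2 / 2 * ((1 / y)\<^sup>2 * b + 2 * ((1 / y) * (1 / y)) * b + (1 / y)\<^sup>2 * b)"
        unfolding norm_mult[of "cplx (k\<^sup>2 / 2)"] norm_of_real
        by (intro mult_mono order_trans[OF norm_triangle_ineq] add_mono s1 s2 s3) auto
    qed
    also have "\<dots> = 8 * k * b / y + 2 * k\<^sup>2 * b / y\<^sup>2"
      using y by (simp add: power2_eq_square field_simps)
    finally show ?thesis .
  qed
  define Q where "Q = (\<Sum>n<N. Ln (1 - ?D n))"
  have Qe: "(\<Prod>n<N. 1 - ?D n) = exp Q"
  proof -
    have "1 - ?D n = exp (Ln (1 - ?D n))" if "n < N" for n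
    proof -
      have "1 - ?D n \<noteq> 0" using D2[OF that] by auto
      then show ?thesis by simp
    qed
    then show ?thesis unfolding Q_def by (simp add: exp_sum)
  qed
  have eq: "Q + (\<Sum>n<N. ?M n) + (\<Sum>n<N. lin n) + cplx (k\<^sup>2 / 2) * (\<Sum>n<N. (?f n)\<^sup>2 + (?g n)\<^sup>2) =
    (\<Sum>n<N. Ln (1 - ?D n) + ?D n + (?D n)\<^sup>2 / 2) - (\<Sum>n<N. ((?D n)\<^sup>2 - (lin n)\<^sup>2) / 2) - (\<Sum>n<N. bias n)"
  proof -
    have "Q + (\<Sum>n<N. ?M n) + (\<Sum>n<N. lin n) + cplx (k\<^sup>2 / 2) * (\<Sum>n<N. (?f n)\<^sup>2 + (?g n)\<^sup>2) =
      (\<Sum>n<N. Ln (1 - ?D n) + ?M n + lin n + cplx (k\<^sup>2 / 2) * ((?f n)\<^sup>2 + (?g n)\<^sup>2))"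
      unfolding Q_def by (simp only: sum_distrib_left) (simp only: sum.distrib)
    also have "\<dots> = (\<Sum>n<N. (Ln (1 - ?D n) + ?D n + (?D n)\<^sup>2 / 2) - ((?D n)\<^sup>2 - (lin n)\<^sup>2) / 2 - bias n)"
    proof (intro sum.cong refl)
      fix n
      have "?M n + lin n + cplx (k\<^sup>2 / 2) * ((?f n)\<^sup>2 + (?g n)\<^sup>2) = ?D n + (lin n)\<^sup>2 / 2 - bias n"
        unfolding id by simp
      then have "Ln (1 - ?D n) + ?M n + lin n + cplx (k\<^sup>2 / 2) * ((?f n)\<^sup>2 + (?g n)\<^sup>2) = Ln (1 - ?D n) + (?D n + (lin n)\<^sup>2 / 2 - bias n)"
        by (simp only: add.assoc)
      then show "Ln (1 - ?D n) + ?M n + lin n + cplx (k\<^sup>2 / 2) * ((?f n)\<^sup>2 + (?g n)\<^sup>2) =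
          (Ln (1 - ?D n) + ?D n + (?D n)\<^sup>2 / 2) - ((?D n)\<^sup>2 - (lin n)\<^sup>2) / 2 - bias n"
        by (simp add: diff_divide_distrib)
    qed
    finally show ?thesis by (simp only: sum_subtractf)
  qed
  have e1: "cmod (\<Sum>n<N. Ln (1 - ?D n) + ?D n + (?D n)\<^sup>2 / 2) \<le> real N * (6 * (k * T) / y) ^ 3"
  proof -
    have "cmod (\<Sum>n<N. Ln (1 - ?D n) + ?D n + (?D n)\<^sup>2 / 2) \<le> (\<Sum>n<N. (6 * (k * T) / y) ^ 3)"
    proof (intro sum_norm_le)
      fix n assume "n \<in> {..<N}"
      then have n: "n < N" by simp
      show "cmod (Ln (1 - ?D n) + ?D n + (?D n)\<^sup>2 / 2) \<le> (6 * (k * T) / y) ^ 3"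
        using norm_Ln_one_minus[OF D2[OF n]] power_mono[OF D[OF n] norm_ge_zero, of 3] by linarith
    qed
    then show ?thesis by simp
  qed
  have e2: "cmod (\<Sum>n<N. ((?D n)\<^sup>2 - (lin n)\<^sup>2) / 2) \<le> 160 * \<epsilon> * (k * T)\<^sup>2 * real N / y\<^sup>2 + 32 * (k * T)\<^sup>2 / y\<^sup>2 * real L"
  proof -
    have "cmod (\<Sum>n<N. ((?D n)\<^sup>2 - (lin n)\<^sup>2) / 2) \<le> (\<Sum>n<N. cmod ((?D n)\<^sup>2 - (lin n)\<^sup>2) / 2)"
      by (intro sum_norm_le) (simp add: norm_divide)
    also have "\<dots> = (\<Sum>n<N. cmod ((?D n)\<^sup>2 - (lin n)\<^sup>2)) / 2" by (simp add: sum_divide_distrib)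
    also have "\<dots> \<le> (320 * \<epsilon> * (k * T)\<^sup>2 * real N / y\<^sup>2 + 64 * (k * T)\<^sup>2 / y\<^sup>2 * real L) / 2"
      by (intro divide_right_mono incr_square_diff_sum[OF sm near[of X Y z, OF XY z] eps0 \<epsilon> yN]) auto
    also have "\<dots> = 160 * \<epsilon> * (k * T)\<^sup>2 * real N / y\<^sup>2 + 32 * (k * T)\<^sup>2 / y\<^sup>2 * real L"
      by (simp add: add_divide_distrib mult_ac)
    finally show ?thesis .
  qed
  have e3: "cmod (\<Sum>n<N. bias n) \<le> real N * (8 * k * b / y + 2 * k\<^sup>2 * b / y\<^sup>2)"
  proof -
    have "cmod (\<Sum>n<N. bias n) \<le> (\<Sum>n<N. 8 * k * b / y + 2 * k\<^sup>2 * b / y\<^sup>2)"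
      by (intro sum_norm_le bias_le) auto
    then show ?thesis by simp
  qed
  have "cmod (Q + (\<Sum>n<N. ?M n) + (\<Sum>n<N. lin n) + cplx (k\<^sup>2 / 2) * (\<Sum>n<N. (?f n)\<^sup>2 + (?g n)\<^sup>2)) \<le> core_error b"
    unfolding eq core_error_def using e1 e2 e3
    by (intro order_trans[OF norm_triangle_ineq4] order_trans[OF add_mono[OF norm_triangle_ineq4 order_refl]]) linarith
  then show thesis using that[OF Qe] by (simp add: lin)
qed

end

section \<open>The matrix model\<close>

lemma (in prob_space) exp_tail:
  assumes [measurable]: "Z \<in> borel_measurable M" and A: "exp_moment M (\<lambda>\<xi>. Z \<xi>) \<le> ennreal A" "0 \<le> A"
  shows "emeasure M {\<xi> \<in> space M. x \<le> Z \<xi>} \<le> ennreal (A * exp (- x))"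
proof -
  have "emeasure M {\<xi> \<in> space M. x \<le> Z \<xi>} = emeasure M ({\<xi> \<in> space M. 1 \<le> ennreal (exp (- x)) * ennreal (exp (Z \<xi>))} \<inter> space M)"
  proof (intro arg_cong2[of _ _ _ _ emeasure] refl)
    have "x \<le> Z \<xi> \<longleftrightarrow> 1 \<le> ennreal (exp (- x)) * ennreal (exp (Z \<xi>))" for \<xi>
      by (simp add: ennreal_mult[symmetric] exp_add[symmetric] ennreal_ge_1)
    then show "{\<xi> \<in> space M. x \<le> Z \<xi>} = {\<xi> \<in> space M. 1 \<le> ennreal (exp (- x)) * ennreal (exp (Z \<xi>))} \<inter> space M" by auto
  qed
  also have "\<dots> \<le> ennreal (exp (- x)) * (\<integral>\<^sup>+\<xi>. ennreal (exp (Z \<xi>)) * indicator (space M) \<xi> \<partial>M)"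
    using nn_integral_Markov_inequality[of "\<lambda>\<xi>. ennreal (exp (Z \<xi>))" "space M" M "ennreal (exp (- x))"] by (simp add: Int_def conj_commute)
  also have "(\<integral>\<^sup>+\<xi>. ennreal (exp (Z \<xi>)) * indicator (space M) \<xi> \<partial>M) = exp_moment M (\<lambda>\<xi>. Z \<xi>)"
    by (intro nn_integral_cong) simp
  also have "ennreal (exp (- x)) * \<dots> \<le> ennreal (exp (- x)) * ennreal A" by (intro mult_left_mono A) simp
  also have "\<dots> = ennreal (A * exp (- x))" using A(2) by (simp add: ennreal_mult[symmetric] mult.commute)
  finally show ?thesis .
qed

lemma (in prob_space) abs_exp_bound:
  assumes [measurable]: "Z \<in> borel_measurable M"
    and A: "exp_moment M (\<lambda>\<xi>. \<tau> * Z \<xi>) \<le> ennreal A" "exp_moment M (\<lambda>\<xi>. - \<tau> * Z \<xi>) \<le> ennreal A" "0 \<le> A" "0 < \<tau>"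
  shows "exp_moment M (\<lambda>\<xi>. \<tau> * \<bar>Z \<xi>\<bar>) \<le> ennreal (2 * A)"
proof -
  have "exp_moment M (\<lambda>\<xi>. \<tau> * \<bar>Z \<xi>\<bar>) \<le> (\<integral>\<^sup>+\<xi>. ennreal (exp (\<tau> * Z \<xi>)) + ennreal (exp (- \<tau> * Z \<xi>)) \<partial>M)"
    by (intro nn_integral_mono) (auto simp: abs_if add_increasing add_increasing2)
  also have "\<dots> = exp_moment M (\<lambda>\<xi>. \<tau> * Z \<xi>) + exp_moment M (\<lambda>\<xi>. - \<tau> * Z \<xi>)"
    by (rule nn_integral_add) auto
  also have "\<dots> \<le> ennreal A + ennreal A" by (intro add_mono A)
  also have "\<dots> = ennreal (2 * A)" using A(3) by (simp only: mult_2 ennreal_plus)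
  finally show ?thesis .
qed

definition trunc :: "real \<Rightarrow> real \<Rightarrow> real" where
  "trunc T x = (if \<bar>x\<bar> \<le> T then x else 0)"

lemma trunc_abs_le: "0 \<le> T \<Longrightarrow> \<bar>trunc T x\<bar> \<le> T"
  by (simp add: trunc_def)

lemma trunc_measurable [measurable]: "trunc T \<in> borel_measurable borel"
  unfolding trunc_def[abs_def] by measurable

lemma exp_ge_square: "x\<^sup>2 \<le> 2 * exp x" if "0 \<le> x" for x :: real
  using exp_lower_Taylor_quadratic[OF that] that by simp

text \<open>Beyond \<open>T\<close> one has \<open>exp (\<tau> * |x|) \<le> exp (- \<tau> * T) * exp
  (2 * \<tau> * |x|)\<close>. Half of the available exponential moment pays for \<open>|x|\<close>
  or \<open>x^2\<close>, the other half gives the decay in \<open>T\<close>.\<close>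

lemma (in prob_space) trunc_bias:
  assumes Zm [measurable]: "Z \<in> borel_measurable M"
    and A: "exp_moment M (\<lambda>\<xi>. 2 * \<tau> * \<bar>Z \<xi>\<bar>) \<le> ennreal A" "0 \<le> A" and \<tau>: "0 < \<tau>" and T: "0 \<le> T"
    and int: "integrable M Z" "integrable M (\<lambda>\<xi>. (Z \<xi>)\<^sup>2)"
  shows "\<bar>expectation (\<lambda>\<xi>. trunc T (Z \<xi>)) - expectation Z\<bar> \<le> A * exp (- \<tau> * T) / \<tau>"
    "\<bar>expectation (\<lambda>\<xi>. (trunc T (Z \<xi>))\<^sup>2) - expectation (\<lambda>\<xi>. (Z \<xi>)\<^sup>2)\<bar> \<le> 2 * A * exp (- \<tau> * T) / \<tau>\<^sup>2"
proof -
  have intE: "integrable M (\<lambda>\<xi>. exp (2 * \<tau> * \<bar>Z \<xi>\<bar>))"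
    using A by (intro integrableI_nonneg) (auto simp: le_less_trans)
  have EA: "expectation (\<lambda>\<xi>. exp (2 * \<tau> * \<bar>Z \<xi>\<bar>)) \<le> A"
    using nn_integral_eq_integral[OF intE] A by simp
  have bT: "exp (\<tau> * \<bar>x\<bar>) \<le> exp (- \<tau> * T) * exp (2 * \<tau> * \<bar>x\<bar>)" if "T < \<bar>x\<bar>" for x
    using that \<tau> by (simp add: exp_add[symmetric])
  have b1: "\<bar>trunc T x - x\<bar> \<le> exp (- \<tau> * T) / \<tau> * exp (2 * \<tau> * \<bar>x\<bar>)" for x
  proof (cases "\<bar>x\<bar> \<le> T")
    case True
    then show ?thesis using \<tau> by (simp add: trunc_def)
  next
    case False
    have "\<tau> * \<bar>x\<bar> \<le> exp (\<tau> * \<bar>x\<bar>)" using exp_ge_add_one_self[of "\<tau> * \<bar>x\<bar>"] by linarith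
    then have "\<tau> * \<bar>x\<bar> \<le> exp (- \<tau> * T) * exp (2 * \<tau> * \<bar>x\<bar>)" using bT[of x] False by linarith
    then have "\<bar>x\<bar> \<le> exp (- \<tau> * T) * exp (2 * \<tau> * \<bar>x\<bar>) / \<tau>" using \<tau> by (simp add: pos_le_divide_eq mult.commute)
    then show ?thesis using False by (simp add: trunc_def)
  qed
  have b2: "\<bar>(trunc T x)\<^sup>2 - x\<^sup>2\<bar> \<le> 2 * exp (- \<tau> * T) / \<tau>\<^sup>2 * exp (2 * \<tau> * \<bar>x\<bar>)" for x
  proof (cases "\<bar>x\<bar> \<le> T")
    case True
    then show ?thesis using \<tau> by (simp add: trunc_def)
  next
    case False
    have "(\<tau> * \<bar>x\<bar>)\<^sup>2 \<le> 2 * exp (\<tau> * \<bar>x\<bar>)" using \<tau> by (intro exp_ge_square) auto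
    then have "\<tau>\<^sup>2 * x\<^sup>2 \<le> 2 * (exp (- \<tau> * T) * exp (2 * \<tau> * \<bar>x\<bar>))" using bT[of x] False by (simp add: power_mult_distrib)
    then have "x\<^sup>2 \<le> 2 * (exp (- \<tau> * T) * exp (2 * \<tau> * \<bar>x\<bar>)) / \<tau>\<^sup>2" using \<tau> by (simp add: pos_le_divide_eq mult.commute)
    then show ?thesis using False by (simp add: trunc_def)
  qed
  have it1: "integrable M (\<lambda>\<xi>. trunc T (Z \<xi>))"
    using trunc_abs_le[OF T] by (auto intro!: integrable_const_bound[where B = T])
  have it2: "integrable M (\<lambda>\<xi>. (trunc T (Z \<xi>))\<^sup>2)"
    using power_mono[OF trunc_abs_le[OF T] abs_ge_zero, of _ 2]
    by (auto intro!: integrable_const_bound[where B = "T\<^sup>2"])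
  note it = it1 it2
  have "\<bar>expectation (\<lambda>\<xi>. trunc T (Z \<xi>)) - expectation Z\<bar> = \<bar>expectation (\<lambda>\<xi>. trunc T (Z \<xi>) - Z \<xi>)\<bar>"
    using it int by simp
  also have "\<dots> \<le> expectation (\<lambda>\<xi>. exp (- \<tau> * T) / \<tau> * exp (2 * \<tau> * \<bar>Z \<xi>\<bar>))"
    using b1 it int intE by (intro order_trans[OF integral_abs_bound] integral_mono) auto
  also have "\<dots> = exp (- \<tau> * T) / \<tau> * expectation (\<lambda>\<xi>. exp (2 * \<tau> * \<bar>Z \<xi>\<bar>))" by simp
  also have "\<dots> \<le> exp (- \<tau> * T) / \<tau> * A" using EA \<tau> by (intro mult_left_mono) auto
  finally show "\<bar>expectation (\<lambda>\<xi>. trunc T (Z \<xi>)) - expectation Z\<bar> \<le> A * exp (- \<tau> * T) / \<tau>" by (simp add: mult.commute)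
  have "\<bar>expectation (\<lambda>\<xi>. (trunc T (Z \<xi>))\<^sup>2) - expectation (\<lambda>\<xi>. (Z \<xi>)\<^sup>2)\<bar> = \<bar>expectation (\<lambda>\<xi>. (trunc T (Z \<xi>))\<^sup>2 - (Z \<xi>)\<^sup>2)\<bar>"
    using it int by simp
  also have "\<dots> \<le> expectation (\<lambda>\<xi>. 2 * exp (- \<tau> * T) / \<tau>\<^sup>2 * exp (2 * \<tau> * \<bar>Z \<xi>\<bar>))"
    using b2 it int intE by (intro order_trans[OF integral_abs_bound] integral_mono) auto
  also have "\<dots> = 2 * exp (- \<tau> * T) / \<tau>\<^sup>2 * expectation (\<lambda>\<xi>. exp (2 * \<tau> * \<bar>Z \<xi>\<bar>))" by simp
  also have "\<dots> \<le> 2 * exp (- \<tau> * T) / \<tau>\<^sup>2 * A" using EA \<tau> by (intro mult_left_mono) auto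
  finally show "\<bar>expectation (\<lambda>\<xi>. (trunc T (Z \<xi>))\<^sup>2) - expectation (\<lambda>\<xi>. (Z \<xi>)\<^sup>2)\<bar> \<le> 2 * A * exp (- \<tau> * T) / \<tau>\<^sup>2" by (simp add: mult_ac)
qed

section \<open>Brownian scaling, and moments of the matrix entries\<close>

context brownian_motion
begin

lemma rescaled_gaussian_increments:
  assumes N: "0 < N"
  shows "gaussian_increments M (rescaled N B)"
proof
  fix t :: real assume "0 \<le> t"
  then show "rescaled N B t \<in> borel_measurable M"
    unfolding rescaled_def[abs_def] using measurable_at[of "t * real N"] by simp
next
  fix s t :: real assume st: "0 \<le> s" "s < t"
  have p: "0 \<le> s * real N" "s * real N < t * real N" "0 < sqrt (t * real N - s * real N)" "1 / sqrt (real N) \<noteq> 0"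
    using st N by auto
  from normal_density_affine[OF gaussian_increments[OF p(1,2)] p(3,4), of 0]
  have "distributed M lborel (\<lambda>\<xi>. 0 + 1 / sqrt (real N) * (B (t * real N) \<xi> - B (s * real N) \<xi>))
    (normal_density (0 + 1 / sqrt (real N) * 0) (\<bar>1 / sqrt (real N)\<bar> * sqrt (t * real N - s * real N)))" .
  moreover have "\<bar>1 / sqrt (real N)\<bar> * sqrt (t * real N - s * real N) = sqrt (t - s)"
    using N by (simp add: left_diff_distrib[symmetric] real_sqrt_mult)
  ultimately show "distributed M lborel (\<lambda>\<xi>. rescaled N B t \<xi> - rescaled N B s \<xi>) (normal_density 0 (sqrt (t - s)))"
    by (simp add: rescaled_def diff_divide_distrib)
next
  fix t :: "nat \<Rightarrow> real" assume t: "0 \<le> t 0" "mono t"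
  have "mono (\<lambda>i. t i * real N)" using t(2) by (auto simp: mono_def intro: mult_right_mono)
  moreover have "0 \<le> t 0 * real N" using t by simp
  ultimately have "indep_vars (\<lambda>_. borel) (\<lambda>i \<xi>. B (t (Suc i) * real N) \<xi> - B (t i * real N) \<xi>) UNIV"
    using indep_increments[of "\<lambda>i. t i * real N"] by simp
  from indep_vars_compose2[OF this, of "\<lambda>_ x. x / sqrt (real N)" "\<lambda>_. borel"]
  show "indep_vars (\<lambda>_. borel) (\<lambda>i \<xi>. rescaled N B (t (Suc i)) \<xi> - rescaled N B (t i) \<xi>) UNIV"
    by (simp add: rescaled_def diff_divide_distrib)
qed

end

context gbe_coupling
begin

text \<open>A step integral is a measurable function of finitely many coordinates of its path, so
  the independence of the two paths passes to step integrals.\<close>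

lemma gaussian_pair_rescaled:
  assumes N: "0 < N"
  shows "gaussian_pair M (rescaled N Xhat) (rescaled N Yhat)"
proof -
  interpret BX: brownian_motion M Xhat by (rule Xhat_bm)
  interpret BY: brownian_motion M Yhat by (rule Yhat_bm)
  interpret X: gaussian_increments M "rescaled N Xhat" by (rule BX.rescaled_gaussian_increments[OF N])
  interpret Y: gaussian_increments M "rescaled N Yhat" by (rule BY.rescaled_gaussian_increments[OF N])
  show ?thesis
  proof
    fix n n' :: nat and c c' :: "nat \<Rightarrow> complex" and t t' :: "nat \<Rightarrow> real" assume t: "mono t" "range t \<subseteq> {0..1 :: real}" "mono t'" "range t' \<subseteq> {0..1 :: real}"
    have t0: "0 \<le> t i" "0 \<le> t' i" for i using t by (auto simp: subset_iff)
    define F where "F n c t p = (\<Sum>i<n. c i * cplx ((p (t (Suc i) * real N) - p (t i * real N)) / sqrt (real N)))"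
      for n :: nat and c :: "nat \<Rightarrow> complex" and t :: "nat \<Rightarrow> real" and p :: "real \<Rightarrow> real"
    have Fm: "F n c t \<in> borel_measurable (PiM {0..} (\<lambda>_. borel))" if "\<And>i. 0 \<le> t i" for n c t
    proof -
      have "(\<lambda>p. p (t i * real N)) \<in> borel_measurable (PiM {0..} (\<lambda>_. borel :: real measure))" for i
        using that[of i] by (intro measurable_component_singleton) simp
      then show ?thesis unfolding F_def by measurable
    qed
    have Fe: "F n c t (\<lambda>u\<in>{0..}. B u \<xi>) = step_integral (rescaled N B) n c t \<xi>" if "\<And>i. 0 \<le> t i" for n c t B \<xi>
      using that by (simp add: F_def step_integral_def rescaled_def diff_divide_distrib)
    have "indep_var borel (F n c t \<circ> (\<lambda>\<xi>. \<lambda>t\<in>{0..}. Xhat t \<xi>)) borel (F n' c' t' \<circ> (\<lambda>\<xi>. \<lambda>t\<in>{0..}. Yhat t \<xi>))"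
      using t0 by (intro indep_var_compose[OF indep_bm] Fm) auto
    moreover have "F n c t \<circ> (\<lambda>\<xi>. \<lambda>t\<in>{0..}. Xhat t \<xi>) = step_integral (rescaled N Xhat) n c t"
      by (rule ext, unfold comp_def, rule Fe, rule t0(1))
    moreover have "F n' c' t' \<circ> (\<lambda>\<xi>. \<lambda>t\<in>{0..}. Yhat t \<xi>) = step_integral (rescaled N Yhat) n' c' t'"
      by (rule ext, unfold comp_def, rule Fe, rule t0(2))
    ultimately show "indep_var borel (step_integral (rescaled N Xhat) n c t) borel (step_integral (rescaled N Yhat) n' c' t')"
      by simp
  qed
qed

lemma b_measurable: "1 \<le> k \<Longrightarrow> b k \<in> borel_measurable M"
  using distributed_measurable[OF b_distr[of k]] by simp

lemma a_measurable: "1 \<le> k \<Longrightarrow> a k \<in> borel_measurable M"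
  using distributed_measurable[OF a_distr[of k]] by simp

lemma X_var_distr: "1 \<le> k \<Longrightarrow> distributed M lborel (X_var b k) std_normal_density"
  using normal_standard_normal_convert[of "sqrt 2" "b k" 0] b_distr[of k] by (simp add: X_var_def[abs_def])

text \<open>The Gaussian exponent \<open>t^2 / 2\<close> is weakened to the one of
  \<open>step_Y_exp\<close>, so that both kinds of noise share their constants.\<close>

lemma X_var_exp:
  assumes "1 \<le> k"
  shows "exp_moment M (\<lambda>\<xi>. t * X_var b k \<xi>) \<le> ennreal (exp (2 * t\<^sup>2))"
proof -
  have D: "distributed M lborel (X_var b k) (normal_density 0 1)" using X_var_distr[OF assms] by simp
  have one_pos: "(0::real) < 1" by simp
  note n = normal_cexp[OF D, of "cplx t"]
  have e: "exp (cplx t * cplx (X_var b k \<xi>)) = cplx (exp (t * X_var b k \<xi>))" for \<xi>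
    by (simp add: exp_of_real[symmetric])
  have int: "integrable M (\<lambda>\<xi>. exp (t * X_var b k \<xi>))"
  proof -
    have "integrable M (\<lambda>\<xi>. Re (exp (cplx t * cplx (X_var b k \<xi>))))"
      by (rule integrable_Re[OF n(1)[OF one_pos]])
    then show ?thesis unfolding e Re_complex_of_real .
  qed
  have "cplx (expectation (\<lambda>\<xi>. exp (t * X_var b k \<xi>))) = cplx (exp (t\<^sup>2 / 2))"
  proof -
    have "cplx (expectation (\<lambda>\<xi>. exp (t * X_var b k \<xi>))) = expectation (\<lambda>\<xi>. cplx (exp (t * X_var b k \<xi>)))"
      by (rule integral_of_real[OF int, symmetric])
    also have "\<dots> = cplx (exp (t\<^sup>2 / 2))"
      using n(2)[OF one_pos] unfolding e by (simp add: exp_of_real[symmetric])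
    finally show ?thesis .
  qed
  then have "expectation (\<lambda>\<xi>. exp (t * X_var b k \<xi>)) = exp (t\<^sup>2 / 2)" by (simp only: of_real_eq_iff)
  also have "\<dots> \<le> exp (2 * t\<^sup>2)" by simp
  finally show ?thesis using nn_integral_eq_integral[OF int] by (simp add: ennreal_leI)
qed

lemma X_var_moments:
  assumes "1 \<le> k"
  shows "integrable M (X_var b k)" "expectation (X_var b k) = 0"
    "integrable M (\<lambda>\<xi>. (X_var b k \<xi>)\<^sup>2)" "expectation (\<lambda>\<xi>. (X_var b k \<xi>)\<^sup>2) = 1"
proof -
  have D: "distributed M lborel (X_var b k) (\<lambda>x. ennreal (std_normal_density x))" using X_var_distr[OF assms] by simp
  show "integrable M (X_var b k)" "expectation (X_var b k) = 0"
    using distributed_integrable[OF D, of "\<lambda>x. x"] distributed_integral[OF D, of "\<lambda>x. x"]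
      integrable_std_normal_moment[of 1] integral_std_normal_moment_odd[of 0] by auto
  show "integrable M (\<lambda>\<xi>. (X_var b k \<xi>)\<^sup>2)" "expectation (\<lambda>\<xi>. (X_var b k \<xi>)\<^sup>2) = 1"
    using distributed_integrable[OF D, of "\<lambda>x. x\<^sup>2"] distributed_integral[OF D, of "\<lambda>x. x\<^sup>2"]
      integrable_std_normal_moment[of 2] integral_std_normal_moment_even[of 1] by auto
qed

text \<open>Shifted by one, so that step \<open>n\<close> uses \<open>a n\<close>. In step 0 there
  is no off-diagonal entry and the value is 0.\<close>

definition step_Y :: "nat \<Rightarrow> 'a \<Rightarrow> real" where
  "step_Y n \<xi> = Y_var \<beta> a (Suc n) \<xi>"

lemma step_Y_eq: "step_Y n \<xi> = (if n = 0 then 0 else ((a n \<xi>)\<^sup>2 - \<beta> * real n) / sqrt (2 * (\<beta> * real n)))"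
  by (simp add: step_Y_def Y_var_def mult.assoc)

lemma step_Y_exp:
  assumes \<beta>: "0 < \<beta>" and t: "\<bar>t\<bar> \<le> sqrt (2 * \<beta>) / 4"
  shows "exp_moment M (\<lambda>\<xi>. t * step_Y n \<xi>) \<le> ennreal (exp (2 * t\<^sup>2))"
proof (cases "n = 0")
  case True
  then show ?thesis by (simp add: step_Y_eq emeasure_space_1 ennreal_ge_1)
next
  case False
  then have n: "1 \<le> n" by simp
  have "0 < \<beta> * real n" using \<beta> n by simp
  moreover have "sqrt (2 * \<beta>) \<le> sqrt (2 * (\<beta> * real n))" using \<beta> n by simp
  then have "\<bar>t\<bar> \<le> sqrt (2 * (\<beta> * real n)) / 4" using t by linarith
  ultimately show ?thesis using chi_square_exp[OF a_distr[OF n]] False by (simp add: step_Y_eq)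
qed

lemma step_Y_moments:
  assumes \<beta>: "0 < \<beta>"
  shows "step_Y n \<in> borel_measurable M" "integrable M (step_Y n)" "expectation (step_Y n) = 0"
    "integrable M (\<lambda>\<xi>. (step_Y n \<xi>)\<^sup>2)" "0 < n \<Longrightarrow> expectation (\<lambda>\<xi>. (step_Y n \<xi>)\<^sup>2) = 1"
proof -
  have *: "step_Y n \<in> borel_measurable M \<and> integrable M (step_Y n) \<and> expectation (step_Y n) = 0 \<and>
    integrable M (\<lambda>\<xi>. (step_Y n \<xi>)\<^sup>2) \<and> (0 < n \<longrightarrow> expectation (\<lambda>\<xi>. (step_Y n \<xi>)\<^sup>2) = 1)"
  proof (cases "n = 0")
    case True
    then have "step_Y n = (\<lambda>_. 0)" by (simp add: step_Y_eq fun_eq_iff)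
    then show ?thesis using True by simp
  next
    case False
    then have n: "1 \<le> n" by simp
    define p where "p = \<beta> * real n"
    have p: "0 < p" using \<beta> n by (simp add: p_def)
    note [measurable] = a_measurable[OF n]
    note m = chi_square_moments[OF a_distr[OF n, folded p_def] p]
    have e: "step_Y n = (\<lambda>\<xi>. ((a n \<xi>)\<^sup>2 - p) / sqrt (2 * p))" using False by (simp add: step_Y_eq fun_eq_iff p_def)
    have e2: "(((a n \<xi>)\<^sup>2 - p) / sqrt (2 * p))\<^sup>2 = ((a n \<xi>) ^ 4 - 2 * p * (a n \<xi>)\<^sup>2 + p\<^sup>2) / (2 * p)" for \<xi>
      using p by (simp add: power_divide power2_diff power4_eq_xxxx power2_eq_square algebra_simps)
    have "expectation (\<lambda>\<xi>. ((a n \<xi>) ^ 4 - 2 * p * (a n \<xi>)\<^sup>2 + p\<^sup>2) / (2 * p)) = (p * (p + 2) - 2 * p * p + p\<^sup>2) / (2 * p)"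
      using m by (simp add: prob_space)
    also have "\<dots> = 1" using p by (simp add: power2_eq_square field_simps)
    finally show ?thesis unfolding e e2 using m p by (simp add: prob_space)
  qed
  then show "step_Y n \<in> borel_measurable M" "integrable M (step_Y n)" "expectation (step_Y n) = 0"
    "integrable M (\<lambda>\<xi>. (step_Y n \<xi>)\<^sup>2)" "0 < n \<Longrightarrow> expectation (\<lambda>\<xi>. (step_Y n \<xi>)\<^sup>2) = 1" by auto
qed

end

lemma Re_mult_of_real: "Re (c * cplx r) = Re c * r"
  by simp

text \<open>Five centred quantities of the current step with coefficients that depend only on the
  past. In this form the vanishing of the mean with frozen past is plain linearity.\<close>

lemma Re_mstep:
  "Re (s * mstep N k X Y z n a b ma mb va vb) =
     Re (s * cplx k * (green N k X Y z n - ker1 (grid N n) z)) * (a - ma) +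
     Re (s * cplx k * (green N k X Y z n * hop N k X Y z n - ker2 (grid N n) z)) * (b - mb) +
     Re (s * cplx (k\<^sup>2 / 2) * (ker1 (grid N n) z)\<^sup>2) * (a\<^sup>2 - va) +
     Re (s * cplx (k\<^sup>2 / 2) * (2 * (ker1 (grid N n) z * ker2 (grid N n) z))) * (a * b - ma * mb) +
     Re (s * cplx (k\<^sup>2 / 2) * (ker2 (grid N n) z)\<^sup>2) * (b\<^sup>2 - vb)"
proof -
  have "s * mstep N k X Y z n a b ma mb va vb =
     s * cplx k * (green N k X Y z n - ker1 (grid N n) z) * cplx (a - ma) +
     s * cplx k * (green N k X Y z n * hop N k X Y z n - ker2 (grid N n) z) * cplx (b - mb) +
     s * cplx (k\<^sup>2 / 2) * (ker1 (grid N n) z)\<^sup>2 * cplx (a\<^sup>2 - va) +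
     s * cplx (k\<^sup>2 / 2) * (2 * (ker1 (grid N n) z * ker2 (grid N n) z)) * cplx (a * b - ma * mb) +
     s * cplx (k\<^sup>2 / 2) * (ker2 (grid N n) z)\<^sup>2 * cplx (b\<^sup>2 - vb)"
    unfolding mstep_def by (simp only: distrib_left mult.assoc add.assoc)
  then show ?thesis by (simp only: plus_complex.simps Re_mult_of_real)
qed

section \<open>The martingale of the truncated recursion\<close>

context gbe_coupling
begin

text \<open>Coordinates \<open>Inl k\<close> and \<open>Inr k\<close> stand for the matrix entries \<open>b k\<close> and \<open>a k\<close>; the \<open>n\<close>-th step of
  the recursion reveals \<open>b (n + 1)\<close> and \<open>a n\<close>.\<close>

definition past :: "nat \<Rightarrow> (nat + nat) set" where
  "past n = Inl ` {1..n} \<union> Inr ` {1..<n}"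

definition fresh :: "nat \<Rightarrow> (nat + nat) set" where
  "fresh n = insert (Inl (Suc n)) (if 0 < n then {Inr n} else {})"

text \<open>\<open>x_of\<close> and \<open>y_of\<close> are the truncated noise as functions of an
  abstract coordinate vector, so that the past can be frozen in \<open>Azuma_exp_bound\<close>;
  \<open>xt\<close> and \<open>yt\<close> are the same along an outcome.\<close>

definition x_of :: "real \<Rightarrow> (nat + nat \<Rightarrow> real) \<Rightarrow> nat \<Rightarrow> real" where
  "x_of T q n = trunc T (q (Inl (Suc n)) / sqrt 2)"

definition y_of :: "real \<Rightarrow> (nat + nat \<Rightarrow> real) \<Rightarrow> nat \<Rightarrow> real" where
  "y_of T q n = trunc T (if n = 0 then 0 else ((q (Inr n))\<^sup>2 - \<beta> * real n) / sqrt (2 * (\<beta> * real n)))"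

definition xt :: "real \<Rightarrow> 'a \<Rightarrow> nat \<Rightarrow> real" where
  "xt T \<xi> n = trunc T (X_var b (Suc n) \<xi>)"

definition yt :: "real \<Rightarrow> 'a \<Rightarrow> nat \<Rightarrow> real" where
  "yt T \<xi> n = trunc T (step_Y n \<xi>)"

text \<open>The exact moments of the truncated noise make every step exactly centred, and the
  truncation makes the sum holomorphic in \<open>z\<close> for every outcome.\<close>

definition mart :: "nat \<Rightarrow> real \<Rightarrow> real \<Rightarrow> complex \<Rightarrow> 'a \<Rightarrow> complex" where
  "mart N k T z \<xi> = (\<Sum>n<N. mstep N k (xt T \<xi>) (yt T \<xi>) z n (xt T \<xi> n) (yt T \<xi> n)
     (expectation (\<lambda>\<xi>. xt T \<xi> n)) (expectation (\<lambda>\<xi>. yt T \<xi> n))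
     (expectation (\<lambda>\<xi>. (xt T \<xi> n)\<^sup>2)) (expectation (\<lambda>\<xi>. (yt T \<xi> n)\<^sup>2)))"

lemma xt_eq: "x_of T (\<lambda>i. case_sum b a i \<xi>) n = xt T \<xi> n"
  by (simp add: x_of_def xt_def X_var_def)

lemma yt_eq: "y_of T (\<lambda>i. case_sum b a i \<xi>) n = yt T \<xi> n"
  by (simp add: y_of_def yt_def step_Y_eq)

lemma past_mem: "m < n \<Longrightarrow> Inl (Suc m) \<in> past n" "m < n \<Longrightarrow> 0 < m \<Longrightarrow> Inr m \<in> past n"
  by (auto simp: past_def)

lemma fresh_mem: "Inl (Suc n) \<in> fresh n" "0 < n \<Longrightarrow> Inr n \<in> fresh n"
  by (auto simp: fresh_def)

lemma x_of_restrict: "Inl (Suc n) \<in> A \<Longrightarrow> x_of T (restrict q A) n = x_of T q n"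
  by (simp add: x_of_def)

lemma y_of_restrict: "(0 < n \<Longrightarrow> Inr n \<in> A) \<Longrightarrow> y_of T (restrict q A) n = y_of T q n"
  by (cases "n = 0") (simp_all add: y_of_def)

lemma x_of_measurable: "Inl (Suc n) \<in> A \<Longrightarrow> (\<lambda>q. x_of T q n) \<in> borel_measurable (PiM A (\<lambda>_. borel))"
proof -
  assume A: "Inl (Suc n) \<in> A"
  have [measurable]: "(\<lambda>q. q (Inl (Suc n))) \<in> borel_measurable (PiM A (\<lambda>_. borel :: real measure))"
    by (rule measurable_component_singleton[OF A])
  show ?thesis unfolding x_of_def by measurable
qed

lemma y_of_measurable: "(0 < n \<Longrightarrow> Inr n \<in> A) \<Longrightarrow> (\<lambda>q. y_of T q n) \<in> borel_measurable (PiM A (\<lambda>_. borel))"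
proof (cases "n = 0")
  case False
  assume "0 < n \<Longrightarrow> Inr n \<in> A"
  then have A: "Inr n \<in> A" using False by simp
  have [measurable]: "(\<lambda>q. q (Inr n)) \<in> borel_measurable (PiM A (\<lambda>_. borel :: real measure))"
    by (rule measurable_component_singleton[OF A])
  show ?thesis unfolding y_of_def using False by simp
qed (simp add: y_of_def)

lemma xt_measurable [measurable]: "(\<lambda>\<xi>. xt T \<xi> n) \<in> borel_measurable M"
  using b_measurable[of "Suc n"] unfolding xt_def X_var_def by simp

lemma yt_measurable [measurable]: "0 < \<beta> \<Longrightarrow> (\<lambda>\<xi>. yt T \<xi> n) \<in> borel_measurable M"
  using step_Y_moments(1)[of n] unfolding yt_def by simp

lemma xt_bound: "0 \<le> T \<Longrightarrow> \<bar>xt T \<xi> n\<bar> \<le> T" and yt_bound: "0 \<le> T \<Longrightarrow> \<bar>yt T \<xi> n\<bar> \<le> T"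
  by (auto simp: xt_def yt_def trunc_abs_le)

lemma ratio_measurable:
  "m < n \<Longrightarrow> (\<lambda>q. ratio N k (x_of T q) (y_of T q) z m) \<in> borel_measurable (PiM (past n) (\<lambda>_. borel))"
proof (induction m)
  case 0
  then have [measurable]: "(\<lambda>q. x_of T q 0) \<in> borel_measurable (PiM (past n) (\<lambda>_. borel))"
    by (intro x_of_measurable past_mem)
  show ?case by simp
next
  case (Suc m)
  then have [measurable]: "(\<lambda>q. x_of T q (Suc m)) \<in> borel_measurable (PiM (past n) (\<lambda>_. borel))"
    "(\<lambda>q. y_of T q (Suc m)) \<in> borel_measurable (PiM (past n) (\<lambda>_. borel))"
    "(\<lambda>q. ratio N k (x_of T q) (y_of T q) z m) \<in> borel_measurable (PiM (past n) (\<lambda>_. borel))"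
    by (auto intro!: x_of_measurable y_of_measurable past_mem)
  show ?case by simp
qed

lemma green_hop_measurable:
  "(\<lambda>q. green N k (x_of T q) (y_of T q) z n) \<in> borel_measurable (PiM (past n) (\<lambda>_. borel))"
  "(\<lambda>q. hop N k (x_of T q) (y_of T q) z n) \<in> borel_measurable (PiM (past n) (\<lambda>_. borel))"
proof -
  have *: "(\<lambda>q. green N k (x_of T q) (y_of T q) z n) \<in> borel_measurable (PiM (past n) (\<lambda>_. borel)) \<and>
    (\<lambda>q. hop N k (x_of T q) (y_of T q) z n) \<in> borel_measurable (PiM (past n) (\<lambda>_. borel))"
  proof (cases "n = 0")
    case False
    then have [measurable]: "(\<lambda>q. ratio N k (x_of T q) (y_of T q) z (n - 1)) \<in> borel_measurable (PiM (past n) (\<lambda>_. borel))"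
      by (intro ratio_measurable) simp
    show ?thesis unfolding green_def hop_def by (intro conjI) measurable
  qed (simp add: green_def hop_def)
  then show "(\<lambda>q. green N k (x_of T q) (y_of T q) z n) \<in> borel_measurable (PiM (past n) (\<lambda>_. borel))"
    "(\<lambda>q. hop N k (x_of T q) (y_of T q) z n) \<in> borel_measurable (PiM (past n) (\<lambda>_. borel))" by auto
qed

text \<open>Centres the cross term of the quadratic part: the two entries revealed in one step are
  independent.\<close>

lemma xt_yt_uncorrelated:
  assumes \<beta>: "0 < \<beta>" and T: "0 \<le> T"
  shows "expectation (\<lambda>\<xi>. xt T \<xi> n * yt T \<xi> n) = expectation (\<lambda>\<xi>. xt T \<xi> n) * expectation (\<lambda>\<xi>. yt T \<xi> n)"
proof (cases "n = 0")
  case True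
  then have "yt T \<xi> n = 0" for \<xi> by (simp add: yt_def step_Y_eq trunc_def)
  then show ?thesis by simp
next
  case False
  let ?I = "{Inl (Suc n), Inr n} :: (nat + nat) set"
  define F where "F i r = (case i of Inl _ \<Rightarrow> trunc T (r / sqrt 2) | Inr n \<Rightarrow> trunc T ((r\<^sup>2 - \<beta> * real n) / sqrt (2 * (\<beta> * real n))))"
    for i :: "nat + nat" and r :: real
  have Fm: "F i \<in> borel_measurable borel" for i unfolding F_def by (cases i) auto
  have sub: "?I \<subseteq> {1..} <+> {1..}" using False by auto
  have "indep_vars (\<lambda>_. borel) (\<lambda>i \<xi>. F i (case_sum b a i \<xi>)) ?I"
    by (intro indep_vars_compose2[OF indep_vars_subset[OF indep_entries sub]] Fm)
  moreover have e: "(\<lambda>\<xi>. F (Inl (Suc n)) (case_sum b a (Inl (Suc n)) \<xi>)) = (\<lambda>\<xi>. xt T \<xi> n)"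
    "(\<lambda>\<xi>. F (Inr n) (case_sum b a (Inr n) \<xi>)) = (\<lambda>\<xi>. yt T \<xi> n)"
    using False by (simp_all add: F_def xt_def yt_def X_var_def step_Y_eq)
  moreover have int: "integrable M (\<lambda>\<xi>. xt T \<xi> n)" "integrable M (\<lambda>\<xi>. yt T \<xi> n)"
    using xt_bound[OF T] yt_bound[OF T] \<beta> by (auto intro!: integrable_const_bound[where B = T])
  have intF: "integrable M (\<lambda>\<xi>. F i (case_sum b a i \<xi>))" if "i \<in> ?I" for i
    using that int e by auto
  ultimately have "expectation (\<lambda>\<xi>. \<Prod>i\<in>?I. F i (case_sum b a i \<xi>)) = (\<Prod>i\<in>?I. expectation (\<lambda>\<xi>. F i (case_sum b a i \<xi>)))"
    by (intro indep_vars_lebesgue_integral) auto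
  moreover have "(\<Prod>i\<in>?I. F i (case_sum b a i \<xi>)) = xt T \<xi> n * yt T \<xi> n" for \<xi>
    using fun_cong[OF e(1), of \<xi>] fun_cong[OF e(2), of \<xi>] by simp
  moreover have "(\<Prod>i\<in>?I. expectation (\<lambda>\<xi>. F i (case_sum b a i \<xi>))) = expectation (\<lambda>\<xi>. xt T \<xi> n) * expectation (\<lambda>\<xi>. yt T \<xi> n)"
    using e by simp
  ultimately show ?thesis by simp
qed

lemma mart_measurable:
  assumes \<beta>: "0 < \<beta>"
  shows "mart N k T z \<in> borel_measurable M"
proof -
  note [measurable] = xt_measurable yt_measurable[OF \<beta>]
  have [measurable]: "(\<lambda>\<xi>. ratio N k (xt T \<xi>) (yt T \<xi>) z m) \<in> borel_measurable M" for m
    by (induction m) simp_all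
  show ?thesis unfolding mart_def[abs_def] mstep_def green_def hop_def by measurable
qed

lemma mart_exp:
  assumes \<beta>: "0 < \<beta>" and "scale N L R y k T \<epsilon>" and z: "z \<in> hyp_dom R y"
  shows "exp_moment M (\<lambda>\<xi>. Re (s * mart N k T z \<xi>))
    \<le> ennreal (exp ((cmod s)\<^sup>2 * (\<Sum>n<N. (scale.step_bound N L y k T \<epsilon> n)\<^sup>2) / 2))"
proof -
  interpret S: scale N L R y k T \<epsilon> by fact
  note z = z
  let ?V = "\<lambda>\<xi> i. case_sum b a i \<xi>"
  define mx where "mx n = expectation (\<lambda>\<xi>. xt T \<xi> n)" for n
  define my where "my n = expectation (\<lambda>\<xi>. yt T \<xi> n)" for n
  define vx where "vx n = expectation (\<lambda>\<xi>. (xt T \<xi> n)\<^sup>2)" for n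
  define vy where "vy n = expectation (\<lambda>\<xi>. (yt T \<xi> n)\<^sup>2)" for n
  define G where "G n p q = Re (s * mstep N k (x_of T p) (y_of T p) z n (x_of T q n) (y_of T q n) (mx n) (my n) (vx n) (vy n))" for n p q
  have b': "\<bar>xt T \<xi> n\<bar> \<le> T" "\<bar>yt T \<xi> n\<bar> \<le> T" for \<xi> n using xt_bound yt_bound S.T by auto
  have sq: "(xt T \<xi> n)\<^sup>2 \<le> T\<^sup>2" "(yt T \<xi> n)\<^sup>2 \<le> T\<^sup>2" for \<xi> n
    using power_mono[OF b'(1)[of \<xi> n] abs_ge_zero, of 2] power_mono[OF b'(2)[of \<xi> n] abs_ge_zero, of 2] by auto
  note [measurable] = xt_measurable yt_measurable[OF \<beta>]
  have int: "integrable M (\<lambda>\<xi>. xt T \<xi> n)" "integrable M (\<lambda>\<xi>. yt T \<xi> n)" "integrable M (\<lambda>\<xi>. (xt T \<xi> n)\<^sup>2)"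
    "integrable M (\<lambda>\<xi>. (yt T \<xi> n)\<^sup>2)" "integrable M (\<lambda>\<xi>. xt T \<xi> n * yt T \<xi> n)" for n
  proof -
    show "integrable M (\<lambda>\<xi>. xt T \<xi> n)" "integrable M (\<lambda>\<xi>. yt T \<xi> n)"
      using b' by (auto intro!: integrable_const_bound[where B = T])
    show "integrable M (\<lambda>\<xi>. (xt T \<xi> n)\<^sup>2)" "integrable M (\<lambda>\<xi>. (yt T \<xi> n)\<^sup>2)"
      using sq by (auto intro!: integrable_const_bound[where B = "T\<^sup>2"])
    have "\<bar>xt T \<xi> n * yt T \<xi> n\<bar> \<le> T * T" for \<xi> unfolding abs_mult using b' S.T by (intro mult_mono) auto
    then show "integrable M (\<lambda>\<xi>. xt T \<xi> n * yt T \<xi> n)" by (auto intro!: integrable_const_bound[where B = "T * T"])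
  qed
  have mb: "\<bar>mx n\<bar> \<le> T" "\<bar>my n\<bar> \<le> T" "0 \<le> vx n" "vx n \<le> T\<^sup>2" "0 \<le> vy n" "vy n \<le> T\<^sup>2" for n
  proof -
    have "\<bar>mx n\<bar> \<le> expectation (\<lambda>\<xi>. T)" unfolding mx_def
      by (rule order_trans[OF integral_abs_bound integral_mono]) (use int b' in auto)
    then show "\<bar>mx n\<bar> \<le> T" by (simp add: prob_space)
    have "\<bar>my n\<bar> \<le> expectation (\<lambda>\<xi>. T)" unfolding my_def
      by (rule order_trans[OF integral_abs_bound integral_mono]) (use int b' in auto)
    then show "\<bar>my n\<bar> \<le> T" by (simp add: prob_space)
    show "0 \<le> vx n" "0 \<le> vy n" by (simp_all add: vx_def vy_def)
    have "vx n \<le> expectation (\<lambda>\<xi>. T\<^sup>2)" "vy n \<le> expectation (\<lambda>\<xi>. T\<^sup>2)"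
      unfolding vx_def vy_def by (rule integral_mono; use int sq in simp)+
    then show "vx n \<le> T\<^sup>2" "vy n \<le> T\<^sup>2" by (simp_all add: prob_space)
  qed
  have xb: "\<bar>x_of T p n\<bar> \<le> T" "\<bar>y_of T p n\<bar> \<le> T" for p n
    unfolding x_of_def y_of_def by (rule trunc_abs_le[OF S.T])+
  have bnd: "\<bar>G n p q\<bar> \<le> cmod s * S.step_bound n" if "n < N" for n p q
  proof -
    have "cmod (mstep N k (x_of T p) (y_of T p) z n (x_of T q n) (y_of T q n) (mx n) (my n) (vx n) (vy n)) \<le> S.step_bound n"
      using xb mb that z by (intro S.mstep_bound) auto
    then have "cmod (s * mstep N k (x_of T p) (y_of T p) z n (x_of T q n) (y_of T q n) (mx n) (my n) (vx n) (vy n)) \<le> cmod s * S.step_bound n"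
      by (simp add: norm_mult mult_left_mono)
    then show ?thesis unfolding G_def using abs_Re_le_cmod order_trans by blast
  qed
  have Gm: "(\<lambda>x. G n (fst x) (snd x)) \<in> borel_measurable (PiM (past n) (\<lambda>_. borel) \<Otimes>\<^sub>M PiM (fresh n) (\<lambda>_. borel))" for n
  proof -
    note [measurable] = green_hop_measurable[of N k T z n]
    have [measurable]: "(\<lambda>q. x_of T q n) \<in> borel_measurable (PiM (fresh n) (\<lambda>_. borel))" "(\<lambda>q. y_of T q n) \<in> borel_measurable (PiM (fresh n) (\<lambda>_. borel))"
      by (auto intro!: x_of_measurable y_of_measurable fresh_mem)
    show ?thesis unfolding G_def mstep_def by measurable
  qed
  have V_past: "G n (restrict (?V \<xi>) (past n)) q = Re (s * mstep N k (xt T \<xi>) (yt T \<xi>) z n (x_of T q n) (y_of T q n) (mx n) (my n) (vx n) (vy n))" for n \<xi> q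
  proof -
    have c: "x_of T (restrict (?V \<xi>) (past n)) m = xt T \<xi> m" "y_of T (restrict (?V \<xi>) (past n)) m = yt T \<xi> m" if "m < n" for m
      using that by (simp_all add: x_of_restrict y_of_restrict past_mem xt_eq yt_eq)
    have gh: "green N k (x_of T (restrict (?V \<xi>) (past n))) (y_of T (restrict (?V \<xi>) (past n))) z n = green N k (xt T \<xi>) (yt T \<xi>) z n"
      "hop N k (x_of T (restrict (?V \<xi>) (past n))) (y_of T (restrict (?V \<xi>) (past n))) z n = hop N k (xt T \<xi>) (yt T \<xi>) z n"
      by (rule green_hop_cong; rule c; assumption)+
    show ?thesis unfolding G_def mstep_def gh ..
  qed
  have V_fresh: "x_of T (restrict (?V \<xi>) (fresh n)) n = xt T \<xi> n" "y_of T (restrict (?V \<xi>) (fresh n)) n = yt T \<xi> n" for n \<xi>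
    by (simp_all add: x_of_restrict y_of_restrict fresh_mem xt_eq yt_eq)
  have centred: "expectation (\<lambda>\<xi>. G n p (restrict (\<lambda>i. case_sum b a i \<xi>) (fresh n))) = 0" for n p
  proof -
    have lin5: "expectation (\<lambda>\<xi>. c1 * (xt T \<xi> n - mx n) + c2 * (yt T \<xi> n - my n) + c3 * ((xt T \<xi> n)\<^sup>2 - vx n) + c4 * (xt T \<xi> n * yt T \<xi> n - mx n * my n) + c5 * ((yt T \<xi> n)\<^sup>2 - vy n)) = 0" for c1 c2 c3 c4 c5 :: real
      using int[of n] xt_yt_uncorrelated[OF \<beta> S.T, of n] by (simp add: mx_def my_def vx_def vy_def prob_space)
    show ?thesis unfolding G_def Re_mstep V_fresh by (rule lin5)
  qed
  have "exp_moment M (\<lambda>\<xi>. \<Sum>n<N. G n (restrict (\<lambda>i. case_sum b a i \<xi>) (past n)) (restrict (\<lambda>i. case_sum b a i \<xi>) (fresh n)))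
    \<le> ennreal (exp (\<Sum>n<N. (cmod s * S.step_bound n)\<^sup>2 / 2))"
  proof (rule Azuma_exp_bound[where I = "{1..} <+> {1..}"])
    show "indep_vars (\<lambda>_. borel) (\<lambda>i \<xi>. case_sum b a i \<xi>) ({1..} <+> {1..})" using indep_entries .
    show "past n \<inter> fresh n = {}" "past (Suc n) = past n \<union> fresh n" "past n \<subseteq> {1..} <+> {1..}" for n
      by (auto simp: past_def fresh_def image_iff not_less less_Suc_eq le_Suc_eq split: if_splits)
  qed (rule Gm bnd centred; assumption?)+
  also have "(\<Sum>n<N. (cmod s * S.step_bound n)\<^sup>2 / 2) = (cmod s)\<^sup>2 * (\<Sum>n<N. (S.step_bound n)\<^sup>2) / 2"
    by (simp add: power_mult_distrib sum_distrib_left sum_divide_distrib)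
  also have "(\<lambda>\<xi>. \<Sum>n<N. G n (restrict (\<lambda>i. case_sum b a i \<xi>) (past n)) (restrict (\<lambda>i. case_sum b a i \<xi>) (fresh n))) = (\<lambda>\<xi>. Re (s * mart N k T z \<xi>))"
    unfolding V_past V_fresh mart_def by (simp add: mx_def my_def vx_def vy_def sum_distrib_left Re_sum)
  finally show ?thesis .
qed

end

context gbe_coupling
begin

text \<open>Half of an exponent that \<open>step_Y_exp\<close> admits in every step, and at most 1
  to keep \<open>noise_mass\<close> independent of \<open>\<beta>\<close>.\<close>

definition rate :: real where "rate = min 1 (sqrt (2 * \<beta>) / 8)"

text \<open>The bound \<open>exp (2 * t^2)\<close> at \<open>|t| \<le> 2\<close>, once for each sign
  of \<open>t\<close>.\<close>

definition noise_mass :: real where "noise_mass = 2 * exp 8"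

definition bias :: "real \<Rightarrow> real" where
  "bias T = 2 * noise_mass * exp (- rate * T) / rate\<^sup>2"

text \<open>Strictly above \<open>C0\<close>, so that some \<open>t\<close> admissible in the Orlicz
  norm lies below \<open>coupling_rate * ln N\<close>; an infimum alone would not provide one at
  \<open>C0 * ln N\<close>.\<close>

definition coupling_rate :: real where "coupling_rate = max C0 0 + 1"

context
  assumes \<beta>: "0 < \<beta>"
begin

lemma rate: "0 < rate" "rate \<le> 1" "2 * rate \<le> sqrt (2 * \<beta>) / 4"
  using \<beta> by (auto simp: rate_def min_def)

lemma exp_rate: "exp (2 * (2 * rate)\<^sup>2) \<le> exp 8"
proof -
  have "rate\<^sup>2 \<le> 1" using rate by (simp add: power_le_one)
  then show ?thesis by (simp add: power_mult_distrib)
qed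

lemma noise_exp:
  "exp_moment M (\<lambda>\<xi>. 2 * rate * \<bar>X_var b (Suc n) \<xi>\<bar>) \<le> ennreal noise_mass"
  "exp_moment M (\<lambda>\<xi>. 2 * rate * \<bar>step_Y n \<xi>\<bar>) \<le> ennreal noise_mass"
proof -
  have pos: "0 < 2 * rate" using rate by simp
  have le: "ennreal (exp (2 * t\<^sup>2)) \<le> ennreal (exp 8)" if "t = 2 * rate \<or> t = - (2 * rate)" for t
    using exp_rate that by (auto intro!: ennreal_leI)
  have m: "X_var b (Suc n) \<in> borel_measurable M" using X_var_moments(1)[of "Suc n"] by simp
  show "exp_moment M (\<lambda>\<xi>. 2 * rate * \<bar>X_var b (Suc n) \<xi>\<bar>) \<le> ennreal noise_mass"
    unfolding noise_mass_def
  proof (rule abs_exp_bound[OF m _ _ _ pos])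
    show "exp_moment M (\<lambda>\<xi>. 2 * rate * X_var b (Suc n) \<xi>) \<le> ennreal (exp 8)"
      by (rule order_trans[OF X_var_exp le]) auto
    show "exp_moment M (\<lambda>\<xi>. - (2 * rate) * X_var b (Suc n) \<xi>) \<le> ennreal (exp 8)"
      by (rule order_trans[OF X_var_exp le]) auto
  qed simp
  have rt: "\<bar>2 * rate\<bar> \<le> sqrt (2 * \<beta>) / 4" "\<bar>- (2 * rate)\<bar> \<le> sqrt (2 * \<beta>) / 4" using rate by auto
  show "exp_moment M (\<lambda>\<xi>. 2 * rate * \<bar>step_Y n \<xi>\<bar>) \<le> ennreal noise_mass"
    unfolding noise_mass_def
  proof (rule abs_exp_bound[OF step_Y_moments(1)[OF \<beta>] _ _ _ pos])
    show "exp_moment M (\<lambda>\<xi>. 2 * rate * step_Y n \<xi>) \<le> ennreal (exp 8)"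
      by (rule order_trans[OF step_Y_exp[OF \<beta> rt(1)] le]) simp
    show "exp_moment M (\<lambda>\<xi>. - (2 * rate) * step_Y n \<xi>) \<le> ennreal (exp 8)"
      by (rule order_trans[OF step_Y_exp[OF \<beta> rt(2)] le]) simp
  qed simp
qed

lemma noise_tail:
  "emeasure M {\<xi> \<in> space M. \<exists>n<N. T \<le> \<bar>X_var b (Suc n) \<xi>\<bar> \<or> T \<le> \<bar>step_Y n \<xi>\<bar>}
     \<le> ennreal (real N * (2 * noise_mass * exp (- 2 * rate * T)))"
  "{\<xi> \<in> space M. \<exists>n<N. T \<le> \<bar>X_var b (Suc n) \<xi>\<bar> \<or> T \<le> \<bar>step_Y n \<xi>\<bar>} \<in> sets M"
proof -
  have Xm [measurable]: "X_var b (Suc n) \<in> borel_measurable M" for n using X_var_moments(1)[of "Suc n"] by simp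
  have Ym [measurable]: "step_Y n \<in> borel_measurable M" for n by (rule step_Y_moments(1)[OF \<beta>])
  have nm: "0 \<le> noise_mass" by (simp add: noise_mass_def)
  have one: "emeasure M {\<xi> \<in> space M. T \<le> \<bar>Z \<xi>\<bar>} \<le> ennreal (noise_mass * exp (- 2 * rate * T))"
    if [measurable]: "Z \<in> borel_measurable M" and "exp_moment M (\<lambda>\<xi>. 2 * rate * \<bar>Z \<xi>\<bar>) \<le> ennreal noise_mass" for Z
  proof -
    have "{\<xi> \<in> space M. T \<le> \<bar>Z \<xi>\<bar>} = {\<xi> \<in> space M. 2 * rate * T \<le> 2 * rate * \<bar>Z \<xi>\<bar>}" using rate by simp
    then show ?thesis using exp_tail[of "\<lambda>\<xi>. 2 * rate * \<bar>Z \<xi>\<bar>" noise_mass "2 * rate * T"] that nm by simp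
  qed
  let ?A = "\<lambda>n. {\<xi> \<in> space M. T \<le> \<bar>X_var b (Suc n) \<xi>\<bar>} \<union> {\<xi> \<in> space M. T \<le> \<bar>step_Y n \<xi>\<bar>}"
  have eq: "{\<xi> \<in> space M. \<exists>n<N. T \<le> \<bar>X_var b (Suc n) \<xi>\<bar> \<or> T \<le> \<bar>step_Y n \<xi>\<bar>} = (\<Union>n\<in>{..<N}. ?A n)" by auto
  show "{\<xi> \<in> space M. \<exists>n<N. T \<le> \<bar>X_var b (Suc n) \<xi>\<bar> \<or> T \<le> \<bar>step_Y n \<xi>\<bar>} \<in> sets M" by measurable
  have A: "emeasure M (?A n) \<le> ennreal (2 * noise_mass * exp (- 2 * rate * T))" for n
  proof -
    have "emeasure M (?A n) \<le> emeasure M {\<xi> \<in> space M. T \<le> \<bar>X_var b (Suc n) \<xi>\<bar>} + emeasure M {\<xi> \<in> space M. T \<le> \<bar>step_Y n \<xi>\<bar>}"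
      by (intro emeasure_subadditive) measurable
    also have "\<dots> \<le> ennreal (noise_mass * exp (- 2 * rate * T)) + ennreal (noise_mass * exp (- 2 * rate * T))"
      by (intro add_mono one noise_exp Xm Ym)
    also have "\<dots> = ennreal (2 * noise_mass * exp (- 2 * rate * T))"
    proof -
      have "2 * noise_mass * E = noise_mass * E + noise_mass * E" for E by simp
      then show ?thesis using nm by (simp only: ennreal_plus mult_nonneg_nonneg exp_ge_zero)
    qed
    finally show ?thesis .
  qed
  have "emeasure M (\<Union>n\<in>{..<N}. ?A n) \<le> (\<Sum>n<N. emeasure M (?A n))"
    by (intro emeasure_subadditive_finite) auto
  also have "\<dots> \<le> (\<Sum>n<N. ennreal (2 * noise_mass * exp (- 2 * rate * T)))" by (intro sum_mono A)
  also have "\<dots> = ennreal (real N * (2 * noise_mass * exp (- 2 * rate * T)))"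
    using nm by (subst sum_ennreal) auto
  finally show "emeasure M {\<xi> \<in> space M. \<exists>n<N. T \<le> \<bar>X_var b (Suc n) \<xi>\<bar> \<or> T \<le> \<bar>step_Y n \<xi>\<bar>}
     \<le> ennreal (real N * (2 * noise_mass * exp (- 2 * rate * T)))" unfolding eq .
qed

lemma trunc_moments:
  assumes T: "0 \<le> T"
  shows "\<bar>expectation (\<lambda>\<xi>. xt T \<xi> n)\<bar> \<le> bias T" "\<bar>expectation (\<lambda>\<xi>. yt T \<xi> n)\<bar> \<le> bias T"
    "\<bar>expectation (\<lambda>\<xi>. (xt T \<xi> n)\<^sup>2) - 1\<bar> \<le> bias T" "0 < n \<Longrightarrow> \<bar>expectation (\<lambda>\<xi>. (yt T \<xi> n)\<^sup>2) - 1\<bar> \<le> bias T"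
proof -
  note r = rate
  have nm: "0 \<le> noise_mass" by (simp add: noise_mass_def)
  have le: "noise_mass * exp (- rate * T) / rate \<le> bias T"
  proof -
    have "noise_mass * exp (- rate * T) / rate \<le> (2 * noise_mass * exp (- rate * T)) / rate\<^sup>2"
      using r nm by (intro frac_le) (auto simp: power2_eq_square mult_left_le)
    then show ?thesis by (simp add: bias_def)
  qed
  note X = X_var_moments[of "Suc n"] and Y = step_Y_moments[OF \<beta>, of n]
  have Xm: "X_var b (Suc n) \<in> borel_measurable M" using X(1) by simp
  note bx = trunc_bias[OF Xm noise_exp(1) nm r(1) T X(1)] and by' = trunc_bias[OF Y(1) noise_exp(2) nm r(1) T Y(2,4)]
  show "\<bar>expectation (\<lambda>\<xi>. xt T \<xi> n)\<bar> \<le> bias T" "\<bar>expectation (\<lambda>\<xi>. (xt T \<xi> n)\<^sup>2) - 1\<bar> \<le> bias T"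
    using bx X le by (simp_all add: xt_def bias_def)
  show "\<bar>expectation (\<lambda>\<xi>. yt T \<xi> n)\<bar> \<le> bias T" using by'(1) Y le by (simp add: yt_def)
  show "0 < n \<Longrightarrow> \<bar>expectation (\<lambda>\<xi>. (yt T \<xi> n)\<^sup>2) - 1\<bar> \<le> bias T" using by'(2) Y by (simp add: yt_def bias_def)
qed

lemma coupling_measurable: "coupling_error \<beta> a Yhat N \<in> borel_measurable M" if "1 \<le> N"
proof -
  interpret BY: brownian_motion M Yhat by (rule Yhat_bm)
  have [measurable]: "Yhat (real k) \<in> borel_measurable M" for k by (rule BY.measurable_at) simp
  have [measurable]: "Y_var \<beta> a j \<in> borel_measurable M" for j
    using step_Y_moments(1)[OF \<beta>, of "j - 1"] by (cases j) (simp_all add: step_Y_def[abs_def] Y_var_def[abs_def])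
  show ?thesis unfolding coupling_error_def[abs_def] using that by (intro borel_measurable_Max) auto
qed

lemma coupling_tail:
  assumes N: "2 \<le> N" and x: "0 \<le> x"
  shows "emeasure M {\<xi> \<in> space M. x * (coupling_rate * ln (real N)) \<le> coupling_error \<beta> a Yhat N \<xi>} \<le> ennreal (2 * exp (- x))"
proof -
  let ?Z = "coupling_error \<beta> a Yhat N"
  have ln: "0 < ln (real N)" using N by simp
  have "psi1_norm M ?Z < ereal (coupling_rate * ln (real N))"
  proof (rule le_less_trans[OF Y_coupled[OF N]])
    have "C0 * ln (real N) < coupling_rate * ln (real N)" using ln by (intro mult_strict_right_mono) (auto simp: coupling_rate_def)
    then show "ereal (C0 * ln (real N)) < ereal (coupling_rate * ln (real N))" by simp
  qed
  then obtain t where t: "0 < t" "exp_moment M (\<lambda>\<xi>. ?Z \<xi> / t) \<le> 2" "t < coupling_rate * ln (real N)"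
    unfolding psi1_norm_def Inf_less_iff by auto
  have [measurable]: "?Z \<in> borel_measurable M" using N by (intro coupling_measurable) simp
  have "emeasure M {\<xi> \<in> space M. x * (coupling_rate * ln (real N)) \<le> ?Z \<xi>} \<le> emeasure M {\<xi> \<in> space M. x \<le> ?Z \<xi> / t}"
  proof (intro emeasure_mono subsetI)
    fix \<xi> assume \<xi>: "\<xi> \<in> {\<xi> \<in> space M. x * (coupling_rate * ln (real N)) \<le> ?Z \<xi>}"
    have "x * t \<le> x * (coupling_rate * ln (real N))" using x t by (intro mult_left_mono) auto
    then have "x * t \<le> ?Z \<xi>" using \<xi> by simp
    then show "\<xi> \<in> {\<xi> \<in> space M. x \<le> ?Z \<xi> / t}" using \<xi> t by (simp add: pos_le_divide_eq)
  qed measurable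
  also have "\<dots> \<le> ennreal (2 * exp (- x))" using t by (intro exp_tail) auto
  finally show ?thesis .
qed

lemma coupling_error_ge: "k \<in> {1..N} \<Longrightarrow> \<bar>(\<Sum>j=1..k. Y_var \<beta> a j \<xi>) - Yhat (real k) \<xi>\<bar> \<le> coupling_error \<beta> a Yhat N \<xi>"
  unfolding coupling_error_def by (intro Max_ge) auto

lemma coupled_AE:
  "AE \<xi> in M. Xhat 0 \<xi> = 0 \<and> Yhat 0 \<xi> = 0 \<and> (\<forall>n\<in>{1..N}. (\<Sum>j=1..n. X_var b j \<xi>) = Xhat (real n) \<xi>)"
proof -
  interpret BX: brownian_motion M Xhat by (rule Xhat_bm)
  interpret BY: brownian_motion M Yhat by (rule Yhat_bm)
  have "AE \<xi> in M. \<forall>n\<in>{1..N}. (\<Sum>j=1..n. X_var b j \<xi>) = Xhat (real n) \<xi>"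
    by (rule AE_finite_allI) (use X_coupled in simp_all)
  with BX.start BY.start show ?thesis by auto
qed

end
end

section \<open>The limiting field\<close>

lemma has_wiener_integral_cong:
  assumes "\<And>u. 0 \<le> u \<Longrightarrow> u \<le> 1 \<Longrightarrow> f u = g u" and W: "has_wiener_integral M B f I"
  shows "has_wiener_integral M B g I"
proof -
  have 1: "(\<lambda>u. indicator {0..1} u *\<^sub>R f u) = (\<lambda>u. indicator {0..1} u *\<^sub>R g u)"
    using assms(1) by (auto simp: fun_eq_iff indicator_def)
  have 2: "(\<integral>\<^sup>+ u\<in>{0..1}. ennreal ((cmod (f u - s u))\<^sup>2) \<partial>lborel) = (\<integral>\<^sup>+ u\<in>{0..1}. ennreal ((cmod (g u - s u))\<^sup>2) \<partial>lborel)" for s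
    using assms(1) by (intro nn_integral_cong) (auto simp: indicator_def)
  show ?thesis using W unfolding has_wiener_integral_def set_borel_measurable_def 1 2 .
qed

lemma hyp_off_segment:
  assumes "hyp y z" "0 < y"
  shows "z \<in> - cplx ` {-1..1}"
proof
  assume "z \<in> cplx ` {-1..1}"
  then obtain x where x: "z = cplx x" "\<bar>x\<bar> \<le> 1" by (auto simp: abs_le_iff)
  have "x\<^sup>2 \<le> 1" using x(2) by (simp add: abs_square_le_1)
  moreover have "0 < y\<^sup>2" using assms by simp
  ultimately have "\<not> y\<^sup>2 \<le> x\<^sup>2 - 1" by linarith
  then show False using assms x by (simp add: hyp_def)
qed

locale gbe_field = gbe_coupling M \<beta> C0 a b Xhat Yhat
  for M :: "'a measure" and \<beta> C0 :: real and a b Xhat Yhat +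
  fixes N :: nat and W :: "complex \<Rightarrow> 'a \<Rightarrow> complex"
  assumes \<beta>: "0 < \<beta>" and N: "0 < N" and W: "is_W_field M (rescaled N Xhat) (rescaled N Yhat) W"
begin

text \<open>The sum of the two Wiener integrals with kernels frozen at the left grid points, an
  approximation of \<open>- 2 * W\<close>.\<close>

definition step_field :: "complex \<Rightarrow> 'a \<Rightarrow> complex" where
  "step_field z \<xi> = step_integral (rescaled N Xhat) N (\<lambda>n. ker1 (grid N n) z) (grid_clamp N) \<xi> +
     step_integral (rescaled N Yhat) N (\<lambda>n. ker2 (grid N n) z) (grid_clamp N) \<xi>"

sublocale pair: gaussian_pair M "rescaled N Xhat" "rescaled N Yhat"
  by (rule gaussian_pair_rescaled[OF N])

definition ker_energy :: "complex \<Rightarrow> complex" where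
  "ker_energy z = (LINT u:{0..1}|lborel. (ker1 u z)\<^sup>2) + (LINT u:{0..1}|lborel. (ker2 u z)\<^sup>2)"

lemma W_holomorphic: "\<xi> \<in> space M \<Longrightarrow> (\<lambda>z. W z \<xi>) holomorphic_on - cplx ` {-1..1}"
  using W by (simp add: is_W_field_def)

context
  fixes y :: real and z :: complex
  assumes hyp: "hyp y z" and y: "0 < y" "y \<le> 1 / 2"
begin

lemma W_integrals:
  obtains I1 I2 where "has_wiener_integral M (rescaled N Xhat) (\<lambda>u. ker1 u z) I1"
    "has_wiener_integral M (rescaled N Yhat) (\<lambda>u. ker2 u z) I2"
    "\<forall>\<xi>\<in>space M. W z \<xi> = - (1 / 2) * (I1 \<xi> + I2 \<xi>)"
proof -
  have z0: "z \<noteq> 0" using hyp y(1) by (rule hyp_nonzero)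
  obtain I1 I2 where I: "has_wiener_integral M (rescaled N Xhat) (\<lambda>u. 1 / sqrt_branch u z) I1"
    "has_wiener_integral M (rescaled N Yhat) (\<lambda>u. Jouk (z / cplx (sqrt u)) / sqrt_branch u z) I2"
    "\<forall>\<xi>\<in>space M. W z \<xi> = - (1 / 2) * (I1 \<xi> + I2 \<xi>)"
    using W hyp_off_segment[OF hyp y(1)] unfolding is_W_field_def by blast
  show thesis
  proof (rule that[of I1 I2])
    show "has_wiener_integral M (rescaled N Xhat) (\<lambda>u. ker1 u z) I1" using I(1) by (simp add: ker1_def)
    show "has_wiener_integral M (rescaled N Yhat) (\<lambda>u. ker2 u z) I2"
      by (rule has_wiener_integral_cong[OF _ I(2)]) (simp add: ker2_def Jouk_eq_rot[OF _ z0])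
  qed (rule I(3))
qed

lemma ker_osc:
  "0 \<le> u \<Longrightarrow> u \<le> v \<Longrightarrow> v \<le> 1 \<Longrightarrow> cmod (ker1 u z - ker1 v z) \<le> 5 / y ^ 3 * (sqrt v - sqrt u)"
  "0 \<le> u \<Longrightarrow> u \<le> v \<Longrightarrow> v \<le> 1 \<Longrightarrow> cmod (ker2 u z - ker2 v z) \<le> 5 / y ^ 3 * (sqrt v - sqrt u)"
  using ker_diff[OF hyp y] by auto

lemma ker_norm: "0 \<le> u \<Longrightarrow> u \<le> 1 \<Longrightarrow> cmod (ker1 u z) \<le> 1 / y" "0 \<le> u \<Longrightarrow> u \<le> 1 \<Longrightarrow> cmod (ker2 u z) \<le> 1 / y"
proof -
  show "0 \<le> u \<Longrightarrow> u \<le> 1 \<Longrightarrow> cmod (ker1 u z) \<le> 1 / y" by (rule norm_ker1_le[OF hyp y])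
  moreover have "0 \<le> u \<Longrightarrow> cmod (ker2 u z) \<le> cmod (ker1 u z)" by (rule norm_ker2_le[OF hyp_nonzero[OF hyp y(1)]])
  ultimately show "0 \<le> u \<Longrightarrow> u \<le> 1 \<Longrightarrow> cmod (ker2 u z) \<le> 1 / y" by linarith
qed

text \<open>Measurability in \<open>u\<close> is part of the meaning of a Wiener integral, so it is
  inherited from the existence of the integrals that define \<open>W\<close>.\<close>

lemma ker_meas: "set_borel_measurable lborel {0..1} (\<lambda>u. ker1 u z)" "set_borel_measurable lborel {0..1} (\<lambda>u. ker2 u z)"
proof -
  obtain I1 I2 where "has_wiener_integral M (rescaled N Xhat) (\<lambda>u. ker1 u z) I1"
    "has_wiener_integral M (rescaled N Yhat) (\<lambda>u. ker2 u z) I2" by (rule W_integrals)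
  then show "set_borel_measurable lborel {0..1} (\<lambda>u. ker1 u z)" "set_borel_measurable lborel {0..1} (\<lambda>u. ker2 u z)"
    by (simp_all add: has_wiener_integral_def)
qed

lemma W_measurable: "W z \<in> borel_measurable M"
proof -
  obtain I1 I2 where I: "has_wiener_integral M (rescaled N Xhat) (\<lambda>u. ker1 u z) I1"
    "has_wiener_integral M (rescaled N Yhat) (\<lambda>u. ker2 u z) I2"
    "\<forall>\<xi>\<in>space M. W z \<xi> = - (1 / 2) * (I1 \<xi> + I2 \<xi>)" by (rule W_integrals)
  then have [measurable]: "I1 \<in> borel_measurable M" "I2 \<in> borel_measurable M" by (simp_all add: has_wiener_integral_def)
  have "W z \<in> borel_measurable M \<longleftrightarrow> (\<lambda>\<xi>. - (1 / 2) * (I1 \<xi> + I2 \<xi>)) \<in> borel_measurable M"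
    by (intro measurable_cong) (use I(3) in blast)
  then show ?thesis by simp
qed

lemma step_field_measurable: "step_field z \<in> borel_measurable M"
proof -
  have [measurable]: "step_integral (rescaled N Xhat) n c (grid_clamp N) \<in> borel_measurable M"
    "step_integral (rescaled N Yhat) n c (grid_clamp N) \<in> borel_measurable M" for n c
    by (intro pair.X.step_integral_measurable pair.Y.step_integral_measurable; simp add: grid_clamp_def grid_def)+
  show ?thesis unfolding step_field_def[abs_def] by simp
qed

text \<open>The field carries the factor \<open>- 1 / 2\<close>, whence
  \<open>(c / 2)^2 / 2 = c^2 / 8\<close>. This evaluates the expectation in the theorem in closed
  form.\<close>

lemma W_cexp: "expectation (\<lambda>\<xi>. exp (c * W z \<xi>)) = exp (c\<^sup>2 / 8 * ker_energy z)"
proof -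
  obtain I1 I2 where I: "has_wiener_integral M (rescaled N Xhat) (\<lambda>u. ker1 u z) I1"
    "has_wiener_integral M (rescaled N Yhat) (\<lambda>u. ker2 u z) I2"
    "\<forall>\<xi>\<in>space M. W z \<xi> = - (1 / 2) * (I1 \<xi> + I2 \<xi>)" by (rule W_integrals)
  have "expectation (\<lambda>\<xi>. exp (c * W z \<xi>)) = expectation (\<lambda>\<xi>. exp (- c / 2 * (I1 \<xi> + I2 \<xi>)))"
    by (intro Bochner_Integration.integral_cong refl) (simp add: I(3))
  also have "\<dots> = exp ((- c / 2)\<^sup>2 / 2 * ker_energy z)"
    unfolding ker_energy_def
    by (rule pair.wiener_pair_cexp[OF I(1,2) square_integral_le[OF N ker_osc(1) ker_norm(1) ker_meas(1)] square_integral_le[OF N ker_osc(2) ker_norm(2) ker_meas(2)]]) auto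
  also have "(- c / 2)\<^sup>2 / 2 = c\<^sup>2 / 8" by (simp add: power2_eq_square)
  finally show ?thesis .
qed

text \<open>The number of cells \<open>n\<close> is kept separate from \<open>N\<close>: besides
  \<open>n = N\<close>, the limit of large \<open>n\<close> yields the continuity of
  \<open>ker_energy\<close>.\<close>

lemma ker_energy_approx:
  assumes n: "0 < n"
  shows "cmod ((\<Sum>i<n. (ker1 (grid n i) z)\<^sup>2 + (ker2 (grid n i) z)\<^sup>2) / of_nat n - ker_energy z) \<le> 20 / (y ^ 4 * real n)"
proof -
  note r = riemann_square_bound[OF n ker_osc(1) ker_norm(1) ker_meas(1)] riemann_square_bound[OF n ker_osc(2) ker_norm(2) ker_meas(2)]
  have "(\<Sum>i<n. (ker1 (grid n i) z)\<^sup>2 + (ker2 (grid n i) z)\<^sup>2) / of_nat n - ker_energy z =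
    ((\<Sum>i<n. (ker1 (grid n i) z)\<^sup>2) / of_nat n - (LINT u:{0..1}|lborel. (ker1 u z)\<^sup>2)) +
    ((\<Sum>i<n. (ker2 (grid n i) z)\<^sup>2) / of_nat n - (LINT u:{0..1}|lborel. (ker2 u z)\<^sup>2))"
    by (simp add: sum.distrib ker_energy_def add_divide_distrib)
  then have "cmod ((\<Sum>i<n. (ker1 (grid n i) z)\<^sup>2 + (ker2 (grid n i) z)\<^sup>2) / of_nat n - ker_energy z) \<le>
      2 * (1 / y) * (5 / y ^ 3) / real n + 2 * (1 / y) * (5 / y ^ 3) / real n"
    by (simp only:) (rule order_trans[OF norm_triangle_ineq add_mono[OF r]])
  also have "\<dots> = 20 / (y ^ 4 * real n)" using y n by (simp add: field_simps eval_nat_numeral)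
  finally show ?thesis .
qed

lemma ker_energy_norm: "cmod (ker_energy z) \<le> 2 / y\<^sup>2"
proof -
  have 1: "cmod (LINT u:{0..1}|lborel. (h u)\<^sup>2) \<le> 1 / y\<^sup>2"
    if "set_integrable lborel {0..1} (\<lambda>u. (h u)\<^sup>2)" "\<And>u. 0 \<le> u \<Longrightarrow> u \<le> 1 \<Longrightarrow> cmod (h u) \<le> 1 / y" for h :: "real \<Rightarrow> complex"
  proof -
    have "cmod (LINT u:{0..1}|lborel. (h u)\<^sup>2) \<le> (LINT u:{0..1}|lborel. cmod ((h u)\<^sup>2))"
      using set_integral_norm_bound[OF that(1)] .
    also have "\<dots> \<le> (LINT u:{0..1::real}|lborel. 1 / y\<^sup>2)"
    proof (rule set_integral_mono)
      show "set_integrable lborel {0..1} (\<lambda>u. cmod ((h u)\<^sup>2))" by (rule set_integrable_norm[OF that(1)])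
      show "set_integrable lborel {0..1::real} (\<lambda>u. 1 / y\<^sup>2)" by (simp add: set_integrable_def)
      show "cmod ((h u)\<^sup>2) \<le> 1 / y\<^sup>2" if "u \<in> {0..1}" for u
        using power_mono[OF \<open>\<And>u. 0 \<le> u \<Longrightarrow> u \<le> 1 \<Longrightarrow> cmod (h u) \<le> 1 / y\<close>[of u] norm_ge_zero, of 2] that
        by (simp add: norm_power power_divide)
    qed
    also have "\<dots> = 1 / y\<^sup>2" by (simp add: set_lebesgue_integral_def)
    finally show ?thesis .
  qed
  have "cmod (ker_energy z) \<le> 1 / y\<^sup>2 + 1 / y\<^sup>2"
    unfolding ker_energy_def
    by (intro order_trans[OF norm_triangle_ineq] add_mono 1 ker_norm
      square_integrable[OF N ker_osc(1) ker_norm(1) ker_meas(1)] square_integrable[OF N ker_osc(2) ker_norm(2) ker_meas(2)]) auto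
  then show ?thesis by simp
qed

text \<open>\<open>step_field + 2 * W\<close> is minus the error of the step approximation in the
  two integrals, each of energy at most \<open>25 / (y^6 * N)\<close>. The 200 is
  \<open>4 * 2 * 25\<close>, where the 2 is the slack that \<open>wiener_pair_exp_bound\<close>
  requires.\<close>

lemma gap_exp:
  "exp_moment M (\<lambda>\<xi>. Re (s * (step_field z \<xi> + 2 * W z \<xi>))) \<le> ennreal (exp (200 * (cmod s)\<^sup>2 / (y ^ 6 * real N)))"
proof -
  obtain I1 I2 where I: "has_wiener_integral M (rescaled N Xhat) (\<lambda>u. ker1 u z) I1"
    "has_wiener_integral M (rescaled N Yhat) (\<lambda>u. ker2 u z) I2"
    "\<forall>\<xi>\<in>space M. W z \<xi> = - (1 / 2) * (I1 \<xi> + I2 \<xi>)" by (rule W_integrals)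
  let ?S1 = "step_integral (rescaled N Xhat) N (\<lambda>n. ker1 (grid N n) z) (grid_clamp N)"
  let ?S2 = "step_integral (rescaled N Yhat) N (\<lambda>n. ker2 (grid N n) z) (grid_clamp N)"
  have "exp_moment M (\<lambda>\<xi>. Re (s * (step_field z \<xi> + 2 * W z \<xi>))) =
    exp_moment M (\<lambda>\<xi>. Re ((- s) * ((I1 \<xi> - ?S1 \<xi>) + (I2 \<xi> - ?S2 \<xi>))))"
  proof (rule nn_integral_cong)
    fix \<xi> assume "\<xi> \<in> space M"
    then have "s * (step_field z \<xi> + 2 * W z \<xi>) = (- s) * ((I1 \<xi> - ?S1 \<xi>) + (I2 \<xi> - ?S2 \<xi>))"
      by (simp add: I(3) step_field_def algebra_simps)
    then show "ennreal (exp (Re (s * (step_field z \<xi> + 2 * W z \<xi>)))) = ennreal (exp (Re ((- s) * ((I1 \<xi> - ?S1 \<xi>) + (I2 \<xi> - ?S2 \<xi>)))))"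
      by (simp only:)
  qed
  also have "\<dots> \<le> ennreal (exp (4 * (cmod (- s))\<^sup>2 * (2 * ((5 / y ^ 3)\<^sup>2 / real N))))"
  proof (rule pair.wiener_pair_exp_bound[OF I(1,2) grid_clamp_mono grid_clamp_range])
    show "energy (\<lambda>u. ker1 u z - step_fun N (\<lambda>n. ker1 (grid N n) z) (grid_clamp N) u) \<le> ennreal ((5 / y ^ 3)\<^sup>2 / real N)"
      by (rule cell_square_bound[OF N ker_osc(1) ker_norm(1) ker_meas(1)])
    show "energy (\<lambda>u. ker2 u z - step_fun N (\<lambda>n. ker2 (grid N n) z) (grid_clamp N) u) \<le> ennreal ((5 / y ^ 3)\<^sup>2 / real N)"
      by (rule cell_square_bound[OF N ker_osc(2) ker_norm(2) ker_meas(2)])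
    have "0 < (5 / y ^ 3)\<^sup>2 / real N" using y N by simp
    then show "0 \<le> (5 / y ^ 3)\<^sup>2 / real N" "(5 / y ^ 3)\<^sup>2 / real N < 2 * ((5 / y ^ 3)\<^sup>2 / real N)" by linarith+
  qed
  also have "4 * (cmod (- s))\<^sup>2 * (2 * ((5 / y ^ 3)\<^sup>2 / real N)) = 200 * (cmod s)\<^sup>2 / (y ^ 6 * real N)"
    by (simp add: power_divide power_mult[symmetric])
  finally show ?thesis .
qed

lemma W_exp: "exp_moment M (\<lambda>\<xi>. Re (s * W z \<xi>)) \<le> ennreal (exp (2 * (cmod s)\<^sup>2 / y\<^sup>2))"
proof -
  obtain I1 I2 where I: "has_wiener_integral M (rescaled N Xhat) (\<lambda>u. ker1 u z) I1"
    "has_wiener_integral M (rescaled N Yhat) (\<lambda>u. ker2 u z) I2"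
    "\<forall>\<xi>\<in>space M. W z \<xi> = - (1 / 2) * (I1 \<xi> + I2 \<xi>)" by (rule W_integrals)
  have "exp_moment M (\<lambda>\<xi>. Re (s * W z \<xi>)) =
    exp_moment M (\<lambda>\<xi>. Re ((- s / 2) * ((I1 \<xi> - step_integral (rescaled N Xhat) 0 (\<lambda>_. 0) (grid_clamp N) \<xi>) + (I2 \<xi> - step_integral (rescaled N Yhat) 0 (\<lambda>_. 0) (grid_clamp N) \<xi>))))"
    by (intro nn_integral_cong) (simp add: I(3))
  also have "\<dots> \<le> ennreal (exp (4 * (cmod (- s / 2))\<^sup>2 * (2 * (1 / y)\<^sup>2)))"
  proof (rule pair.wiener_pair_exp_bound[OF I(1,2) grid_clamp_mono grid_clamp_range])
    show "energy (\<lambda>u. ker1 u z - step_fun 0 (\<lambda>_. 0) (grid_clamp N) u) \<le> ennreal ((1 / y)\<^sup>2)"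
      using square_integral_le[OF N ker_osc(1) ker_norm(1) ker_meas(1)] by simp
    show "energy (\<lambda>u. ker2 u z - step_fun 0 (\<lambda>_. 0) (grid_clamp N) u) \<le> ennreal ((1 / y)\<^sup>2)"
      using square_integral_le[OF N ker_osc(2) ker_norm(2) ker_meas(2)] by simp
    have "0 < (1 / y)\<^sup>2" using y by simp
    then show "0 \<le> (1 / y)\<^sup>2" "(1 / y)\<^sup>2 < 2 * (1 / y)\<^sup>2" by linarith+
  qed
  also have "4 * (cmod (- s / 2))\<^sup>2 * (2 * (1 / y)\<^sup>2) = 2 * (cmod s)\<^sup>2 / y\<^sup>2"
    by (simp add: norm_divide power_divide)
  finally show ?thesis .
qed

text \<open>The \<open>X\<close> sums equal the Brownian path at integer times, so only the coupling
  error of the \<open>Y\<close> sums remains. Summation by parts against \<open>ker2\<close> bounds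
  its contribution by the maximal error.\<close>

lemma noise_field_gap:
  assumes \<xi>: "Xhat 0 \<xi> = 0" "Yhat 0 \<xi> = 0" "\<And>n. n \<in> {1..N} \<Longrightarrow> (\<Sum>j=1..n. X_var b j \<xi>) = Xhat (real n) \<xi>"
    and m: "coupling_error \<beta> a Yhat N \<xi> \<le> m"
  shows "cmod ((\<Sum>n<N. cplx (X_var b (Suc n) \<xi>) * ker1 (grid N n) z + cplx (step_Y n \<xi>) * ker2 (grid N n) z)
      - sqrt (real N) * step_field z \<xi>) \<le> 6 / y ^ 3 * m"
proof -
  have sN: "0 < sqrt (real N)" using N by simp
  have g: "rescaled N B (grid_clamp N n) \<xi> = B (real n) \<xi> / sqrt (real N)" if "n \<le> N" for n B
    using that N by (simp add: rescaled_def grid_clamp_def grid_def)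
  have st: "cplx (sqrt (real N)) * step_integral (rescaled N B) N c (grid_clamp N) \<xi> = (\<Sum>n<N. c n * cplx (B (real (Suc n)) \<xi> - B (real n) \<xi>))" for B c
    unfolding step_integral_def sum_distrib_left
  proof (intro sum.cong refl)
    fix n assume "n \<in> {..<N}"
    then show "cplx (sqrt (real N)) * (c n * cplx (rescaled N B (grid_clamp N (Suc n)) \<xi> - rescaled N B (grid_clamp N n) \<xi>)) = c n * cplx (B (real (Suc n)) \<xi> - B (real n) \<xi>)"
      using sN by (simp add: g diff_divide_distrib[symmetric] del: of_nat_Suc of_real_diff)
  qed
  have X: "X_var b (Suc n) \<xi> = Xhat (real (Suc n)) \<xi> - Xhat (real n) \<xi>" if "n < N" for n
  proof (cases "n = 0")
    case True
    then show ?thesis using \<xi>(3)[of 1] \<xi>(1) N by simp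
  next
    case False
    then show ?thesis using \<xi>(3)[of n] \<xi>(3)[of "Suc n"] that by simp
  qed
  define D where "D k = (\<Sum>j=1..k. Y_var \<beta> a j \<xi>) - Yhat (real k) \<xi>" for k
  have D0: "D 0 = 0" using \<xi>(2) by (simp add: D_def)
  have Db: "\<bar>D n\<bar> \<le> m" if "n \<le> N" for n
  proof (cases "n = 0")
    case True
    have "0 \<le> coupling_error \<beta> a Yhat N \<xi>" using coupling_error_ge[OF \<beta>, of N N] N by (auto intro: order_trans[OF abs_ge_zero])
    then show ?thesis using True D0 m by simp
  next
    case False
    then show ?thesis using coupling_error_ge[OF \<beta>, of n N \<xi>] that m unfolding D_def by force
  qed
  have DS: "D (Suc n) - D n = step_Y n \<xi> - (Yhat (real (Suc n)) \<xi> - Yhat (real n) \<xi>)" for n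
    by (simp add: D_def step_Y_def)
  have "(\<Sum>n<N. cplx (X_var b (Suc n) \<xi>) * ker1 (grid N n) z + cplx (step_Y n \<xi>) * ker2 (grid N n) z) - sqrt (real N) * step_field z \<xi>
    = (\<Sum>n<N. ker2 (grid N n) z * cplx (D (Suc n) - D n))"
  proof -
    have 1: "cplx (X_var b (Suc n) \<xi>) * ker1 (grid N n) z + cplx (step_Y n \<xi>) * ker2 (grid N n) z =
      ker1 (grid N n) z * cplx (Xhat (real (Suc n)) \<xi> - Xhat (real n) \<xi>) + ker2 (grid N n) z * cplx (Yhat (real (Suc n)) \<xi> - Yhat (real n) \<xi>) + ker2 (grid N n) z * cplx (D (Suc n) - D n)" if "n < N" for n
      unfolding DS X[OF that] by (simp add: algebra_simps)
    have 2: "(\<Sum>n<N. cplx (X_var b (Suc n) \<xi>) * ker1 (grid N n) z + cplx (step_Y n \<xi>) * ker2 (grid N n) z) =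
      (\<Sum>n<N. ker1 (grid N n) z * cplx (Xhat (real (Suc n)) \<xi> - Xhat (real n) \<xi>)) + (\<Sum>n<N. ker2 (grid N n) z * cplx (Yhat (real (Suc n)) \<xi> - Yhat (real n) \<xi>)) + (\<Sum>n<N. ker2 (grid N n) z * cplx (D (Suc n) - D n))"
      unfolding sum.distrib[symmetric] by (intro sum.cong refl 1) simp
    show ?thesis unfolding 2 step_field_def distrib_left st by simp
  qed
  moreover have "cmod (\<Sum>n<N. ker2 (grid N n) z * cplx (D (Suc n) - D n)) \<le> (1 / y + 5 / y ^ 3) * m"
    by (rule abel_bound[where h = "\<lambda>u. ker2 u z" and D = D, OF N ker_osc(2) ker_norm(2) ker_meas(2) D0 Db])
  moreover have "(1 / y + 5 / y ^ 3) * m \<le> 6 / y ^ 3 * m"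
  proof (rule mult_right_mono)
    have "y ^ 3 \<le> y ^ 1" using y by (intro power_decreasing) auto
    then have "1 / y \<le> 1 / y ^ 3" using y by (intro divide_left_mono) auto
    then show "1 / y + 5 / y ^ 3 \<le> 6 / y ^ 3" by (simp add: add_divide_distrib[symmetric] field_simps)
    show "0 \<le> m" using Db[of 0] D0 by simp
  qed
  ultimately show ?thesis by simp
qed

end
end

section \<open>Events\<close>

text \<open>Square cells of side \<open>r / 4\<close>, each represented by one of its points in
  \<open>S\<close>, so that the centres lie in \<open>S\<close> and cell mates are within
  \<open>r / 2\<close>. At most \<open>8 * R / r + 5\<close> cells per axis are met, hence the
  13.\<close>

lemma finite_cover:
  fixes S :: "complex set"
  assumes S: "\<And>z. z \<in> S \<Longrightarrow> cmod z \<le> R" and R: "1 \<le> R" and r: "0 < r" "r \<le> 1"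
  obtains F where "finite F" "F \<subseteq> S" "real (card F) \<le> (13 * R / r)\<^sup>2" "\<And>w. w \<in> S \<Longrightarrow> \<exists>z\<in>F. w \<in> ball z (r / 2)"
proof -
  define s where "s = r / 4"
  have s: "0 < s" using r by (simp add: s_def)
  define g where "g z = (\<lfloor>Re z / s\<rfloor>, \<lfloor>Im z / s\<rfloor>)" for z
  define m where "m = \<lceil>4 * R / r\<rceil> + 1"
  have in_m: "\<lfloor>x / s\<rfloor> \<in> {- m..m}" if "\<bar>x\<bar> \<le> R" for x
  proof -
    have "\<bar>x / s\<bar> \<le> 4 * R / r" using that r by (simp add: s_def abs_divide field_simps)
    moreover have "\<lfloor>t\<rfloor> \<in> {- (\<lceil>c\<rceil> + 1)..\<lceil>c\<rceil> + 1}" if "\<bar>t\<bar> \<le> c" for t c :: real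
    proof -
      have "- c \<le> t" "t \<le> c" using that by linarith+
      then show ?thesis unfolding atLeastAtMost_iff by (intro conjI) linarith+
    qed
    ultimately show ?thesis unfolding m_def by blast
  qed
  have sub: "g ` S \<subseteq> {- m..m} \<times> {- m..m}"
  proof
    fix p assume "p \<in> g ` S"
    then obtain z where z: "z \<in> S" "p = g z" by auto
    have "\<bar>Re z\<bar> \<le> R" "\<bar>Im z\<bar> \<le> R" using S[OF z(1)] abs_Re_le_cmod[of z] abs_Im_le_cmod[of z] by linarith+
    then show "p \<in> {- m..m} \<times> {- m..m}" using in_m by (simp add: z(2) g_def del: atLeastAtMost_iff)
  qed
  have fin: "finite (g ` S)" by (rule finite_subset[OF sub]) simp
  have card: "real (card (g ` S)) \<le> (13 * R / r)\<^sup>2"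
  proof -
    have Rr: "1 \<le> R / r" using R r by (simp add: pos_le_divide_eq)
    have "0 \<le> 4 * R / r" using Rr by simp
    then have m0: "0 \<le> m" unfolding m_def by linarith
    have "card (g ` S) \<le> card ({- m..m} \<times> {- m..m})" by (rule card_mono[OF _ sub]) simp
    also have "\<dots> = nat (2 * m + 1) * nat (2 * m + 1)" by (simp add: card_cartesian_product)
    finally have "real (card (g ` S)) \<le> real (nat (2 * m + 1) * nat (2 * m + 1))" by (simp only: of_nat_le_iff)
    also have "\<dots> = (real_of_int (2 * m + 1))\<^sup>2" using m0 by (simp add: power2_eq_square)
    also have "\<dots> \<le> (13 * R / r)\<^sup>2"
    proof (rule power_mono)
      have "real_of_int m \<le> 4 * R / r + 2" unfolding m_def by linarith
      then show "real_of_int (2 * m + 1) \<le> 13 * R / r" using Rr by simp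
    qed (use m0 in simp)
    finally show ?thesis .
  qed
  define c where "c p = (SOME z. z \<in> S \<and> g z = p)" for p
  have c: "c (g w) \<in> S" "g (c (g w)) = g w" if "w \<in> S" for w
    using someI[of "\<lambda>z. z \<in> S \<and> g z = g w" w] that by (auto simp: c_def)
  show thesis
  proof (rule that[of "c ` g ` S"])
    show "finite (c ` g ` S)" using fin by simp
    show "c ` g ` S \<subseteq> S" using c by auto
    show "real (card (c ` g ` S)) \<le> (13 * R / r)\<^sup>2" using card card_image_le[OF fin, of c] by linarith
    fix w assume w: "w \<in> S"
    let ?z = "c (g w)"
    have fl: "\<bar>a - a'\<bar> < s" if "\<lfloor>a / s\<rfloor> = \<lfloor>a' / s\<rfloor>" for a a'
    proof -
      have "\<bar>a / s - a' / s\<bar> < 1" using that by linarith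
      moreover have "a - a' = s * (a / s - a' / s)" using s by (simp add: field_simps)
      ultimately show ?thesis using s by (simp add: abs_mult)
    qed
    have "cmod (?z - w) \<le> \<bar>Re (?z - w)\<bar> + \<bar>Im (?z - w)\<bar>" by (rule cmod_le)
    also have "\<dots> < s + s" using c(2)[OF w] by (intro add_strict_mono) (auto simp: g_def intro!: fl)
    finally have "w \<in> ball ?z (r / 2)" by (simp add: dist_norm s_def)
    then show "\<exists>z\<in>c ` g ` S. w \<in> ball z (r / 2)" using w by blast
  qed
qed

text \<open>Only exponential moments at single points of \<open>D\<close> enter; the price of the
  supremum is the number of discs, which is polynomial in \<open>1 / r\<close>.\<close>

lemma (in prob_space) holomorphic_sup_tail_cover:
  assumes S: "\<And>z. z \<in> S \<Longrightarrow> cmod z \<le> R" and R: "1 \<le> R" and r: "0 < r" "r \<le> 1" and D: "\<And>z. z \<in> S \<Longrightarrow> cball z r \<subseteq> D"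
    and hol: "\<And>\<xi>. \<xi> \<in> space M \<Longrightarrow> (\<lambda>z. F z \<xi>) holomorphic_on D"
    and meas: "\<And>z. z \<in> D \<Longrightarrow> F z \<in> borel_measurable M"
    and A: "\<And>z s. z \<in> D \<Longrightarrow> cmod s = l \<Longrightarrow> exp_moment M (\<lambda>\<xi>. Re (s * F z \<xi>)) \<le> ennreal A"
    and l: "0 < l" and A0: "0 \<le> A"
  obtains B where "B \<in> sets M" "emeasure M B \<le> ennreal ((13 * R / r)\<^sup>2 * (8 * A * exp (- l * x / 2)))"
    "\<And>\<xi> w. \<xi> \<in> space M \<Longrightarrow> \<xi> \<notin> B \<Longrightarrow> w \<in> S \<Longrightarrow> cmod (F w \<xi>) < x"
proof -
  obtain C where C: "finite C" "C \<subseteq> S" "real (card C) \<le> (13 * R / r)\<^sup>2" "\<And>w. w \<in> S \<Longrightarrow> \<exists>z\<in>C. w \<in> ball z (r / 2)"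
    using finite_cover[OF S R r] by blast
  have "\<exists>B\<in>sets M. emeasure M B \<le> ennreal (8 * A * exp (- l * x / 2)) \<and> (\<forall>\<xi>\<in>space M - B. \<forall>w\<in>ball z (r / 2). cmod (F w \<xi>) < x)"
    if z: "z \<in> C" for z
  proof (rule holomorphic_sup_tail[OF _ r(1) _ _ l A0])
    have D': "cball z r \<subseteq> D" using D C(2) z by blast
    show "(\<lambda>z. F z \<xi>) holomorphic_on cball z r" if "\<xi> \<in> space M" for \<xi> using hol[OF that] D' by (rule holomorphic_on_subset)
    show "F z' \<in> borel_measurable M" if "z' \<in> cball z r" for z' using meas D' that by blast
    show "exp_moment M (\<lambda>\<xi>. Re (s * F z' \<xi>)) \<le> ennreal A" if "z' \<in> cball z r" "cmod s = l" for z' s using A D' that by blast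
  qed
  then obtain B where B: "\<And>z. z \<in> C \<Longrightarrow> B z \<in> sets M" "\<And>z. z \<in> C \<Longrightarrow> emeasure M (B z) \<le> ennreal (8 * A * exp (- l * x / 2))"
    "\<And>z \<xi> w. z \<in> C \<Longrightarrow> \<xi> \<in> space M - B z \<Longrightarrow> w \<in> ball z (r / 2) \<Longrightarrow> cmod (F w \<xi>) < x" by metis
  show thesis
  proof (rule that[of "\<Union>z\<in>C. B z"])
    show "(\<Union>z\<in>C. B z) \<in> sets M" using C(1) B(1) by auto
    have "emeasure M (\<Union>z\<in>C. B z) \<le> (\<Sum>z\<in>C. emeasure M (B z))" using C(1) B(1) by (intro emeasure_subadditive_finite) auto
    also have "\<dots> \<le> (\<Sum>z\<in>C. ennreal (8 * A * exp (- l * x / 2)))" by (intro sum_mono B(2))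
    also have "\<dots> = ennreal (real (card C) * (8 * A * exp (- l * x / 2)))" using A0 by (subst sum_ennreal) auto
    also have "\<dots> \<le> ennreal ((13 * R / r)\<^sup>2 * (8 * A * exp (- l * x / 2)))" using A0 C(3) by (intro ennreal_leI mult_right_mono) auto
    finally show "emeasure M (\<Union>z\<in>C. B z) \<le> ennreal ((13 * R / r)\<^sup>2 * (8 * A * exp (- l * x / 2)))" .
    fix \<xi> w assume a: "\<xi> \<in> space M" "\<xi> \<notin> (\<Union>z\<in>C. B z)" "w \<in> S"
    then obtain z where "z \<in> C" "w \<in> ball z (r / 2)" using C(4) by blast
    then show "cmod (F w \<xi>) < x" using B(3)[of z \<xi> w] a by auto
  qed
qed

text \<open>By continuity the supremum may be taken over a countable dense subset of
  \<open>S\<close>.\<close>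

lemma sup_event_measurable:
  fixes H :: "complex \<Rightarrow> 'a \<Rightarrow> complex"
  assumes cont: "\<And>\<xi>. \<xi> \<in> space M \<Longrightarrow> continuous_on S (\<lambda>z. H z \<xi>)" and meas: "\<And>z. z \<in> S \<Longrightarrow> H z \<in> borel_measurable M"
  shows "{\<xi> \<in> space M. c \<le> (SUP z\<in>S. ennreal (cmod (H z \<xi>)))} \<in> sets M"
proof -
  obtain T where T: "countable T" "T \<subseteq> S" "S \<subseteq> closure T" using separable by blast
  have eq: "(SUP z\<in>S. ennreal (cmod (H z \<xi>))) = (SUP z\<in>T. ennreal (cmod (H z \<xi>)))" if \<xi>: "\<xi> \<in> space M" for \<xi>
  proof (rule antisym)
    show "(SUP z\<in>T. ennreal (cmod (H z \<xi>))) \<le> (SUP z\<in>S. ennreal (cmod (H z \<xi>)))" by (rule SUP_subset_mono[OF T(2)]) simp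
    show "(SUP z\<in>S. ennreal (cmod (H z \<xi>))) \<le> (SUP z\<in>T. ennreal (cmod (H z \<xi>)))"
    proof (rule SUP_least)
      fix z assume z: "z \<in> S"
      then have "z \<in> closure T" using T(3) by blast
      then obtain t where t: "\<And>n. t n \<in> T" "t \<longlonglongrightarrow> z" unfolding closure_sequential by blast
      have "(\<lambda>n. H (t n) \<xi>) \<longlonglongrightarrow> H z \<xi>"
        using continuous_on_tendsto_compose[OF cont[OF \<xi>] t(2) z] t(1) T(2) by (auto intro: always_eventually)
      then have "(\<lambda>n. ennreal (cmod (H (t n) \<xi>))) \<longlonglongrightarrow> ennreal (cmod (H z \<xi>))" by (intro tendsto_intros)
      then show "ennreal (cmod (H z \<xi>)) \<le> (SUP z\<in>T. ennreal (cmod (H z \<xi>)))"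
        by (rule LIMSEQ_le_const2) (auto intro!: SUP_upper t)
    qed
  qed
  have "{\<xi> \<in> space M. c \<le> (SUP z\<in>S. ennreal (cmod (H z \<xi>)))} = {\<xi> \<in> space M. c \<le> (SUP z\<in>T. ennreal (cmod (H z \<xi>)))}"
    using eq by auto
  moreover have "(\<lambda>\<xi>. SUP z\<in>T. ennreal (cmod (H z \<xi>))) \<in> borel_measurable M"
    using T meas by (intro borel_measurable_SUP) auto
  ultimately show ?thesis by simp
qed

lemma tri_det_norm_le:
  assumes "\<And>i. i < n \<Longrightarrow> cmod (d i) \<le> B1" "\<And>i. Suc i < n \<Longrightarrow> cmod ((e i)\<^sup>2) \<le> B2" "1 \<le> B1" "0 \<le> B2"
  shows "cmod (tri_det d e n) \<le> (B1 + B2) ^ n"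
  using assms(1,2)
proof (induction n rule: induct_nat_012)
  case 1
  then show ?case using assms(4) by (simp add: add_increasing2)
next
  case (ge2 n)
  have 1: "1 \<le> B1 + B2" using assms by linarith
  have "cmod (tri_det d e (Suc (Suc n))) \<le> cmod (d (Suc n)) * cmod (tri_det d e (Suc n)) + cmod ((e n)\<^sup>2) * cmod (tri_det d e n)"
    by (simp only: tri_det.simps norm_mult[symmetric] norm_triangle_ineq4)
  also have "\<dots> \<le> B1 * (B1 + B2) ^ Suc n + B2 * (B1 + B2) ^ n"
    using ge2 assms by (intro add_mono mult_mono) auto
  also have "\<dots> \<le> B1 * (B1 + B2) ^ Suc n + B2 * (B1 + B2) ^ Suc n"
    using 1 assms by (intro add_mono mult_left_mono order_refl power_increasing) auto
  also have "\<dots> = (B1 + B2) ^ Suc (Suc n)" by (simp add: distrib_right)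
  finally show ?case .
qed simp

lemma tri_det_continuous:
  assumes "\<And>i. i < n \<Longrightarrow> continuous_on S (\<lambda>z. d z i)"
  shows "continuous_on S (\<lambda>z. tri_det (d z) e n)"
  using assms by (induction n rule: induct_nat_012) (auto intro!: continuous_intros)

lemma tri_det_measurable:
  assumes "\<And>i. i < n \<Longrightarrow> (\<lambda>\<xi>. d \<xi> i) \<in> borel_measurable M" "\<And>i. Suc i < n \<Longrightarrow> (\<lambda>\<xi>. e \<xi> i) \<in> borel_measurable M"
  shows "(\<lambda>\<xi>. tri_det (d \<xi>) (e \<xi>) n :: complex) \<in> borel_measurable M"
  using assms by (induction n rule: induct_nat_012) auto

text \<open>With \<open>q = N^(-1/9)\<close> the disc has radius \<open>q^2 / 4\<close>. Such a move
  costs at most half of \<open>q\<close> in the imaginary part, and half of the excess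
  \<open>q^2 / 2\<close> in the real part, which leaves
  \<open>(Re w)^2 - 1 \<ge> q^2 / 2 \<ge> (q / 2)^2\<close>.\<close>

lemma region_hyp:
  assumes N: "1 \<le> N" and A: "A = real N powr (1 / 90)" and z: "z \<in> region (1 / 9) N" and w: "w \<in> cball z (1 / (4 * A ^ 20))"
  shows "hyp (1 / (2 * A ^ 10)) w"
proof -
  have N0: "0 < real N" using N by simp
  have A1: "1 \<le> A" unfolding A using N by (simp add: ge_one_powr_ge_zero)
  have A0: "0 < A" using A1 by simp
  have e1: "real N powr (- (1 / 9)) = 1 / A ^ 10"
  proof -
    have "A ^ 10 = real N powr (1 / 9)" unfolding A using N0 by (simp add: powr_power[symmetric] powr_powr flip: powr_realpow)
    then show ?thesis using N0 by (simp add: powr_minus_divide)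
  qed
  have e2: "real N powr (- 2 * (1 / 9)) = (1 / A ^ 10)\<^sup>2"
    unfolding e1[symmetric] using N0 by (simp add: powr_powr[symmetric] powr_power)
  define q where "q = 1 / A ^ 10"
  have q: "0 < q" "q \<le> 1" using A1 by (auto simp: q_def one_le_power)
  have q2: "1 / (4 * A ^ 20) = q\<^sup>2 / 4" by (simp add: q_def power_divide power_mult[symmetric])
  have qy: "1 / (2 * A ^ 10) = q / 2" by (simp add: q_def)
  have d: "cmod (z - w) \<le> q\<^sup>2 / 4" using w unfolding q2 by (simp add: dist_norm)
  have q3: "q\<^sup>2 \<le> q" using q by (simp add: power2_eq_square mult_left_le)
  from z consider "q \<le> \<bar>Im z\<bar>" | "1 + 1 / 2 * q\<^sup>2 \<le> \<bar>Re z\<bar>"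
    unfolding region_def e2 q_def[symmetric] using e1 q_def by auto
  then show ?thesis
  proof cases
    case 1
    have "\<bar>Im z - Im w\<bar> \<le> q\<^sup>2 / 4" using abs_Im_le_cmod[of "z - w"] d by simp
    then have "q / 2 \<le> \<bar>Im w\<bar>" using 1 q q3 by linarith
    then show ?thesis unfolding hyp_def qy by simp
  next
    case 2
    have "\<bar>Re z - Re w\<bar> \<le> q\<^sup>2 / 4" using abs_Re_le_cmod[of "z - w"] d by simp
    then have re: "1 + q\<^sup>2 / 4 \<le> \<bar>Re w\<bar>" using 2 by linarith
    have "(1 + q\<^sup>2 / 4)\<^sup>2 \<le> \<bar>Re w\<bar>\<^sup>2" using re by (intro power_mono) auto
    moreover have "(1 + q\<^sup>2 / 4)\<^sup>2 = 1 + q\<^sup>2 / 2 + (q\<^sup>2 / 4)\<^sup>2" by (simp add: power2_sum)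
    moreover have "(q / 2)\<^sup>2 = q\<^sup>2 / 4" by (simp add: power_divide)
    moreover have "0 \<le> (q\<^sup>2 / 4)\<^sup>2" "0 \<le> q\<^sup>2" by simp_all
    ultimately have "(q / 2)\<^sup>2 \<le> (Re w)\<^sup>2 - 1" unfolding power2_abs by linarith
    moreover have "1 \<le> \<bar>Re w\<bar>" using re \<open>0 \<le> q\<^sup>2\<close> by linarith
    ultimately show ?thesis unfolding hyp_def qy by simp
  qed
qed

section \<open>The comparison\<close>

lemma exp_minus_one_le:
  fixes e :: complex
  assumes "cmod e \<le> 1 / 4"
  shows "cmod (exp e - 1) \<le> 3 * cmod e"
proof -
  have "Re e \<le> 1 / 4" using abs_Re_le_cmod[of e] assms by linarith
  then have "exp (Re e) \<le> exp (1 / 4)" by simp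
  also have "\<dots> \<le> 1 + 1 / 4 + (1 / 4)\<^sup>2" by (rule exp_bound) auto
  finally have "exp (Re e) + exp (Re 0) \<le> 3" by (simp add: power2_eq_square)
  then have "cmod (e - 0) * (exp (Re e) + exp (Re 0)) \<le> cmod (e - 0) * 3" by (intro mult_left_mono) auto
  then show ?thesis using norm_exp_diff_le[of e 0] by simp
qed

text \<open>For \<open>A \<ge> 1\<close> the power \<open>A^m\<close> costs \<open>m\<close> in the
  rate and the constant costs a logarithm; the remaining 1 is the decay that is kept. The quarter
  prepares the union of four bad events.\<close>

lemma poly_exp_le:
  fixes A C q :: real
  assumes A: "1 \<le> A" and C: "0 \<le> C" and q: "real m + 1 + ln (max 1 (4 * C)) \<le> q"
  shows "C * A ^ m * exp (- q * A\<^sup>2) \<le> exp (- A\<^sup>2) / 4"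
proof -
  define D where "D = max 1 (4 * C)"
  have D: "1 \<le> D" "4 * C \<le> D" by (auto simp: D_def)
  have A2: "1 \<le> A\<^sup>2" using A by (simp add: one_le_power)
  have "A \<le> A\<^sup>2" using A by (simp add: power2_eq_square mult_left_le)
  then have "A \<le> exp (A\<^sup>2)" using exp_ge_add_one_self[of "A\<^sup>2"] by linarith
  then have "A ^ m \<le> exp (A\<^sup>2) ^ m" using A by (intro power_mono) auto
  also have "\<dots> = exp (real m * A\<^sup>2)" by (simp add: exp_of_nat_mult)
  finally have 1: "A ^ m \<le> exp (real m * A\<^sup>2)" .
  have "ln D * 1 \<le> ln D * A\<^sup>2" using A2 D by (intro mult_left_mono) auto
  then have "exp (ln D) \<le> exp (ln D * A\<^sup>2)" by simp
  then have 2: "4 * C \<le> exp (ln D * A\<^sup>2)" using D by simp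
  have "4 * C * A ^ m * exp (- q * A\<^sup>2) \<le> exp (ln D * A\<^sup>2) * exp (real m * A\<^sup>2) * exp (- q * A\<^sup>2)"
    using 1 2 C A by (intro mult_right_mono mult_mono) auto
  also have "\<dots> = exp ((ln D + real m - q) * A\<^sup>2)" by (simp add: exp_add[symmetric] algebra_simps)
  also have "\<dots> \<le> exp (- 1 * A\<^sup>2)" using q unfolding D_def exp_le_cancel_iff by (intro mult_right_mono) auto
  finally show ?thesis by simp
qed

text \<open>The smallness conditions needed at \<open>x = N\<^sup>1\<^sup>/\<^sup>9\<^sup>0\<close>, for points at scale \<open>y = 1 / (2 x\<^sup>1\<^sup>0)\<close>, noise truncated at
  \<open>R1 x\<^sup>2\<close>, exponential moments of order \<open>x\<^sup>9\<close> and fluctuations of size \<open>R2 / x\<^sup>7\<close>.\<close>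

definition ample :: "real \<Rightarrow> real \<Rightarrow> real \<Rightarrow> real \<Rightarrow> real \<Rightarrow> real \<Rightarrow> real \<Rightarrow> bool" where
  "ample R R1 R2 \<gamma> cr cb x \<longleftrightarrow>
     2 / ((1 / (2 * x ^ 10)) / (R + 1)) * (3 * (\<gamma> * R1 / x ^ 43) + 1 / (2 * (1 / (2 * x ^ 10)) * x ^ 90)) + 1 / (2 * (1 / (2 * x ^ 10)) * x ^ 90)
       \<le> ((1 / (2 * x ^ 10)) / (R + 1))\<^sup>2 / 8 \<and>
     (R + 1) / (1 / (2 * x ^ 10)) * (exp (- 43 * x) * (R + 1) + 2 * (1 / (2 * (1 / (2 * x ^ 10)) * x ^ 90)) / ((1 / (2 * x ^ 10)) / (R + 1))) +
       (2 / ((1 / (2 * x ^ 10)) / (R + 1)) * (3 * (\<gamma> * R1 / x ^ 43) + 1 / (2 * (1 / (2 * x ^ 10)) * x ^ 90)) + 1 / (2 * (1 / (2 * x ^ 10)) * x ^ 90))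
       \<le> 1 / x ^ 32 \<and>
     1 / x ^ 32 \<le> (1 / (2 * x ^ 10)) / 2 \<and> 12 * (\<gamma> * R1 / x ^ 43) \<le> 1 / (2 * x ^ 10) \<and> 1 / (1 / (2 * x ^ 10)) \<le> x ^ 90 \<and>
     (x ^ 9)\<^sup>2 * (x ^ 90 * (20 * (1 / x ^ 32) * (\<gamma> * R1 / x ^ 43) / (1 / (2 * x ^ 10))\<^sup>2 + 3 * (\<gamma> * R1 / x ^ 43)\<^sup>2 / (1 / (2 * x ^ 10))\<^sup>2)\<^sup>2 +
        (172 * (R + 1) * x ^ 11 + 1) * (16 * (\<gamma> * R1 / x ^ 43) / (1 / (2 * x ^ 10)) + 3 * (\<gamma> * R1 / x ^ 43)\<^sup>2 / (1 / (2 * x ^ 10))\<^sup>2)\<^sup>2) / 2 \<le> 1 \<and>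
     200 * (x ^ 9)\<^sup>2 / ((1 / (2 * x ^ 10)) ^ 6 * x ^ 90) \<le> 1 \<and>
     cb * exp (- x\<^sup>2) \<le> 1 \<and>
     R2 / x ^ 7 + \<gamma> * (R2 / x ^ 7) + \<gamma> / x ^ 45 * (6 / (1 / (2 * x ^ 10)) ^ 3 * (4 * x\<^sup>2 * (cr * (90 * x)))) +
       \<gamma>\<^sup>2 / 2 * (20 / ((1 / (2 * x ^ 10)) ^ 4 * x ^ 90)) +
       (x ^ 90 * (8 * (\<gamma> / x ^ 45) * (cb * exp (- x\<^sup>2)) / (1 / (2 * x ^ 10)) + 2 * (\<gamma> / x ^ 45)\<^sup>2 * (cb * exp (- x\<^sup>2)) / (1 / (2 * x ^ 10))\<^sup>2) +
        (160 * (1 / x ^ 32) * (\<gamma> * R1 / x ^ 43)\<^sup>2 * x ^ 90 / (1 / (2 * x ^ 10))\<^sup>2 + 32 * (\<gamma> * R1 / x ^ 43)\<^sup>2 / (1 / (2 * x ^ 10))\<^sup>2 * (172 * (R + 1) * x ^ 11 + 1)) +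
        x ^ 90 * (6 * (\<gamma> * R1 / x ^ 43) / (1 / (2 * x ^ 10))) ^ 3)
       \<le> 1 / (4 * x ^ 6)"

lemma eventually_ample:
  assumes "1 \<le> R" "0 < R1" "0 < R2" "0 < \<gamma>" "0 < cr" "0 < cb"
  shows "eventually (ample R R1 R2 \<gamma> cr cb) at_top"
  unfolding ample_def[abs_def]
  by (intro eventually_conj; use assms in real_asymp)

context gbe_field
begin

text \<open>Half of the coefficient \<open>sqrt (2 / \<beta>)\<close> of \<open>W\<close>, and also
  \<open>sqrt N\<close> times the noise scale \<open>k\<close>. The factor 2 matches the
  \<open>- 1 / 2\<close> in the definition of the field.\<close>

definition \<gamma> :: real where "\<gamma> = 1 / sqrt (2 * \<beta>)"

definition likelihood :: "complex \<Rightarrow> 'a \<Rightarrow> complex" where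
  "likelihood z \<xi> = phi \<beta> (\<lambda>k. a k \<xi>) (\<lambda>k. b k \<xi>) N z *
      (LINT \<xi>'|M. exp (cplx (sqrt (2 / \<beta>)) * W z \<xi>')) /
     (pi_N N z * exp (cplx (sqrt (2 / \<beta>)) * W z \<xi>))"

lemma \<gamma>: "0 < \<gamma>" "sqrt (2 / \<beta>) = 2 * \<gamma>" "1 / sqrt (2 * real N * \<beta>) = \<gamma> / sqrt (real N)"
  "(1 / sqrt (2 * real N * \<beta>))\<^sup>2 / 2 = \<gamma>\<^sup>2 / 2 / real N"
proof -
  show "0 < \<gamma>" using \<beta> by (simp add: \<gamma>_def)
  have "sqrt (2 / \<beta>) = 2 / sqrt (2 * \<beta>)"
  proof -
    have "2 / \<beta> = 2\<^sup>2 / (2 * \<beta>)" using \<beta> by (simp add: power2_eq_square)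
    then show ?thesis by (simp only: real_sqrt_divide real_sqrt_abs)
  qed
  then show "sqrt (2 / \<beta>) = 2 * \<gamma>" by (simp add: \<gamma>_def)
  show "1 / sqrt (2 * real N * \<beta>) = \<gamma> / sqrt (real N)" by (simp add: \<gamma>_def real_sqrt_mult)
  then show "(1 / sqrt (2 * real N * \<beta>))\<^sup>2 / 2 = \<gamma>\<^sup>2 / 2 / real N" by (simp add: power_divide)
qed

lemma step_field_holomorphic:
  assumes y: "0 < y" "y \<le> 1 / 2"
  shows "(\<lambda>z. step_field z \<xi>) holomorphic_on hyp_dom R y"
proof -
  have "ker1 (grid N n) holomorphic_on hyp_dom R y \<and> ker2 (grid N n) holomorphic_on hyp_dom R y" if "n \<in> {..<N}" for n
    using ker_holomorphic[OF y, of "grid N n" R] grid_bounds[of n N] that by simp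
  then show ?thesis unfolding step_field_def step_integral_def by (intro holomorphic_intros) auto
qed

lemma phi_ratio:
  assumes r: "\<And>n. n < N \<Longrightarrow> ratio N (1 / sqrt (2 * real N * \<beta>)) (xt T \<xi>) (yt T \<xi>) z n \<noteq> 0"
    and small: "\<And>n. n < N \<Longrightarrow> \<bar>X_var b (Suc n) \<xi>\<bar> \<le> T" "\<And>n. n < N \<Longrightarrow> \<bar>step_Y n \<xi>\<bar> \<le> T"
  shows "phi \<beta> (\<lambda>k. a k \<xi>) (\<lambda>k. b k \<xi>) N z = (\<Prod>n<N. ratio N (1 / sqrt (2 * real N * \<beta>)) (xt T \<xi>) (yt T \<xi>) z n)"
proof -
  let ?k = "1 / sqrt (2 * real N * \<beta>)"
  let ?X = "\<lambda>n. b (n + 1) \<xi> / sqrt 2" and ?Y = "\<lambda>n. if n = 0 then 0 else ((a n \<xi>)\<^sup>2 - \<beta> * real n) / sqrt (2 * \<beta> * real n)"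
  have eq: "ratio N ?k ?X ?Y z n = ratio N ?k (xt T \<xi>) (yt T \<xi>) z n" if "n < N" for n
  proof (rule ratio_cong)
    fix m assume "m \<le> n"
    then have m: "m < N" using that by simp
    show "?X m = xt T \<xi> m" using small(1)[OF m] by (simp add: xt_def trunc_def X_var_def)
    show "?Y m = yt T \<xi> m" using small(2)[OF m] by (simp add: yt_def trunc_def step_Y_eq mult.assoc)
  qed
  have "phi \<beta> (\<lambda>k. a k \<xi>) (\<lambda>k. b k \<xi>) N z = (\<Prod>n<N. ratio N ?k ?X ?Y z n)"
    by (rule phi_eq_prod_ratio[OF \<beta> N]) (use eq r in auto)
  also have "\<dots> = (\<Prod>n<N. ratio N ?k (xt T \<xi>) (yt T \<xi>) z n)" by (intro prod.cong refl eq) simp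
  finally show ?thesis .
qed

lemma likelihood_deviation:
  assumes "scale N L R y (1 / sqrt (2 * real N * \<beta>)) T \<epsilon>" and z: "z \<in> hyp_dom R y" and bT: "bias T \<le> 1"
    and noise: "\<And>n. n < N \<Longrightarrow> \<bar>X_var b (Suc n) \<xi>\<bar> \<le> T" "\<And>n. n < N \<Longrightarrow> \<bar>step_Y n \<xi>\<bar> \<le> T" and \<xi>: "\<xi> \<in> space M"
    and coupled: "Xhat 0 \<xi> = 0" "Yhat 0 \<xi> = 0" "\<And>n. n \<in> {1..N} \<Longrightarrow> (\<Sum>j=1..n. X_var b j \<xi>) = Xhat (real n) \<xi>"
    and m: "coupling_error \<beta> a Yhat N \<xi> \<le> m"
    and mart: "cmod (mart N (1 / sqrt (2 * real N * \<beta>)) T z \<xi>) \<le> x1" and gap: "cmod (step_field z \<xi> + 2 * W z \<xi>) \<le> x2"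
    and E: "x1 + \<gamma> * x2 + \<gamma> / sqrt (real N) * (6 / y ^ 3 * m) + \<gamma>\<^sup>2 / 2 * (20 / (y ^ 4 * real N)) +
      scale.core_error N L y (1 / sqrt (2 * real N * \<beta>)) T \<epsilon> (bias T) \<le> E" "E \<le> 1 / 4"
  shows "cmod (likelihood z \<xi> - 1) \<le> 3 * E"
proof -
  interpret S: scale N L R y "1 / sqrt (2 * real N * \<beta>)" T \<epsilon> by fact
  let ?k = "1 / sqrt (2 * real N * \<beta>)"
  let ?X = "xt T \<xi>" and ?Y = "yt T \<xi>"
  have hyp: "hyp y z" using z by (rule hyp_domD)
  have XY: "\<And>n. n < N \<Longrightarrow> \<bar>?X n\<bar> \<le> T" "\<And>n. n < N \<Longrightarrow> \<bar>?Y n\<bar> \<le> T" using xt_bound yt_bound S.T by auto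
  obtain Q where Q: "(\<Prod>n<N. 1 - incr N ?k ?X ?Y z n) = exp Q"
    "cmod (Q + mart N ?k T z \<xi> + (\<Sum>n<N. cplx (?k * ?X n) * ker1 (grid N n) z + cplx (?k * ?Y n) * ker2 (grid N n) z) +
      cplx (?k\<^sup>2 / 2) * (\<Sum>n<N. (ker1 (grid N n) z)\<^sup>2 + (ker2 (grid N n) z)\<^sup>2)) \<le> S.core_error (bias T)"
    unfolding mart_def
    by (rule S.prod_incr_eq_exp[of ?X ?Y z "bias T" "\<lambda>n. expectation (\<lambda>\<xi>. xt T \<xi> n)" "\<lambda>n. expectation (\<lambda>\<xi>. yt T \<xi> n)"
        "\<lambda>n. expectation (\<lambda>\<xi>. (xt T \<xi> n)\<^sup>2)" "\<lambda>n. expectation (\<lambda>\<xi>. (yt T \<xi> n)\<^sup>2)"])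
      (use XY z bT trunc_moments[OF \<beta> S.T] in auto)
  interpret R: noisy_recursion N z R y ?k "?k * T" ?X ?Y using z XY by (rule S.recursion)
  have pi: "pi_N N z = (\<Prod>n<N. theta N z n)" by (rule pi_N_eq_prod_theta[OF N hyp S.y])
  have pi0: "pi_N N z \<noteq> 0" unfolding pi by (simp add: R.theta_nonzero)
  have "phi \<beta> (\<lambda>k. a k \<xi>) (\<lambda>k. b k \<xi>) N z = (\<Prod>n<N. ratio N ?k ?X ?Y z n)"
    using noise S.ratio_nonzero[of ?X ?Y z, OF XY z] by (intro phi_ratio) auto
  also have "\<dots> = (\<Prod>n<N. theta N z n) * (\<Prod>n<N. 1 - incr N ?k ?X ?Y z n)"
    by (rule R.prod_ratio[OF S.small_dom[of ?X ?Y z, OF XY z]])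
  finally have phi: "phi \<beta> (\<lambda>k. a k \<xi>) (\<lambda>k. b k \<xi>) N z = pi_N N z * exp Q" by (simp only: pi Q(1))
  have "likelihood z \<xi> = exp (Q + cplx (\<gamma>\<^sup>2 / 2) * ker_energy z - cplx (2 * \<gamma>) * W z \<xi>)"
  proof -
    have "(cplx (2 * \<gamma>))\<^sup>2 / 8 = cplx (\<gamma>\<^sup>2 / 2)" by (simp add: power_mult_distrib)
    then show ?thesis unfolding likelihood_def phi \<gamma>(2) W_cexp[OF hyp S.y] using pi0 by (simp add: exp_add exp_diff)
  qed
  moreover define e where "e = Q + cplx (\<gamma>\<^sup>2 / 2) * ker_energy z - cplx (2 * \<gamma>) * W z \<xi>"
  let ?lin = "\<Sum>n<N. cplx (?k * ?X n) * ker1 (grid N n) z + cplx (?k * ?Y n) * ker2 (grid N n) z"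
  let ?en = "\<Sum>n<N. (ker1 (grid N n) z)\<^sup>2 + (ker2 (grid N n) z)\<^sup>2"
  let ?raw = "\<Sum>n<N. cplx (X_var b (Suc n) \<xi>) * ker1 (grid N n) z + cplx (step_Y n \<xi>) * ker2 (grid N n) z"
  have sN: "sqrt (real N) \<noteq> 0" using N by simp
  have lin: "?lin = cplx ?k * ?raw"
    unfolding sum_distrib_left
  proof (intro sum.cong refl)
    fix n assume "n \<in> {..<N}"
    then have "?X n = X_var b (Suc n) \<xi>" "?Y n = step_Y n \<xi>" using noise[of n] by (simp_all add: xt_def yt_def trunc_def)
    then show "cplx (?k * ?X n) * ker1 (grid N n) z + cplx (?k * ?Y n) * ker2 (grid N n) z =
      cplx ?k * (cplx (X_var b (Suc n) \<xi>) * ker1 (grid N n) z + cplx (step_Y n \<xi>) * ker2 (grid N n) z)"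
      by (simp add: algebra_simps)
  qed
  have lin2: "?lin = cplx ?k * (?raw - sqrt (real N) * step_field z \<xi>) + cplx \<gamma> * step_field z \<xi>"
  proof -
    have "?k * sqrt (real N) = \<gamma>" unfolding \<gamma>(3) using sN by simp
    then have k: "cplx ?k * cplx (sqrt (real N)) = cplx \<gamma>" by (simp only: of_real_mult[symmetric])
    have "c * r = c * (r - w * s) + c * w * s" for c r w s :: complex by (simp add: algebra_simps)
    then show ?thesis unfolding lin k[symmetric] .
  qed
  have en: "cplx (?k\<^sup>2 / 2) * ?en = cplx (\<gamma>\<^sup>2 / 2) * (?en / of_nat N)"
    unfolding \<gamma>(4) by simp
  \<comment> \<open>An exact splitting: the error of the expansion, the martingale, the coupling
    error, the step approximation of the field and the Riemann sum of its variance.\<close>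
  have e: "e = (Q + mart N ?k T z \<xi> + ?lin + cplx (?k\<^sup>2 / 2) * ?en) - mart N ?k T z \<xi>
      - cplx ?k * (?raw - sqrt (real N) * step_field z \<xi>) - cplx \<gamma> * (step_field z \<xi> + 2 * W z \<xi>)
      - cplx (\<gamma>\<^sup>2 / 2) * (?en / of_nat N - ker_energy z)"
    unfolding e_def lin2 en by (simp add: algebra_simps)
  have g0: "0 \<le> \<gamma>" using \<gamma>(1) by simp
  have k0: "\<bar>?k\<bar> = \<gamma> / sqrt (real N)" using g0 unfolding \<gamma>(3) by simp
  have b1: "cmod (cplx ?k * (?raw - sqrt (real N) * step_field z \<xi>)) \<le> \<gamma> / sqrt (real N) * (6 / y ^ 3 * m)"
    unfolding norm_mult norm_of_real k0 using g0 by (intro mult_left_mono noise_field_gap[OF hyp S.y coupled m]) auto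
  have b2: "cmod (cplx \<gamma> * (step_field z \<xi> + 2 * W z \<xi>)) \<le> \<gamma> * x2"
    unfolding norm_mult norm_of_real using gap g0 by (simp add: mult_left_mono)
  have b3: "cmod (cplx (\<gamma>\<^sup>2 / 2) * (?en / of_nat N - ker_energy z)) \<le> \<gamma>\<^sup>2 / 2 * (20 / (y ^ 4 * real N))"
    unfolding norm_mult norm_of_real using mult_left_mono[OF ker_energy_approx[OF hyp S.y N], of "\<gamma>\<^sup>2 / 2"] by simp
  have "cmod e \<le> E"
    unfolding e using Q(2) mart b1 b2 b3 E(1)
    by (intro order_trans[OF norm_triangle_ineq4] order_trans[OF add_mono[OF norm_triangle_ineq4 order_refl]]
      order_trans[OF add_mono[OF add_mono[OF norm_triangle_ineq4 order_refl] order_refl]]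
      order_trans[OF add_mono[OF add_mono[OF add_mono[OF norm_triangle_ineq4 order_refl] order_refl] order_refl]]) linarith
  then show ?thesis
    using exp_minus_one_le[of e] E(2) calculation unfolding e_def by fastforce
qed

end

context gbe_field
begin

text \<open>The exponents \<open>1/9\<close>, \<open>1/15\<close>, \<open>1/45\<close> and
  \<open>1/2\<close> are all multiples of \<open>1/90\<close>, so in this unit only integer powers
  occur.\<close>

definition scl :: real where "scl = real N powr (1 / 90)"

lemma scl: "1 \<le> scl" "real N = scl ^ 90" "sqrt (real N) = scl ^ 45" "ln (real N) = 90 * ln scl" "ln (real N) \<le> 90 * scl"
  "real N powr (1 / 15) = scl ^ 6" "real N powr (- 1 / 15) = 1 / scl ^ 6" "real N powr (1 / 45) = scl\<^sup>2"
proof -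
  have N1: "0 < real N" "1 \<le> real N" using N by simp_all
  show s1: "1 \<le> scl" unfolding scl_def using N1 by (simp add: ge_one_powr_ge_zero)
  have pw: "scl ^ j = real N powr (real j / 90)" for j
    unfolding scl_def using N1 by (simp add: powr_powr flip: powr_realpow)
  show N90: "real N = scl ^ 90" using pw[of 90] N1 by simp
  have "(scl ^ 45)\<^sup>2 = scl ^ 90" by (simp flip: power_mult)
  then show "sqrt (real N) = scl ^ 45" using N90 s1 by (metis abs_of_nonneg real_sqrt_abs zero_le_power order_trans zero_le_one)
  show ln: "ln (real N) = 90 * ln scl" using N90 s1 by (simp add: ln_realpow)
  have "ln scl \<le> scl" using s1 ln_le_minus_one[of scl] by simp
  then show "ln (real N) \<le> 90 * scl" unfolding ln by simp
  show e: "real N powr (1 / 15) = scl ^ 6" using pw[of 6] by simp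
  then show "real N powr (- 1 / 15) = 1 / scl ^ 6" using N1 by (simp add: powr_minus_divide)
  show "real N powr (1 / 45) = scl\<^sup>2" using pw[of 2] by simp
qed

text \<open>The condition on \<open>R1\<close> is that of \<open>poly_exp_le\<close> with
  \<open>m = 90\<close>, from the union over \<open>N = scl^90\<close> steps, and
  \<open>C = 2 * noise_mass\<close>.\<close>

lemma noise_event:
  assumes R1: "91 + ln (max 1 (8 * noise_mass)) \<le> 2 * rate * R1"
  obtains B where "B \<in> sets M" "emeasure M B \<le> ennreal (exp (- scl\<^sup>2) / 4)"
    "\<And>\<xi> n. \<xi> \<in> space M \<Longrightarrow> \<xi> \<notin> B \<Longrightarrow> n < N \<Longrightarrow> \<bar>X_var b (Suc n) \<xi>\<bar> \<le> R1 * scl\<^sup>2"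
    "\<And>\<xi> n. \<xi> \<in> space M \<Longrightarrow> \<xi> \<notin> B \<Longrightarrow> n < N \<Longrightarrow> \<bar>step_Y n \<xi>\<bar> \<le> R1 * scl\<^sup>2"
proof -
  let ?T = "R1 * scl\<^sup>2"
  note tail = noise_tail[OF \<beta>, where N = N and T = ?T]
  have "2 * noise_mass * scl ^ 90 * exp (- (2 * rate * R1) * scl\<^sup>2) \<le> exp (- scl\<^sup>2) / 4"
    by (rule poly_exp_le) (use scl(1) R1 in \<open>auto simp: noise_mass_def\<close>)
  moreover have "real N * (2 * noise_mass * exp (- 2 * rate * ?T)) = 2 * noise_mass * scl ^ 90 * exp (- (2 * rate * R1) * scl\<^sup>2)"
    unfolding scl(2) by (simp add: mult_ac)
  ultimately have "real N * (2 * noise_mass * exp (- 2 * rate * ?T)) \<le> exp (- scl\<^sup>2) / 4" by (simp only:)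
  then have "emeasure M {\<xi> \<in> space M. \<exists>n<N. ?T \<le> \<bar>X_var b (Suc n) \<xi>\<bar> \<or> ?T \<le> \<bar>step_Y n \<xi>\<bar>} \<le> ennreal (exp (- scl\<^sup>2) / 4)"
    by (intro order_trans[OF tail(1)] ennreal_leI)
  then show thesis by (rule that[OF tail(2)]) (auto simp: not_le intro: less_imp_le)
qed

lemma union_bound:
  assumes "B1 \<in> sets M" "B2 \<in> sets M" "B3 \<in> sets M" "B4 \<in> sets M"
    and "emeasure M B1 \<le> ennreal (p / 4)" "emeasure M B2 \<le> ennreal (p / 4)" "emeasure M B3 \<le> ennreal (p / 4)" "emeasure M B4 \<le> ennreal (p / 4)" and p: "0 \<le> p"
  shows "emeasure M (B1 \<union> B2 \<union> B3 \<union> B4) \<le> ennreal p"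
proof -
  have "emeasure M (B1 \<union> B2 \<union> B3 \<union> B4) \<le> emeasure M B1 + emeasure M B2 + emeasure M B3 + emeasure M B4"
    using assms(1-4) by (intro order_trans[OF emeasure_subadditive] add_mono order_refl) auto
  also have "\<dots> \<le> ennreal (p / 4) + ennreal (p / 4) + ennreal (p / 4) + ennreal (p / 4)" by (intro add_mono assms)
  also have "\<dots> = ennreal (p / 4 + p / 4 + p / 4 + p / 4)" using p by (simp only: ennreal_plus add_nonneg_nonneg divide_nonneg_nonneg zero_le_numeral)
  also have "p / 4 + p / 4 + p / 4 + p / 4 = p" by simp
  finally show ?thesis .
qed

lemma coupled_event:
  obtains B where "B \<in> sets M" "emeasure M B = 0"
    "\<forall>\<xi>\<in>space M - B. Xhat 0 \<xi> = 0 \<and> Yhat 0 \<xi> = 0 \<and> (\<forall>n\<in>{1..N}. (\<Sum>j=1..n. X_var b j \<xi>) = Xhat (real n) \<xi>)"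
proof -
  obtain B where B: "{\<xi> \<in> space M. \<not> (Xhat 0 \<xi> = 0 \<and> Yhat 0 \<xi> = 0 \<and> (\<forall>n\<in>{1..N}. (\<Sum>j=1..n. X_var b j \<xi>) = Xhat (real n) \<xi>))} \<subseteq> B"
    "emeasure M B = 0" "B \<in> sets M"
    by (rule AE_E[OF coupled_AE[OF \<beta>, of N]])
  show thesis by (rule that[OF B(3,2)]) (use B(1) in blast)
qed

definition yy :: real where "yy = 1 / (2 * scl ^ 10)"

lemma yy: "0 < yy" "yy \<le> 1 / 2"
  using scl(1) by (auto simp: yy_def one_le_power)

text \<open>The radius granted by \<open>region_hyp\<close>; it equals \<open>yy^2\<close>.\<close>

definition rr :: real where "rr = 1 / (4 * scl ^ 20)"

lemma rr: "0 < rr" "rr \<le> 1"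
proof -
  have "1 \<le> scl ^ 20" using scl(1) by (simp add: one_le_power)
  then have "1 \<le> 4 * scl ^ 20" by linarith
  then show "0 < rr" "rr \<le> 1" unfolding rr_def using scl(1) by (auto simp: pos_divide_le_eq)
qed

lemma W_holomorphic_dom: "\<xi> \<in> space M \<Longrightarrow> (\<lambda>z. W z \<xi>) holomorphic_on hyp_dom R yy"
  by (rule holomorphic_on_subset[OF W_holomorphic]) (use hyp_off_segment yy hyp_domD in blast)+

context
  fixes R :: real and S :: "complex set"
  assumes R: "1 \<le> R" and S: "S \<subseteq> region (1 / 9) N" "\<And>z. z \<in> S \<Longrightarrow> cmod z \<le> R - 1"
begin

lemma S_dom: "z \<in> S \<Longrightarrow> cball z rr \<subseteq> hyp_dom R yy"
proof
  fix w assume z: "z \<in> S" and w: "w \<in> cball z rr"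
  have "hyp yy w" unfolding yy_def by (rule region_hyp[of N scl z]) (use N z S w in \<open>auto simp: scl_def rr_def\<close>)
  moreover have "cmod w \<le> R"
  proof -
    have "cmod (w - z) \<le> 1" using w rr by (simp add: dist_norm norm_minus_commute)
    then show ?thesis using S(2)[OF z] norm_triangle_sub[of w z] by linarith
  qed
  ultimately show "w \<in> hyp_dom R yy" by (simp add: hyp_dom_def)
qed

lemma S_sub: "S \<subseteq> hyp_dom R yy"
  using S_dom rr by (meson centre_in_cball less_imp_le subset_iff)

lemma S_norm: "z \<in> S \<Longrightarrow> cmod z \<le> R" using S(2)[of z] by linarith

text \<open>Four bad events share the probability equally: large noise, a large martingale, a large
  error of the step approximation, and a large coupling error together with the null set on which
  the paths fail to match.\<close>

lemma large_event:
  assumes ample: "ample R R1 R2 \<gamma> coupling_rate (2 * noise_mass / rate\<^sup>2) scl" and N2: "2 \<le> N"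
    and R1: "91 + ln (max 1 (8 * noise_mass)) \<le> 2 * rate * R1" "1 \<le> rate * R1"
    and R2: "41 + ln (max 1 (4 * (2704 * R\<^sup>2 * (8 * exp 1)))) \<le> R2 / 2"
  obtains B where "B \<in> sets M" "emeasure M B \<le> ennreal (exp (- scl\<^sup>2))"
    "\<And>\<xi> z. \<xi> \<in> space M \<Longrightarrow> \<xi> \<notin> B \<Longrightarrow> z \<in> S \<Longrightarrow> cmod (likelihood z \<xi> - 1) \<le> 3 / (4 * scl ^ 6)"
proof -
  let ?k = "1 / sqrt (2 * real N * \<beta>)" and ?T = "R1 * scl\<^sup>2" and ?\<epsilon> = "1 / scl ^ 32"
  \<comment> \<open>For this length \<open>(1 - yy / (2 * (R + 1)))^L\<close> is at most
    \<open>exp (- 43 * scl)\<close>, because \<open>172 / 4 = 43\<close>; this beats every power of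
    \<open>scl\<close>.\<close>
  define L where "L = nat \<lceil>172 * (R + 1) * scl ^ 11\<rceil>"
  note s1 = scl(1)
  have s0: "0 < scl" using s1 by simp
  have k: "?k = \<gamma> / scl ^ 45" unfolding \<gamma>(3) scl(3) ..
  have R10: "0 < R1"
  proof -
    have "0 < rate * R1" using R1(2) by linarith
    then show ?thesis using rate(1)[OF \<beta>] by (simp add: zero_less_mult_iff)
  qed
  have kT: "?k * ?T = \<gamma> * R1 / scl ^ 43"
    unfolding k using s0 by (simp add: field_simps eval_nat_numeral)
  have Lge: "172 * (R + 1) * scl ^ 11 \<le> real L" unfolding L_def by linarith
  have Lle: "real L \<le> 172 * (R + 1) * scl ^ 11 + 1"
    unfolding L_def using R s0 by simp
  note am = ample[unfolded ample_def]
  have sc: "scale N L R yy ?k ?T ?\<epsilon>"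
  proof
    show "0 < N" "0 < yy" "yy \<le> 1 / 2" "1 \<le> R" using N yy R by auto
    show "0 \<le> ?k" "0 \<le> ?T" using R10 \<beta> by auto
    show "2 / (yy / (R + 1)) * (3 * (?k * ?T) + 1 / (2 * yy * real N)) + 1 / (2 * yy * real N) \<le> (yy / (R + 1))\<^sup>2 / 8"
      unfolding kT unfolding yy_def scl(2) using am by blast
    have pow: "(1 - yy / (R + 1) / 2) ^ L \<le> exp (- 43 * scl)"
    proof -
      have t: "0 \<le> yy / (R + 1) / 2" "yy / (R + 1) / 2 \<le> 1" using yy R by (auto simp: divide_le_eq)
      have "(1 - yy / (R + 1) / 2) ^ L \<le> exp (- (yy / (R + 1) / 2)) ^ L"
        using t exp_ge_add_one_self[of "- (yy / (R + 1) / 2)"] by (intro power_mono) auto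
      also have "\<dots> = exp (- (yy / (R + 1) / 2) * real L)" by (simp add: exp_of_nat_mult[symmetric] mult.commute)
      also have "\<dots> \<le> exp (- 43 * scl)"
      proof -
        have "yy / (R + 1) / 2 * (172 * (R + 1) * scl ^ 11) \<le> yy / (R + 1) / 2 * real L" using t Lge by (intro mult_left_mono) auto
        moreover have "yy / (R + 1) / 2 * (172 * (R + 1) * scl ^ 11) = 43 * scl"
        proof -
          have gen: "1 / (2 * a) / p / 2 * (172 * p * (s * a)) = 43 * s" if "a \<noteq> 0" "p \<noteq> 0" for a p s :: real
            using that by (simp add: field_simps)
          have "scl ^ 11 = scl * scl ^ 10" by (simp flip: power_Suc)
          then show ?thesis unfolding yy_def by (simp only:) (rule gen, use R s0 in auto)
        qed
        ultimately show ?thesis by simp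
      qed
      finally show ?thesis .
    qed
    have "(R + 1) / yy * ((1 - yy / (R + 1) / 2) ^ L * (R + 1) + 2 * (1 / (2 * yy * real N)) / (yy / (R + 1)))
      \<le> (R + 1) / yy * (exp (- 43 * scl) * (R + 1) + 2 * (1 / (2 * yy * real N)) / (yy / (R + 1)))"
      using pow R yy by (intro mult_left_mono add_right_mono mult_right_mono) auto
    moreover have "(R + 1) / yy * (exp (- 43 * scl) * (R + 1) + 2 * (1 / (2 * yy * real N)) / (yy / (R + 1))) +
      (2 / (yy / (R + 1)) * (3 * (?k * ?T) + 1 / (2 * yy * real N)) + 1 / (2 * yy * real N)) \<le> ?\<epsilon>"
      unfolding kT unfolding yy_def scl(2) using am by blast
    ultimately show "(R + 1) / yy * ((1 - yy / (R + 1) / 2) ^ L * (R + 1) + 2 * (1 / (2 * yy * real N)) / (yy / (R + 1))) +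
      (2 / (yy / (R + 1)) * (3 * (?k * ?T) + 1 / (2 * yy * real N)) + 1 / (2 * yy * real N)) \<le> ?\<epsilon>" by linarith
    show "?\<epsilon> \<le> yy / 2" unfolding yy_def using am by blast
    show "12 * (?k * ?T) \<le> yy" unfolding kT yy_def using am by blast
    show "1 / yy \<le> real N" unfolding scl(2) yy_def using am by blast
  qed
  interpret Sc: scale N L R yy ?k ?T ?\<epsilon> by (rule sc)
  have sq: "(scl ^ 9)\<^sup>2 * (\<Sum>n<N. (Sc.step_bound n)\<^sup>2) / 2 \<le> 1"
  proof -
    have "(\<Sum>n<N. (Sc.step_bound n)\<^sup>2) \<le> real N * (20 * ?\<epsilon> * (?k * ?T) / yy\<^sup>2 + 3 * (?k * ?T)\<^sup>2 / yy\<^sup>2)\<^sup>2 + (172 * (R + 1) * scl ^ 11 + 1) * (16 * (?k * ?T) / yy + 3 * (?k * ?T)\<^sup>2 / yy\<^sup>2)\<^sup>2"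
      using Sc.step_bound_square_sum mult_right_mono[OF Lle zero_le_power2[of "16 * (?k * ?T) / yy + 3 * (?k * ?T)\<^sup>2 / yy\<^sup>2"]] by linarith
    then have "(scl ^ 9)\<^sup>2 * (\<Sum>n<N. (Sc.step_bound n)\<^sup>2) / 2 \<le> (scl ^ 9)\<^sup>2 * (real N * (20 * ?\<epsilon> * (?k * ?T) / yy\<^sup>2 + 3 * (?k * ?T)\<^sup>2 / yy\<^sup>2)\<^sup>2 + (172 * (R + 1) * scl ^ 11 + 1) * (16 * (?k * ?T) / yy + 3 * (?k * ?T)\<^sup>2 / yy\<^sup>2)\<^sup>2) / 2"
      by (intro divide_right_mono mult_left_mono) auto
    also have "\<dots> \<le> 1" unfolding kT unfolding yy_def scl(2) using am by blast
    finally show ?thesis .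
  qed
  \<comment> \<open>Exponent \<open>scl^9\<close> against deviation \<open>R2 / scl^7\<close> gives
    \<open>scl^2\<close> in the tail. The 2704 is \<open>(13 * 4)^2\<close>, from the covering
    number at radius \<open>rr\<close>, whose growth \<open>scl^40\<close> explains the 41 in the
    condition on \<open>R2\<close>.\<close>
  have cover: "(13 * R / rr)\<^sup>2 * (8 * exp 1 * exp (- (scl ^ 9) * (R2 / scl ^ 7) / 2)) \<le> exp (- scl\<^sup>2) / 4"
  proof -
    have "2704 * R\<^sup>2 * (8 * exp 1) * scl ^ 40 * exp (- (R2 / 2) * scl\<^sup>2) \<le> exp (- scl\<^sup>2) / 4"
      by (rule poly_exp_le) (use s1 R2 in auto)
    moreover have "(13 * R / rr)\<^sup>2 = 2704 * R\<^sup>2 * scl ^ 40"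
      unfolding rr_def by (simp add: power_mult_distrib power_mult[symmetric])
    moreover have "- (scl ^ 9) * (R2 / scl ^ 7) / 2 = - (R2 / 2) * scl\<^sup>2"
      using s0 by (simp add: field_simps eval_nat_numeral)
    ultimately show ?thesis by (simp only:) (simp add: mult_ac)
  qed
  obtain B1 where B1: "B1 \<in> sets M" "emeasure M B1 \<le> ennreal (exp (- scl\<^sup>2) / 4)"
    "\<And>\<xi> n. \<xi> \<in> space M \<Longrightarrow> \<xi> \<notin> B1 \<Longrightarrow> n < N \<Longrightarrow> \<bar>X_var b (Suc n) \<xi>\<bar> \<le> ?T"
    "\<And>\<xi> n. \<xi> \<in> space M \<Longrightarrow> \<xi> \<notin> B1 \<Longrightarrow> n < N \<Longrightarrow> \<bar>step_Y n \<xi>\<bar> \<le> ?T"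
    using noise_event[OF R1(1)] by blast
  obtain B2 where B2: "B2 \<in> sets M" "emeasure M B2 \<le> ennreal ((13 * R / rr)\<^sup>2 * (8 * exp 1 * exp (- (scl ^ 9) * (R2 / scl ^ 7) / 2)))"
    "\<And>\<xi> w. \<xi> \<in> space M \<Longrightarrow> \<xi> \<notin> B2 \<Longrightarrow> w \<in> S \<Longrightarrow> cmod (mart N ?k ?T w \<xi>) < R2 / scl ^ 7"
  proof (rule holomorphic_sup_tail_cover[OF S_norm R rr S_dom, where F = "mart N ?k ?T" and l = "scl ^ 9" and A = "exp 1" and x = "R2 / scl ^ 7"])
    show "(\<lambda>z. mart N ?k ?T z \<xi>) holomorphic_on hyp_dom R yy" for \<xi>
      unfolding mart_def using xt_bound[OF Sc.T] yt_bound[OF Sc.T] by (intro holomorphic_intros Sc.mstep_holomorphic) auto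
    show "mart N ?k ?T z \<in> borel_measurable M" for z by (rule mart_measurable[OF \<beta>])
    fix z s assume z: "z \<in> hyp_dom R yy" "cmod s = scl ^ 9"
    have "exp_moment M (\<lambda>\<xi>. Re (s * mart N ?k ?T z \<xi>)) \<le> ennreal (exp ((cmod s)\<^sup>2 * (\<Sum>n<N. (Sc.step_bound n)\<^sup>2) / 2))"
      by (rule mart_exp[OF \<beta> sc z(1)])
    also have "\<dots> \<le> ennreal (exp 1)" using sq z(2) by (intro ennreal_leI) simp
    finally show "exp_moment M (\<lambda>\<xi>. Re (s * mart N ?k ?T z \<xi>)) \<le> ennreal (exp 1)" .
  qed (use s0 in auto)
  obtain B3 where B3: "B3 \<in> sets M" "emeasure M B3 \<le> ennreal ((13 * R / rr)\<^sup>2 * (8 * exp 1 * exp (- (scl ^ 9) * (R2 / scl ^ 7) / 2)))"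
    "\<And>\<xi> w. \<xi> \<in> space M \<Longrightarrow> \<xi> \<notin> B3 \<Longrightarrow> w \<in> S \<Longrightarrow> cmod (step_field w \<xi> + 2 * W w \<xi>) < R2 / scl ^ 7"
  proof (rule holomorphic_sup_tail_cover[OF S_norm R rr S_dom, where F = "\<lambda>z \<xi>. step_field z \<xi> + 2 * W z \<xi>" and l = "scl ^ 9" and A = "exp 1" and x = "R2 / scl ^ 7"])
    show "(\<lambda>z. step_field z \<xi> + 2 * W z \<xi>) holomorphic_on hyp_dom R yy" if "\<xi> \<in> space M" for \<xi>
      by (intro holomorphic_intros step_field_holomorphic yy W_holomorphic_dom that)
    show "(\<lambda>\<xi>. step_field z \<xi> + 2 * W z \<xi>) \<in> borel_measurable M" if "z \<in> hyp_dom R yy" for z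
      using step_field_measurable W_measurable hyp_domD(1)[OF that] yy by simp
    fix z s assume z: "z \<in> hyp_dom R yy" "cmod s = scl ^ 9"
    have "exp_moment M (\<lambda>\<xi>. Re (s * (step_field z \<xi> + 2 * W z \<xi>))) \<le> ennreal (exp (200 * (cmod s)\<^sup>2 / (yy ^ 6 * real N)))"
      by (rule gap_exp[OF hyp_domD(1)[OF z(1)] yy])
    also have "\<dots> \<le> ennreal (exp 1)"
    proof -
      have "200 * (scl ^ 9)\<^sup>2 / (yy ^ 6 * real N) \<le> 1" unfolding yy_def scl(2) using am by blast
      then show ?thesis using z(2) by (intro ennreal_leI) simp
    qed
    finally show "exp_moment M (\<lambda>\<xi>. Re (s * (step_field z \<xi> + 2 * W z \<xi>))) \<le> ennreal (exp 1)" .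
  qed (use s0 in auto)
  obtain B0 where B0: "B0 \<in> sets M" "emeasure M B0 = 0"
    "\<forall>\<xi>\<in>space M - B0. Xhat 0 \<xi> = 0 \<and> Yhat 0 \<xi> = 0 \<and> (\<forall>n\<in>{1..N}. (\<Sum>j=1..n. X_var b j \<xi>) = Xhat (real n) \<xi>)"
    by (rule coupled_event)
  \<comment> \<open>The tail at this level is \<open>2 * exp (- 4 * scl^2)\<close>, which is below a
    quarter of \<open>exp (- scl^2)\<close> because \<open>8 \<le> exp (3 * scl^2)\<close>.\<close>
  let ?m = "4 * scl\<^sup>2 * (coupling_rate * ln (real N))"
  define B4 where "B4 = {\<xi> \<in> space M. ?m \<le> coupling_error \<beta> a Yhat N \<xi>}"
  have B4m: "B4 \<in> sets M" unfolding B4_def using coupling_measurable[OF \<beta>, of N] N by simp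
  have B4e: "emeasure M (B4 \<union> B0) \<le> ennreal (exp (- scl\<^sup>2) / 4)"
  proof -
    have "emeasure M (B4 \<union> B0) \<le> emeasure M B4 + emeasure M B0" by (rule emeasure_subadditive[OF B4m B0(1)])
    also have "\<dots> \<le> ennreal (2 * exp (- (4 * scl\<^sup>2)))" unfolding B0(2) B4_def using coupling_tail[OF \<beta> N2, of "4 * scl\<^sup>2"] by simp
    also have "\<dots> \<le> ennreal (exp (- scl\<^sup>2) / 4)"
    proof (rule ennreal_leI)
      have s2: "1 \<le> scl\<^sup>2" using s1 by (simp add: one_le_power)
      have "2 \<le> exp (1 :: real)" using exp_ge_add_one_self[of "1 :: real"] by simp
      then have "2 ^ 3 \<le> exp (1 :: real) ^ 3" by (intro power_mono) auto
      also have "\<dots> = exp 3" by (simp flip: exp_of_nat_mult)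
      also have "\<dots> \<le> exp (3 * scl\<^sup>2)" using s2 by simp
      finally have "8 * exp (- (4 * scl\<^sup>2)) \<le> exp (3 * scl\<^sup>2) * exp (- (4 * scl\<^sup>2))" by (intro mult_right_mono) auto
      also have "\<dots> = exp (- scl\<^sup>2)" by (simp flip: exp_add)
      finally show "2 * exp (- (4 * scl\<^sup>2)) \<le> exp (- scl\<^sup>2) / 4" by simp
    qed
    finally show ?thesis .
  qed
  show thesis
  proof (rule that[of "B1 \<union> B2 \<union> B3 \<union> (B4 \<union> B0)"])
    show "B1 \<union> B2 \<union> B3 \<union> (B4 \<union> B0) \<in> sets M" using B1(1) B2(1) B3(1) B4m B0(1) by auto
    show "emeasure M (B1 \<union> B2 \<union> B3 \<union> (B4 \<union> B0)) \<le> ennreal (exp (- scl\<^sup>2))"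
      using B1(1,2) B2(1) B3(1) B4m B0(1) B4e order_trans[OF B2(2) ennreal_leI[OF cover]] order_trans[OF B3(2) ennreal_leI[OF cover]]
      by (intro union_bound) auto
    fix \<xi> z assume \<xi>: "\<xi> \<in> space M" "\<xi> \<notin> B1 \<union> B2 \<union> B3 \<union> (B4 \<union> B0)" and z: "z \<in> S"
    have bT: "bias ?T \<le> 2 * noise_mass / rate\<^sup>2 * exp (- scl\<^sup>2)"
    proof -
      have "- rate * ?T \<le> - scl\<^sup>2" using mult_right_mono[OF R1(2), of "scl\<^sup>2"] by (simp add: mult_ac)
      then have "2 * noise_mass / rate\<^sup>2 * exp (- rate * ?T) \<le> 2 * noise_mass / rate\<^sup>2 * exp (- scl\<^sup>2)"
        by (intro mult_left_mono) (auto simp: noise_mass_def)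
      then show ?thesis by (simp add: bias_def)
    qed
    have bT1: "bias ?T \<le> 1" using bT am by linarith
    have cr: "0 < coupling_rate" by (simp add: coupling_rate_def add_nonneg_pos)
    have "cmod (likelihood z \<xi> - 1) \<le> 3 * (1 / (4 * scl ^ 6))"
    proof (rule likelihood_deviation[OF sc _ bT1 _ _ \<xi>(1), where m = ?m and ?x1.0 = "R2 / scl ^ 7" and ?x2.0 = "R2 / scl ^ 7"])
      show "z \<in> hyp_dom R yy" using z S_sub by blast
      show "\<bar>X_var b (Suc n) \<xi>\<bar> \<le> ?T" "\<bar>step_Y n \<xi>\<bar> \<le> ?T" if "n < N" for n using B1(3,4) \<xi> that by blast+
      show "(\<Sum>j=1..n. X_var b j \<xi>) = Xhat (real n) \<xi>" if "n \<in> {1..N}" for n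
        using B0(3) \<xi> that by blast+
      show "Xhat 0 \<xi> = 0" "Yhat 0 \<xi> = 0" using B0(3) \<xi> by blast+
      show "coupling_error \<beta> a Yhat N \<xi> \<le> ?m" using \<xi> by (auto simp: B4_def not_le intro: less_imp_le)
      show "cmod (mart N ?k ?T z \<xi>) \<le> R2 / scl ^ 7" using B2(3)[OF \<xi>(1) _ z] \<xi>(2) by (auto intro: less_imp_le)
      show "cmod (step_field z \<xi> + 2 * W z \<xi>) \<le> R2 / scl ^ 7" using B3(3)[OF \<xi>(1) _ z] \<xi>(2) by (auto intro: less_imp_le)
      have m: "?m \<le> 4 * scl\<^sup>2 * (coupling_rate * (90 * scl))" using scl(5) cr by (intro mult_left_mono) auto
      have c1: "\<gamma> / sqrt (real N) * (6 / yy ^ 3 * ?m) \<le> \<gamma> / scl ^ 45 * (6 / yy ^ 3 * (4 * scl\<^sup>2 * (coupling_rate * (90 * scl))))"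
        unfolding scl(3) by (rule mult_left_mono[OF mult_left_mono[OF m]]) (use \<gamma>(1) s0 yy in auto)
      have c2: "Sc.core_error (bias ?T) \<le>
        real N * (8 * (\<gamma> / scl ^ 45) * (2 * noise_mass / rate\<^sup>2 * exp (- scl\<^sup>2)) / yy + 2 * (\<gamma> / scl ^ 45)\<^sup>2 * (2 * noise_mass / rate\<^sup>2 * exp (- scl\<^sup>2)) / yy\<^sup>2) +
        (160 * (1 / scl ^ 32) * (\<gamma> * R1 / scl ^ 43)\<^sup>2 * real N / yy\<^sup>2 + 32 * (\<gamma> * R1 / scl ^ 43)\<^sup>2 / yy\<^sup>2 * (172 * (R + 1) * scl ^ 11 + 1)) +
        real N * (6 * (\<gamma> * R1 / scl ^ 43) / yy) ^ 3"
        unfolding Sc.core_error_def unfolding kT unfolding k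
        by (intro add_mono mult_left_mono divide_right_mono Lle bT order_refl) (use \<gamma>(1) s0 yy in auto)
      have tot: "R2 / scl ^ 7 + \<gamma> * (R2 / scl ^ 7) + \<gamma> / scl ^ 45 * (6 / yy ^ 3 * (4 * scl\<^sup>2 * (coupling_rate * (90 * scl)))) +
        \<gamma>\<^sup>2 / 2 * (20 / (yy ^ 4 * real N)) +
        (real N * (8 * (\<gamma> / scl ^ 45) * (2 * noise_mass / rate\<^sup>2 * exp (- scl\<^sup>2)) / yy + 2 * (\<gamma> / scl ^ 45)\<^sup>2 * (2 * noise_mass / rate\<^sup>2 * exp (- scl\<^sup>2)) / yy\<^sup>2) +
        (160 * (1 / scl ^ 32) * (\<gamma> * R1 / scl ^ 43)\<^sup>2 * real N / yy\<^sup>2 + 32 * (\<gamma> * R1 / scl ^ 43)\<^sup>2 / yy\<^sup>2 * (172 * (R + 1) * scl ^ 11 + 1)) +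
        real N * (6 * (\<gamma> * R1 / scl ^ 43) / yy) ^ 3) \<le> 1 / (4 * scl ^ 6)"
        unfolding scl(2) yy_def using am by blast
      show "R2 / scl ^ 7 + \<gamma> * (R2 / scl ^ 7) + \<gamma> / sqrt (real N) * (6 / yy ^ 3 * ?m) + \<gamma>\<^sup>2 / 2 * (20 / (yy ^ 4 * real N)) + Sc.core_error (bias ?T) \<le> 1 / (4 * scl ^ 6)"
        using c1 c2 tot by linarith
      have "1 \<le> scl ^ 6" using s1 by (simp add: one_le_power)
      then show "1 / (4 * scl ^ 6) \<le> 1 / 4" by (simp add: divide_le_eq)
    qed
    then show "cmod (likelihood z \<xi> - 1) \<le> 3 / (4 * scl ^ 6)" by simp
  qed
qed

end
end

text \<open>Small \<open>N\<close> only affect the constant: there a bound that depends on \<open>N\<close> but not on the coupling suffices.\<close>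

definition crude_bound :: "real \<Rightarrow> real \<Rightarrow> real \<Rightarrow> nat \<Rightarrow> real" where
  "crude_bound \<gamma> R R1 N = (let A = real N powr (1 / 90); y = 1 / (2 * A ^ 10); r = 1 / (4 * A ^ 20);
     x = 2 * (A\<^sup>2 + ln (4 * ((13 * R / r)\<^sup>2 * (8 * exp (2 / y\<^sup>2))))) in
     1 + (R + \<gamma> * R1 * A\<^sup>2 + (1 + \<gamma> * R1 * A\<^sup>2)) ^ N * exp (\<gamma>\<^sup>2 / y\<^sup>2) / (y ^ N * exp (- (2 * \<gamma> * x))))"

context gbe_field
begin

context
  fixes R :: real and S :: "complex set"
  assumes R: "1 \<le> R" and S: "S \<subseteq> region (1 / 9) N" "\<And>z. z \<in> S \<Longrightarrow> cmod z \<le> R - 1"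
begin

lemma likelihood_measurable:
  assumes z: "z \<in> S"
  shows "likelihood z \<in> borel_measurable M"
proof -
  have hyp: "hyp yy z" using S_sub[OF R S] z hyp_domD(1) by blast
  have [measurable]: "W z \<in> borel_measurable M" by (rule W_measurable[OF hyp yy])
  have [measurable]: "a (Suc i) \<in> borel_measurable M" "b (Suc i) \<in> borel_measurable M" for i
    using a_measurable[of "Suc i"] b_measurable[of "Suc i"] by simp_all
  have [measurable]: "(\<lambda>\<xi>. phi \<beta> (\<lambda>k. a k \<xi>) (\<lambda>k. b k \<xi>) N z) \<in> borel_measurable M"
    unfolding phi_eq_tri_det by (rule tri_det_measurable) simp_all
  show ?thesis unfolding likelihood_def[abs_def] by measurable
qed

text \<open>A uniform limit of Riemann sums that are continuous in \<open>z\<close>: the rate in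
  \<open>ker_energy_approx\<close> is the same for all points of the domain.\<close>

lemma ker_energy_continuous: "continuous_on (hyp_dom R yy) ker_energy"
proof -
  let ?s = "\<lambda>n z. (\<Sum>i<n. (ker1 (grid n i) z)\<^sup>2 + (ker2 (grid n i) z)\<^sup>2) / of_nat n"
  have cont: "continuous_on (hyp_dom R yy) (?s n)" for n
  proof -
    have "continuous_on (hyp_dom R yy) (ker1 (grid n i))" "continuous_on (hyp_dom R yy) (ker2 (grid n i))" if "i < n" for i
      using ker_holomorphic[OF yy, of "grid n i" R] grid_bounds[of i n] that by (auto intro!: holomorphic_on_imp_continuous_on)
    then show ?thesis unfolding divide_inverse by (intro continuous_intros) auto
  qed
  have "uniform_limit (hyp_dom R yy) ?s ker_energy sequentially"
  proof (rule uniform_limitI)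
    fix e :: real assume e: "0 < e"
    have "(\<lambda>n. 20 / yy ^ 4 * (1 / real n)) \<longlonglongrightarrow> 20 / yy ^ 4 * 0" by (intro tendsto_intros lim_1_over_n)
    then have "\<forall>\<^sub>F n in sequentially. 20 / yy ^ 4 * (1 / real n) < e" using e by (intro order_tendstoD) auto
    then show "\<forall>\<^sub>F n in sequentially. \<forall>z\<in>hyp_dom R yy. dist (?s n z) (ker_energy z) < e"
      using eventually_gt_at_top[of 0]
    proof eventually_elim
      case (elim n)
      show ?case
      proof
        fix z assume "z \<in> hyp_dom R yy"
        then have "dist (?s n z) (ker_energy z) \<le> 20 / (yy ^ 4 * real n)"
          unfolding dist_norm by (intro ker_energy_approx[OF hyp_domD(1) yy elim(2)])
        then show "dist (?s n z) (ker_energy z) < e" using elim(1) by simp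
      qed
    qed
  qed
  then show ?thesis by (rule uniform_limit_theorem[rotated]) (auto simp: cont)
qed

lemma likelihood_continuous:
  assumes \<xi>: "\<xi> \<in> space M"
  shows "continuous_on S (\<lambda>z. likelihood z \<xi>)"
proof -
  note sub = S_sub[OF R S]
  have 1: "continuous_on S (\<lambda>z. LINT \<xi>'|M. exp (cplx (sqrt (2 / \<beta>)) * W z \<xi>'))"
  proof -
    have "continuous_on S (\<lambda>z. exp ((cplx (sqrt (2 / \<beta>)))\<^sup>2 / 8 * ker_energy z))"
      by (intro continuous_intros continuous_on_subset[OF ker_energy_continuous sub])
    also have "?this \<longleftrightarrow> ?thesis"
    proof (rule continuous_on_cong[OF refl])
      fix z assume "z \<in> S"
      then have "hyp yy z" using sub hyp_domD(1) by blast
      then show "exp ((cplx (sqrt (2 / \<beta>)))\<^sup>2 / 8 * ker_energy z) = (LINT \<xi>'|M. exp (cplx (sqrt (2 / \<beta>)) * W z \<xi>'))"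
        by (rule W_cexp[OF _ yy, symmetric])
    qed
    finally show ?thesis .
  qed
  have 2: "continuous_on S (\<lambda>z. W z \<xi>)"
    by (rule continuous_on_subset[OF holomorphic_on_imp_continuous_on[OF W_holomorphic_dom[OF \<xi>]] sub])
  have 3: "continuous_on S (\<lambda>z. phi \<beta> (\<lambda>k. a k \<xi>) (\<lambda>k. b k \<xi>) N z)"
    unfolding phi_eq_tri_det by (rule tri_det_continuous) (auto intro!: continuous_intros)
  have 4: "continuous_on S (\<lambda>z. pi_N N z)" unfolding pi_N_def by (intro continuous_intros)
  have 5: "pi_N N z \<noteq> 0" if "z \<in> S" for z
  proof -
    have "hyp yy z" using that sub hyp_domD(1) by blast
    from pi_N_norm_ge[OF N this yy] have "yy ^ N \<le> cmod (pi_N N z)" .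
    moreover have "0 < yy ^ N" using yy by simp
    ultimately show ?thesis by auto
  qed
  show ?thesis unfolding likelihood_def using 1 2 3 4 5 by (intro continuous_intros) auto
qed

lemma deviation_event_measurable:
  "{\<xi> \<in> space M. t \<le> (SUP z\<in>S. ennreal (cmod (likelihood z \<xi> - 1)))} \<in> sets M"
  using likelihood_measurable likelihood_continuous
  by (intro sup_event_measurable[where H = "\<lambda>z \<xi>. likelihood z \<xi> - 1"]) (auto intro!: continuous_intros)

lemma phi_norm_le:
  assumes z: "cmod z \<le> R" and T: "0 \<le> T"
    and noise: "\<And>n. n < N \<Longrightarrow> \<bar>X_var b (Suc n) \<xi>\<bar> \<le> T" "\<And>n. n < N \<Longrightarrow> \<bar>step_Y n \<xi>\<bar> \<le> T"
  shows "cmod (phi \<beta> (\<lambda>k. a k \<xi>) (\<lambda>k. b k \<xi>) N z) \<le> (R + \<gamma> * T + (1 + \<gamma> * T)) ^ N"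
  unfolding phi_eq_tri_det
proof (rule tri_det_norm_le)
  let ?k = "1 / sqrt (2 * real N * \<beta>)"
  have sN: "1 \<le> sqrt (real N)" using N by simp
  have k: "0 \<le> ?k" "?k \<le> \<gamma>"
  proof -
    show "0 \<le> ?k" using \<beta> by simp
    have "\<gamma> / sqrt (real N) \<le> \<gamma> / 1" using \<gamma>(1) sN by (intro divide_left_mono) auto
    then show "?k \<le> \<gamma>" unfolding \<gamma>(3) by simp
  qed
  have kn: "\<bar>?k * x\<bar> \<le> \<gamma> * T" if "\<bar>x\<bar> \<le> T" for x
    unfolding abs_mult using k that \<gamma>(1) by (intro mult_mono) auto
  have gT: "0 \<le> \<gamma> * T" using \<gamma>(1) T by simp
  show "1 \<le> R + \<gamma> * T" "0 \<le> 1 + \<gamma> * T" using R gT by auto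
  fix i
  show "cmod (z - cplx (b (i + 1) \<xi> / sqrt (4 * real N * \<beta>))) \<le> R + \<gamma> * T" if i: "i < N"
  proof -
    have "sqrt (4 * real N * \<beta>) = sqrt 2 * sqrt (2 * real N * \<beta>)" by (simp flip: real_sqrt_mult)
    then have "b (i + 1) \<xi> / sqrt (4 * real N * \<beta>) = ?k * X_var b (Suc i) \<xi>" by (simp add: X_var_def)
    then have "\<bar>b (i + 1) \<xi> / sqrt (4 * real N * \<beta>)\<bar> \<le> \<gamma> * T" using kn[OF noise(1)[OF i]] by simp
    then have "cmod (cplx (b (i + 1) \<xi> / sqrt (4 * real N * \<beta>))) \<le> \<gamma> * T" unfolding norm_of_real .
    then show ?thesis using z norm_triangle_ineq4[of z "cplx (b (i + 1) \<xi> / sqrt (4 * real N * \<beta>))"] by linarith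
  qed
  show "cmod ((- cplx (a (i + 1) \<xi> / sqrt (4 * real N * \<beta>)))\<^sup>2) \<le> 1 + \<gamma> * T" if i: "Suc i < N"
  proof -
    have st: "step_Y (Suc i) \<xi> = ((a (Suc i) \<xi>)\<^sup>2 - \<beta> * real (Suc i)) / sqrt (2 * \<beta> * real (Suc i))"
      by (simp add: step_Y_eq mult.assoc del: of_nat_Suc)
    let ?g = "grid N (Suc i)"
    have g: "0 \<le> ?g" "?g \<le> 1" using grid_bounds[of "Suc i" N] i by auto
    have "cmod ((- cplx (a (i + 1) \<xi> / sqrt (4 * real N * \<beta>)))\<^sup>2) = (a (Suc i) \<xi> / sqrt (4 * real N * \<beta>))\<^sup>2"
      by (simp add: norm_power norm_divide power_divide)
    also have "\<dots> = ?g / 4 + sqrt ?g / 2 * (?k * step_Y (Suc i) \<xi>)"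
      unfolding st by (rule offdiag_square[OF \<beta> N, symmetric])
    also have "\<dots> \<le> 1 + 1 * (\<gamma> * T)"
    proof (rule add_mono)
      have "sqrt ?g / 2 * (?k * step_Y (Suc i) \<xi>) \<le> sqrt ?g / 2 * (\<gamma> * T)"
        using g by (intro mult_left_mono abs_le_D1[OF kn[OF noise(2)[OF i]]]) auto
      also have "\<dots> \<le> 1 * (\<gamma> * T)"
      proof (rule mult_right_mono[OF _ gT])
        have "sqrt ?g \<le> 1" using g by simp
        then show "sqrt ?g / 2 \<le> 1" by linarith
      qed
      finally show "sqrt ?g / 2 * (?k * step_Y (Suc i) \<xi>) \<le> 1 * (\<gamma> * T)" .
    qed (use g in simp)
    finally show ?thesis by simp
  qed
qed

text \<open>Every factor is bounded separately: the determinant through the noise,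
  \<open>pi_N\<close> from below, the expectation in closed form, and the field by its exponential
  moments of order 1. The level \<open>x\<close> is chosen so that the tail of the field is exactly
  \<open>exp (- scl^2) / 4\<close>.\<close>

lemma crude_event:
  assumes R1: "91 + ln (max 1 (8 * noise_mass)) \<le> 2 * rate * R1" and R10: "0 \<le> R1"
  obtains B where "B \<in> sets M" "emeasure M B \<le> ennreal (exp (- scl\<^sup>2))"
    "\<And>\<xi> z. \<xi> \<in> space M \<Longrightarrow> \<xi> \<notin> B \<Longrightarrow> z \<in> S \<Longrightarrow> cmod (likelihood z \<xi> - 1) \<le> crude_bound \<gamma> R R1 N"
proof -
  let ?T = "R1 * scl\<^sup>2"
  define q where "q = 4 * ((13 * R / rr)\<^sup>2 * (8 * exp (2 / yy\<^sup>2)))"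
  define x where "x = 2 * (scl\<^sup>2 + ln q)"
  have q0: "0 < q" unfolding q_def using R rr by simp
  obtain B1 where B1: "B1 \<in> sets M" "emeasure M B1 \<le> ennreal (exp (- scl\<^sup>2) / 4)"
    "\<And>\<xi> n. \<xi> \<in> space M \<Longrightarrow> \<xi> \<notin> B1 \<Longrightarrow> n < N \<Longrightarrow> \<bar>X_var b (Suc n) \<xi>\<bar> \<le> ?T"
    "\<And>\<xi> n. \<xi> \<in> space M \<Longrightarrow> \<xi> \<notin> B1 \<Longrightarrow> n < N \<Longrightarrow> \<bar>step_Y n \<xi>\<bar> \<le> ?T"
    using noise_event[OF R1] by blast
  obtain B2 where B2: "B2 \<in> sets M" "emeasure M B2 \<le> ennreal ((13 * R / rr)\<^sup>2 * (8 * exp (2 / yy\<^sup>2) * exp (- 1 * x / 2)))"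
    "\<And>\<xi> w. \<xi> \<in> space M \<Longrightarrow> \<xi> \<notin> B2 \<Longrightarrow> w \<in> S \<Longrightarrow> cmod (W w \<xi>) < x"
  proof (rule holomorphic_sup_tail_cover[OF S_norm[OF R S] R rr S_dom[OF R S], where F = W and l = 1 and A = "exp (2 / yy\<^sup>2)" and x = x])
    show "(\<lambda>z. W z \<xi>) holomorphic_on hyp_dom R yy" if "\<xi> \<in> space M" for \<xi> by (rule W_holomorphic_dom[OF that])
    show "W z \<in> borel_measurable M" if "z \<in> hyp_dom R yy" for z by (rule W_measurable[OF hyp_domD(1)[OF that] yy])
    show "exp_moment M (\<lambda>\<xi>. Re (s * W z \<xi>)) \<le> ennreal (exp (2 / yy\<^sup>2))" if "z \<in> hyp_dom R yy" "cmod s = 1" for z s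
      using W_exp[OF hyp_domD(1)[OF that(1)] yy, of s] that(2) by simp
  qed auto
  have tail: "(13 * R / rr)\<^sup>2 * (8 * exp (2 / yy\<^sup>2) * exp (- 1 * x / 2)) \<le> exp (- scl\<^sup>2) / 4"
  proof -
    have "- 1 * x / 2 = - scl\<^sup>2 - ln q" unfolding x_def by simp
    then have "exp (- 1 * x / 2) = exp (- scl\<^sup>2) / q" using q0 by (simp only: exp_diff exp_ln)
    moreover have "(13 * R / rr)\<^sup>2 * (8 * exp (2 / yy\<^sup>2) * (exp (- scl\<^sup>2) / q)) = q / 4 * (exp (- scl\<^sup>2) / q)" by (simp add: q_def)
    ultimately show ?thesis using q0 by simp
  qed
  show thesis
  proof (rule that[of "B1 \<union> B2 \<union> {} \<union> {}"])
    show "B1 \<union> B2 \<union> {} \<union> {} \<in> sets M" using B1 B2 by auto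
    show "emeasure M (B1 \<union> B2 \<union> {} \<union> {}) \<le> ennreal (exp (- scl\<^sup>2))"
      using B1(1,2) B2(1) order_trans[OF B2(2) ennreal_leI[OF tail]] by (intro union_bound) auto
    fix \<xi> z assume \<xi>: "\<xi> \<in> space M" "\<xi> \<notin> B1 \<union> B2 \<union> {} \<union> {}" and z: "z \<in> S"
    have zd: "z \<in> hyp_dom R yy" using S_sub[OF R S] z by blast
    have hyp: "hyp yy z" using zd by (rule hyp_domD)
    let ?P = "(R + \<gamma> * ?T + (1 + \<gamma> * ?T)) ^ N"
    have phi: "cmod (phi \<beta> (\<lambda>k. a k \<xi>) (\<lambda>k. b k \<xi>) N z) \<le> ?P"
      by (rule phi_norm_le) (use hyp_domD(2)[OF zd] R10 B1(3,4) \<xi> in auto)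
    have E: "cmod (LINT \<xi>'|M. exp (cplx (sqrt (2 / \<beta>)) * W z \<xi>')) \<le> exp (\<gamma>\<^sup>2 / yy\<^sup>2)"
    proof -
      have "(cplx (2 * \<gamma>))\<^sup>2 / 8 = cplx (\<gamma>\<^sup>2 / 2)" by (simp add: power_mult_distrib)
      then have "cmod (LINT \<xi>'|M. exp (cplx (sqrt (2 / \<beta>)) * W z \<xi>')) = exp (\<gamma>\<^sup>2 / 2 * Re (ker_energy z))"
        unfolding \<gamma>(2) W_cexp[OF hyp yy] by (simp only: norm_exp_eq_Re) simp
      also have "\<dots> \<le> exp (\<gamma>\<^sup>2 / 2 * (2 / yy\<^sup>2))"
        unfolding exp_le_cancel_iff using complex_Re_le_cmod[of "ker_energy z"] ker_energy_norm[OF hyp yy]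
        by (intro mult_left_mono) auto
      finally show ?thesis by simp
    qed
    have W: "exp (- (2 * \<gamma> * x)) \<le> cmod (exp (cplx (sqrt (2 / \<beta>)) * W z \<xi>))"
    proof -
      have "- (2 * \<gamma> * x) \<le> 2 * \<gamma> * Re (W z \<xi>)"
      proof -
        have "- x \<le> Re (W z \<xi>)" using B2(3)[OF \<xi>(1) _ z] \<xi>(2) abs_Re_le_cmod[of "W z \<xi>"] by fastforce
        from mult_left_mono[OF this, of "2 * \<gamma>"] show ?thesis using \<gamma>(1) by simp
      qed
      then show ?thesis unfolding \<gamma>(2) norm_exp_eq_Re exp_le_cancel_iff by simp
    qed
    have P0: "0 \<le> ?P" using R \<gamma>(1) R10 by (intro zero_le_power add_nonneg_nonneg mult_nonneg_nonneg zero_le_power2) auto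
    have "cmod (likelihood z \<xi>) \<le> ?P * exp (\<gamma>\<^sup>2 / yy\<^sup>2) / (yy ^ N * exp (- (2 * \<gamma> * x)))"
      unfolding likelihood_def norm_divide norm_mult
      by (intro frac_le mult_mono phi E W pi_N_norm_ge[OF N hyp yy]) (use P0 yy in auto)
    then have "cmod (likelihood z \<xi> - 1) \<le> 1 + ?P * exp (\<gamma>\<^sup>2 / yy\<^sup>2) / (yy ^ N * exp (- (2 * \<gamma> * x)))"
      using norm_triangle_ineq4[of "likelihood z \<xi>" 1] by simp
    also have "\<dots> = crude_bound \<gamma> R R1 N"
      unfolding crude_bound_def Let_def scl_def[symmetric] yy_def[symmetric] rr_def[symmetric] q_def[symmetric] x_def[symmetric]
      by (simp only: mult.assoc)
    finally show "cmod (likelihood z \<xi> - 1) \<le> crude_bound \<gamma> R R1 N" .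
  qed
qed

lemma deviation_probability:
  assumes B: "B \<in> sets M" "emeasure M B \<le> ennreal (exp (- scl\<^sup>2))"
    and dev: "\<And>\<xi> z. \<xi> \<in> space M \<Longrightarrow> \<xi> \<notin> B \<Longrightarrow> z \<in> S \<Longrightarrow> cmod (likelihood z \<xi> - 1) \<le> s" and s: "s < t" "0 \<le> s"
  shows "measure M {\<xi> \<in> space M. ennreal t \<le> (SUP z\<in>S. ennreal (cmod (likelihood z \<xi> - 1)))} \<le> exp (- scl\<^sup>2)"
proof -
  have sub: "{\<xi> \<in> space M. ennreal t \<le> (SUP z\<in>S. ennreal (cmod (likelihood z \<xi> - 1)))} \<subseteq> B"
  proof
    fix \<xi> assume \<xi>: "\<xi> \<in> {\<xi> \<in> space M. ennreal t \<le> (SUP z\<in>S. ennreal (cmod (likelihood z \<xi> - 1)))}"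
    show "\<xi> \<in> B"
    proof (rule ccontr)
      assume "\<xi> \<notin> B"
      then have "(SUP z\<in>S. ennreal (cmod (likelihood z \<xi> - 1))) \<le> ennreal s"
        using \<xi> dev by (intro SUP_least ennreal_leI) auto
      then have "ennreal t \<le> ennreal s" using \<xi> by (auto intro: order_trans)
      then show False using s by (simp add: ennreal_le_iff)
    qed
  qed
  have "measure M {\<xi> \<in> space M. ennreal t \<le> (SUP z\<in>S. ennreal (cmod (likelihood z \<xi> - 1)))} \<le> measure M B"
    by (rule finite_measure_mono[OF sub B(1)])
  also have "\<dots> \<le> exp (- scl\<^sup>2)" using B(2) by (simp add: emeasure_eq_measure)
  finally show ?thesis .
qed

end
end

theorem theorem1p5:
  fixes \<beta> C0 \<alpha> \<delta> :: real
  assumes "\<beta> > 0" and "\<alpha> = 1 / 9" and "\<delta> = 1 / 45"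
  shows "\<exists>c>0. \<forall>K :: complex set. compact K \<longrightarrow> (\<exists>C>0.
    \<forall>(M :: 'a measure) a b Xhat Yhat. gbe_coupling M \<beta> C0 a b Xhat Yhat \<longrightarrow>
      (\<forall>N\<ge>1. \<forall>W. is_W_field M (rescaled N Xhat) (rescaled N Yhat) W \<longrightarrow>
        (let E = {\<omega> \<in> space M.
             (SUP z \<in> K \<inter> region \<alpha> N. ennreal (cmod (
                 phi \<beta> (\<lambda>k. a k \<omega>) (\<lambda>k. b k \<omega>) N z *
                   (LINT \<omega>'|M. exp (complex_of_real (sqrt (2 / \<beta>)) * W z \<omega>')) /
                 (pi_N N z * exp (complex_of_real (sqrt (2 / \<beta>)) * W z \<omega>)) - 1)))
             \<ge> ennreal (C * real N powr (- 1 / 15))}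
         in E \<in> sets M \<and> measure M E \<le> exp (- c * real N powr \<delta>))))"
proof (rule exI[of _ 1], rule conjI, simp, intro allI impI, goal_cases)
  case (1 K)
  then obtain R0 where R0: "\<And>z. z \<in> K \<Longrightarrow> cmod z \<le> R0" using compact_imp_bounded bounded_iff by metis
  define R where "R = max R0 0 + 1"
  have R: "1 \<le> R" "\<And>z. z \<in> K \<Longrightarrow> cmod z \<le> R - 1" using R0 by (auto simp: R_def le_max_iff_disj)
  \<comment> \<open>\<open>\<tau>\<close>, \<open>m\<close> and \<open>g\<close> repeat
    \<open>rate\<close>, \<open>noise_mass\<close> and \<open>\<gamma>\<close> in terms of
    \<open>\<beta>\<close> alone, since \<open>C\<close> has to be fixed before the probability
    space and the coupling.\<close>
  define \<tau> where "\<tau> = min 1 (sqrt (2 * \<beta>) / 8)"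
  define m where "m = 2 * exp (8 :: real)"
  define R1 where "R1 = max (1 / \<tau>) ((91 + ln (max 1 (8 * m))) / (2 * \<tau>))"
  define R2 where "R2 = 2 * (41 + ln (max 1 (4 * (2704 * R\<^sup>2 * (8 * exp 1)))))"
  define g where "g = 1 / sqrt (2 * \<beta>)"
  have pos: "0 < \<tau>" "0 < m" "0 < g" using assms by (auto simp: \<tau>_def m_def g_def)
  have R1: "91 + ln (max 1 (8 * m)) \<le> 2 * \<tau> * R1" "1 \<le> \<tau> * R1" "0 < R1"
  proof -
    have "(91 + ln (max 1 (8 * m))) / (2 * \<tau>) \<le> R1" "1 / \<tau> \<le> R1" by (auto simp: R1_def)
    then show "91 + ln (max 1 (8 * m)) \<le> 2 * \<tau> * R1" "1 \<le> \<tau> * R1" using pos by (auto simp: pos_divide_le_eq mult_ac)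
    show "0 < R1" using pos by (simp add: R1_def less_max_iff_disj)
  qed
  have R2: "41 + ln (max 1 (4 * (2704 * R\<^sup>2 * (8 * exp 1)))) \<le> R2 / 2" "0 < R2"
  proof -
    show "41 + ln (max 1 (4 * (2704 * R\<^sup>2 * (8 * exp 1)))) \<le> R2 / 2" by (simp add: R2_def)
    have "0 \<le> ln (max 1 (4 * (2704 * R\<^sup>2 * (8 * exp 1))))" by simp
    then show "0 < R2" unfolding R2_def by (intro mult_pos_pos add_pos_nonneg) auto
  qed
  have "eventually (ample R R1 R2 g (max C0 0 + 1) (2 * m / \<tau>\<^sup>2)) at_top"
    using pos R R1 R2 by (intro eventually_ample) (auto simp: add_nonneg_pos)
  moreover have "filterlim (\<lambda>n. real n powr (1 / 90)) at_top sequentially"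
    by real_asymp
  ultimately have "eventually (\<lambda>n. ample R R1 R2 g (max C0 0 + 1) (2 * m / \<tau>\<^sup>2) (real n powr (1 / 90))) sequentially"
    by (auto simp: filterlim_iff)
  then obtain N0 where N0: "\<And>n. N0 \<le> n \<Longrightarrow> ample R R1 R2 g (max C0 0 + 1) (2 * m / \<tau>\<^sup>2) (real n powr (1 / 90))"
    by (auto simp: eventually_sequentially)
  let ?cb = "\<lambda>n. \<bar>crude_bound g R R1 n\<bar> * real n powr (1 / 15)"
  \<comment> \<open>The sum dominates each of the finitely many small cases, and the 1 serves the
    large ones. The shift by 2 ensures \<open>N \<ge> 2\<close> there, as the logarithm in the
    coupling bound requires.\<close>
  define C where "C = 1 + (\<Sum>n<N0 + 2. ?cb n)"
  have C1: "1 \<le> C" unfolding C_def by (simp add: sum_nonneg)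
  have "0 < C" using C1 by linarith
  then show ?case
  proof (intro exI[of _ C] conjI, simp, intro allI impI, goal_cases)
    case (1 M a b Xhat Yhat N W)
    then have cp: "gbe_coupling M \<beta> C0 a b Xhat Yhat" and N: "1 \<le> N" and W: "is_W_field M (rescaled N Xhat) (rescaled N Yhat) W" by auto
    interpret gbe_coupling M \<beta> C0 a b Xhat Yhat by (rule cp)
    interpret F: gbe_field M \<beta> C0 a b Xhat Yhat N W by unfold_locales (use assms N W in auto)
    let ?S = "K \<inter> region (1 / 9) N"
    have S: "?S \<subseteq> region (1 / 9) N" "\<And>z. z \<in> ?S \<Longrightarrow> cmod z \<le> R - 1" using R(2) by auto
    have cs: "rate = \<tau>" "noise_mass = m" "coupling_rate = max C0 0 + 1" "F.\<gamma> = g"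
      by (simp_all add: rate_def noise_mass_def coupling_rate_def F.\<gamma>_def \<tau>_def m_def g_def)
    let ?t = "C * real N powr (- 1 / 15)"
    have s0: "0 < F.scl" using F.scl(1) by linarith
    obtain B s where B: "B \<in> sets M" "emeasure M B \<le> ennreal (exp (- F.scl\<^sup>2))"
      "\<And>\<xi> z. \<xi> \<in> space M \<Longrightarrow> \<xi> \<notin> B \<Longrightarrow> z \<in> ?S \<Longrightarrow> cmod (F.likelihood z \<xi> - 1) \<le> s" "s < ?t" "0 \<le> s"
    proof (cases "N < N0 + 2")
      case True
      obtain B where B: "B \<in> sets M" "emeasure M B \<le> ennreal (exp (- F.scl\<^sup>2))"
        "\<And>\<xi> z. \<xi> \<in> space M \<Longrightarrow> \<xi> \<notin> B \<Longrightarrow> z \<in> ?S \<Longrightarrow> cmod (F.likelihood z \<xi> - 1) \<le> crude_bound g R R1 N"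
        using F.crude_event[OF R(1) S, of R1] R1 unfolding cs by (metis less_imp_le)
      have "?cb N < C"
      proof -
        have "?cb N \<le> (\<Sum>n<N0 + 2. ?cb n)" using True by (intro member_le_sum) auto
        then show ?thesis by (simp add: C_def)
      qed
      then have lt: "\<bar>crude_bound g R R1 N\<bar> < ?t" unfolding F.scl(6,7) using s0 by (simp add: pos_less_divide_eq)
      show thesis by (rule that[OF B(1,2) order_trans[OF B(3) abs_ge_self] lt abs_ge_zero])
    next
      case False
      have am: "ample R R1 R2 F.\<gamma> coupling_rate (2 * noise_mass / rate\<^sup>2) F.scl"
        unfolding cs F.scl_def using False by (intro N0) simp
      obtain B where B: "B \<in> sets M" "emeasure M B \<le> ennreal (exp (- F.scl\<^sup>2))"
        "\<And>\<xi> z. \<xi> \<in> space M \<Longrightarrow> \<xi> \<notin> B \<Longrightarrow> z \<in> ?S \<Longrightarrow> cmod (F.likelihood z \<xi> - 1) \<le> 3 / (4 * F.scl ^ 6)"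
        by (rule F.large_event[OF R(1) S am]) (use False R1 R2 in \<open>auto simp: cs\<close>)
      \<comment> \<open>The 3 comes from \<open>exp e - 1\<close> and the 4 from the error budget in
        \<open>ample\<close>; their quotient below 1 yields the strict inequality.\<close>
      have "3 / (4 * F.scl ^ 6) < 1 / F.scl ^ 6" using s0 by (simp add: field_simps)
      also have "\<dots> \<le> ?t" unfolding F.scl(7) using C1 s0 by (simp add: divide_right_mono)
      finally have lt: "3 / (4 * F.scl ^ 6) < ?t" .
      show thesis by (rule that[OF B lt]) (use s0 in auto)
    qed
    have 1: "{\<xi> \<in> space M. ennreal ?t \<le> (SUP z\<in>?S. ennreal (cmod (F.likelihood z \<xi> - 1)))} \<in> sets M"
      by (rule F.deviation_event_measurable[OF R(1) S])
    \<comment> \<open>The witness \<open>c = 1\<close> works because each exceptional set has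
      probability at most \<open>exp (- scl^2)\<close>, with
      \<open>scl^2 = N^(1/45)\<close>.\<close>
    have 2: "measure M {\<xi> \<in> space M. ennreal ?t \<le> (SUP z\<in>?S. ennreal (cmod (F.likelihood z \<xi> - 1)))} \<le> exp (- 1 * real N powr (1 / 45))"
      using F.deviation_probability[OF R(1) S B] unfolding F.scl(8) by simp
    show ?case
      unfolding Let_def assms(2,3) using 1 2 unfolding F.likelihood_def by blast
  qed
qed

end
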